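(* Let $a>1$ and let $(\lambda_k)_{k\in\mathbb{N}}$ be given by $\lambda_k=a^k$. (i) Fix $p>\frac{d-3}{2d}$. Then, with probability one, as $k\to\infty$, $$\frac{\operatorname{vol}(K_{\lambda_k})-\mathbb{E}[\operatorname{vol}(K_{\lambda_k})]}{(\log\lambda_k)^{p\frac d2}}\longrightarrow 0.$$ (ii) Fix $j\in\{0,\ldots,d-1\}$ and $p>\frac12$. Then, with probability one, as $k\to\infty$, $$\frac{f_j(K_{\lambda_k})-\mathbb{E}[f_j(K_{\lambda_k})]}{(\log\lambda_k)^{p\frac{d-1}{2}}}\longrightarrow 0.$$
   Context: Fix $d\ge2$. Let $\gamma_d$ be the standard Gaussian measure on $\mathbb{R}^d$. For $\lambda>0$ let $\mathcal{P}_\lambda$ be a Poisson point process on $\mathbb{R}^d$ with intensity measure $\lambda\gamma_d$, and let $K_\lambda$ be the convex hull of $\mathcal{P}_\lambda$. $\operatorname{vol}(K_\lambda)$ is its volume and $f_j(K_\lambda)$ its number of $j$-dimensional faces. The processes $\mathcal{P}_{\lambda_k}$, $k\in\mathbb{N}$, are defined on a common probability space; no particular joint distribution is prescribed. *)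

theory Defs
  imports "HOL-Probability.Probability"
begin

definition std_gaussian :: "(real ^ 'n) measure" where
  "std_gaussian = density lborel
     (\<lambda>x. ennreal ((2 * pi) powr (- real CARD('n) / 2) * exp (- (norm x)\<^sup>2 / 2)))"

definition num_points :: "'a set \<Rightarrow> 'a set \<Rightarrow> ennreal" where
  "num_points S A = emeasure (count_space UNIV) (S \<inter> A)"

text \<open>
  A Poisson point process with intensity measure \<open>\<mu>\<close>, given as a random set of points.
  A set cannot carry multiplicities, so the notion is meant for atomless intensity measures,
  for which a Poisson process almost surely has no multiple points. The law is written out
  because \<^const>\<open>poisson_pmf\<close> is specified for positive rates only, while \<open>\<mu> A = 0\<close> must be
  covered as well. Counts are extended-valued, since infinite configurations are not excluded
  on null sets.
\<close>

definition poisson_process :: "'w measure \<Rightarrow> 'a measure \<Rightarrow> ('w \<Rightarrow> 'a set) \<Rightarrow> bool" where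
  "poisson_process M \<mu> X \<longleftrightarrow>
     (\<forall>\<omega>\<in>space M. X \<omega> \<subseteq> space \<mu>) \<and>
     (\<forall>A\<in>sets \<mu>. (\<lambda>\<omega>. num_points (X \<omega>) A) \<in> borel_measurable M) \<and>
     (\<forall>A\<in>sets \<mu>. emeasure \<mu> A < \<infinity> \<longrightarrow>
        (\<forall>n::nat. measure M {\<omega> \<in> space M. num_points (X \<omega>) A = of_nat n}
           = measure \<mu> A ^ n / fact n * exp (- measure \<mu> A))) \<and>
     (\<forall>A\<in>sets \<mu>. emeasure \<mu> A = \<infinity> \<longrightarrow> (AE \<omega> in M. num_points (X \<omega>) A = \<infinity>)) \<and>
     (\<forall>(m::nat) A. (\<forall>i<m. A i \<in> sets \<mu>) \<and> disjoint_family_on A {..<m} \<longrightarrow>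
        prob_space.indep_vars M (\<lambda>_. borel) (\<lambda>i \<omega>. num_points (X \<omega>) (A i)) {..<m})"

definition hull_volume :: "(real ^ 'n) set \<Rightarrow> real" where
  "hull_volume S = measure lebesgue (convex hull S)"

definition hull_faces :: "nat \<Rightarrow> (real ^ 'n) set \<Rightarrow> real" where
  "hull_faces j S = real (card {F. F face_of (convex hull S) \<and> aff_dim F = int j})"

text \<open>
  The expectation of a function of \<open>\<omega>\<close> that need only be measurable up to a null set: the law
  of a Poisson process does not constrain the configuration on the null event that it is
  infinite, where the volume and the face numbers of its hull could fail to be \<open>M\<close>-measurable.
  It coincides with the integral over \<open>M\<close> for every \<open>M\<close>-measurable function.
\<close>

definition expect :: "'w measure \<Rightarrow> ('w \<Rightarrow> real) \<Rightarrow> real" where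
  "expect M f = (\<integral>\<omega>. f \<omega> \<partial>completion M)"

end

theory Submission
  imports Defs "HOL-Real_Asymp.Real_Asymp"
begin

text \<open>
  Write \<open>d\<close> for the dimension and \<open>L\<close> for the logarithm of the intensity. The statement is a
  Borel--Cantelli argument: along \<open>L = k ln a\<close> it suffices that a deviation of size
  \<open>\<tau> L powr \<beta>\<close>, with \<open>\<beta> = p d / 2\<close> for the volume and \<open>\<beta> = p (d - 1) / 2\<close> for the face numbers,
  has probability at most \<open>2 L powr (- 2)\<close> at each single large \<open>L\<close>. Hence the joint law of the
  processes does not enter, and the whole work is the tail bound \<open>asymptotic_tail\<close>.

  The geometry behind it is that the hull is close to the ball of radius \<open>sqrt (2 L)\<close>, and that
  it is built from many almost independent pieces. Cut the unit sphere into about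
  \<open>L powr ((d - 1) / 2)\<close> Voronoi cells of diameter about \<open>1 / sqrt L\<close>. The cone over one cell,
  beyond the radius \<open>rad b L = sqrt (2 L - b ln L)\<close>, has intensity \<open>L powr ((b - 1) / 2)\<close> up to
  logarithms. Fix a small \<open>\<epsilon>\<close> and a large \<open>B\<close>. Then outside an event of probability at most
  \<open>L powr (- K)\<close>, with \<open>K\<close> as large as desired (\<open>bad_probability_eventually\<close>), every cone
  contains a point beyond the radius \<open>rad (1 + 2 \<epsilon>) L\<close>, contains at most \<open>L powr (2 \<epsilon>)\<close> points
  (rounded up) beyond \<open>rad (1 + 3 \<epsilon>) L\<close>, and there are no points beyond \<open>rad (- B) L\<close>. For such
  a configuration the hull contains the ball of radius \<open>rad (1 + 3 \<epsilon>) L\<close>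
  (\<open>hull_contains_ball\<close>), so the points inside that ball are irrelevant. A hyperplane that
  avoids the interior of this ball cuts off a cap of angular diameter at most about
  \<open>L powr (\<epsilon> - 1 / 2)\<close>; changing the points in one cone therefore affects only the part of the
  hull over such a cap. The volume changes by at most \<open>L powr (- 1 / 2)\<close> and a face number by
  at most a constant, up to factors \<open>L powr (O(\<epsilon>))\<close> (\<open>volume_difference_le\<close>,
  \<open>face_difference_le\<close>).

  Configurations in different cones are independent, so McDiarmid's inequality yields
  sub-Gaussian tails. Its variance proxy is the number of cones times the square of the change,
  that is \<open>L powr ((d - 3) / 2 + O(\<epsilon>))\<close> for the volume and \<open>L powr ((d - 1) / 2 + O(\<epsilon>))\<close> for
  face numbers. The conditions on \<open>p\<close> say exactly that the squared normalization \<open>L powr (2 \<beta>)\<close>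
  beats this by a power of \<open>L\<close> once \<open>\<epsilon>\<close> is small. The exceptional event shifts the expectation
  only slightly, because the second moments are polynomial in \<open>L\<close> (\<open>second_moment_volume\<close>,
  \<open>second_moment_faces\<close>) while its probability is an arbitrarily small power of \<open>L\<close>.

  The law of a Poisson process is given through counts of points in Borel sets, so neither the
  measurability of a functional of the configuration nor the independence of the configurations
  in disjoint cones is immediate. Both are obtained by discretization. Rounding each point to a
  representative of its dyadic cube leaves finitely many possible configurations in a bounded
  set, and each of them is an event about counts. Almost surely the points are in general
  position (\<open>AE_gen_pos\<close>), and there the volume and the face numbers depend continuously on the
  points (\<open>hull_volume_stable\<close>, \<open>hull_faces_stable\<close>), so that the discretized functionals
  converge to the original ones. The passage to the limit in McDiarmid's inequality is carried
  out in \<open>concentration\<close>.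
\<close>

section \<open>Concentration under bounded differences\<close>

text \<open>
  The values lie in the interval of length \<open>c\<close> that starts at their minimum, so Hoeffding's
  lemma for random variables with values in an interval applies.
\<close>

lemma Hoeffding_mgf_pmf:
  fixes g :: "'b \<Rightarrow> real"
  assumes fin: "finite (set_pmf p)"
    and osc: "\<And>x y. x \<in> set_pmf p \<Longrightarrow> y \<in> set_pmf p \<Longrightarrow> \<bar>g x - g y\<bar> \<le> c"
    and s: "s > 0"
  shows "measure_pmf.expectation p (\<lambda>x. exp (s * (g x - measure_pmf.expectation p g))) \<le> exp (s\<^sup>2 * c\<^sup>2 / 8)"
proof -
  define m where "m = Min (g ` set_pmf p)"
  have ne: "set_pmf p \<noteq> {}" by (simp add: set_pmf_not_empty)
  have m_in: "m \<in> g ` set_pmf p" unfolding m_def using fin ne by simp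
  then obtain y where y: "y \<in> set_pmf p" "m = g y" by auto
  have c0: "c \<ge> 0" using osc[OF y(1) y(1)] by simp
  have lo: "m \<le> g x" if "x \<in> set_pmf p" for x unfolding m_def using fin that by simp
  have hi: "g x \<le> m + c" if "x \<in> set_pmf p" for x using osc[OF that y(1)] y(2) by linarith
  have "AE x in measure_pmf p. g x \<in> {m..m + c}" using lo hi by (auto simp: AE_measure_pmf_iff)
  interpret interval_bounded_random_variable "measure_pmf p" g m "m + c"
    by unfold_locales (use \<open>AE x in measure_pmf p. g x \<in> {m..m + c}\<close> in auto)
  have int: "integrable (measure_pmf p) h" for h :: "'b \<Rightarrow> real"
    using fin by (rule integrable_measure_pmf_finite)
  have "ennreal (measure_pmf.expectation p (\<lambda>x. exp (s * (g x - measure_pmf.expectation p g))))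
      = (\<integral>\<^sup>+x. ennreal (exp (s * (g x - measure_pmf.expectation p g))) \<partial>measure_pmf p)"
    by (subst nn_integral_eq_integral[OF int]) auto
  also have "\<dots> \<le> ennreal (exp (s\<^sup>2 * (m + c - m)\<^sup>2 / 8))"
    using Hoeffdings_lemma_nn_integral[OF s] by simp
  finally show ?thesis by (simp add: ennreal_le_iff)
qed

text \<open>
  Induction on the number of coordinates. Averaging out all coordinates except the new one
  leaves a function \<open>g\<close> of one variable that still oscillates by at most \<open>c\<close>. Hoeffding's lemma
  bounds its contribution, and the induction hypothesis bounds the fluctuation around \<open>g\<close> for
  each fixed value of the new coordinate; the two exponents add up.
\<close>

lemma McDiarmid_mgf_pmf:
  fixes f :: "('i \<Rightarrow> 'b) \<Rightarrow> real" and p :: "'i \<Rightarrow> 'b pmf"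
  assumes "finite I"
    and fin: "\<And>i. finite (set_pmf (p i))"
    and lip: "\<And>x i v w. i \<in> I \<Longrightarrow> x \<in> PiE_dflt I z (\<lambda>i. set_pmf (p i)) \<Longrightarrow> v \<in> set_pmf (p i) \<Longrightarrow>
        w \<in> set_pmf (p i) \<Longrightarrow> \<bar>f (x(i := v)) - f (x(i := w))\<bar> \<le> c"
    and s: "s > 0"
  shows "measure_pmf.expectation (Pi_pmf I z p)
      (\<lambda>x. exp (s * (f x - measure_pmf.expectation (Pi_pmf I z p) f))) \<le> exp (s\<^sup>2 * (real (card I) * c\<^sup>2) / 8)"
  using assms(1) lip
proof (induction I arbitrary: f rule: finite_induct)
  case empty
  then show ?case by simp
next
  case (insert i A)
  let ?P = "Pi_pmf A z p"
  have finP: "finite (set_pmf ?P)"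
    using insert.hyps fin by (simp add: set_Pi_pmf finite_PiE_dflt)
  have eq: "Pi_pmf (insert i A) z p = bind_pmf (p i) (\<lambda>v. map_pmf (\<lambda>x. x(i := v)) ?P)"
    using insert.hyps by (simp add: Pi_pmf_insert' map_pmf_def)
  have E: "measure_pmf.expectation (Pi_pmf (insert i A) z p) h =
     measure_pmf.expectation (p i) (\<lambda>v. measure_pmf.expectation ?P (\<lambda>x. h (x(i := v))))" for h :: "_ \<Rightarrow> real"
    unfolding eq by (subst pmf_expectation_bind[where A = "set_pmf (p i)"])
      (use fin finP in \<open>auto simp: integral_measure_pmf_real[where A = "set_pmf (p i)"] mult.commute\<close>)
  define g where "g v = measure_pmf.expectation ?P (\<lambda>x. f (x(i := v)))" for v
  define m where "m = measure_pmf.expectation (Pi_pmf (insert i A) z p) f"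
  have m: "m = measure_pmf.expectation (p i) g" unfolding m_def E g_def ..
  have mem: "x \<in> PiE_dflt A z (\<lambda>i. set_pmf (p i))" if "x \<in> set_pmf ?P" for x
    using that insert.hyps fin by (simp add: set_Pi_pmf comp_def)
  have mem': "x(i := v) \<in> PiE_dflt (insert i A) z (\<lambda>i. set_pmf (p i))"
    if "x \<in> PiE_dflt A z (\<lambda>i. set_pmf (p i))" "v \<in> set_pmf (p i)" for x v
    using that by (auto simp: PiE_dflt_def)
  have intP: "integrable (measure_pmf ?P) h" for h :: "_ \<Rightarrow> real"
    using finP by (rule integrable_measure_pmf_finite)
  have inti: "integrable (measure_pmf (p i)) h" for h :: "_ \<Rightarrow> real"
    using fin by (rule integrable_measure_pmf_finite)
  have osc: "\<bar>g v - g w\<bar> \<le> c" if v: "v \<in> set_pmf (p i)" and w: "w \<in> set_pmf (p i)" for v w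
  proof -
    have "\<bar>f (x(i := v)) - f (x(i := w))\<bar> \<le> c" if "x \<in> set_pmf ?P" for x
      using insert.prems[OF insertI1 mem'[OF mem[OF that] v] v w] by (simp only: fun_upd_upd)
    then have *: "AE x in ?P. \<bar>f (x(i := v)) - f (x(i := w))\<bar> \<le> c" by (simp add: AE_measure_pmf_iff)
    have "\<bar>g v - g w\<bar> = \<bar>measure_pmf.expectation ?P (\<lambda>x. f (x(i := v)) - f (x(i := w)))\<bar>"
      unfolding g_def by (subst Bochner_Integration.integral_diff[OF intP intP]) simp
    also have "\<dots> \<le> measure_pmf.expectation ?P (\<lambda>x. \<bar>f (x(i := v)) - f (x(i := w))\<bar>)"
      by (rule integral_abs_bound)
    also have "\<dots> \<le> measure_pmf.expectation ?P (\<lambda>_. c)"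
      by (rule integral_mono_AE[OF intP intP *])
    finally show ?thesis by simp
  qed
  have inner: "measure_pmf.expectation ?P (\<lambda>x. exp (s * (f (x(i := v)) - g v))) \<le> exp (s\<^sup>2 * (real (card A) * c\<^sup>2) / 8)"
    if v: "v \<in> set_pmf (p i)" for v
    unfolding g_def
  proof (rule insert.IH)
    fix x j v' w assume *: "j \<in> A" "x \<in> PiE_dflt A z (\<lambda>i. set_pmf (p i))" "v' \<in> set_pmf (p j)" "w \<in> set_pmf (p j)"
    then have "j \<noteq> i" using insert.hyps by auto
    then show "\<bar>f ((x(j := v'))(i := v)) - f ((x(j := w))(i := v))\<bar> \<le> c"
      using insert.prems[of j "x(i := v)" v' w] mem'[OF *(2) v] * by (simp add: fun_upd_twist del: fun_upd_apply)
  qed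
  have "measure_pmf.expectation (Pi_pmf (insert i A) z p) (\<lambda>x. exp (s * (f x - m)))
      = measure_pmf.expectation (p i) (\<lambda>v. exp (s * (g v - m)) * measure_pmf.expectation ?P (\<lambda>x. exp (s * (f (x(i := v)) - g v))))"
    unfolding E
    by (rule integral_cong_AE) (auto simp: exp_add[symmetric] algebra_simps simp flip: integral_mult_right_zero)
  also have "\<dots> \<le> measure_pmf.expectation (p i) (\<lambda>v. exp (s * (g v - m)) * exp (s\<^sup>2 * (real (card A) * c\<^sup>2) / 8))"
    by (rule integral_mono_AE[OF inti inti]) (use inner in \<open>auto simp: AE_measure_pmf_iff\<close>)
  also have "\<dots> = measure_pmf.expectation (p i) (\<lambda>v. exp (s * (g v - m))) * exp (s\<^sup>2 * (real (card A) * c\<^sup>2) / 8)"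
    by simp
  also have "\<dots> \<le> exp (s\<^sup>2 * c\<^sup>2 / 8) * exp (s\<^sup>2 * (real (card A) * c\<^sup>2) / 8)"
    unfolding m by (rule mult_right_mono[OF Hoeffding_mgf_pmf[OF fin osc s]]) auto
  also have "\<dots> = exp (s\<^sup>2 * (real (card (insert i A)) * c\<^sup>2) / 8)"
    using insert.hyps by (simp add: exp_add[symmetric] field_simps)
  finally show ?case unfolding m_def .
qed

lemma McDiarmid_pmf:
  fixes f :: "('i \<Rightarrow> 'b) \<Rightarrow> real" and p :: "'i \<Rightarrow> 'b pmf"
  assumes I: "finite I"
    and fin: "\<And>i. finite (set_pmf (p i))"
    and lip: "\<And>x i v w. i \<in> I \<Longrightarrow> x \<in> PiE_dflt I z (\<lambda>i. set_pmf (p i)) \<Longrightarrow> v \<in> set_pmf (p i) \<Longrightarrow>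
        w \<in> set_pmf (p i) \<Longrightarrow> \<bar>f (x(i := v)) - f (x(i := w))\<bar> \<le> c"
    and Kc: "real (card I) * c\<^sup>2 \<le> K" "K > 0" and t: "t > 0"
  shows "measure_pmf.prob (Pi_pmf I z p) {x. \<bar>f x - measure_pmf.expectation (Pi_pmf I z p) f\<bar> \<ge> t}
    \<le> 2 * exp (- 2 * t\<^sup>2 / K)"
proof -
  let ?P = "Pi_pmf I z p"
  have finP: "finite (set_pmf ?P)"
    using I fin by (simp add: set_Pi_pmf finite_PiE_dflt)
  have int: "integrable (measure_pmf ?P) h" for h :: "_ \<Rightarrow> real"
    using finP by (rule integrable_measure_pmf_finite)
  have one: "measure_pmf.prob ?P {x. h x - measure_pmf.expectation ?P h \<ge> t} \<le> exp (- 2 * t\<^sup>2 / K)"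
    if h: "\<And>x i v w. i \<in> I \<Longrightarrow> x \<in> PiE_dflt I z (\<lambda>i. set_pmf (p i)) \<Longrightarrow> v \<in> set_pmf (p i) \<Longrightarrow>
        w \<in> set_pmf (p i) \<Longrightarrow> \<bar>h (x(i := v)) - h (x(i := w))\<bar> \<le> c" for h
  proof -
    \<comment> \<open>The minimizer of \<open>s\<^sup>2 * K / 8 - s * t\<close> in the Chernoff bound.\<close>
    define s where "s = 4 * t / K"
    have s: "s > 0" using t Kc by (simp add: s_def)
    let ?u = "\<lambda>x. exp (s * (h x - measure_pmf.expectation ?P h))"
    have "measure_pmf.prob ?P {x. h x - measure_pmf.expectation ?P h \<ge> t} \<le> measure_pmf.prob ?P {x. ?u x \<ge> exp (s * t)}"
      by (rule measure_pmf.finite_measure_mono) (use s in auto)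
    also have "\<dots> \<le> measure_pmf.expectation ?P ?u / exp (s * t)"
      using integral_Markov_inequality_measure[where M = "measure_pmf ?P" and u = ?u and A = UNIV and c = "exp (s * t)", OF int]
      by simp
    also have "\<dots> \<le> exp (s\<^sup>2 * (real (card I) * c\<^sup>2) / 8) / exp (s * t)"
      by (intro divide_right_mono McDiarmid_mgf_pmf[where z = z, OF I fin _ s] h) auto
    also have "\<dots> \<le> exp (s\<^sup>2 * K / 8) / exp (s * t)"
      by (intro divide_right_mono) (use Kc in \<open>auto intro!: mult_left_mono\<close>)
    also have "\<dots> = exp (- 2 * t\<^sup>2 / K)"
      using Kc by (simp add: exp_diff[symmetric] s_def power2_eq_square field_simps)
    finally show ?thesis .
  qed
  have "measure_pmf.prob ?P {x. \<bar>f x - measure_pmf.expectation ?P f\<bar> \<ge> t}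
     \<le> measure_pmf.prob ?P ({x. f x - measure_pmf.expectation ?P f \<ge> t} \<union> {x. - f x - measure_pmf.expectation ?P (\<lambda>x. - f x) \<ge> t})"
    by (rule measure_pmf.finite_measure_mono) auto
  also have "\<dots> \<le> measure_pmf.prob ?P {x. f x - measure_pmf.expectation ?P f \<ge> t}
      + measure_pmf.prob ?P {x. - f x - measure_pmf.expectation ?P (\<lambda>x. - f x) \<ge> t}"
    by (rule measure_Un_le) auto
  also have "\<dots> \<le> exp (- 2 * t\<^sup>2 / K) + exp (- 2 * t\<^sup>2 / K)"
    by (intro add_mono one) (use lip in \<open>force simp: abs_minus_commute\<close>)+
  finally show ?thesis by simp
qed

text \<open>
  The joint law of independent random variables with finitely many values is a product of
  finitely supported mass functions. Independence is asked for only as the product rule for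
  single values, which is the form in which it can be read off from counts of Poisson points.
  Coordinates outside \<open>I\<close> get the default value \<open>z\<close>, as in \<^const>\<open>Pi_pmf\<close>.
\<close>

lemma McDiarmid_finite_rv:
  fixes f :: "('i \<Rightarrow> 'b) \<Rightarrow> real" and W :: "'i \<Rightarrow> 'w \<Rightarrow> 'b"
  assumes M: "prob_space M" and I: "finite I" and R: "finite R"
    and meas: "\<And>i y. i \<in> I \<Longrightarrow> {\<omega>\<in>space M. W i \<omega> = y} \<in> sets M"
    and range: "\<And>i \<omega>. i \<in> I \<Longrightarrow> \<omega> \<in> space M \<Longrightarrow> W i \<omega> \<in> R"
    and indep: "\<And>y. (\<And>i. i \<in> I \<Longrightarrow> y i \<in> R) \<Longrightarrow> measure M {\<omega>\<in>space M. \<forall>i\<in>I. W i \<omega> = y i} = (\<Prod>i\<in>I. measure M {\<omega>\<in>space M. W i \<omega> = y i})"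
    and lip: "\<And>x i v w. i \<in> I \<Longrightarrow> x \<in> PiE_dflt I z (\<lambda>_. R) \<Longrightarrow> v \<in> R \<Longrightarrow> w \<in> R \<Longrightarrow>
        \<bar>f (x(i := v)) - f (x(i := w))\<bar> \<le> c"
    and Kc: "real (card I) * c\<^sup>2 \<le> K" "K > 0" and t: "t > 0"
  defines "W' \<equiv> \<lambda>\<omega> i. if i \<in> I then W i \<omega> else z"
  shows "(\<lambda>\<omega>. f (W' \<omega>)) \<in> borel_measurable M"
    and "measure M {\<omega>\<in>space M. \<bar>f (W' \<omega>) - (\<integral>\<omega>. f (W' \<omega>) \<partial>M)\<bar> \<ge> t} \<le> 2 * exp (- 2 * t\<^sup>2 / K)"
proof -
  interpret prob_space M by (rule M)
  let ?D = "PiE_dflt I z (\<lambda>_. R)"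
  have finD: "finite ?D" using I R by (intro finite_PiE_dflt) auto
  define q where "q i y = measure M {\<omega>\<in>space M. W i \<omega> = y}" for i y
  have q_out: "q i y = 0" if "i \<in> I" "y \<notin> R" for i y
  proof -
    have "{\<omega>\<in>space M. W i \<omega> = y} = {}" using range[OF that(1)] that(2) by blast
    then show ?thesis unfolding q_def by (simp only: measure_empty)
  qed
  have q_sum: "(\<Sum>y\<in>R. q i y) = 1" if i: "i \<in> I" for i
  proof -
    have "(\<Sum>y\<in>R. q i y) = measure M (\<Union>y\<in>R. {\<omega>\<in>space M. W i \<omega> = y})"
      unfolding q_def by (rule finite_measure_finite_Union[symmetric])
        (use R meas i in \<open>auto simp: disjoint_family_on_def\<close>)
    also have "(\<Union>y\<in>R. {\<omega>\<in>space M. W i \<omega> = y}) = space M" using range[OF i] by auto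
    finally show ?thesis by (simp add: prob_space)
  qed
  define p where "p i = (if i \<in> I then embed_pmf (q i) else return_pmf z)" for i
  have pmf_p: "pmf (p i) y = q i y" if i: "i \<in> I" for i y
  proof -
    have "(\<integral>\<^sup>+ y. ennreal (q i y) \<partial>count_space UNIV) = (\<Sum>y\<in>R. ennreal (q i y))"
      by (rule nn_integral_count_space') (use R q_out[OF i] in auto)
    also have "\<dots> = 1" using q_sum[OF i] by (subst sum_ennreal) (auto simp: q_def)
    finally show ?thesis unfolding p_def using i by (simp add: pmf_embed_pmf q_def)
  qed
  have set_p: "set_pmf (p i) \<subseteq> R" if "i \<in> I" for i
    using pmf_p[OF that] q_out[OF that] by (auto simp: set_pmf_eq)
  have fin_p: "finite (set_pmf (p i))" for i
    using set_p[of i] R finite_subset by (cases "i \<in> I") (auto simp: p_def)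
  let ?P = "Pi_pmf I z p"
  have W'D: "W' \<omega> \<in> ?D" if "\<omega> \<in> space M" for \<omega> using range that by (auto simp: PiE_dflt_def W'_def)
  have ev: "{\<omega>\<in>space M. W' \<omega> = w} \<in> events" for w
  proof (cases "\<forall>i. i \<notin> I \<longrightarrow> w i = z")
    case True
    then have "{\<omega>\<in>space M. W' \<omega> = w} = {\<omega>\<in>space M. \<forall>i\<in>I. W i \<omega> = w i}"
      by (auto simp: W'_def fun_eq_iff)
    also have "\<dots> \<in> events" using I meas by (intro sets.sets_Collect_finite_All) auto
    finally show ?thesis .
  next
    case False
    then have "{\<omega>\<in>space M. W' \<omega> = w} = {}" by (auto simp: W'_def fun_eq_iff)
    then show ?thesis by (simp only: sets.empty_sets)
  qed
  have prob_W': "prob {\<omega>\<in>space M. W' \<omega> = w} = pmf ?P w" if w: "w \<in> ?D" for w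
  proof -
    have "{\<omega>\<in>space M. W' \<omega> = w} = {\<omega>\<in>space M. \<forall>i\<in>I. W i \<omega> = w i}"
      using w by (auto simp: W'_def fun_eq_iff PiE_dflt_def)
    then have "prob {\<omega>\<in>space M. W' \<omega> = w} = (\<Prod>i\<in>I. q i (w i))"
      using indep[of w] w by (simp add: q_def PiE_dflt_def)
    also have "\<dots> = pmf ?P w"
      using w by (subst pmf_Pi'[OF I]) (auto simp: pmf_p PiE_dflt_def)
    finally show ?thesis .
  qed
  have set_P: "set_pmf ?P \<subseteq> ?D"
    using set_Pi_pmf_subset'[OF I, of z p] set_p by (fastforce simp: PiE_dflt_def)
  have repr: "h (W' \<omega>) = (\<Sum>w\<in>?D. h w * indicator {\<omega>\<in>space M. W' \<omega> = w} \<omega>)" if "\<omega> \<in> space M" for h :: "_ \<Rightarrow> real" and \<omega>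
  proof -
    have "(\<Sum>w\<in>?D. h w * indicator {\<omega>\<in>space M. W' \<omega> = w} \<omega>) = (\<Sum>w\<in>?D. if w = W' \<omega> then h w else 0)"
      by (rule sum.cong) (use that in auto)
    then show ?thesis using finD W'D[OF that] by simp
  qed
  have "(\<lambda>\<omega>. \<Sum>w\<in>?D. h w * indicator {\<omega>\<in>space M. W' \<omega> = w} \<omega>) \<in> borel_measurable M" for h :: "_ \<Rightarrow> real"
    using ev by (intro borel_measurable_sum borel_measurable_times borel_measurable_indicator) auto
  then have hm: "(\<lambda>\<omega>. h (W' \<omega>)) \<in> borel_measurable M" for h :: "_ \<Rightarrow> real"
    by (subst measurable_cong[OF repr]) auto
  have hE: "(\<integral>\<omega>. h (W' \<omega>) \<partial>M) = measure_pmf.expectation ?P h" for h :: "_ \<Rightarrow> real"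
  proof -
    have "(\<integral>\<omega>. h (W' \<omega>) \<partial>M) = (\<integral>\<omega>. (\<Sum>w\<in>?D. h w * indicator {\<omega>\<in>space M. W' \<omega> = w} \<omega>) \<partial>M)"
      by (rule Bochner_Integration.integral_cong) (use repr in auto)
    also have "\<dots> = (\<Sum>w\<in>?D. h w * prob {\<omega>\<in>space M. W' \<omega> = w})"
      by (subst Bochner_Integration.integral_sum) (use ev in \<open>auto simp: emeasure_eq_measure intro!: integrable_mult_right\<close>)
    also have "\<dots> = (\<Sum>w\<in>?D. h w * pmf ?P w)" using prob_W' by simp
    also have "\<dots> = measure_pmf.expectation ?P h"
      by (rule integral_measure_pmf_real[OF finD, symmetric]) (use set_P in auto)
    finally show ?thesis .
  qed
  show "(\<lambda>\<omega>. f (W' \<omega>)) \<in> borel_measurable M" by (rule hm)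
  have "measure M {\<omega>\<in>space M. \<bar>f (W' \<omega>) - (\<integral>\<omega>. f (W' \<omega>) \<partial>M)\<bar> \<ge> t}
      = (\<integral>\<omega>. indicator {w. \<bar>f w - measure_pmf.expectation ?P f\<bar> \<ge> t} (W' \<omega>) \<partial>M)"
  proof -
    have "(\<integral>\<omega>. indicator {w. \<bar>f w - measure_pmf.expectation ?P f\<bar> \<ge> t} (W' \<omega>) \<partial>M :: real)
      = (\<integral>\<omega>. indicator {\<omega>\<in>space M. \<bar>f (W' \<omega>) - measure_pmf.expectation ?P f\<bar> \<ge> t} \<omega> \<partial>M)"
      by (rule Bochner_Integration.integral_cong) (auto simp: indicator_def)
    moreover have "{\<omega>\<in>space M. \<bar>f (W' \<omega>) - measure_pmf.expectation ?P f\<bar> \<ge> t} \<inter> space M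
      = {\<omega>\<in>space M. \<bar>f (W' \<omega>) - measure_pmf.expectation ?P f\<bar> \<ge> t}" by blast
    ultimately show ?thesis unfolding hE[of f] by (simp only: Bochner_Integration.integral_indicator)
  qed
  also have "\<dots> = measure_pmf.prob ?P {w. \<bar>f w - measure_pmf.expectation ?P f\<bar> \<ge> t}"
    using hE[of "indicator {w. \<bar>f w - measure_pmf.expectation ?P f\<bar> \<ge> t}"] by simp
  also have "\<dots> \<le> 2 * exp (- 2 * t\<^sup>2 / K)"
  proof (rule McDiarmid_pmf[OF I fin_p _ Kc t])
    fix x i v w assume "i \<in> I" "x \<in> PiE_dflt I z (\<lambda>i. set_pmf (p i))" "v \<in> set_pmf (p i)" "w \<in> set_pmf (p i)"
    then show "\<bar>f (x(i := v)) - f (x(i := w))\<bar> \<le> c"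
      using set_p by (intro lip) (fastforce simp: PiE_dflt_def)+
  qed
  finally show "measure M {\<omega>\<in>space M. \<bar>f (W' \<omega>) - (\<integral>\<omega>. f (W' \<omega>) \<partial>M)\<bar> \<ge> t} \<le> 2 * exp (- 2 * t\<^sup>2 / K)" .
qed

section \<open>Poisson point configurations\<close>

locale poisson_points = prob_space M for M :: "'w measure" +
  fixes \<mu> :: "'a::euclidean_space measure" and X :: "'w \<Rightarrow> 'a set"
  assumes pp: "poisson_process M \<mu> X"
    and sets_mu [measurable_cong]: "sets \<mu> = sets borel"
    and fin_mu: "finite_measure \<mu>"
begin

sublocale mu: finite_measure \<mu> by (rule fin_mu)

lemma num_measurable [measurable]: "A \<in> sets borel \<Longrightarrow> (\<lambda>\<omega>. num_points (X \<omega>) A) \<in> borel_measurable M"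
  using pp sets_mu unfolding poisson_process_def by auto

lemma prob_num: "A \<in> sets borel \<Longrightarrow>
    prob {\<omega> \<in> space M. num_points (X \<omega>) A = of_nat n} = measure \<mu> A ^ n / fact n * exp (- measure \<mu> A)"
proof -
  assume "A \<in> sets borel"
  moreover have "emeasure \<mu> A < \<infinity>" by (simp add: top.not_eq_extremum[symmetric])
  ultimately show ?thesis using pp sets_mu unfolding poisson_process_def by auto
qed

lemma num_points_eq_card: "finite (S \<inter> A) \<Longrightarrow> num_points S A = of_nat (card (S \<inter> A))"
  by (simp add: num_points_def emeasure_count_space_finite)

lemma num_points_infinite: "infinite (S \<inter> A) \<Longrightarrow> num_points S A = \<infinity>"
  by (simp add: num_points_def emeasure_count_space_infinite)

lemma num_points_eq_of_nat: "num_points S A = of_nat n \<longleftrightarrow> finite (S \<inter> A) \<and> card (S \<inter> A) = n"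
  by (cases "finite (S \<inter> A)") (auto simp: num_points_eq_card num_points_infinite)

lemma num_points_eq_0: "num_points S A = 0 \<longleftrightarrow> S \<inter> A = {}"
  using num_points_eq_of_nat[of S A 0] by auto

text \<open>
  The Poisson weights of the total count sum up to one, which leaves no mass for an infinite
  count.
\<close>

lemma AE_finite: "AE \<omega> in M. finite (X \<omega>)"
proof -
  have ev: "{\<omega> \<in> space M. num_points (X \<omega>) UNIV = of_nat n} \<in> events" for n :: nat by measurable
  let ?l = "measure \<mu> UNIV"
  have "(\<lambda>n. prob {\<omega> \<in> space M. num_points (X \<omega>) UNIV = of_nat n}) sums prob (\<Union>n. {\<omega> \<in> space M. num_points (X \<omega>) UNIV = of_nat n})"
    by (rule finite_measure_UNION) (use ev in \<open>auto simp: disjoint_family_on_def\<close>)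
  moreover have "(\<lambda>n. ?l ^ n / fact n * exp (- ?l)) sums (exp ?l * exp (- ?l))"
    using exp_converges[of ?l] by (intro sums_mult2) (simp add: divide_inverse mult.commute)
  ultimately have "prob (\<Union>n. {\<omega> \<in> space M. num_points (X \<omega>) UNIV = of_nat n}) = 1"
    using sums_unique2 by (fastforce simp: prob_num simp flip: exp_add)
  then have "AE \<omega> in M. \<omega> \<in> (\<Union>n. {\<omega> \<in> space M. num_points (X \<omega>) UNIV = of_nat n})"
    using ev by (subst AE_in_set_eq_1) auto
  then show ?thesis by eventually_elim (auto simp: num_points_eq_of_nat)
qed

lemma hit_measurable [measurable]: "A \<in> sets borel \<Longrightarrow> {\<omega> \<in> space M. X \<omega> \<inter> A = {}} \<in> sets M"
  using borel_measurable_vimage[OF num_measurable[of A], of 0] measurable_sets[OF num_measurable[of A], of "{0}"]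
  by (simp add: num_points_eq_0 vimage_def Int_def conj_commute)

lemma prob_empty: "A \<in> sets borel \<Longrightarrow> prob {\<omega> \<in> space M. X \<omega> \<inter> A = {}} = exp (- measure \<mu> A)"
  using prob_num[of A 0] by (simp add: num_points_eq_0)

lemma prob_nonempty: "A \<in> sets borel \<Longrightarrow> prob {\<omega> \<in> space M. X \<omega> \<inter> A \<noteq> {}} = 1 - exp (- measure \<mu> A)"
proof -
  assume A: "A \<in> sets borel"
  have "prob (space M - {\<omega> \<in> space M. X \<omega> \<inter> A = {}}) = 1 - exp (- measure \<mu> A)"
    using prob_compl[OF hit_measurable[OF A]] prob_empty[OF A] by simp
  moreover have "space M - {\<omega> \<in> space M. X \<omega> \<inter> A = {}} = {\<omega> \<in> space M. X \<omega> \<inter> A \<noteq> {}}" by auto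
  ultimately show ?thesis by simp
qed

lemma prob_nonempty_le: "A \<in> sets borel \<Longrightarrow> prob {\<omega> \<in> space M. X \<omega> \<inter> A \<noteq> {}} \<le> measure \<mu> A"
  using prob_nonempty[of A] exp_ge_add_one_self[of "- measure \<mu> A"] by linarith

lemma card_measurable [measurable]:
  assumes A: "A \<in> sets borel"
  shows "(\<lambda>\<omega>. card (X \<omega> \<inter> A)) \<in> measurable M (count_space UNIV)"
proof -
  have "(\<lambda>\<omega>. card (X \<omega> \<inter> A)) -` {n} \<inter> space M \<in> sets M" for n
  proof -
    have "(\<lambda>\<omega>. card (X \<omega> \<inter> A)) -` {n} \<inter> space M =
      (if n = 0 then {\<omega>\<in>space M. num_points (X \<omega>) A = 0 \<or> num_points (X \<omega>) A = \<infinity>}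
       else {\<omega>\<in>space M. num_points (X \<omega>) A = of_nat n})"
    proof -
      have "(card (S \<inter> A) = n) = (if n = 0 then num_points S A = 0 \<or> num_points S A = \<infinity> else num_points S A = of_nat n)" for S
        by (cases "finite (S \<inter> A)") (auto simp: num_points_eq_card num_points_infinite num_points_eq_of_nat num_points_eq_0)
      then show ?thesis by (cases "n = 0") auto
    qed
    also have "\<dots> \<in> sets M" using A by auto
    finally show ?thesis .
  qed
  then show ?thesis by (subst measurable_count_space_eq2_countable) auto
qed

lemma nn_integral_card:
  assumes A: "A \<in> sets borel"
  shows "(\<integral>\<^sup>+\<omega>. g (card (X \<omega> \<inter> A)) \<partial>M) = (\<Sum>n. g n * ennreal (measure \<mu> A ^ n / fact n * exp (- measure \<mu> A)))"
proof -
  let ?E = "\<lambda>n. {\<omega> \<in> space M. num_points (X \<omega>) A = of_nat n}"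
  have ev: "?E n \<in> sets M" for n :: nat using A by measurable
  have "(\<integral>\<^sup>+\<omega>. g (card (X \<omega> \<inter> A)) \<partial>M) = (\<integral>\<^sup>+\<omega>. (\<Sum>n. g n * indicator (?E n) \<omega>) \<partial>M)"
  proof (rule nn_integral_cong_AE)
    show "AE \<omega> in M. g (card (X \<omega> \<inter> A)) = (\<Sum>n. g n * indicator (?E n) \<omega>)"
      using AE_finite AE_space
    proof eventually_elim
      case (elim \<omega>)
      have "(\<Sum>n. g n * indicator (?E n) \<omega>) = (\<Sum>n\<in>{card (X \<omega> \<inter> A)}. g n * indicator (?E n) \<omega>)"
        by (rule suminf_finite) (use elim in \<open>auto simp: num_points_eq_of_nat\<close>)
      then show ?case using elim by (simp add: num_points_eq_of_nat)
    qed
  qed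
  also have "\<dots> = (\<Sum>n. g n * emeasure M (?E n))"
    using ev by (subst nn_integral_suminf) (auto simp: nn_integral_cmult_indicator)
  also have "\<dots> = (\<Sum>n. g n * ennreal (measure \<mu> A ^ n / fact n * exp (- measure \<mu> A)))"
    by (simp add: emeasure_eq_measure prob_num[OF A])
  finally show ?thesis .
qed

lemma nn_integral_exp_card:
  assumes A: "A \<in> sets borel"
  shows "(\<integral>\<^sup>+\<omega>. ennreal (exp (s * real (card (X \<omega> \<inter> A)))) \<partial>M) = ennreal (exp (measure \<mu> A * (exp s - 1)))"
proof -
  let ?l = "measure \<mu> A"
  have eq: "exp (s * real n) * (?l ^ n / fact n * exp (- ?l)) = (?l * exp s) ^ n / fact n * exp (- ?l)" for n
    by (simp add: power_mult_distrib exp_of_nat_mult[symmetric] mult.commute)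
  have "(\<lambda>n. (?l * exp s) ^ n / fact n * exp (- ?l)) sums (exp (?l * exp s) * exp (- ?l))"
    using exp_converges[of "?l * exp s"] by (intro sums_mult2) (simp add: divide_inverse mult.commute)
  then have s: "(\<lambda>n. exp (s * real n) * (?l ^ n / fact n * exp (- ?l))) sums (exp (?l * (exp s - 1)))"
    unfolding eq by (simp add: right_diff_distrib exp_diff exp_minus divide_inverse)
  have "(\<integral>\<^sup>+\<omega>. ennreal (exp (s * real (card (X \<omega> \<inter> A)))) \<partial>M)
     = (\<Sum>n. ennreal (exp (s * real n) * (?l ^ n / fact n * exp (- ?l))))"
    by (subst nn_integral_card[OF A, of "\<lambda>n. ennreal (exp (s * real n))"]) (simp only: ennreal_mult'[symmetric] exp_ge_zero)
  also have "\<dots> = ennreal (exp (?l * (exp s - 1)))"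
    using s by (subst suminf_ennreal_eq) auto
  finally show ?thesis .
qed

text \<open>
  Chernoff's bound with the exponent \<open>s = 1\<close>, where \<open>exp 1 - 1 \<le> 2\<close>.
\<close>

lemma prob_card_ge:
  assumes A: "A \<in> sets borel"
  shows "prob {\<omega> \<in> space M. card (X \<omega> \<inter> A) \<ge> m} \<le> exp (2 * measure \<mu> A - real m)"
proof -
  have "emeasure M {\<omega> \<in> space M. card (X \<omega> \<inter> A) \<ge> m}
      \<le> (\<integral>\<^sup>+\<omega>. ennreal (exp (- real m)) * ennreal (exp (1 * real (card (X \<omega> \<inter> A)))) \<partial>M)"
  proof -
    have ev: "{\<omega> \<in> space M. card (X \<omega> \<inter> A) \<ge> m} \<in> sets M" using A by measurable
    have "emeasure M {\<omega> \<in> space M. card (X \<omega> \<inter> A) \<ge> m} = (\<integral>\<^sup>+\<omega>. indicator {\<omega> \<in> space M. card (X \<omega> \<inter> A) \<ge> m} \<omega> \<partial>M)"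
      using ev by simp
    also have "\<dots> \<le> (\<integral>\<^sup>+\<omega>. ennreal (exp (- real m)) * ennreal (exp (1 * real (card (X \<omega> \<inter> A)))) \<partial>M)"
      by (rule nn_integral_mono) (auto simp: indicator_def ennreal_mult'[symmetric] exp_add[symmetric])
    finally show ?thesis .
  qed
  also have "\<dots> = ennreal (exp (- real m)) * ennreal (exp (measure \<mu> A * (exp 1 - 1)))"
    using A by (subst nn_integral_cmult) (auto simp: nn_integral_exp_card[OF A, of 1, simplified])
  also have "\<dots> \<le> ennreal (exp (2 * measure \<mu> A - real m))"
  proof -
    have "exp 1 - 1 \<le> (2::real)" using exp_le by simp
    then have "measure \<mu> A * (exp 1 - 1) \<le> measure \<mu> A * 2" by (rule mult_left_mono) simp
    then show ?thesis by (auto simp: ennreal_mult'[symmetric] exp_add[symmetric])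
  qed
  finally show ?thesis by (simp add: emeasure_eq_measure)
qed

text \<open>
  The inequality \<open>x ^ q \<le> fact q * exp x\<close> at \<open>x = card / c\<close> reduces this to an exponential
  moment, and the choice of \<open>c\<close> keeps the latter bounded: \<open>c * (exp (1 / c) - 1) \<le> 2\<close> for
  \<open>c \<ge> 1\<close>.
\<close>

lemma nn_integral_card_power:
  assumes A: "A \<in> sets borel" and c: "c \<ge> 1" "c \<ge> measure \<mu> A"
  shows "(\<integral>\<^sup>+\<omega>. ennreal (real (card (X \<omega> \<inter> A)) ^ q) \<partial>M) \<le> ennreal (fact q * exp 2 * c ^ q)"
proof -
  have pt: "real n ^ q \<le> fact q * c ^ q * exp (1 / c * real n)" for n
  proof -
    let ?x = "real n / c"
    have "?x ^ q / fact q \<le> exp ?x"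
    proof -
      have "(\<Sum>k\<in>{q}. ?x ^ k /\<^sub>R fact k) \<le> (\<Sum>k. ?x ^ k /\<^sub>R fact k)"
        by (rule sum_le_suminf) (use c summable_exp_generic[of ?x] in auto)
      then show ?thesis by (simp add: exp_def divide_inverse mult.commute)
    qed
    then have "?x ^ q \<le> fact q * exp ?x" by (simp add: pos_divide_le_eq mult.commute)
    then have "c ^ q * ?x ^ q \<le> c ^ q * (fact q * exp ?x)" using c by (intro mult_left_mono) auto
    moreover have "c ^ q * ?x ^ q = real n ^ q" using c by (simp add: power_divide)
    ultimately show ?thesis by (simp add: mult_ac)
  qed
  have "(\<integral>\<^sup>+\<omega>. ennreal (real (card (X \<omega> \<inter> A)) ^ q) \<partial>M)
     \<le> (\<integral>\<^sup>+\<omega>. ennreal (fact q * c ^ q) * ennreal (exp (1 / c * real (card (X \<omega> \<inter> A)))) \<partial>M)"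
    by (rule nn_integral_mono) (use pt c in \<open>auto simp: ennreal_mult'[symmetric] intro!: ennreal_leI\<close>)
  also have "\<dots> = ennreal (fact q * c ^ q) * ennreal (exp (measure \<mu> A * (exp (1 / c) - 1)))"
    using A by (subst nn_integral_cmult) (auto simp: nn_integral_exp_card[OF A, of "1 / c", simplified])
  also have "\<dots> \<le> ennreal (fact q * c ^ q) * ennreal (exp 2)"
  proof -
    have e1: "exp (1 / c) \<le> 1 + 1 / c + (1 / c)\<^sup>2" using c by (intro exp_bound) auto
    have "(1 / c)\<^sup>2 \<le> 1 / c" using c by (simp add: power2_eq_square field_simps)
    then have "exp (1 / c) - 1 \<le> 2 / c" using e1 by simp
    then have "measure \<mu> A * (exp (1 / c) - 1) \<le> c * (2 / c)" using c by (intro mult_mono) auto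
    also have "\<dots> = 2" using c by simp
    finally show ?thesis by (intro mult_left_mono ennreal_leI) auto
  qed
  finally show ?thesis using c by (simp add: ennreal_mult'[symmetric] mult_ac)
qed

text \<open>
  Independence is postulated for families indexed by an initial segment of the natural numbers;
  this version allows an arbitrary finite index set and events instead of random variables.
\<close>

lemma indep_counts:
  assumes C: "finite C" and A: "\<And>c. c \<in> C \<Longrightarrow> A c \<in> sets borel" and dis: "disjoint_family_on A C"
    and E: "\<And>c. c \<in> C \<Longrightarrow> E c \<in> sets borel"
  shows "prob {\<omega>\<in>space M. \<forall>c\<in>C. num_points (X \<omega>) (A c) \<in> E c}
       = (\<Prod>c\<in>C. prob {\<omega>\<in>space M. num_points (X \<omega>) (A c) \<in> E c})"
proof -
  obtain b where b: "bij_betw b {..<card C} C"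
    using ex_bij_betw_nat_finite[OF C] by (metis atLeast0LessThan)
  have bC: "b i \<in> C" if "i < card C" for i using b that by (auto simp: bij_betw_def)
  have "disjoint_family_on (\<lambda>i. A (b i)) {..<card C}"
    using dis b unfolding disjoint_family_on_def bij_betw_def inj_on_def by blast
  then have ind: "indep_vars (\<lambda>_. borel) (\<lambda>i \<omega>. num_points (X \<omega>) (A (b i))) {..<card C}"
    using pp bC A sets_mu unfolding poisson_process_def by auto
  show ?thesis
  proof (cases "C = {}")
    case False
    then have ne: "{..<card C} \<noteq> {}" using C by (simp add: lessThan_empty_iff)
    have "prob (\<Inter>i\<in>{..<card C}. (\<lambda>\<omega>. num_points (X \<omega>) (A (b i))) -` E (b i) \<inter> space M)
       = (\<Prod>i\<in>{..<card C}. prob ((\<lambda>\<omega>. num_points (X \<omega>) (A (b i))) -` E (b i) \<inter> space M))"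
      by (rule indep_varsD[OF ind ne]) (use bC E in auto)
    moreover have "(\<Inter>i\<in>{..<card C}. (\<lambda>\<omega>. num_points (X \<omega>) (A (b i))) -` E (b i) \<inter> space M)
      = {\<omega>\<in>space M. \<forall>c\<in>C. num_points (X \<omega>) (A c) \<in> E c}"
    proof -
      have "(\<forall>c\<in>C. P c) = (\<forall>i<card C. P (b i))" for P
        using bij_betw_imp_surj_on[OF b] by (metis imageE image_eqI lessThan_iff)
      then show ?thesis using ne by auto
    qed
    moreover have "(\<lambda>\<omega>. num_points (X \<omega>) (A (b i))) -` E (b i) \<inter> space M = {\<omega>\<in>space M. num_points (X \<omega>) (A (b i)) \<in> E (b i)}" for i
      by auto
    ultimately show ?thesis
      using prod.reindex_bij_betw[OF b, of "\<lambda>c. prob {\<omega>\<in>space M. num_points (X \<omega>) (A c) \<in> E c}"] by simp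
  qed (simp add: prob_space)
qed

text \<open>
  For a map with finitely many values on \<open>C i\<close>, the image of the configuration in \<open>C i\<close> records
  which of the disjoint sets \<open>C i \<inter> \<phi> -` {v}\<close> contain a point. Events about these images are
  therefore events about counts in disjoint sets, to which the independence of counts applies.
\<close>

lemma indep_images:
  fixes \<phi> :: "'a \<Rightarrow> 'a" and C :: "'i \<Rightarrow> 'a set"
  assumes I: "finite I" and C: "\<And>i. i \<in> I \<Longrightarrow> C i \<in> sets borel" and dis: "disjoint_family_on C I"
    and \<phi>: "\<And>v. \<phi> -` {v} \<in> sets borel" and V: "finite V" "\<And>i. i \<in> I \<Longrightarrow> \<phi> ` C i \<subseteq> V"
  shows "i \<in> I \<Longrightarrow> {\<omega>\<in>space M. \<phi> ` (X \<omega> \<inter> C i) = y} \<in> sets M"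
    and "(\<And>i. i \<in> I \<Longrightarrow> y' i \<subseteq> V) \<Longrightarrow> prob {\<omega>\<in>space M. \<forall>i\<in>I. \<phi> ` (X \<omega> \<inter> C i) = y' i}
      = (\<Prod>i\<in>I. prob {\<omega>\<in>space M. \<phi> ` (X \<omega> \<inter> C i) = y' i})"
proof -
  let ?A = "\<lambda>(i, v). C i \<inter> \<phi> -` {v}"
  let ?E = "\<lambda>y' (i, v). if v \<in> y' i then - {0} else {0 :: ennreal}"
  have A: "?A c \<in> sets borel" if "c \<in> I \<times> V" for c using that C \<phi> by auto
  have E: "?E y' c \<in> sets borel" for c y' by (cases c) auto
  have one: "(\<phi> ` (X \<omega> \<inter> C i) = y' i) = (\<forall>v\<in>V. num_points (X \<omega>) (?A (i, v)) \<in> ?E y' (i, v))"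
    if "i \<in> I" "y' i \<subseteq> V" for i \<omega> y'
  proof -
    have "(num_points (X \<omega>) (?A (i, v)) \<in> ?E y' (i, v)) = (v \<in> \<phi> ` (X \<omega> \<inter> C i) \<longleftrightarrow> v \<in> y' i)" for v
      by (auto simp: num_points_eq_0)
    moreover have "\<phi> ` (X \<omega> \<inter> C i) \<subseteq> V" using V(2)[OF that(1)] by blast
    ultimately show ?thesis using that(2) by blast
  qed
  have ev: "{\<omega>\<in>space M. num_points (X \<omega>) (?A c) \<in> ?E y' c} \<in> sets M" if "c \<in> I \<times> V" for c and y' :: "'i \<Rightarrow> 'a set"
    using measurable_sets[OF num_measurable[OF A[OF that]] E[of y' c]] by (simp add: vimage_def Int_def conj_commute)
  show "{\<omega>\<in>space M. \<phi> ` (X \<omega> \<inter> C i) = y} \<in> sets M" if i: "i \<in> I"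
  proof (cases "y \<subseteq> V")
    case True
    then have "{\<omega>\<in>space M. \<phi> ` (X \<omega> \<inter> C i) = y} = {\<omega>\<in>space M. \<forall>v\<in>V. num_points (X \<omega>) (?A (i, v)) \<in> ?E (\<lambda>_. y) (i, v)}"
      using one[OF i, of "\<lambda>_. y"] by auto
    also have "\<dots> \<in> sets M"
    proof (rule sets.sets_Collect_finite_All[OF _ V(1)])
      fix v assume "v \<in> V"
      then show "{\<omega>\<in>space M. num_points (X \<omega>) (?A (i, v)) \<in> ?E (\<lambda>_. y) (i, v)} \<in> sets M"
        using ev[of "(i, v)" "\<lambda>_. y"] i by blast
    qed
    finally show ?thesis .
  next
    case False
    then have "{\<omega>\<in>space M. \<phi> ` (X \<omega> \<inter> C i) = y} = {}" using V(2)[OF i] by blast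
    then show ?thesis by (simp only: sets.empty_sets)
  qed
  assume y': "\<And>i. i \<in> I \<Longrightarrow> y' i \<subseteq> V"
  have disA: "disjoint_family_on ?A (I \<times> V)"
    using dis unfolding disjoint_family_on_def by fastforce
  have single: "prob {\<omega>\<in>space M. \<phi> ` (X \<omega> \<inter> C i) = y' i} = (\<Prod>v\<in>V. prob {\<omega>\<in>space M. num_points (X \<omega>) (?A (i, v)) \<in> ?E y' (i, v)})"
    if i: "i \<in> I" for i
  proof -
    have "prob {\<omega>\<in>space M. \<phi> ` (X \<omega> \<inter> C i) = y' i} = prob {\<omega>\<in>space M. \<forall>c\<in>{i} \<times> V. num_points (X \<omega>) (?A c) \<in> ?E y' c}"
      using one[of i y', OF i y'[OF i]] by simp
    also have "\<dots> = (\<Prod>c\<in>{i} \<times> V. prob {\<omega>\<in>space M. num_points (X \<omega>) (?A c) \<in> ?E y' c})"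
      by (rule indep_counts) (use V(1) A E i disA in \<open>auto intro: disjoint_family_on_mono[of _ "I \<times> V"]\<close>)
    also have "\<dots> = (\<Prod>v\<in>V. prob {\<omega>\<in>space M. num_points (X \<omega>) (?A (i, v)) \<in> ?E y' (i, v)})"
    proof -
      have "{i} \<times> V = Pair i ` V" by auto
      then show ?thesis by (simp add: prod.reindex inj_on_def)
    qed
    finally show ?thesis .
  qed
  have "prob {\<omega>\<in>space M. \<forall>i\<in>I. \<phi> ` (X \<omega> \<inter> C i) = y' i}
     = prob {\<omega>\<in>space M. \<forall>c\<in>I \<times> V. num_points (X \<omega>) (?A c) \<in> ?E y' c}"
    using one y' by (intro arg_cong[where f = prob]) fastforce
  also have "\<dots> = (\<Prod>c\<in>I \<times> V. prob {\<omega>\<in>space M. num_points (X \<omega>) (?A c) \<in> ?E y' c})"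
    by (rule indep_counts) (use V(1) I A E disA in auto)
  also have "\<dots> = (\<Prod>i\<in>I. \<Prod>v\<in>V. prob {\<omega>\<in>space M. num_points (X \<omega>) (?A (i, v)) \<in> ?E y' (i, v)})"
    by (simp add: prod.cartesian_product case_prod_unfold)
  finally show "prob {\<omega>\<in>space M. \<forall>i\<in>I. \<phi> ` (X \<omega> \<inter> C i) = y' i} = (\<Prod>i\<in>I. prob {\<omega>\<in>space M. \<phi> ` (X \<omega> \<inter> C i) = y' i})"
    using single by simp
qed

end

section \<open>Points in general position and their convex hulls\<close>

definition gen_pos :: "'a::euclidean_space set \<Rightarrow> bool" where
  "gen_pos S \<longleftrightarrow> (\<forall>T\<subseteq>S. finite T \<and> card T \<le> DIM('a) + 1 \<longrightarrow> \<not> affine_dependent T)"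

text \<open>
  Affine independence of an indexed family. Repeated points make a family dependent, and the
  condition on coefficients allows for quantitative versions, which are needed for
  perturbations.
\<close>

definition aff_indep_family :: "('i \<Rightarrow> 'a::euclidean_space) \<Rightarrow> 'i set \<Rightarrow> bool" where
  "aff_indep_family f I \<longleftrightarrow> (\<forall>c. (\<Sum>i\<in>I. c i) = 0 \<and> (\<Sum>i\<in>I. c i *\<^sub>R f i) = 0 \<longrightarrow> (\<forall>i\<in>I. c i = 0))"

lemma aff_indep_familyD_inj:
  assumes "finite I" "aff_indep_family f I"
  shows "inj_on f I"
proof (rule inj_onI, rule ccontr)
  fix i j assume ij: "i \<in> I" "j \<in> I" "f i = f j" "i \<noteq> j"
  let ?c = "\<lambda>k. if k = i then 1 else if k = j then -1 else (0::real)"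
  have "(\<Sum>k\<in>I. ?c k) = (\<Sum>k\<in>I. (if k = i then 1 else 0) + (if k = j then -1 else 0))"
    by (rule sum.cong) (use ij in auto)
  also have "\<dots> = 0" using ij assms(1) by (simp add: sum.distrib sum.delta)
  finally have 1: "(\<Sum>k\<in>I. ?c k) = 0" .
  have "(\<Sum>k\<in>I. ?c k *\<^sub>R f k) = (\<Sum>k\<in>I. (if k = i then f k else 0) + (if k = j then - f k else 0))"
    by (rule sum.cong) (use ij in auto)
  also have "\<dots> = 0" using ij assms(1) by (simp add: sum.distrib sum.delta)
  finally have 2: "(\<Sum>k\<in>I. ?c k *\<^sub>R f k) = 0" .
  have "?c i = 0" using assms(2) 1 2 ij(1) unfolding aff_indep_family_def by blast
  then show False by simp
qed

lemma aff_indep_family_iff: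
  assumes "finite I"
  shows "aff_indep_family f I \<longleftrightarrow> inj_on f I \<and> \<not> affine_dependent (f ` I)"
proof
  assume L: "aff_indep_family f I"
  have inj: "inj_on f I" by (rule aff_indep_familyD_inj[OF assms L])
  have "\<not> affine_dependent (f ` I)"
  proof
    assume "affine_dependent (f ` I)"
    then obtain U where U: "sum U (f ` I) = 0" "\<exists>v\<in>f ` I. U v \<noteq> 0" "(\<Sum>v\<in>f ` I. U v *\<^sub>R v) = 0"
      using assms by (auto simp: affine_dependent_explicit_finite)
    have "(\<Sum>i\<in>I. (U \<circ> f) i) = 0" "(\<Sum>i\<in>I. (U \<circ> f) i *\<^sub>R f i) = 0"
      using U inj by (simp_all add: sum.reindex)
    then have "\<forall>i\<in>I. (U \<circ> f) i = 0" using L unfolding aff_indep_family_def by blast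
    then show False using U by auto
  qed
  then show "inj_on f I \<and> \<not> affine_dependent (f ` I)" using inj by blast
next
  assume R: "inj_on f I \<and> \<not> affine_dependent (f ` I)"
  show "aff_indep_family f I"
    unfolding aff_indep_family_def
  proof (intro allI impI ballI, elim conjE, rule ccontr)
    fix c i assume c: "(\<Sum>i\<in>I. c i) = 0" "(\<Sum>i\<in>I. c i *\<^sub>R f i) = 0" "i \<in> I" "c i \<noteq> 0"
    let ?U = "\<lambda>v. c (inv_into I f v)"
    have inv: "inv_into I f (f j) = j" if "j \<in> I" for j using R that by simp
    have "sum ?U (f ` I) = 0" using R c inv by (simp add: sum.reindex)
    moreover have "(\<Sum>v\<in>f ` I. ?U v *\<^sub>R v) = 0" using R c inv by (simp add: sum.reindex)
    moreover have "\<exists>v\<in>f ` I. ?U v \<noteq> 0" using c inv by force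
    ultimately have "affine_dependent (f ` I)"
      using assms by (auto simp: affine_dependent_explicit_finite)
    then show False using R by simp
  qed
qed

text \<open>
  The vectors \<open>(f i, 1)\<close> are linearly independent, so each coefficient is a linear and hence
  bounded function of the combination.
\<close>

lemma aff_indep_family_bounded_below:
  assumes I: "finite I" and "aff_indep_family f I"
  shows "\<exists>\<eta>>0. \<forall>c. \<eta> * (\<Sum>i\<in>I. \<bar>c i\<bar>) \<le> norm (\<Sum>i\<in>I. c i *\<^sub>R f i) + \<bar>\<Sum>i\<in>I. c i\<bar>"
proof -
  let ?h = "\<lambda>i. (f i, 1::real)"
  have inj: "inj_on ?h I" using aff_indep_familyD_inj[OF assms] by (auto simp: inj_on_def)
  have sum_pair: "(\<Sum>i\<in>I. c i *\<^sub>R ?h i) = (\<Sum>i\<in>I. c i *\<^sub>R f i, \<Sum>i\<in>I. c i)" for c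
    using I by (induction I) (auto simp: zero_prod_def)
  have indep: "independent (?h ` I)"
  proof (rule independent_if_scalars_zero)
    show "finite (?h ` I)" using I by simp
    fix u x assume u: "(\<Sum>x\<in>?h ` I. u x *\<^sub>R x) = 0" and x: "x \<in> ?h ` I"
    have "(\<Sum>i\<in>I. u (?h i) *\<^sub>R ?h i) = 0" using u inj by (simp add: sum.reindex)
    then have "(\<Sum>i\<in>I. u (?h i) *\<^sub>R f i) = 0" "(\<Sum>i\<in>I. u (?h i)) = 0"
      unfolding sum_pair by (auto simp: zero_prod_def)
    then have "\<forall>i\<in>I. u (?h i) = 0" using assms(2) unfolding aff_indep_family_def by blast
    then show "u x = 0" using x by auto
  qed
  have "\<exists>K>0. \<forall>c. \<bar>c i\<bar> \<le> K * norm (\<Sum>i\<in>I. c i *\<^sub>R ?h i)" if i: "i \<in> I" for i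
  proof -
    \<comment> \<open>The coordinate functional of index \<open>i\<close>, extended to the whole space.\<close>
    obtain g :: "'b \<times> real \<Rightarrow> real" where g: "linear g" "\<forall>x\<in>?h ` I. g x = (if x = ?h i then 1 else 0)"
      using linear_independent_extend[OF indep, of "\<lambda>x. if x = ?h i then 1 else 0"] by blast
    obtain B where B: "B > 0" "\<And>x. norm (g x) \<le> B * norm x" using linear_bounded_pos[OF g(1)] by blast
    have "\<bar>c i\<bar> \<le> B * norm (\<Sum>i\<in>I. c i *\<^sub>R ?h i)" for c
    proof -
      have "g (\<Sum>j\<in>I. c j *\<^sub>R ?h j) = (\<Sum>j\<in>I. c j * g (?h j))"
        by (simp only: linear_sum[OF g(1)] linear_cmul[OF g(1)] real_scaleR_def)
      also have "\<dots> = (\<Sum>j\<in>I. if j = i then c j else 0)"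
        by (rule sum.cong) (use g(2) i inj in \<open>auto simp: inj_on_def\<close>)
      also have "\<dots> = c i" using i I by simp
      finally show ?thesis using B(2)[of "\<Sum>j\<in>I. c j *\<^sub>R ?h j"] by simp
    qed
    then show ?thesis using B(1) by blast
  qed
  then obtain K where K: "\<And>i. i \<in> I \<Longrightarrow> K i > 0" "\<And>i c. i \<in> I \<Longrightarrow> \<bar>c i\<bar> \<le> K i * norm (\<Sum>i\<in>I. c i *\<^sub>R ?h i)"
    by metis
  define K' where "K' = 1 + (\<Sum>i\<in>I. K i)"
  have K': "K' > 0" unfolding K'_def using K(1) by (intro add_pos_nonneg sum_nonneg) (auto simp: less_imp_le)
  have "1 / K' * (\<Sum>i\<in>I. \<bar>c i\<bar>) \<le> norm (\<Sum>i\<in>I. c i *\<^sub>R f i) + \<bar>\<Sum>i\<in>I. c i\<bar>" for c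
  proof -
    have "(\<Sum>i\<in>I. \<bar>c i\<bar>) \<le> (\<Sum>i\<in>I. K i * norm (\<Sum>i\<in>I. c i *\<^sub>R ?h i))"
      by (rule sum_mono) (use K(2) in auto)
    also have "\<dots> \<le> K' * norm (\<Sum>i\<in>I. c i *\<^sub>R ?h i)"
      by (simp add: K'_def distrib_right flip: sum_distrib_right)
    also have "norm (\<Sum>i\<in>I. c i *\<^sub>R ?h i) \<le> norm (\<Sum>i\<in>I. c i *\<^sub>R f i) + \<bar>\<Sum>i\<in>I. c i\<bar>"
      unfolding sum_pair using norm_Pair_le by (metis real_norm_def)
    finally show ?thesis using K' by (simp add: field_simps)
  qed
  then show ?thesis using K' by (intro exI[of _ "1 / K'"]) auto
qed

text \<open>
  Moving every point by less than \<open>\<eta> / 2\<close> changes a combination by at most half of the lower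
  bound. The resulting constant is uniform over all such perturbations, which is what limit
  arguments need.
\<close>

lemma aff_indep_family_stable:
  assumes I: "finite I" and f: "aff_indep_family f I"
  shows "\<exists>\<eta>>0. \<forall>g. (\<forall>i\<in>I. dist (g i) (f i) < \<eta>) \<longrightarrow>
      (\<forall>c. \<eta> * (\<Sum>i\<in>I. \<bar>c i\<bar>) \<le> norm (\<Sum>i\<in>I. c i *\<^sub>R g i) + \<bar>\<Sum>i\<in>I. c i\<bar>)"
proof -
  obtain \<eta> where \<eta>: "\<eta> > 0" and b: "\<And>c. \<eta> * (\<Sum>i\<in>I. \<bar>c i\<bar>) \<le> norm (\<Sum>i\<in>I. c i *\<^sub>R f i) + \<bar>\<Sum>i\<in>I. c i\<bar>"
    using aff_indep_family_bounded_below[OF assms] by blast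
  have "\<eta>/2 * (\<Sum>i\<in>I. \<bar>c i\<bar>) \<le> norm (\<Sum>i\<in>I. c i *\<^sub>R g i) + \<bar>\<Sum>i\<in>I. c i\<bar>"
    if g: "\<forall>i\<in>I. dist (g i) (f i) < \<eta>/2" for g c
  proof -
    have "norm (\<Sum>i\<in>I. c i *\<^sub>R f i) - norm (\<Sum>i\<in>I. c i *\<^sub>R g i) \<le> norm ((\<Sum>i\<in>I. c i *\<^sub>R f i) - (\<Sum>i\<in>I. c i *\<^sub>R g i))"
      by (rule norm_triangle_ineq2)
    also have "\<dots> = norm (\<Sum>i\<in>I. c i *\<^sub>R (f i - g i))"
      by (simp add: sum_subtractf scaleR_diff_right)
    also have "\<dots> \<le> (\<Sum>i\<in>I. \<bar>c i\<bar> * (\<eta>/2))"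
    proof (rule sum_norm_le)
      fix i assume "i \<in> I"
      then have "norm (f i - g i) \<le> \<eta> / 2" using g by (auto simp: dist_norm norm_minus_commute less_imp_le)
      then show "norm (c i *\<^sub>R (f i - g i)) \<le> \<bar>c i\<bar> * (\<eta> / 2)"
        unfolding norm_scaleR by (rule mult_left_mono) simp
    qed
    also have "\<dots> = \<eta>/2 * (\<Sum>i\<in>I. \<bar>c i\<bar>)" by (simp add: mult.commute sum_distrib_left)
    finally show ?thesis using b[of c] by linarith
  qed
  then show ?thesis using \<eta> by (intro exI[of _ "\<eta>/2"]) auto
qed

lemma bounded_below_aff_indep_family:
  assumes I: "finite I" and \<eta>: "\<eta> > 0" and b: "\<And>c. \<eta> * (\<Sum>i\<in>I. \<bar>c i\<bar>) \<le> norm (\<Sum>i\<in>I. c i *\<^sub>R g i) + \<bar>\<Sum>i\<in>I. c i\<bar>"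
  shows "aff_indep_family g I"
  unfolding aff_indep_family_def
proof (intro allI impI, elim conjE)
  fix c assume "(\<Sum>i\<in>I. c i) = (0::real)" "(\<Sum>i\<in>I. c i *\<^sub>R g i) = 0"
  then have "\<eta> * (\<Sum>i\<in>I. \<bar>c i\<bar>) \<le> 0" using b[of c] by simp
  then have "(\<Sum>i\<in>I. \<bar>c i\<bar>) \<le> 0" using \<eta> by (simp add: mult_le_0_iff)
  then have "(\<Sum>i\<in>I. \<bar>c i\<bar>) = 0" by (meson abs_ge_zero antisym sum_nonneg)
  then show "\<forall>i\<in>I. c i = 0" using I by (simp add: sum_nonneg_eq_0_iff)
qed

text \<open>
  The strict inequality off \<open>T\<close> makes the property open under perturbations of the points.
\<close>

definition exposes :: "'a::euclidean_space set \<Rightarrow> 'a set \<Rightarrow> bool" where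
  "exposes S T \<longleftrightarrow> (\<exists>u h. (\<forall>t\<in>T. u \<bullet> t = h) \<and> (\<forall>s\<in>S - T. u \<bullet> s < h))"

lemma face_of_convex_hull_points:
  fixes S :: "'a::euclidean_space set"
  assumes "finite S" "F face_of convex hull S"
  shows "F = convex hull (F \<inter> S)"
proof
  obtain S' where S': "S' \<subseteq> S" "F = convex hull S'"
    using face_of_convex_hull_subset[OF finite_imp_compact[OF assms(1)] assms(2)] by blast
  then have "S' \<subseteq> F \<inter> S" using hull_subset[of S' convex] by blast
  then show "F \<subseteq> convex hull (F \<inter> S)" using S'(2) hull_mono[of S' "F \<inter> S" convex] by blast
  show "convex hull (F \<inter> S) \<subseteq> F"
    using face_of_imp_convex[OF assms(2)] by (simp add: hull_minimal)
qed

lemma exposes_face: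
  assumes "finite S" "T \<subseteq> S" "exposes S T"
  shows "convex hull T face_of convex hull S"
proof -
  obtain u h where uh: "\<forall>t\<in>T. u \<bullet> t = h" "\<forall>s\<in>S - T. u \<bullet> s < h" using assms(3) by (auto simp: exposes_def)
  have "affine hull T \<subseteq> {x. u \<bullet> x = h}"
    by (rule hull_minimal) (use uh in \<open>auto simp: affine_hyperplane\<close>)
  moreover have "convex hull (S - T) \<subseteq> {x. u \<bullet> x < h}"
    by (rule hull_minimal) (use uh in \<open>auto simp: convex_halfspace_lt\<close>)
  ultimately have "affine hull T \<inter> convex hull (S - T) = {}" by fastforce
  then show ?thesis using face_of_convex_hulls[OF assms(1,2)] by blast
qed

lemma face_exposed_points:
  fixes S :: "'a::euclidean_space set"
  assumes S: "finite S" and F: "F face_of convex hull S"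
  obtains u h where "\<And>x. x \<in> convex hull S \<Longrightarrow> u \<bullet> x \<le> h" "F = convex hull S \<inter> {x. u \<bullet> x = h}"
proof -
  have "polyhedron (convex hull S)" using S by (rule polyhedron_convex_hull)
  then have "F exposed_face_of convex hull S" using F by (simp add: exposed_face_of_polyhedron)
  then show ?thesis using that unfolding exposed_face_of_def by blast
qed

text \<open>
  If \<open>d + 1\<close> of the points were in a set of smaller affine dimension, they would be dependent.
\<close>

lemma gen_pos_card_le:
  fixes S :: "'a::euclidean_space set"
  assumes S: "gen_pos S" and T: "T \<subseteq> S" "finite T" "aff_dim T < int DIM('a)"
  shows "\<not> affine_dependent T" "card T \<le> DIM('a)"
proof -
  show "card T \<le> DIM('a)"
  proof (rule ccontr)
    assume "\<not> card T \<le> DIM('a)"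
    then have "DIM('a) + 1 \<le> card T" by simp
    then obtain T' where T': "T' \<subseteq> T" "card T' = DIM('a) + 1" "finite T'"
      using obtain_subset_with_card_n by metis
    then have "\<not> affine_dependent T'" using S T unfolding gen_pos_def by auto
    then have "aff_dim T' = int DIM('a)" using T' aff_dim_affine_independent[of T'] by simp
    then show False using aff_dim_subset[OF T'(1)] T(3) by simp
  qed
  then show "\<not> affine_dependent T" using S T unfolding gen_pos_def by auto
qed

lemma exposes_if_face:
  fixes S :: "'a::euclidean_space set"
  assumes S: "finite S" "gen_pos S" and T: "T \<subseteq> S" "card T \<le> DIM('a)" and F: "convex hull T face_of convex hull S"
  shows "exposes S T"
proof -
  obtain u h where uh: "\<And>x. x \<in> convex hull S \<Longrightarrow> u \<bullet> x \<le> h" "convex hull T = convex hull S \<inter> {x. u \<bullet> x = h}"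
    using face_exposed_points[OF S(1) F] by blast
  have "u \<bullet> t = h" if "t \<in> T" for t using uh(2) that hull_inc[of t T] by blast
  moreover have "u \<bullet> s < h" if s: "s \<in> S - T" for s
  proof -
    have s': "s \<in> convex hull S" using s by (simp add: hull_inc)
    have "u \<bullet> s \<noteq> h"
    proof
      assume "u \<bullet> s = h"
      then have sT: "s \<in> convex hull T" using uh(2) s' by blast
      have "finite T" using S(1) T(1) finite_subset by blast
      then have "\<not> affine_dependent (insert s T)"
        using S(2) T s unfolding gen_pos_def by auto
      moreover have "s \<in> affine hull (insert s T - {s})"
        using sT s convex_hull_subset_affine_hull[of T] by auto
      ultimately show False unfolding affine_dependent_def by blast
    qed
    then show ?thesis using uh(1)[OF s'] by linarith
  qed
  ultimately show ?thesis unfolding exposes_def by (intro exI[of _ u] exI[of _ h] conjI ballI)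
qed

text \<open>
  In general position all proper faces are simplices, so that a face amounts to its vertex set,
  and the face numbers become a count of exposed subsets of the configuration.
\<close>

lemma card_faces_gen_pos:
  fixes S :: "'a::euclidean_space set"
  assumes S: "finite S" "gen_pos S" and j: "j < DIM('a)"
  shows "card {F. F face_of convex hull S \<and> aff_dim F = int j} = card {T. T \<subseteq> S \<and> card T = j + 1 \<and> exposes S T}"
proof -
  let ?A = "{T. T \<subseteq> S \<and> card T = j + 1 \<and> exposes S T}"
  have indep: "\<not> affine_dependent T" "finite T" if "T \<in> ?A" for T
    using that S j finite_subset[of T S] unfolding gen_pos_def by auto
  have "bij_betw (\<lambda>T. convex hull T) ?A {F. F face_of convex hull S \<and> aff_dim F = int j}"
  proof (rule bij_betwI')
    fix T1 T2 assume T: "T1 \<in> ?A" "T2 \<in> ?A"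
    show "(convex hull T1 = convex hull T2) = (T1 = T2)"
    proof
      assume eq: "convex hull T1 = convex hull T2"
      have "x \<in> T1 \<longleftrightarrow> x \<in> T2" for x
        using extreme_point_of_convex_hull_affine_independent[of T1 x]
          extreme_point_of_convex_hull_affine_independent[of T2 x] indep[OF T(1)] indep[OF T(2)] eq by simp
      then show "T1 = T2" by blast
    qed simp
  next
    fix T assume T: "T \<in> ?A"
    then show "convex hull T \<in> {F. F face_of convex hull S \<and> aff_dim F = int j}"
      using exposes_face[OF S(1)] aff_dim_affine_independent[OF indep(1)[OF T]]
      by (auto simp: aff_dim_convex_hull)
  next
    fix F assume F: "F \<in> {F. F face_of convex hull S \<and> aff_dim F = int j}"
    define T where "T = F \<inter> S"
    have FT: "F = convex hull T" unfolding T_def using F face_of_convex_hull_points[OF S(1)] by blast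
    have aff: "aff_dim T = int j" using F unfolding FT by (simp add: aff_dim_convex_hull)
    have sub: "T \<subseteq> S" "finite T" using S(1) by (auto simp: T_def)
    have ind: "\<not> affine_dependent T" "card T \<le> DIM('a)" using gen_pos_card_le[OF S(2) sub] aff j by simp_all
    then have "card T = j + 1" using aff aff_dim_affine_independent[of T] by simp
    moreover have "exposes S T" using exposes_if_face[OF S sub(1) ind(2)] F FT by simp
    ultimately show "\<exists>T\<in>?A. F = convex hull T" using FT sub by blast
  qed
  then show ?thesis by (rule bij_betw_same_card[symmetric])
qed

section \<open>Stability of face numbers and volume\<close>

text \<open>
  The direction space of the affine hull consists of the combinations with coefficient sum
  zero.
\<close>

lemma span_diffs:
  fixes g :: "'i \<Rightarrow> 'a::real_vector"
  assumes fin: "finite T" and t0: "t0 \<in> T" and x: "x \<in> span ((\<lambda>t. g t - g t0) ` T)"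
  shows "\<exists>c. x = (\<Sum>t\<in>T. c t *\<^sub>R g t) \<and> (\<Sum>t\<in>T. c t) = 0"
proof -
  let ?V = "{x. \<exists>c. x = (\<Sum>t\<in>T. c t *\<^sub>R g t) \<and> (\<Sum>t\<in>T. c t) = (0::real)}"
  have "subspace ?V"
  proof (rule subspaceI)
    show "0 \<in> ?V" by (auto intro: exI[of _ "\<lambda>_. 0"])
    fix x y assume "x \<in> ?V" "y \<in> ?V"
    then obtain c d where "x = (\<Sum>t\<in>T. c t *\<^sub>R g t)" "(\<Sum>t\<in>T. c t) = 0" "y = (\<Sum>t\<in>T. d t *\<^sub>R g t)" "(\<Sum>t\<in>T. d t) = 0" by auto
    then show "x + y \<in> ?V"
      by (auto intro!: exI[of _ "\<lambda>t. c t + d t"] simp: sum.distrib scaleR_add_left)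
  next
    fix a x assume "x \<in> ?V"
    then obtain c where "x = (\<Sum>t\<in>T. c t *\<^sub>R g t)" "(\<Sum>t\<in>T. c t) = 0" by auto
    then show "a *\<^sub>R x \<in> ?V"
      by (auto intro!: exI[of _ "\<lambda>t. a * c t"] simp: scaleR_sum_right simp flip: sum_distrib_left)
  qed
  moreover have "(\<lambda>t. g t - g t0) ` T \<subseteq> ?V"
  proof clarsimp
    fix t assume t: "t \<in> T"
    let ?c = "\<lambda>s. (if s = t then 1 else 0) - (if s = t0 then 1 else (0::real))"
    have "(\<Sum>s\<in>T. ?c s *\<^sub>R g s) = (\<Sum>s\<in>T. (if s = t then g s else 0) - (if s = t0 then g s else 0))"
      by (rule sum.cong) auto
    then have "(\<Sum>s\<in>T. ?c s *\<^sub>R g s) = g t - g t0" using t t0 fin by (simp add: sum_subtractf)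
    moreover have "(\<Sum>s\<in>T. ?c s) = 0" using t t0 fin by (simp add: sum_subtractf)
    ultimately show "\<exists>c. g t - g t0 = (\<Sum>t\<in>T. c t *\<^sub>R g t) \<and> (\<Sum>t\<in>T. c t) = (0::real)" by (metis (no_types))
  qed
  ultimately have "span ((\<lambda>t. g t - g t0) ` T) \<subseteq> ?V" by (rule span_minimal[rotated])
  then show ?thesis using x by blast
qed

text \<open>
  Unit normals of supporting hyperplanes have a convergent subsequence, and the limit \<open>v\<close>
  supports the limiting hull at \<open>T\<close>. Its contact set \<open>T'\<close> can be larger than \<open>T\<close>. As it lies in
  a hyperplane, general position makes it affinely independent, so \<open>T\<close> still spans a face of
  the simplex spanned by \<open>T'\<close>.
\<close>

lemma exposes_limit:
  fixes S :: "'a::euclidean_space set" and \<phi> :: "nat \<Rightarrow> 'a \<Rightarrow> 'a"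
  assumes S: "finite S" "gen_pos S" and T: "T \<subseteq> S" "T \<noteq> {}" "card T \<le> DIM('a)"
    and conv: "\<And>s. s \<in> S \<Longrightarrow> (\<lambda>n. \<phi> n s) \<longlonglongrightarrow> s"
    and ex: "\<And>n. exposes (\<phi> n ` S) (\<phi> n ` T)" and inj: "\<And>n. inj_on (\<phi> n) S"
  shows "exposes S T"
proof (cases "T = S")
  case True
  then show ?thesis unfolding exposes_def by (intro exI[of _ 0]) auto
next
  case False
  then obtain s0 where s0: "s0 \<in> S" "s0 \<notin> T" using T(1) by blast
  obtain t0 where t0: "t0 \<in> T" using T(2) by blast
  have "\<exists>u. norm u = 1 \<and> (\<forall>t\<in>T. u \<bullet> \<phi> n t = u \<bullet> \<phi> n t0) \<and> (\<forall>s\<in>S. u \<bullet> \<phi> n s \<le> u \<bullet> \<phi> n t0)" for n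
  proof -
    obtain u h where uh: "\<forall>t\<in>\<phi> n ` T. u \<bullet> t = h" "\<forall>s\<in>\<phi> n ` S - \<phi> n ` T. u \<bullet> s < h"
      using ex[of n] unfolding exposes_def by blast
    have le: "u \<bullet> \<phi> n s \<le> h" if "s \<in> S" for s
    proof (cases "\<phi> n s \<in> \<phi> n ` T")
      case True
      then have "u \<bullet> \<phi> n s = h" using uh(1) by blast
      then show ?thesis by simp
    next
      case False
      then have "\<phi> n s \<in> \<phi> n ` S - \<phi> n ` T" using that by blast
      then show ?thesis using uh(2) by (simp add: less_imp_le)
    qed
    have "\<phi> n s0 \<notin> \<phi> n ` T" using inj[of n] s0 T(1) by (auto simp: inj_on_def)
    \<comment> \<open>A point off the contact set shows that the normal is nonzero and can be normalized.\<close>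
    then have "u \<bullet> \<phi> n s0 < h" using uh s0 by blast
    moreover have "u \<bullet> \<phi> n t0 = h" using uh t0 by blast
    ultimately have "u \<noteq> 0" by auto
    then show ?thesis using uh le t0
      by (intro exI[of _ "u /\<^sub>R norm u"]) (auto simp: divide_right_mono)
  qed
  then obtain u where u: "\<And>n. norm (u n) = 1" "\<And>n t. t \<in> T \<Longrightarrow> u n \<bullet> \<phi> n t = u n \<bullet> \<phi> n t0"
    "\<And>n s. s \<in> S \<Longrightarrow> u n \<bullet> \<phi> n s \<le> u n \<bullet> \<phi> n t0" by metis
  have "\<forall>n. u n \<in> sphere 0 1" using u(1) by simp
  then obtain v r where v: "v \<in> sphere 0 1" "strict_mono r" "(u \<circ> r) \<longlonglongrightarrow> v"
    using compact_sphere[of "0::'a" 1] unfolding compact_def by meson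
  have lim: "(\<lambda>n. u (r n) \<bullet> \<phi> (r n) s) \<longlonglongrightarrow> v \<bullet> s" if "s \<in> S" for s
    using tendsto_inner[OF v(3) LIMSEQ_subseq_LIMSEQ[OF conv[OF that] v(2)]] by (simp add: o_def)
  have t0S: "t0 \<in> S" using t0 T(1) by blast
  have eqT: "v \<bullet> t = v \<bullet> t0" if "t \<in> T" for t
  proof -
    have "(\<lambda>n. u (r n) \<bullet> \<phi> (r n) t) = (\<lambda>n. u (r n) \<bullet> \<phi> (r n) t0)" using u(2)[OF that] by simp
    moreover have "t \<in> S" using that T(1) by blast
    ultimately show ?thesis using lim[of t] lim[OF t0S] by (metis LIMSEQ_unique)
  qed
  have leS: "v \<bullet> s \<le> v \<bullet> t0" if "s \<in> S" for s
    by (rule LIMSEQ_le[OF lim[OF that] lim[OF t0S]]) (use u(3)[OF that] in auto)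
  define T' where "T' = S \<inter> {x. v \<bullet> x = v \<bullet> t0}"
  have T': "T' \<subseteq> S" "finite T'" "T \<subseteq> T'" using S(1) T(1) eqT by (auto simp: T'_def)
  have "v \<noteq> 0" using v(1) by auto
  then have "aff_dim {x. v \<bullet> x = v \<bullet> t0} = int DIM('a) - 1" by (simp add: aff_dim_hyperplane)
  moreover have "aff_dim T' \<le> aff_dim {x. v \<bullet> x = v \<bullet> t0}" by (rule aff_dim_subset) (auto simp: T'_def)
  ultimately have "\<not> affine_dependent T'" using gen_pos_card_le[OF S(2) T'(1,2)] by simp
  then have "convex hull T face_of convex hull T'"
    using face_of_convex_hull_affine_independent[of T' "convex hull T"] T'(3) by blast
  moreover have "exposes S T'"
    unfolding exposes_def T'_def using leS by (intro exI[of _ v] exI[of _ "v \<bullet> t0"]) (auto simp: less_le)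
  then have "convex hull T' face_of convex hull S" by (rule exposes_face[OF S(1) T'(1)])
  ultimately have "convex hull T face_of convex hull S" by (rule face_of_trans)
  then show ?thesis by (rule exposes_if_face[OF S T(1) T(3)])
qed

text \<open>
  The old normal \<open>u\<close> need not be constant on the perturbed points of \<open>T\<close>. Its projection \<open>p n\<close>
  onto the orthogonal complement of their directions is, and the quantitative affine
  independence of the perturbed points shows that the correction \<open>q n\<close> tends to zero. Hence
  \<open>p n\<close> exposes for all large \<open>n\<close>.
\<close>

lemma exposes_stable:
  fixes S :: "'a::euclidean_space set" and \<phi> :: "nat \<Rightarrow> 'a \<Rightarrow> 'a"
  assumes S: "finite S" and T: "T \<subseteq> S" "T \<noteq> {}" "\<not> affine_dependent T"
    and conv: "\<And>s. s \<in> S \<Longrightarrow> (\<lambda>n. \<phi> n s) \<longlonglongrightarrow> s"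
    and ex: "exposes S T"
  shows "eventually (\<lambda>n. exposes (\<phi> n ` S) (\<phi> n ` T)) sequentially"
proof -
  obtain u h where uh: "\<forall>t\<in>T. u \<bullet> t = h" "\<forall>s\<in>S - T. u \<bullet> s < h" using ex unfolding exposes_def by blast
  obtain t0 where t0: "t0 \<in> T" using T(2) by blast
  have fT: "finite T" using S T(1) finite_subset by blast
  have "aff_indep_family (\<lambda>x. x) T" using T(3) by (simp add: aff_indep_family_iff fT)
  then obtain \<eta> where \<eta>: "\<eta> > 0" and below: "\<And>g c. (\<forall>t\<in>T. dist (g t) t < \<eta>) \<Longrightarrow>
      \<eta> * (\<Sum>t\<in>T. \<bar>c t\<bar>) \<le> norm (\<Sum>t\<in>T. c t *\<^sub>R g t) + \<bar>\<Sum>t\<in>T. c t\<bar>"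
    using aff_indep_family_stable[OF fT, of "\<lambda>x. x"] by blast
  define L where "L n = (\<lambda>t. \<phi> n t - \<phi> n t0) ` T" for n
  have "\<exists>q p. q \<in> span (L n) \<and> (\<forall>w\<in>span (L n). p \<bullet> w = 0) \<and> u = q + p" for n
    using orthogonal_subspace_decomp_exists[of "L n" u] unfolding orthogonal_def by metis
  then obtain q p where qp: "\<And>n. q n \<in> span (L n)" "\<And>n w. w \<in> span (L n) \<Longrightarrow> p n \<bullet> w = 0" "\<And>n. u = q n + p n"
    by metis
  \<comment> \<open>The defect of \<open>u\<close> from being constant on the perturbed points of \<open>T\<close>.\<close>
  define e where "e n = (\<Sum>t\<in>T. \<bar>u \<bullet> \<phi> n t - h\<bar>)" for n
  have e_lim: "e \<longlonglongrightarrow> 0"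
  proof -
    have "e \<longlonglongrightarrow> (\<Sum>t\<in>T. \<bar>u \<bullet> t - h\<bar>)" unfolding e_def
      by (intro tendsto_intros conv) (use T(1) in auto)
    then show ?thesis using uh(1) by simp
  qed
  have qbound: "norm (q n) \<le> e n / \<eta>" if n: "\<forall>t\<in>T. dist (\<phi> n t) t < \<eta>" for n
  proof -
    obtain c where c: "q n = (\<Sum>t\<in>T. c t *\<^sub>R \<phi> n t)" "(\<Sum>t\<in>T. c t) = 0"
      using span_diffs[OF fT t0 qp(1)[of n, unfolded L_def]] by blast
    have small: "(\<Sum>t\<in>T. \<bar>c t\<bar>) \<le> norm (q n) / \<eta>"
      using below[OF n, of c] c \<eta> by (simp add: field_simps)
    have "norm (q n) * norm (q n) = q n \<bullet> q n" by (simp add: dot_square_norm power2_eq_square)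
    also have "\<dots> = u \<bullet> q n" using qp(2)[OF qp(1)[of n]] qp(3)[of n] by (simp add: inner_add_left)
    also have "\<dots> = (\<Sum>t\<in>T. c t * (u \<bullet> \<phi> n t))" unfolding c(1) by (simp add: inner_sum_right)
    also have "\<dots> = (\<Sum>t\<in>T. c t * (u \<bullet> \<phi> n t - h))"
      using c(2) by (simp add: right_diff_distrib sum_subtractf flip: sum_distrib_right)
    also have "\<dots> \<le> (\<Sum>t\<in>T. \<bar>c t\<bar> * e n)"
    proof (rule sum_mono)
      fix t assume t: "t \<in> T"
      have "c t * (u \<bullet> \<phi> n t - h) \<le> \<bar>c t\<bar> * \<bar>u \<bullet> \<phi> n t - h\<bar>" by (metis abs_ge_self abs_mult)
      also have "\<dots> \<le> \<bar>c t\<bar> * e n" unfolding e_def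
        by (intro mult_left_mono member_le_sum) (use t fT in auto)
      finally show "c t * (u \<bullet> \<phi> n t - h) \<le> \<bar>c t\<bar> * e n" .
    qed
    also have "\<dots> = (\<Sum>t\<in>T. \<bar>c t\<bar>) * e n" by (simp add: sum_distrib_right)
    also have "\<dots> \<le> norm (q n) / \<eta> * e n"
      by (rule mult_right_mono[OF small]) (auto simp: e_def intro: sum_nonneg)
    finally have "norm (q n) * norm (q n) \<le> norm (q n) * (e n / \<eta>)" by simp
    moreover have "0 \<le> e n / \<eta>" using \<eta> by (auto simp: e_def intro: sum_nonneg)
    ultimately show ?thesis
      by (cases "q n = 0") (simp_all only: mult_le_cancel_left_pos zero_less_norm_iff norm_zero not_False_eq_True)
  qed
  have near: "eventually (\<lambda>n. \<forall>t\<in>T. dist (\<phi> n t) t < \<eta>) sequentially"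
    using fT T(1) conv \<eta> by (intro eventually_ball_finite ballI tendstoD[OF conv]) auto
  have q0: "q \<longlonglongrightarrow> 0"
  proof (rule tendsto_norm_zero_cancel, rule tendsto_sandwich[OF _ _ tendsto_const])
    show "(\<lambda>n. e n / \<eta>) \<longlonglongrightarrow> 0" using tendsto_divide[OF e_lim tendsto_const[of \<eta>]] \<eta> by simp
    show "eventually (\<lambda>n. norm (q n) \<le> e n / \<eta>) sequentially" using near by eventually_elim (rule qbound)
  qed auto
  have p_lim: "p \<longlonglongrightarrow> u"
  proof -
    have "p = (\<lambda>n. u - q n)" using qp(3) by (auto simp: algebra_simps)
    then show ?thesis using tendsto_diff[OF tendsto_const[of u] q0] by simp
  qed
  have t0S: "t0 \<in> S" using t0 T(1) by blast
  have "eventually (\<lambda>n. p n \<bullet> \<phi> n s < p n \<bullet> \<phi> n t0) sequentially" if s: "s \<in> S - T" for s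
  proof -
    have "(\<lambda>n. p n \<bullet> \<phi> n t0 - p n \<bullet> \<phi> n s) \<longlonglongrightarrow> u \<bullet> t0 - u \<bullet> s"
      by (intro tendsto_intros p_lim conv) (use s t0S in auto)
    moreover have "0 < u \<bullet> t0 - u \<bullet> s" using uh s t0 by auto
    ultimately have "eventually (\<lambda>n. 0 < p n \<bullet> \<phi> n t0 - p n \<bullet> \<phi> n s) sequentially" by (rule order_tendstoD)
    then show ?thesis by eventually_elim simp
  qed
  then have "eventually (\<lambda>n. \<forall>s\<in>S - T. p n \<bullet> \<phi> n s < p n \<bullet> \<phi> n t0) sequentially"
    using S by (intro eventually_ball_finite) auto
  then show ?thesis
  proof eventually_elim
    case (elim n)
    have "p n \<bullet> \<phi> n t = p n \<bullet> \<phi> n t0" if "t \<in> T" for t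
    proof -
      have "\<phi> n t - \<phi> n t0 \<in> span (L n)" unfolding L_def using that by (intro span_base) auto
      then show ?thesis using qp(2)[of "\<phi> n t - \<phi> n t0" n] by (simp add: inner_diff_right)
    qed
    then show ?case using elim unfolding exposes_def
      by (intro exI[of _ "p n"] exI[of _ "p n \<bullet> \<phi> n t0"]) auto
  qed
qed

lemma eventually_inj_on:
  fixes \<phi> :: "nat \<Rightarrow> 'a::metric_space \<Rightarrow> 'a"
  assumes "finite S" "\<And>s. s \<in> S \<Longrightarrow> (\<lambda>n. \<phi> n s) \<longlonglongrightarrow> s"
  shows "eventually (\<lambda>n. inj_on (\<phi> n) S) sequentially"
proof -
  have "eventually (\<lambda>n. s \<noteq> t \<longrightarrow> \<phi> n s \<noteq> \<phi> n t) sequentially" if st: "s \<in> S" "t \<in> S" for s t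
  proof (cases "s = t")
    case False
    then have "0 < dist s t" by simp
    moreover have "(\<lambda>n. dist (\<phi> n s) (\<phi> n t)) \<longlonglongrightarrow> dist s t" by (intro tendsto_intros assms st)
    ultimately have "eventually (\<lambda>n. 0 < dist (\<phi> n s) (\<phi> n t)) sequentially" by (rule order_tendstoD(1)[rotated])
    then show ?thesis by eventually_elim auto
  qed simp
  then have "eventually (\<lambda>n. \<forall>s\<in>S. \<forall>t\<in>S. s \<noteq> t \<longrightarrow> \<phi> n s \<noteq> \<phi> n t) sequentially"
    using assms(1) by (intro eventually_ball_finite ballI) auto
  then show ?thesis by eventually_elim (auto simp: inj_on_def)
qed

lemma eventually_gen_pos:
  fixes S :: "'a::euclidean_space set"
  assumes S: "finite S" "gen_pos S" and conv: "\<And>s. s \<in> S \<Longrightarrow> (\<lambda>n. \<phi> n s) \<longlonglongrightarrow> s"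
  shows "eventually (\<lambda>n. gen_pos (\<phi> n ` S)) sequentially"
proof -
  have ev: "eventually (\<lambda>n. \<not> affine_dependent (\<phi> n ` T)) sequentially" if T: "T \<subseteq> S" "card T \<le> DIM('a) + 1" for T
  proof -
    have fT: "finite T" using T S finite_subset by blast
    have "\<not> affine_dependent T" using S T fT unfolding gen_pos_def by blast
    then have "aff_indep_family (\<lambda>x. x) T" by (simp add: aff_indep_family_iff fT)
    then obtain \<eta> where \<eta>: "\<eta> > 0" and below: "\<And>g c. (\<forall>t\<in>T. dist (g t) t < \<eta>) \<Longrightarrow>
      \<eta> * (\<Sum>t\<in>T. \<bar>c t\<bar>) \<le> norm (\<Sum>t\<in>T. c t *\<^sub>R g t) + \<bar>\<Sum>t\<in>T. c t\<bar>"
      using aff_indep_family_stable[OF fT, of "\<lambda>x. x"] by blast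
    have near: "eventually (\<lambda>n. \<forall>t\<in>T. dist (\<phi> n t) t < \<eta>) sequentially"
      using fT T(1) conv \<eta> by (intro eventually_ball_finite ballI tendstoD[OF conv]) auto
    then show ?thesis
    proof eventually_elim
      case (elim n)
      then show ?case using bounded_below_aff_indep_family[OF fT \<eta> below[OF elim]] aff_indep_family_iff[OF fT] by blast
    qed
  qed
  have "eventually (\<lambda>n. \<forall>T\<in>{T. T \<subseteq> S \<and> card T \<le> DIM('a) + 1}. \<not> affine_dependent (\<phi> n ` T)) sequentially"
    using S(1) ev by (intro eventually_ball_finite ballI) auto
  moreover have "eventually (\<lambda>n. inj_on (\<phi> n) S) sequentially"
    using S(1) conv by (rule eventually_inj_on)
  ultimately show ?thesis
  proof eventually_elim
    case (elim n)
    show ?case unfolding gen_pos_def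
    proof (intro allI impI, elim conjE)
      fix T' assume T': "T' \<subseteq> \<phi> n ` S" "finite T'" "card T' \<le> DIM('a) + 1"
      then obtain T where T: "T \<subseteq> S" "T' = \<phi> n ` T" by (meson subset_imageE)
      then have "card T \<le> DIM('a) + 1" using T'(3) elim(2) by (metis card_image inj_on_subset)
      then show "\<not> affine_dependent T'" using elim(1) T by blast
    qed
  qed
qed

text \<open>
  Of the finitely many candidates for a vertex set, the exposed ones remain exposed under small
  perturbations, and the others cannot be exposed infinitely often. The face number is
  therefore eventually constant.
\<close>

lemma hull_faces_stable:
  fixes S :: "(real ^ 'n) set" and \<phi> :: "nat \<Rightarrow> real ^ 'n \<Rightarrow> real ^ 'n"
  assumes S: "finite S" "gen_pos S" and conv: "\<And>s. s \<in> S \<Longrightarrow> (\<lambda>n. \<phi> n s) \<longlonglongrightarrow> s"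
    and j: "j < CARD('n)"
  shows "(\<lambda>n. hull_faces j (\<phi> n ` S)) \<longlonglongrightarrow> hull_faces j S"
proof -
  have jd: "j < DIM(real ^ 'n)" using j by simp
  have ev_inj: "eventually (\<lambda>n. inj_on (\<phi> n) S) sequentially" using S(1) conv by (rule eventually_inj_on)
  have ev_gen: "eventually (\<lambda>n. gen_pos (\<phi> n ` S)) sequentially" using S conv by (rule eventually_gen_pos)
  let ?\<T> = "{T. T \<subseteq> S \<and> card T = j + 1}"
  have ev: "eventually (\<lambda>n. exposes (\<phi> n ` S) (\<phi> n ` T) \<longleftrightarrow> exposes S T) sequentially" if T: "T \<in> ?\<T>" for T
  proof -
    have fT: "finite T" "T \<noteq> {}" "T \<subseteq> S" "card T \<le> DIM(real^'n)" using T S finite_subset jd by auto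
    have ind: "\<not> affine_dependent T" using S fT unfolding gen_pos_def by auto
    show ?thesis
    proof (cases "exposes S T")
      case True
      show ?thesis using exposes_stable[OF S(1) fT(3,2) ind conv True] True by simp
    next
      case False
      have "eventually (\<lambda>n. \<not> (exposes (\<phi> n ` S) (\<phi> n ` T) \<and> inj_on (\<phi> n) S)) sequentially"
      proof (rule ccontr)
        assume "\<not> eventually (\<lambda>n. \<not> (exposes (\<phi> n ` S) (\<phi> n ` T) \<and> inj_on (\<phi> n) S)) sequentially"
        then have "frequently (\<lambda>n. exposes (\<phi> n ` S) (\<phi> n ` T) \<and> inj_on (\<phi> n) S) sequentially"
          by (simp add: frequently_def)
        then have inf: "infinite {n. exposes (\<phi> n ` S) (\<phi> n ` T) \<and> inj_on (\<phi> n) S}"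
          unfolding cofinite_eq_sequentially[symmetric] by (simp only: frequently_cofinite simp_thms)
        define r where "r = enumerate {n. exposes (\<phi> n ` S) (\<phi> n ` T) \<and> inj_on (\<phi> n) S}"
        have r: "strict_mono r" "\<And>n. exposes (\<phi> (r n) ` S) (\<phi> (r n) ` T)" "\<And>n. inj_on (\<phi> (r n)) S"
          using strict_mono_enumerate[OF inf] enumerate_in_set[OF inf] by (auto simp: r_def)
        have "exposes S T"
          by (rule exposes_limit[OF S fT(3,2,4) _ r(2,3)])
             (use LIMSEQ_subseq_LIMSEQ[OF conv r(1)] in \<open>auto simp: o_def\<close>)
        then show False using False by simp
      qed
      with ev_inj show ?thesis by eventually_elim (use False in auto)
    qed
  qed
  have "eventually (\<lambda>n. \<forall>T\<in>?\<T>. exposes (\<phi> n ` S) (\<phi> n ` T) \<longleftrightarrow> exposes S T) sequentially"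
    using S(1) ev by (intro eventually_ball_finite ballI) auto
  then have "eventually (\<lambda>n. hull_faces j (\<phi> n ` S) = hull_faces j S) sequentially"
    using ev_inj ev_gen
  proof eventually_elim
    case (elim n)
    have "bij_betw ((`) (\<phi> n)) {T. T \<subseteq> S \<and> card T = j + 1 \<and> exposes S T}
        {T'. T' \<subseteq> \<phi> n ` S \<and> card T' = j + 1 \<and> exposes (\<phi> n ` S) T'}"
    proof (rule bij_betw_imageI)
      show "inj_on ((`) (\<phi> n)) {T. T \<subseteq> S \<and> card T = j + 1 \<and> exposes S T}"
        by (intro inj_onI) (use inj_on_image_eq_iff[OF elim(2)] in auto)
      show "(`) (\<phi> n) ` {T. T \<subseteq> S \<and> card T = j + 1 \<and> exposes S T} =
        {T'. T' \<subseteq> \<phi> n ` S \<and> card T' = j + 1 \<and> exposes (\<phi> n ` S) T'}" (is "?A = ?B")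
      proof
        show "?A \<subseteq> ?B" using elim(1,2) by (auto simp: card_image inj_on_subset)
        show "?B \<subseteq> ?A"
        proof
          fix T' assume T': "T' \<in> ?B"
          then obtain T where T: "T \<subseteq> S" "T' = \<phi> n ` T" by (auto elim: subset_imageE)
          then have "card T = j + 1" using T' elim(2) by (metis (mono_tags, lifting) card_image inj_on_subset mem_Collect_eq)
          then show "T' \<in> ?A" using elim(1) T T' by auto
        qed
      qed
    qed
    then show ?case
      unfolding hull_faces_def card_faces_gen_pos[OF S jd] card_faces_gen_pos[OF finite_imageI[OF S(1)] elim(3) jd]
      by (simp only: bij_betw_same_card)
  qed
  then show ?thesis by (rule tendsto_eventually)
qed

text \<open>
  Interior points of the limiting hull lie eventually in the perturbed hulls, exterior points
  eventually do not, and the boundary of a convex set is a null set. Dominated convergence of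
  indicators gives the claim.
\<close>

lemma hull_volume_stable:
  fixes S :: "(real ^ 'n) set" and \<phi> :: "nat \<Rightarrow> real ^ 'n \<Rightarrow> real ^ 'n"
  assumes S: "finite S" and conv: "\<And>s. s \<in> S \<Longrightarrow> (\<lambda>n. \<phi> n s) \<longlonglongrightarrow> s"
  shows "(\<lambda>n. hull_volume (\<phi> n ` S)) \<longlonglongrightarrow> hull_volume S"
proof -
  let ?K = "convex hull S" and ?Kn = "\<lambda>n. convex hull (\<phi> n ` S)"
  have inside: "eventually (\<lambda>n. x \<in> ?Kn n) sequentially" if x: "x \<in> interior ?K" for x
  proof (rule ccontr)
    assume "\<not> eventually (\<lambda>n. x \<in> ?Kn n) sequentially"
    then have "frequently (\<lambda>n. x \<notin> ?Kn n) sequentially" by (simp add: frequently_def)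
    then have inf: "infinite {n. x \<notin> ?Kn n}" unfolding cofinite_eq_sequentially[symmetric] by (simp only: frequently_cofinite simp_thms)
    define r where "r = enumerate {n. x \<notin> ?Kn n}"
    have r: "strict_mono r" "\<And>n. x \<notin> ?Kn (r n)"
      using strict_mono_enumerate[OF inf] enumerate_in_set[OF inf] by (auto simp: r_def)
    \<comment> \<open>Otherwise separate \<open>x\<close> from infinitely many perturbed hulls and pass to the limit of the normals.\<close>
    have "\<exists>u. norm u = 1 \<and> (\<forall>s\<in>S. u \<bullet> x \<le> u \<bullet> \<phi> (r n) s)" for n
    proof -
      have "closed (?Kn (r n))" using S by (simp add: compact_imp_closed finite_imp_compact compact_convex_hull)
      then obtain a b where ab: "a \<bullet> x < b" "\<forall>y\<in>?Kn (r n). a \<bullet> y > b"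
        using separating_hyperplane_closed_point[OF convex_convex_hull _ r(2)] by blast
      have "S \<noteq> {}" using x by auto
      then have "a \<noteq> 0" using ab hull_inc[of _ "\<phi> (r n) ` S" convex] by fastforce
      moreover have "a \<bullet> x \<le> a \<bullet> \<phi> (r n) s" if "s \<in> S" for s
        using ab hull_inc[of "\<phi> (r n) s" "\<phi> (r n) ` S" convex] that by fastforce
      ultimately show ?thesis by (intro exI[of _ "a /\<^sub>R norm a"]) (auto simp: divide_right_mono)
    qed
    then obtain u where u: "\<And>n. norm (u n) = 1" "\<And>n s. s \<in> S \<Longrightarrow> u n \<bullet> x \<le> u n \<bullet> \<phi> (r n) s" by metis
    have "\<forall>n. u n \<in> sphere 0 1" using u(1) by simp
    then obtain v r' where v: "v \<in> sphere 0 1" "strict_mono r'" "(u \<circ> r') \<longlonglongrightarrow> v"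
      using compact_sphere[of "0::real^'n" 1] unfolding compact_def by meson
    have "v \<bullet> x \<le> v \<bullet> s" if s: "s \<in> S" for s
    proof (rule LIMSEQ_le)
      show "(\<lambda>n. u (r' n) \<bullet> x) \<longlonglongrightarrow> v \<bullet> x" using tendsto_inner[OF v(3) tendsto_const] by (simp add: o_def)
      have "strict_mono (r \<circ> r')" using r(1) v(2) by (rule strict_mono_o)
      from LIMSEQ_subseq_LIMSEQ[OF conv[OF s] this]
      show "(\<lambda>n. u (r' n) \<bullet> \<phi> (r (r' n)) s) \<longlonglongrightarrow> v \<bullet> s" using tendsto_inner[OF v(3)] by (simp add: o_def)
    qed (use u(2)[OF s] in auto)
    then have "S \<subseteq> {y. v \<bullet> x \<le> v \<bullet> y}" by auto
    then have K: "?K \<subseteq> {y. v \<bullet> x \<le> v \<bullet> y}" by (rule hull_minimal) (simp add: convex_halfspace_ge)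
    obtain e where e: "e > 0" "ball x e \<subseteq> ?K" using x mem_interior by blast
    have "x - (e/2) *\<^sub>R v \<in> ball x e" using e(1) v(1) by (simp add: dist_norm)
    then have "v \<bullet> x \<le> v \<bullet> (x - (e/2) *\<^sub>R v)" using e(2) K by blast
    then show False using e(1) v(1) by (simp add: inner_diff_right dot_square_norm)
  qed
  have outside: "eventually (\<lambda>n. x \<notin> ?Kn n) sequentially" if x: "x \<notin> ?K" for x
  proof -
    have "closed ?K" using S by (simp add: compact_imp_closed finite_imp_compact compact_convex_hull)
    then obtain a b where ab: "a \<bullet> x < b" "\<forall>y\<in>?K. a \<bullet> y > b"
      using separating_hyperplane_closed_point[OF convex_convex_hull _ x] by blast
    have "eventually (\<lambda>n. b < a \<bullet> \<phi> n s) sequentially" if s: "s \<in> S" for s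
      by (rule order_tendstoD[OF tendsto_inner[OF tendsto_const conv[OF s]]]) (use ab s in \<open>auto simp: hull_inc\<close>)
    then have "eventually (\<lambda>n. \<forall>s\<in>S. b < a \<bullet> \<phi> n s) sequentially" using S by (intro eventually_ball_finite) auto
    then show ?thesis
    proof eventually_elim
      case (elim n)
      have "?Kn n \<subseteq> {y. b < a \<bullet> y}" by (rule hull_minimal) (use elim in \<open>auto simp: convex_halfspace_gt\<close>)
      then show ?case using ab by auto
    qed
  qed
  obtain R where R: "\<And>s. s \<in> S \<Longrightarrow> norm s \<le> R" using S finite_imp_bounded bounded_iff by metis
  have bd: "eventually (\<lambda>n. ?Kn n \<subseteq> cball 0 (R + 1)) sequentially"
  proof -
    have "eventually (\<lambda>n. \<forall>s\<in>S. dist (\<phi> n s) s < 1) sequentially"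
      using S tendstoD[OF conv, of _ 1] by (intro eventually_ball_finite) auto
    then show ?thesis
    proof eventually_elim
      case (elim n)
      show ?case
      proof (rule hull_minimal)
        have "norm (\<phi> n s) \<le> R + 1" if "s \<in> S" for s
          using R[OF that] elim that norm_triangle_ineq2[of "\<phi> n s" s] by (force simp: dist_norm)
        then show "\<phi> n ` S \<subseteq> cball 0 (R + 1)" by auto
      qed simp
    qed
  qed
  have meas: "?Kn n \<in> sets lebesgue" "?K \<in> sets lebesgue" for n
    using S by (auto intro!: lmeasurable_compact fmeasurableD simp: finite_imp_compact compact_convex_hull)
  have lim: "(\<lambda>n. \<integral>x. indicator (?Kn n \<inter> cball 0 (R + 1)) x \<partial>lebesgue) \<longlonglongrightarrow> (\<integral>x. indicator ?K x \<partial>lebesgue :: real)"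
  proof (rule integral_dominated_convergence[where w = "indicator (cball 0 (R + 1))"])
    show "AE x in lebesgue. (\<lambda>n. indicator (?Kn n \<inter> cball 0 (R + 1)) x :: real) \<longlonglongrightarrow> indicator ?K x"
    proof (rule AE_I')
      show "frontier ?K \<in> null_sets lebesgue"
        using negligible_convex_frontier[of ?K] by (simp add: negligible_iff_null_sets)
      show "{x \<in> space lebesgue. \<not> (\<lambda>n. indicator (?Kn n \<inter> cball 0 (R + 1)) x :: real) \<longlonglongrightarrow> indicator ?K x} \<subseteq> frontier ?K"
      proof (clarsimp, rule ccontr)
        fix x assume x: "x \<notin> frontier ?K" and n: "\<not> (\<lambda>n. indicator (?Kn n \<inter> cball 0 (R + 1)) x :: real) \<longlonglongrightarrow> indicator ?K x"
        have "closure ?K = ?K" using S by (simp add: compact_imp_closed finite_imp_compact compact_convex_hull)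
        then consider "x \<in> interior ?K" | "x \<notin> ?K" using x unfolding frontier_def by auto
        then have "eventually (\<lambda>n. indicator (?Kn n \<inter> cball 0 (R + 1)) x = (indicator ?K x :: real)) sequentially"
        proof cases
          case 1
          have xK: "x \<in> ?K" using 1 interior_subset by blast
          show ?thesis using inside[OF 1] bd by eventually_elim (use xK in \<open>auto simp: indicator_def\<close>)
        next
          case 2
          show ?thesis using outside[OF 2] by eventually_elim (use 2 in \<open>auto simp: indicator_def\<close>)
        qed
        from tendsto_eventually[OF this] show False using n by contradiction
      qed
    qed
  next
    have "cball (0::real^'n) (R + 1) \<in> fmeasurable lebesgue" by (rule lmeasurable_cball)
    then show "integrable lebesgue (indicator (cball 0 (R + 1)) :: real^'n \<Rightarrow> real)"
      unfolding fmeasurable_def by (intro integrable_real_indicator) blast+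
  next
    show "AE x in lebesgue. norm (indicator (?Kn n \<inter> cball 0 (R + 1)) x :: real) \<le> indicator (cball 0 (R + 1)) x" for n
      by (auto simp: indicator_def)
  next
    show "(\<lambda>x. indicator (?Kn n \<inter> cball 0 (R + 1)) x :: real) \<in> borel_measurable lebesgue" for n
      by (intro borel_measurable_indicator sets.Int meas) simp
  next
    show "(\<lambda>x. indicator ?K x :: real) \<in> borel_measurable lebesgue"
      by (intro borel_measurable_indicator meas)
  qed
  have "eventually (\<lambda>n. (\<integral>x. indicator (?Kn n \<inter> cball 0 (R + 1)) x \<partial>lebesgue) = hull_volume (\<phi> n ` S)) sequentially"
    using bd
  proof eventually_elim
    case (elim n)
    then have "?Kn n \<inter> cball 0 (R + 1) = ?Kn n" by blast
    then show ?case by (simp add: hull_volume_def)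
  qed
  from Lim_transform_eventually[OF lim this] show ?thesis by (simp add: hull_volume_def)
qed

section \<open>Dyadic discretization and almost sure general position\<close>

text \<open>
  The index of the dyadic cube of side length \<open>(1 / 2) ^ n\<close> that contains \<open>x\<close>. The default
  value off the basis makes equality of indices as functions the same as equality of cubes.
\<close>

definition grid :: "nat \<Rightarrow> 'a::euclidean_space \<Rightarrow> 'a \<Rightarrow> int" where
  "grid n x = (\<lambda>b. if b \<in> Basis then \<lfloor>2 ^ n * (x \<bullet> b)\<rfloor> else 0)"

lemma grid_measurable: "grid n -` {c} \<in> sets borel"
proof (cases "\<forall>b. b \<notin> Basis \<longrightarrow> c b = 0")
  case True
  then have "grid n -` {c} = (\<Inter>b\<in>Basis. {x. \<lfloor>2 ^ n * (x \<bullet> b)\<rfloor> = c b})"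
    by (auto simp: grid_def fun_eq_iff split: if_splits)
  also have "\<dots> \<in> sets borel"
    by (intro sets.finite_INT) auto
  finally show ?thesis .
next
  case False
  then have "grid n -` {c} = {}" by (auto simp: grid_def fun_eq_iff split: if_splits)
  then show ?thesis by (simp only: sets.empty_sets)
qed

lemma dist_grid:
  fixes x y :: "'a::euclidean_space"
  assumes "grid n x = grid n y"
  shows "dist x y \<le> DIM('a) / 2 ^ n"
proof -
  have "\<bar>(x - y) \<bullet> b\<bar> \<le> 1 / 2 ^ n" if b: "b \<in> Basis" for b
  proof -
    have "\<lfloor>2 ^ n * (x \<bullet> b)\<rfloor> = \<lfloor>2 ^ n * (y \<bullet> b)\<rfloor>" using fun_cong[OF assms, of b] b by (simp add: grid_def)
    then have "\<bar>2 ^ n * (x \<bullet> b) - 2 ^ n * (y \<bullet> b)\<bar> \<le> 1" by linarith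
    then have "2 ^ n * \<bar>(x - y) \<bullet> b\<bar> \<le> 1"
      by (simp add: inner_diff_left abs_mult flip: right_diff_distrib)
    then show ?thesis by (simp add: field_simps)
  qed
  then have "(\<Sum>b\<in>Basis. \<bar>(x - y) \<bullet> b\<bar>) \<le> (\<Sum>b\<in>(Basis :: 'a set). 1 / 2 ^ n)" by (rule sum_mono)
  then show ?thesis using norm_le_l1[of "x - y"] by (simp add: dist_norm)
qed

lemma grid_refine:
  assumes "grid n x = grid n y" "m \<le> n"
  shows "grid m x = grid m y"
proof
  fix b
  have "\<lfloor>2 ^ m * (x \<bullet> b)\<rfloor> = \<lfloor>2 ^ m * (y \<bullet> b)\<rfloor>" if b: "b \<in> Basis"
  proof -
    have eq: "\<lfloor>2 ^ n * (x \<bullet> b)\<rfloor> = \<lfloor>2 ^ n * (y \<bullet> b)\<rfloor>" using fun_cong[OF assms(1), of b] b by (simp add: grid_def)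
    have "\<lfloor>2 ^ m * r\<rfloor> = \<lfloor>2 ^ n * r\<rfloor> div 2 ^ (n - m)" for r :: real
    proof -
      have "(2::real) ^ n = 2 ^ m * 2 ^ (n - m)" using assms(2) by (simp flip: power_add)
      then have "2 ^ n * r / real (2 ^ (n - m)) = 2 ^ m * r" by simp
      then have "\<lfloor>2 ^ m * r\<rfloor> = \<lfloor>(2 ^ n * r) / real (2 ^ (n - m))\<rfloor>" by simp
      also have "\<dots> = \<lfloor>2 ^ n * r\<rfloor> div int (2 ^ (n - m))"
        using floor_divide_real_eq_div[of "int (2 ^ (n - m))" "2 ^ n * r"] by simp
      finally show ?thesis by simp
    qed
    then show ?thesis using eq by simp
  qed
  then show "grid m x b = grid m y b" by (simp add: grid_def)
qed

lemma finite_grid_image: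
  assumes "bounded (B :: 'a::euclidean_space set)"
  shows "finite (grid n ` B)"
proof -
  obtain R where R: "\<And>x. x \<in> B \<Longrightarrow> norm x \<le> R" using assms bounded_iff by metis
  let ?r = "\<lceil>2 ^ n * R\<rceil> + 1"
  have "grid n x b \<in> {- ?r..?r}" if "x \<in> B" "b \<in> Basis" for x b
  proof -
    have "\<bar>x \<bullet> b\<bar> \<le> R" using Basis_le_norm[OF that(2), of x] R[OF that(1)] by linarith
    then have "\<bar>2 ^ n * (x \<bullet> b)\<bar> \<le> 2 ^ n * R" by (simp add: abs_mult)
    then have ab: "2 ^ n * (x \<bullet> b) \<le> 2 ^ n * R" "- (2 ^ n * R) \<le> 2 ^ n * (x \<bullet> b)" by (simp_all only: abs_le_iff minus_le_iff)
    have "\<lfloor>2 ^ n * (x \<bullet> b)\<rfloor> \<le> ?r"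
      by (rule order_trans[OF floor_mono[OF ab(1)] order_trans[OF floor_le_ceiling]]) simp
    moreover have "- ?r \<le> \<lfloor>2 ^ n * (x \<bullet> b)\<rfloor>"
      by (rule order_trans[OF _ floor_mono[OF ab(2)]]) (simp add: floor_minus)
    ultimately have "grid n x b \<le> ?r" "- ?r \<le> grid n x b" using that(2) unfolding grid_def by simp_all
    then show ?thesis by simp
  qed
  then have "grid n ` B \<subseteq> {f. \<forall>b. (b \<in> Basis \<longrightarrow> f b \<in> {- ?r..?r}) \<and> (b \<notin> Basis \<longrightarrow> f b = 0)}"
    by (auto simp: grid_def)
  moreover have "finite {f :: 'a \<Rightarrow> int. \<forall>b. (b \<in> Basis \<longrightarrow> f b \<in> {- ?r..?r}) \<and> (b \<notin> Basis \<longrightarrow> f b = 0)}"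
    by (rule finite_set_of_finite_funs) auto
  ultimately show ?thesis by (rule finite_subset)
qed

lemma countable_range_grid: "countable (range (grid n :: 'a::euclidean_space \<Rightarrow> _))"
proof (rule countable_subset)
  show "range (grid n :: 'a \<Rightarrow> _) \<subseteq> (\<Union>k. grid n ` cball 0 (real k))"
  proof clarify
    fix x :: 'a
    obtain k where "norm x \<le> real k" using real_arch_simple by blast
    then have "x \<in> cball 0 (real k)" by simp
    then show "grid n x \<in> (\<Union>k. grid n ` cball 0 (real k))" by blast
  qed
  show "countable (\<Union>k. grid n ` cball (0::'a) (real k))"
    by (rule countable_UN) (auto intro: countable_finite[OF finite_grid_image])
qed

lemma grid_separates:
  fixes S :: "'a::euclidean_space set"
  assumes "finite S"
  shows "\<exists>n. inj_on (grid n) S"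
proof -
  have "\<exists>e>0. \<forall>x\<in>S. \<forall>y\<in>S. x \<noteq> y \<longrightarrow> e \<le> dist x y"
  proof -
    have "\<exists>e>0. \<forall>p\<in>S \<times> S. fst p \<noteq> snd p \<longrightarrow> e \<le> dist (fst p) (snd p)"
    proof -
      let ?D = "{p \<in> S \<times> S. fst p \<noteq> snd p}"
      let ?e = "Min (insert 1 ((\<lambda>p. dist (fst p) (snd p)) ` ?D))"
      have f: "finite (insert 1 ((\<lambda>p. dist (fst p) (snd p)) ` ?D))" using assms by simp
      have "?e > 0" using f by (subst Min_gr_iff) auto
      moreover have "?e \<le> dist (fst p) (snd p)" if "p \<in> ?D" for p using f that by (intro Min_le) auto
      ultimately show ?thesis by blast
    qed
    then show ?thesis by force
  qed
  then obtain e where e: "e > 0" "\<And>x y. x \<in> S \<Longrightarrow> y \<in> S \<Longrightarrow> x \<noteq> y \<Longrightarrow> e \<le> dist x y" by blast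
  have "(\<lambda>n. real DIM('a) * (1/2) ^ n) \<longlonglongrightarrow> real DIM('a) * 0" by (intro tendsto_intros LIMSEQ_power_zero) auto
  then have "eventually (\<lambda>n. real DIM('a) * (1/2) ^ n < e) sequentially" using e(1) by (intro order_tendstoD) auto
  then obtain n where n: "real DIM('a) * (1/2) ^ n < e" using eventually_happens by (metis trivial_limit_sequentially)
  have "inj_on (grid n) S"
  proof (rule inj_onI, rule ccontr)
    fix x y assume xy: "x \<in> S" "y \<in> S" "grid n x = grid n y" "x \<noteq> y"
    have "e \<le> DIM('a) / 2 ^ n" using e(2)[OF xy(1,2,4)] dist_grid[OF xy(3)] by linarith
    then show False using n by (simp add: power_divide)
  qed
  then show ?thesis by blast
qed

text \<open>
  Fubini, one point at a time: if the first points are affinely independent, the next one has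
  to avoid only their affine hull, which is a null set as long as its dimension is less than
  \<open>d\<close>.
\<close>

lemma null_aff_dependent_tuples:
  fixes \<mu> :: "'a::euclidean_space measure"
  assumes sets: "sets \<mu> = sets borel" and fin: "finite_measure \<mu>"
    and ac: "\<And>A. A \<in> sets borel \<Longrightarrow> A \<in> null_sets lborel \<Longrightarrow> emeasure \<mu> A = 0"
  shows "k \<le> DIM('a) \<Longrightarrow> E \<in> sets (Pi\<^sub>M {..k} (\<lambda>_. \<mu>)) \<Longrightarrow> (\<And>y. y \<in> E \<Longrightarrow> \<not> aff_indep_family y {..k}) \<Longrightarrow>
    emeasure (Pi\<^sub>M {..k} (\<lambda>_. \<mu>)) E = 0"
proof (induction k arbitrary: E)
  case 0
  have "aff_indep_family y {..0}" for y :: "nat \<Rightarrow> 'a" by (simp add: aff_indep_family_def)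
  then have "E = {}" using 0 by blast
  then show ?case by (simp only: emeasure_empty)
next
  case (Suc k)
  interpret mu: finite_measure \<mu> by (rule fin)
  interpret product_sigma_finite "\<lambda>_::nat. \<mu>" ..
  have E: "E \<in> sets (Pi\<^sub>M (insert (Suc k) {..k}) (\<lambda>_. \<mu>))" using Suc.prems(2) by (simp add: atMost_Suc)
  let ?G = "\<lambda>y. \<integral>\<^sup>+x. indicator E (y(Suc k := x)) \<partial>\<mu>"
  have Gm: "?G \<in> borel_measurable (Pi\<^sub>M {..k} (\<lambda>_. \<mu>))"
  proof -
    have "(\<lambda>(y, x). indicator E (y(Suc k := x)) :: ennreal) \<in> borel_measurable (Pi\<^sub>M {..k} (\<lambda>_. \<mu>) \<Otimes>\<^sub>M \<mu>)"
      using E measurable_add_dim[of "Suc k" "{..k}" "\<lambda>_. \<mu>"]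
      by (auto simp: case_prod_unfold intro!: borel_measurable_indicator' measurable_compose[of _ _ "Pi\<^sub>M (insert (Suc k) {..k}) (\<lambda>_. \<mu>)"])
    from mu.borel_measurable_nn_integral[OF this] show ?thesis by simp
  qed
  have zero: "?G y = 0" if y: "aff_indep_family y {..k}" for y
  proof -
    have inj: "inj_on y {..k}" "\<not> affine_dependent (y ` {..k})" using y by (simp_all add: aff_indep_family_iff)
    have "aff_dim (y ` {..k}) = int k" using aff_dim_affine_independent[OF inj(2)] card_image[OF inj(1)] by simp
    then have "aff_dim (affine hull (y ` {..k})) < int DIM('a)" using Suc.prems(1) by simp
    then have "negligible (affine hull (y ` {..k}))"
      using negligible_convex_interior[of "affine hull (y ` {..k})"] aff_dim_nonempty_interior[of "affine hull (y ` {..k})"]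
      by (auto simp: affine_imp_convex)
    then have null: "affine hull (y ` {..k}) \<in> null_sets lborel"
      by (simp add: negligible_iff_null_sets null_sets_completion_iff closed_affine_hull)
    have "?G y \<le> (\<integral>\<^sup>+x. indicator (affine hull (y ` {..k})) x \<partial>\<mu>)"
    proof (rule nn_integral_mono)
      fix x
      show "indicator E (y(Suc k := x)) \<le> (indicator (affine hull (y ` {..k})) x :: ennreal)"
      proof (cases "y(Suc k := x) \<in> E \<and> x \<notin> affine hull (y ` {..k})")
        case True
        have "\<not> affine_dependent (insert x (y ` {..k}))"
          using True inj(2) by (intro affine_independent_insert) auto
        moreover have "(y(Suc k := x)) ` {..Suc k} = insert x (y ` {..k})" by (auto simp: atMost_Suc)
        moreover have "inj_on (y(Suc k := x)) {..Suc k}"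
        proof -
          have "x \<notin> y ` {..k}" using True hull_subset[of "y ` {..k}" affine] by blast
          then show ?thesis using inj(1) by (auto simp: inj_on_def atMost_Suc)
        qed
        ultimately have "aff_indep_family (y(Suc k := x)) {..Suc k}" by (simp add: aff_indep_family_iff)
        then show ?thesis using Suc.prems(3)[of "y(Suc k := x)"] True by blast
      qed (auto simp: indicator_def)
    qed
    also have "\<dots> = emeasure \<mu> (affine hull (y ` {..k}))" using sets by (simp add: closed_affine_hull borel_closed)
    also have "\<dots> = 0" using null by (intro ac) auto
    finally show ?thesis by simp
  qed
  have "{y \<in> space (Pi\<^sub>M {..k} (\<lambda>_. \<mu>)). ?G y \<noteq> 0} \<in> sets (Pi\<^sub>M {..k} (\<lambda>_. \<mu>))"
    using Gm by measurable
  then have "emeasure (Pi\<^sub>M {..k} (\<lambda>_. \<mu>)) {y \<in> space (Pi\<^sub>M {..k} (\<lambda>_. \<mu>)). ?G y \<noteq> 0} = 0"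
    using zero Suc.prems(1) by (intro Suc.IH) auto
  then have "AE y in Pi\<^sub>M {..k} (\<lambda>_. \<mu>). ?G y = 0"
    using Gm by (subst AE_iff_measurable[OF _ refl]) auto
  then have "(\<integral>\<^sup>+y. ?G y \<partial>Pi\<^sub>M {..k} (\<lambda>_. \<mu>)) = 0"
    using Gm by (subst nn_integral_0_iff_AE) auto
  moreover have "emeasure (Pi\<^sub>M {..Suc k} (\<lambda>_. \<mu>)) E = (\<integral>\<^sup>+y. ?G y \<partial>Pi\<^sub>M {..k} (\<lambda>_. \<mu>))"
    using E product_nn_integral_insert[of "{..k}" "Suc k" "indicator E"]
    by (simp add: atMost_Suc nn_integral_indicator[symmetric] del: nn_integral_indicator)
  ultimately show ?case by simp
qed

context poisson_points
begin

text \<open>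
  The probability of seeing a dependent tuple of distinct points is compared with the product
  measure of the dependent tuples. Once a tuple is separated by the cubes of level \<open>m\<close>, its
  points are in different cubes at every level \<open>n \<ge> m\<close>. The counts in these cubes are
  independent, so a product box of such cubes is occupied with probability at most its product
  measure. Summing over the boxes of level \<open>n\<close> that meet the dependent tuples bounds the
  probability by the measure of their union \<open>B n\<close>. These unions decrease with \<open>n\<close> to a set that
  contains only dependent tuples, as independence is stable under small perturbations.
\<close>

lemma AE_gen_pos:
  assumes ac: "\<And>A. A \<in> sets borel \<Longrightarrow> A \<in> null_sets lborel \<Longrightarrow> emeasure \<mu> A = 0"
  shows "AE \<omega> in M. gen_pos (X \<omega>)"
proof -
  interpret product_sigma_finite "\<lambda>_::nat. \<mu>" ..
  define bad where "bad k m y \<longleftrightarrow> inj_on (grid m \<circ> y) {..k} \<and> \<not> aff_indep_family y {..k}" for k m :: nat and y :: "nat \<Rightarrow> 'a"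
  have main: "\<exists>N\<in>null_sets M. {\<omega>\<in>space M. \<exists>y. (\<forall>i\<le>k. y i \<in> X \<omega>) \<and> bad k m y} \<subseteq> N" if k: "k \<le> DIM('a)" for k m
  proof -
    let ?P = "Pi\<^sub>M {..k} (\<lambda>_. \<mu>)"
    interpret P: finite_measure ?P
    proof (rule finite_measureI)
      have "emeasure ?P (space ?P) = (\<Prod>i\<in>{..k}. emeasure \<mu> (space \<mu>))"
        unfolding space_PiM by (rule emeasure_PiM) auto
      also have "\<dots> = ennreal (\<Prod>i\<in>{..k}. measure \<mu> (space \<mu>))"
        by (simp only: mu.emeasure_eq_measure prod_ennreal measure_nonneg)
      finally show "emeasure ?P (space ?P) \<noteq> \<infinity>" by simp
    qed
    define cell where "cell n c = grid n -` {c}" for n and c :: "'a \<Rightarrow> int"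
    \<comment> \<open>The indices of the boxes of level \<open>n\<close> that contain a dependent tuple separated at level \<open>m\<close>.\<close>
    define G where "G n = {g. \<exists>y. g = restrict (grid n \<circ> y) {..k} \<and> bad k m y}" for n
    define box where "box n g = PiE {..k} (\<lambda>i. cell n (g i))" for n g
    define B where "B n = (\<Union>g\<in>G n. box n g)" for n
    \<comment> \<open>The event that all factors of the box \<open>g\<close> contain a point.\<close>
    define H where "H n g = {\<omega>\<in>space M. \<forall>i\<in>{..k}. num_points (X \<omega>) (cell n (g i)) \<in> - {0}}" for n g
    have cell_sets: "cell n c \<in> sets borel" for n c unfolding cell_def by (rule grid_measurable)
    have cG: "countable (G n)" for n
    proof (rule countable_subset)
      show "G n \<subseteq> PiE {..k} (\<lambda>_. range (grid n))" by (auto simp: G_def)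
      show "countable (PiE {..k} (\<lambda>_. range (grid n :: 'a \<Rightarrow> _)))"
        by (intro countable_PiE countable_range_grid) auto
    qed
    have box_sets: "box n g \<in> sets ?P" for n g
      unfolding box_def using cell_sets sets_mu by (intro sets_PiM_I_finite) auto
    have B_sets: "B n \<in> sets ?P" for n unfolding B_def by (intro sets.countable_UN'' cG box_sets)
    have B_iff: "y \<in> B n \<longleftrightarrow> y \<in> extensional {..k} \<and> (\<exists>y'. (\<forall>i\<le>k. grid n (y i) = grid n (y' i)) \<and> bad k m y')" for n y
    proof
      assume "y \<in> B n"
      then obtain y' where y': "bad k m y'" "y \<in> box n (restrict (grid n \<circ> y') {..k})" by (auto simp: B_def G_def)
      then have "y \<in> extensional {..k}" "\<forall>i\<le>k. grid n (y i) = grid n (y' i)"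
        by (auto simp: box_def cell_def PiE_def Pi_def)
      then show "y \<in> extensional {..k} \<and> (\<exists>y'. (\<forall>i\<le>k. grid n (y i) = grid n (y' i)) \<and> bad k m y')"
        using y'(1) by blast
    next
      assume "y \<in> extensional {..k} \<and> (\<exists>y'. (\<forall>i\<le>k. grid n (y i) = grid n (y' i)) \<and> bad k m y')"
      then obtain y' where y': "y \<in> extensional {..k}" "\<forall>i\<le>k. grid n (y i) = grid n (y' i)" "bad k m y'" by blast
      then have "y \<in> box n (restrict (grid n \<circ> y') {..k})" by (auto simp: box_def cell_def PiE_def Pi_def)
      moreover have "restrict (grid n \<circ> y') {..k} \<in> G n" using y'(3) by (auto simp: G_def)
      ultimately show "y \<in> B n" unfolding B_def by blast
    qed
    have decB: "decseq B"
    proof (rule decseq_SucI)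
      fix n show "B (Suc n) \<subseteq> B n"
      proof
        fix y assume "y \<in> B (Suc n)"
        then obtain y' where y: "y \<in> extensional {..k}" "\<forall>i\<le>k. grid (Suc n) (y i) = grid (Suc n) (y' i)" "bad k m y'"
          unfolding B_iff by blast
        then have "\<forall>i\<le>k. grid n (y i) = grid n (y' i)" by (auto intro: grid_refine[where n = "Suc n"])
        then show "y \<in> B n" unfolding B_iff using y by blast
      qed
    qed
    have "\<not> aff_indep_family y {..k}" if y: "y \<in> (\<Inter>n. B n)" for y
    proof
      assume ind: "aff_indep_family y {..k}"
      obtain \<eta> where \<eta>: "\<eta> > 0" and st: "\<And>g c. \<forall>i\<in>{..k}. dist (g i) (y i) < \<eta> \<Longrightarrow>
          \<eta> * (\<Sum>i\<in>{..k}. \<bar>c i\<bar>) \<le> norm (\<Sum>i\<in>{..k}. c i *\<^sub>R g i) + \<bar>\<Sum>i\<in>{..k}. c i\<bar>"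
        using aff_indep_family_stable[OF finite_atMost ind] by blast
      have "(\<lambda>n. real DIM('a) * (1/2) ^ n) \<longlonglongrightarrow> real DIM('a) * 0" by (intro tendsto_intros LIMSEQ_power_zero) auto
      then have "eventually (\<lambda>n. real DIM('a) * (1/2) ^ n < \<eta>) sequentially" using \<eta> by (intro order_tendstoD) auto
      then obtain n where n: "real DIM('a) * (1/2) ^ n < \<eta>" using eventually_happens by (metis trivial_limit_sequentially)
      obtain y' where y': "\<forall>i\<le>k. grid n (y i) = grid n (y' i)" "bad k m y'"
      proof -
        have "y \<in> B n" using y by blast
        then show thesis using that unfolding B_iff by blast
      qed
      have "dist (y' i) (y i) < \<eta>" if "i \<le> k" for i
        using dist_grid[of n "y' i" "y i"] y'(1) that n by (simp add: power_divide)
      then have "aff_indep_family y' {..k}"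
        by (intro bounded_below_aff_indep_family[OF _ \<eta> st]) auto
      then show False using y'(2) by (simp add: bad_def)
    qed
    then have "emeasure ?P (\<Inter>n. B n) = 0"
      using B_sets by (intro null_aff_dependent_tuples[OF sets_mu fin_mu ac k]) auto
    moreover have "(\<lambda>n. emeasure ?P (B n)) \<longlonglongrightarrow> emeasure ?P (\<Inter>n. B n)"
      by (rule Lim_emeasure_decseq) (use B_sets decB P.emeasure_finite in auto)
    ultimately have lim: "(\<lambda>n. emeasure ?P (B n)) \<longlonglongrightarrow> 0" by simp
    have H_sets: "H n g \<in> sets M" for n g
      unfolding H_def
    proof (rule sets.sets_Collect_finite_All)
      fix i assume "i \<in> {..k}"
      show "{\<omega> \<in> space M. num_points (X \<omega>) (cell n (g i)) \<in> - {0}} \<in> sets M"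
        using measurable_sets[OF num_measurable[OF cell_sets], of "- {0}" n "g i"]
        by (simp add: vimage_def Int_def conj_commute)
    qed simp
    define U where "U n = (\<Union>g\<in>G n. H n g)" for n
    have U_sets: "U n \<in> sets M" for n unfolding U_def by (intro sets.countable_UN'' cG H_sets)
    have Hle: "emeasure M (H n g) \<le> emeasure ?P (box n g)" if n: "n \<ge> m" and g: "g \<in> G n" for n g
    proof -
      obtain y where y: "g = restrict (grid n \<circ> y) {..k}" "bad k m y" using g by (auto simp: G_def)
      have "inj_on g {..k}"
        using y n grid_refine[of n _ _ m] unfolding bad_def inj_on_def by (auto; blast)
      then have dis: "disjoint_family_on (\<lambda>i. cell n (g i)) {..k}"
        by (auto simp: disjoint_family_on_def cell_def inj_on_def)
      have "prob (H n g) = (\<Prod>i\<in>{..k}. prob {\<omega>\<in>space M. num_points (X \<omega>) (cell n (g i)) \<in> - {0}})"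
        unfolding H_def by (rule indep_counts) (use cell_sets dis in auto)
      also have "\<dots> \<le> (\<Prod>i\<in>{..k}. measure \<mu> (cell n (g i)))"
      proof (rule prod_mono)
        fix i assume "i \<in> {..k}"
        have "{\<omega>\<in>space M. num_points (X \<omega>) (cell n (g i)) \<in> - {0}} = {\<omega>\<in>space M. X \<omega> \<inter> cell n (g i) \<noteq> {}}"
          by (simp add: num_points_eq_0)
        then show "0 \<le> prob {\<omega>\<in>space M. num_points (X \<omega>) (cell n (g i)) \<in> - {0}} \<and>
            prob {\<omega>\<in>space M. num_points (X \<omega>) (cell n (g i)) \<in> - {0}} \<le> measure \<mu> (cell n (g i))"
          using prob_nonempty_le[OF cell_sets, of n "g i"] by simp
      qed
      finally have "emeasure M (H n g) \<le> ennreal (\<Prod>i\<in>{..k}. measure \<mu> (cell n (g i)))"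
        unfolding emeasure_eq_measure by (rule ennreal_leI)
      also have "\<dots> = (\<Prod>i\<in>{..k}. emeasure \<mu> (cell n (g i)))"
        by (simp add: prod_ennreal mu.emeasure_eq_measure)
      also have "\<dots> = emeasure ?P (box n g)"
        unfolding box_def by (rule emeasure_PiM[symmetric]) (use cell_sets sets_mu in auto)
      finally show ?thesis .
    qed
    have Ule: "emeasure M (U n) \<le> emeasure ?P (B n)" if n: "n \<ge> m" for n
    proof -
      have "emeasure M (U n) = (\<integral>\<^sup>+\<omega>. indicator (U n) \<omega> \<partial>M)" using U_sets by simp
      also have "\<dots> \<le> (\<integral>\<^sup>+\<omega>. (\<integral>\<^sup>+g. indicator (H n g) \<omega> \<partial>count_space (G n)) \<partial>M)"
      proof (rule nn_integral_mono)
        fix \<omega>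
        show "indicator (U n) \<omega> \<le> (\<integral>\<^sup>+g. indicator (H n g) \<omega> \<partial>count_space (G n))"
        proof (cases "\<omega> \<in> U n")
          case True
          then obtain g where g: "g \<in> G n" "\<omega> \<in> H n g" by (auto simp: U_def)
          then show ?thesis using nn_integral_ge_point[of g "G n" "\<lambda>g. indicator (H n g) \<omega>"] by (simp add: indicator_def)
        qed simp
      qed
      also have "\<dots> = (\<integral>\<^sup>+g. (\<integral>\<^sup>+\<omega>. indicator (H n g) \<omega> \<partial>M) \<partial>count_space (G n))"
        by (rule nn_integral_count_space_nn_integral) (use cG H_sets in auto)
      also have "\<dots> \<le> (\<integral>\<^sup>+g. emeasure ?P (box n g) \<partial>count_space (G n))"
        by (rule nn_integral_mono) (use Hle[OF n] H_sets in auto)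
      also have "\<dots> = emeasure ?P (B n)"
        unfolding B_def
      proof (rule emeasure_UN_countable[symmetric])
        show "disjoint_family_on (box n) (G n)"
          unfolding disjoint_family_on_def
        proof (intro ballI impI, rule ccontr)
          fix g g' assume g: "g \<in> G n" "g' \<in> G n" "g \<noteq> g'" "box n g \<inter> box n g' \<noteq> {}"
          then obtain y where "y \<in> box n g" "y \<in> box n g'" by blast
          then have "\<forall>i\<in>{..k}. g i = g' i" by (auto simp: box_def cell_def PiE_def Pi_def)
          moreover have "g \<in> extensional {..k}" "g' \<in> extensional {..k}" using g by (auto simp: G_def)
          ultimately have "g = g'" by (intro extensionalityI[of g "{..k}" g']) auto
          then show False using g(3) by simp
        qed
      qed (use cG box_sets in auto)
      finally show ?thesis .
    qed
    let ?N = "\<Inter>n\<in>{m..}. U n"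
    have N_sets: "?N \<in> sets M" by (intro sets.countable_INT') (use U_sets in auto)
    have "emeasure M ?N \<le> 0"
    proof (rule LIMSEQ_le_const[OF lim])
      have "emeasure M ?N \<le> emeasure ?P (B n)" if "n \<ge> m" for n
        using emeasure_mono[of ?N "U n" M] U_sets Ule[OF that] that by (meson INT_lower atLeast_iff order_trans)
      then show "\<exists>N. \<forall>n\<ge>N. emeasure M ?N \<le> emeasure ?P (B n)" by blast
    qed
    then have null: "?N \<in> null_sets M" using N_sets by (simp add: null_sets_def)
    have "{\<omega>\<in>space M. \<exists>y. (\<forall>i\<le>k. y i \<in> X \<omega>) \<and> bad k m y} \<subseteq> ?N"
    proof (clarsimp)
      fix \<omega> y n assume w: "\<omega> \<in> space M" "\<forall>i\<le>k. y i \<in> X \<omega>" "bad k m y" "m \<le> n"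
      let ?g = "restrict (grid n \<circ> y) {..k}"
      have "?g \<in> G n" unfolding G_def using w by blast
      moreover have "\<omega> \<in> H n ?g" using w unfolding H_def by (auto simp: num_points_eq_0 cell_def)
      ultimately show "\<omega> \<in> U n" unfolding U_def by blast
    qed
    then show ?thesis using null by blast
  qed
  have "AE \<omega> in M. \<forall>k\<in>{..DIM('a)}. \<forall>m. \<not> (\<exists>y. (\<forall>i\<le>k. y i \<in> X \<omega>) \<and> bad k m y)"
  proof (rule AE_finite_allI[OF finite_atMost], unfold AE_all_countable, rule allI)
    fix k m assume "k \<in> {..DIM('a)}"
    then obtain N where "N \<in> null_sets M" "{\<omega>\<in>space M. \<exists>y. (\<forall>i\<le>k. y i \<in> X \<omega>) \<and> bad k m y} \<subseteq> N"
      using main[of k m] by (meson atMost_iff)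
    then show "AE \<omega> in M. \<not> (\<exists>y. (\<forall>i\<le>k. y i \<in> X \<omega>) \<and> bad k m y)" by (intro AE_I') auto
  qed
  then show ?thesis
  proof eventually_elim
    case (elim \<omega>)
    show ?case unfolding gen_pos_def
    proof (intro allI impI notI, elim conjE)
      fix T assume T: "T \<subseteq> X \<omega>" "finite T" "card T \<le> DIM('a) + 1" and dep: "affine_dependent T"
      have "T \<noteq> {}" using dep by auto
      then obtain k where k: "card T = Suc k" using T(2) by (metis card_eq_0_iff not0_implies_Suc)
      obtain y where y: "bij_betw y {..k} T"
        using ex_bij_betw_nat_finite[OF T(2)] k by (metis atLeast0LessThan lessThan_Suc_atMost)
      then have yT: "y ` {..k} = T" "inj_on y {..k}" by (auto simp: bij_betw_def)
      obtain m where m: "inj_on (grid m) T" using grid_separates[OF T(2)] by blast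
      have "bad k m y" unfolding bad_def using comp_inj_on[OF yT(2), of "grid m"] m yT dep
        by (simp add: aff_indep_family_iff)
      moreover have "\<forall>i\<le>k. y i \<in> X \<omega>" using yT(1) T(1) by blast
      moreover have "k \<in> {..DIM('a)}" using k T(3) by simp
      ultimately show False using elim by blast
    qed
  qed
qed

end

section \<open>Spherical packings and cone sectors\<close>

lemma norm_sgn_diff_le:
  fixes x y :: "'a::real_normed_vector"
  assumes y: "y \<noteq> 0"
  shows "norm (sgn x - sgn y) \<le> 2 * norm (x - y) / norm y"
proof (cases "x = 0")
  case True
  then show ?thesis using y by (simp add: norm_sgn)
next
  case False
  have "sgn x - sgn y = (x - y) /\<^sub>R norm y + (1 / norm x - 1 / norm y) *\<^sub>R x"
    using y False by (simp add: sgn_div_norm scaleR_diff_right scaleR_diff_left divide_inverse)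
  also have "norm \<dots> \<le> norm ((x - y) /\<^sub>R norm y) + norm ((1 / norm x - 1 / norm y) *\<^sub>R x)"
    by (rule norm_triangle_ineq)
  also have "norm ((1 / norm x - 1 / norm y) *\<^sub>R x) = \<bar>norm y - norm x\<bar> / norm y"
  proof -
    have "1 / norm x - 1 / norm y = (norm y - norm x) / (norm x * norm y)"
      using y False by (simp add: field_simps)
    then show ?thesis using y False by (simp add: abs_mult)
  qed
  also have "\<bar>norm y - norm x\<bar> / norm y \<le> norm (x - y) / norm y"
    using y norm_triangle_ineq3[of y x] by (intro divide_right_mono) (auto simp: norm_minus_commute)
  finally have "norm (sgn x - sgn y) \<le> norm ((x - y) /\<^sub>R norm y) + norm (x - y) / norm y" by simp
  moreover have "norm ((x - y) /\<^sub>R norm y) = norm (x - y) / norm y"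
    by (simp only: norm_scaleR) (simp add: divide_inverse mult.commute)
  ultimately show ?thesis by simp
qed

abbreviation unit_vol :: "'a::euclidean_space itself \<Rightarrow> real" where
  "unit_vol _ \<equiv> measure lborel (ball (0::'a) 1)"

lemma unit_vol_pos: "unit_vol TYPE('a::euclidean_space) > 0"
  by (rule content_ball_pos) simp

lemma ball_fmeasurable [simp]:
  fixes c :: "'a::euclidean_space"
  shows "ball c r \<in> fmeasurable lborel" "cball c r \<in> fmeasurable lborel"
  using emeasure_bounded_finite[of "ball c r"] emeasure_bounded_finite[of "cball c r"]
  by (auto intro!: fmeasurableI)

lemma disjoint_balls_volume_le:
  fixes c :: "'j \<Rightarrow> 'a::euclidean_space"
  assumes J: "finite J" and r: "r > 0" and sep: "\<And>i j. i \<in> J \<Longrightarrow> j \<in> J \<Longrightarrow> i \<noteq> j \<Longrightarrow> 2 * r \<le> dist (c i) (c j)"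
    and sub: "\<And>j. j \<in> J \<Longrightarrow> ball (c j) r \<subseteq> A" and A: "A \<in> fmeasurable lborel"
  shows "real (card J) * (r ^ DIM('a) * unit_vol TYPE('a)) \<le> measure lborel A"
proof -
  have "disjoint_family_on (\<lambda>j. ball (c j) r) J"
    unfolding disjoint_family_on_def
  proof (intro ballI impI, rule ccontr)
    fix i j assume ij: "i \<in> J" "j \<in> J" "i \<noteq> j" "ball (c i) r \<inter> ball (c j) r \<noteq> {}"
    then obtain x where "dist (c i) x < r" "dist (c j) x < r" by auto
    then have "dist (c i) (c j) < 2 * r" using dist_triangle[of "c i" "c j" x] by (simp add: dist_commute)
    then show False using sep[OF ij(1-3)] by simp
  qed
  then have "measure lborel (\<Union>j\<in>J. ball (c j) r) = (\<Sum>j\<in>J. measure lborel (ball (c j) r))"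
    using fmeasurableD2[OF ball_fmeasurable(1)] by (intro measure_finite_Union J) (auto simp: image_subset_iff)
  also have "\<dots> = real (card J) * (r ^ DIM('a) * unit_vol TYPE('a))"
    using r by (simp add: content_ball_conv_unit_ball[of r])
  finally have eq: "measure lborel (\<Union>j\<in>J. ball (c j) r) = real (card J) * (r ^ DIM('a) * unit_vol TYPE('a))" .
  have "(\<Union>j\<in>J. ball (c j) r) \<subseteq> A" using sub by blast
  moreover have "(\<Union>j\<in>J. ball (c j) r) \<in> sets lborel" by (simp add: borel_open open_UN)
  ultimately show ?thesis using measure_mono_fmeasurable[OF _ _ A] eq by metis
qed

lemma floor_inverse_bound:
  fixes \<delta> :: real
  assumes "0 < \<delta>" "\<delta> \<le> 1"
  shows "1 / (2 * \<delta>) \<le> real (nat \<lfloor>1 / \<delta>\<rfloor>)" "real (nat \<lfloor>1 / \<delta>\<rfloor>) \<le> 1 / \<delta>"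
proof -
  have 1: "1 \<le> 1 / \<delta>" using assms by simp
  then have f: "1 \<le> \<lfloor>1 / \<delta>\<rfloor>" unfolding le_floor_iff by simp
  have g: "1 / \<delta> < of_int \<lfloor>1 / \<delta>\<rfloor> + 1" by linarith
  have h: "1 / (2 * \<delta>) = (1 / \<delta>) / 2" by simp
  have aux: "z / 2 \<le> n" if "1 \<le> n" "z < n + 1" for n z :: real using that by linarith
  have "0 \<le> \<lfloor>1 / \<delta>\<rfloor>" using f by linarith
  then have "real (nat \<lfloor>1 / \<delta>\<rfloor>) = of_int \<lfloor>1 / \<delta>\<rfloor>" by (rule of_nat_nat)
  moreover have "(1::real) \<le> of_int \<lfloor>1 / \<delta>\<rfloor>" using f by linarith
  ultimately show "1 / (2 * \<delta>) \<le> real (nat \<lfloor>1 / \<delta>\<rfloor>)" using g aux[of "of_int \<lfloor>1 / \<delta>\<rfloor>" "1 / \<delta>"] unfolding h by presburger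
  show "real (nat \<lfloor>1 / \<delta>\<rfloor>) \<le> 1 / \<delta>"
    unfolding of_nat_nat[OF \<open>0 \<le> \<lfloor>1 / \<delta>\<rfloor>\<close>] by (rule of_int_floor_le)
qed

definition separated :: "real \<Rightarrow> 'a::metric_space set \<Rightarrow> bool" where
  "separated \<delta> W \<longleftrightarrow> (\<forall>v\<in>W. \<forall>w\<in>W. v \<noteq> w \<longrightarrow> \<delta> \<le> dist v w)"

lemma subset_ball_norm_bound:
  fixes c :: "'a::real_normed_vector"
  shows "norm c + r \<le> R \<Longrightarrow> ball c r \<subseteq> ball 0 R"
proof
  fix x assume "norm c + r \<le> R" "x \<in> ball c r"
  then show "x \<in> ball 0 R" using norm_triangle_ineq2[of x c] by (simp add: dist_norm norm_minus_commute)
qed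

text \<open>
  Balls of radius \<open>\<delta> / 2\<close> around the points of \<open>W\<close> alone would give the exponent \<open>d\<close>. Stacking
  about \<open>1 / \<delta>\<close> disjoint balls along each ray, at the distances \<open>1 + k * \<delta>\<close>, improves it to
  \<open>d - 1\<close>.
\<close>

lemma sphere_packing_bound:
  fixes W :: "'a::euclidean_space set"
  assumes W: "finite W" "W \<subseteq> sphere 0 1" "separated \<delta> W" and \<delta>: "0 < \<delta>" "\<delta> \<le> 1"
  shows "real (card W) * \<delta> ^ (DIM('a) - 1) \<le> 2 * 6 ^ DIM('a)"
proof -
  define K where "K = nat \<lfloor>1 / \<delta>\<rfloor>"
  have K: "1 / (2 * \<delta>) \<le> real K" "real K \<le> 1 / \<delta>" using floor_inverse_bound[OF \<delta>] by (simp_all add: K_def)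
  have Kd: "real k * \<delta> \<le> 1" if "k < K" for k
  proof -
    have "real k * \<delta> \<le> real K * \<delta>" using that \<delta> by (intro mult_right_mono) auto
    also have "\<dots> \<le> 1" using K(2) \<delta> by (simp add: field_simps)
    finally show ?thesis .
  qed
  let ?c = "\<lambda>(w, k). (1 + real k * \<delta>) *\<^sub>R w"
  have "real (card (W \<times> {..<K})) * ((\<delta> / 2) ^ DIM('a) * unit_vol TYPE('a)) \<le> measure lborel (ball (0::'a) 3)"
  proof (rule disjoint_balls_volume_le[where c = ?c])
    fix i j assume ij: "i \<in> W \<times> {..<K}" "j \<in> W \<times> {..<K}" "i \<noteq> j"
    obtain w k w' k' where eq: "i = (w, k)" "j = (w', k')" by (cases i, cases j)
    have w: "norm w = 1" "norm w' = 1" using ij eq W(2) by auto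
    show "2 * (\<delta> / 2) \<le> dist (?c i) (?c j)"
    proof (cases "k = k'")
      case True
      then have "\<delta> \<le> dist w w'" using ij eq W(3) unfolding separated_def by auto
      also have "\<dots> \<le> (1 + real k * \<delta>) * dist w w'" using \<delta> by (simp add: distrib_right)
      also have "\<dots> = dist (?c i) (?c j)"
        using True eq \<delta> by (simp add: dist_norm flip: scaleR_diff_right)
      finally show ?thesis by simp
    next
      case False
      then have "1 \<le> \<bar>real k - real k'\<bar>" by linarith
      then have "\<delta> \<le> \<bar>real k - real k'\<bar> * \<delta>" using \<delta> by simp
      also have "\<dots> = \<bar>norm (?c i) - norm (?c j)\<bar>"
      proof -
        have "norm (?c i) = 1 + real k * \<delta>" "norm (?c j) = 1 + real k' * \<delta>" using w \<delta> eq by simp_all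
        then show ?thesis using \<delta> by (simp add: abs_mult flip: left_diff_distrib)
      qed
      also have "\<dots> \<le> dist (?c i) (?c j)" unfolding dist_norm by (rule norm_triangle_ineq3)
      finally show ?thesis by simp
    qed
  next
    fix j assume j: "j \<in> W \<times> {..<K}"
    obtain w k where eq: "j = (w, k)" by (cases j)
    have "norm w = 1" "k < K" using j eq W(2) by auto
    then have "norm (?c j) \<le> 2" using Kd[of k] \<delta> eq by simp
    then show "ball (?c j) (\<delta> / 2) \<subseteq> ball 0 3"
      using \<delta> by (simp add: subset_ball_norm_bound)
  qed (use W \<delta> in auto)
  also have "\<dots> = 3 ^ DIM('a) * unit_vol TYPE('a)" by (simp add: content_ball_conv_unit_ball[of 3])
  finally have "real (card W) * real K * (\<delta> / 2) ^ DIM('a) \<le> 3 ^ DIM('a)"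
    using unit_vol_pos[where 'a = 'a] by (simp add: card_cartesian_product mult.assoc[symmetric])
  then have 1: "real (card W) * real K * \<delta> ^ DIM('a) \<le> 6 ^ DIM('a)"
    by (simp add: power_divide field_simps flip: power_mult_distrib)
  have "real (card W) * (1 / (2 * \<delta>)) * \<delta> ^ DIM('a) \<le> real (card W) * real K * \<delta> ^ DIM('a)"
    using K(1) \<delta> by (intro mult_right_mono mult_left_mono) auto
  also note 1
  also have "\<delta> ^ DIM('a) = \<delta> * \<delta> ^ (DIM('a) - 1)" by (simp flip: power_Suc)
  finally show ?thesis using \<delta> by (simp add: field_simps)
qed

lemma ball_packing_bound:
  fixes W :: "'a::euclidean_space set"
  assumes W: "finite W" "W \<subseteq> cball w0 \<eta>" "separated \<delta> W" and \<delta>: "0 < \<delta>" "\<delta> \<le> \<eta>"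
  shows "real (card W) \<le> (3 * \<eta> / \<delta>) ^ DIM('a)"
proof -
  have "real (card W) * ((\<delta> / 2) ^ DIM('a) * unit_vol TYPE('a)) \<le> measure lborel (ball w0 (3 / 2 * \<eta>))"
  proof (rule disjoint_balls_volume_le[where c = "\<lambda>w. w"])
    fix w assume w: "w \<in> W"
    show "ball w (\<delta> / 2) \<subseteq> ball w0 (3 / 2 * \<eta>)"
    proof
      fix x assume "x \<in> ball w (\<delta> / 2)"
      moreover have "dist w0 w \<le> \<eta>" using w W(2) by auto
      ultimately show "x \<in> ball w0 (3 / 2 * \<eta>)" using dist_triangle[of w0 x w] \<delta> by simp
    qed
  qed (use W \<delta> in \<open>auto simp: separated_def\<close>)
  also have "\<dots> = (3 / 2 * \<eta>) ^ DIM('a) * unit_vol TYPE('a)"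
    using \<delta> by (subst content_ball_conv_unit_ball) auto
  finally have "real (card W) * (\<delta> / 2) ^ DIM('a) \<le> (3 / 2 * \<eta>) ^ DIM('a)"
    using unit_vol_pos[where 'a = 'a] by (simp add: mult.assoc[symmetric])
  then have "real (card W) \<le> (3 / 2 * \<eta>) ^ DIM('a) / (\<delta> / 2) ^ DIM('a)"
    using \<delta> by (simp add: pos_le_divide_eq)
  also have "\<dots> = (3 * \<eta> / \<delta>) ^ DIM('a)" using \<delta> by (simp flip: power_divide)
  finally show ?thesis .
qed

text \<open>
  A separated set of maximal cardinality is a net.
\<close>

lemma sphere_net_exists:
  assumes \<delta>: "0 < \<delta>" "\<delta> \<le> 1"
  shows "\<exists>W :: 'a::euclidean_space set. finite W \<and> W \<noteq> {} \<and> W \<subseteq> sphere 0 1 \<and> separated \<delta> W \<and> (\<forall>x\<in>sphere 0 1. \<exists>w\<in>W. dist x w < \<delta>)"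
proof -
  let ?P = "\<lambda>W :: 'a set. finite W \<and> W \<subseteq> sphere 0 1 \<and> separated \<delta> W"
  obtain b where b: "2 * 6 ^ DIM('a) / \<delta> ^ (DIM('a) - 1) < real b" using reals_Archimedean2 by blast
  have "\<forall>W. ?P W \<longrightarrow> card W < b"
  proof (intro allI impI)
    fix W assume "?P W"
    then have "real (card W) \<le> 2 * 6 ^ DIM('a) / \<delta> ^ (DIM('a) - 1)"
      using sphere_packing_bound[of W \<delta>] \<delta> by (simp add: field_simps)
    then show "card W < b" using b by linarith
  qed
  moreover have "?P {}" by (simp add: separated_def)
  ultimately obtain W where W: "?P W" "\<And>W'. ?P W' \<Longrightarrow> card W' \<le> card W"
    using ex_has_greatest_nat[of ?P "{}" card b] by blast
  have cover: "\<exists>w\<in>W. dist x w < \<delta>" if x: "x \<in> sphere 0 1" for x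
  proof (rule ccontr)
    assume n: "\<not> (\<exists>w\<in>W. dist x w < \<delta>)"
    then have "x \<notin> W" using \<delta> by force
    have "?P (insert x W)" using n W(1) x by (auto simp: separated_def not_less dist_commute)
    then have "card (insert x W) \<le> card W" by (rule W(2))
    then show False using W(1) \<open>x \<notin> W\<close> by simp
  qed
  obtain b :: 'a where "b \<in> Basis" using nonempty_Basis by blast
  then have "W \<noteq> {}" using cover[of b] by auto
  then show ?thesis using W(1) cover by blast
qed

definition cone_part :: "'a::euclidean_space set \<Rightarrow> real \<Rightarrow> real \<Rightarrow> 'a set" where
  "cone_part Q a b = {x. a < norm x \<and> norm x \<le> b \<and> sgn x \<in> Q}"

lemma cone_part_borel [measurable]:
  assumes [measurable]: "Q \<in> sets borel" shows "cone_part Q a b \<in> sets borel"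
proof -
  have "(sgn :: 'a \<Rightarrow> 'a) \<in> borel_measurable borel" unfolding sgn_div_norm by measurable
  note [measurable] = this
  show ?thesis unfolding cone_part_def by measurable
qed

lemma cone_part_bounded: "bounded (cone_part Q a b)"
  by (rule bounded_subset[of "cball 0 b"]) (auto simp: cone_part_def)

lemma cone_part_fmeasurable:
  assumes "Q \<in> sets borel" shows "cone_part Q a b \<in> fmeasurable lborel"
  using cone_part_borel[OF assms] emeasure_bounded_finite[OF cone_part_bounded[of Q a b]]
  by (intro fmeasurableI) auto

definition cone_vol :: "'a::euclidean_space set \<Rightarrow> real" where
  "cone_vol Q = measure lborel (cone_part Q 0 1)"

text \<open>
  Homogeneity of Lebesgue measure under dilations, which preserve cones.
\<close>

lemma measure_cone_part_0:
  fixes Q :: "'a::euclidean_space set"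
  assumes Q: "Q \<in> sets borel" and r: "r \<ge> 0"
  shows "measure lborel (cone_part Q 0 r) = r ^ DIM('a) * cone_vol Q"
proof (cases "r = 0")
  case True
  then have "cone_part Q 0 r = {}" by (auto simp: cone_part_def)
  then show ?thesis using True by simp
next
  case False
  then have r: "r > 0" using r by simp
  have "emeasure lborel (cone_part Q 0 r) = emeasure (density (distr lborel borel (\<lambda>x. 0 + r *\<^sub>R x)) (\<lambda>_. ennreal (\<bar>r\<bar> ^ DIM('a)))) (cone_part Q 0 r)"
    using lborel_affine[of r "0::'a"] r by simp
  also have "\<dots> = ennreal (r ^ DIM('a)) * emeasure lborel ((\<lambda>x. r *\<^sub>R x) -` cone_part Q 0 r)"
    using r Q by (subst emeasure_density_const) (auto simp: emeasure_distr)
  also have "(\<lambda>x. r *\<^sub>R x) -` cone_part Q 0 r = cone_part Q 0 1"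
    using r by (auto simp: cone_part_def sgn_scaleR)
  finally show ?thesis unfolding cone_vol_def measure_def using r by (simp add: enn2real_mult)
qed

lemma measure_cone_part:
  fixes Q :: "'a::euclidean_space set"
  assumes Q: "Q \<in> sets borel" and ab: "0 \<le> a" "a \<le> b"
  shows "measure lborel (cone_part Q a b) = (b ^ DIM('a) - a ^ DIM('a)) * cone_vol Q"
proof -
  have "cone_part Q a b = cone_part Q 0 b - cone_part Q 0 a"
    using ab by (auto simp: cone_part_def)
  moreover have "cone_part Q 0 a \<subseteq> cone_part Q 0 b" using ab by (auto simp: cone_part_def)
  ultimately have "measure lborel (cone_part Q a b) = measure lborel (cone_part Q 0 b) - measure lborel (cone_part Q 0 a)"
    using measurable_measure_Diff[OF cone_part_fmeasurable[OF Q] fmeasurableD[OF cone_part_fmeasurable[OF Q]]] by simp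
  then show ?thesis using measure_cone_part_0[OF Q] ab by (simp add: left_diff_distrib)
qed

text \<open>
  The cone is covered by about \<open>1 / \<eta>\<close> balls of radius \<open>2 * \<eta>\<close> centred along its axis.
\<close>

lemma cone_vol_le:
  fixes Q :: "'a::euclidean_space set"
  assumes Q: "Q \<in> sets borel" "Q \<inter> sphere 0 1 \<subseteq> cball u \<eta>" and u: "norm u = 1" and \<eta>: "0 < \<eta>" "\<eta> \<le> 1"
  shows "cone_vol Q \<le> (3 * 2 ^ DIM('a) * unit_vol TYPE('a)) * \<eta> ^ (DIM('a) - 1)"
proof -
  define K where "K = nat \<lceil>1 / \<eta>\<rceil>"
  have K: "1 / \<eta> \<le> real K" "real K \<le> 1 / \<eta> + 1" using \<eta> by (auto simp: K_def of_nat_nat)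
  have "cone_part Q 0 1 \<subseteq> (\<Union>k\<in>{..K}. cball ((real k * \<eta>) *\<^sub>R u) (2 * \<eta>))"
  proof
    fix x assume x: "x \<in> cone_part Q 0 1"
    then have nx: "0 < norm x" "norm x \<le> 1" "sgn x \<in> Q" by (auto simp: cone_part_def)
    then have "sgn x \<in> sphere 0 1" by (auto simp: norm_sgn)
    then have d: "dist u (sgn x) \<le> \<eta>" using Q(2) nx(3) by auto
    define k where "k = nat \<lfloor>norm x / \<eta>\<rfloor>"
    have k: "real k \<le> norm x / \<eta>" "norm x / \<eta> < real k + 1" using nx \<eta> by (auto simp: k_def of_nat_nat)
    have "norm x / \<eta> \<le> 1 / \<eta>" using nx \<eta> by (simp add: divide_right_mono)
    then have "real k \<le> real K" using k(1) K(1) by linarith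
    then have kK: "k \<in> {..K}" by simp
    have k': "\<bar>real k * \<eta> - norm x\<bar> \<le> \<eta>" using k \<eta> by (simp add: field_simps)
    have "dist ((real k * \<eta>) *\<^sub>R u) x \<le> dist ((real k * \<eta>) *\<^sub>R u) (norm x *\<^sub>R u) + dist (norm x *\<^sub>R u) x"
      by (rule dist_triangle)
    also have "dist ((real k * \<eta>) *\<^sub>R u) (norm x *\<^sub>R u) = \<bar>real k * \<eta> - norm x\<bar>"
      using u by (simp add: dist_norm flip: scaleR_diff_left)
    also have "dist (norm x *\<^sub>R u) x = norm x * dist u (sgn x)"
    proof -
      have "x = norm x *\<^sub>R sgn x" using nx by (simp add: sgn_div_norm)
      then have "dist (norm x *\<^sub>R u) x = norm (norm x *\<^sub>R (u - sgn x))"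
        unfolding dist_norm by (metis scaleR_diff_right)
      then show ?thesis by (simp add: dist_norm)
    qed
    also have "\<bar>real k * \<eta> - norm x\<bar> + norm x * dist u (sgn x) \<le> \<eta> + 1 * \<eta>"
      by (intro add_mono mult_mono k' d) (use nx in auto)
    finally show "x \<in> (\<Union>k\<in>{..K}. cball ((real k * \<eta>) *\<^sub>R u) (2 * \<eta>))" using kK by auto
  qed
  then have "cone_vol Q \<le> measure lborel (\<Union>k\<in>{..K}. cball ((real k * \<eta>) *\<^sub>R u) (2 * \<eta>))"
    unfolding cone_vol_def using Q(1)
    by (intro measure_mono_fmeasurable) (auto intro!: fmeasurable.finite_UN)
  also have "\<dots> \<le> (\<Sum>k\<in>{..K}. measure lborel (cball ((real k * \<eta>) *\<^sub>R u) (2 * \<eta>)))"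
    by (rule measure_UNION_le) auto
  also have "\<dots> = (real K + 1) * ((2 * \<eta>) ^ DIM('a) * unit_vol TYPE('a))"
    using \<eta> by (simp add: content_cball_conv_ball content_ball_conv_unit_ball[of "2 * \<eta>"])
  also have "\<dots> \<le> (3 / \<eta>) * ((2 * \<eta>) ^ DIM('a) * unit_vol TYPE('a))"
  proof (rule mult_right_mono)
    have "1 \<le> 1 / \<eta>" using \<eta> by simp
    then show "real K + 1 \<le> 3 / \<eta>" using K(2) by simp
  qed (use \<eta> in auto)
  also have "\<eta> ^ DIM('a) = \<eta> * \<eta> ^ (DIM('a) - 1)" by (simp flip: power_Suc)
  then have "(3 / \<eta>) * ((2 * \<eta>) ^ DIM('a) * unit_vol TYPE('a)) = (3 * 2 ^ DIM('a) * unit_vol TYPE('a)) * \<eta> ^ (DIM('a) - 1)"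
    using \<eta> by (simp add: power_mult_distrib)
  finally show ?thesis .
qed

text \<open>
  The outer half of the cone contains about \<open>1 / \<eta>\<close> disjoint balls of radius \<open>\<eta> / 8\<close> centred
  along its axis.
\<close>

lemma cone_vol_ge:
  fixes Q :: "'a::euclidean_space set"
  assumes Q: "Q \<in> sets borel" "ball u \<eta> \<inter> sphere 0 1 \<subseteq> Q" and u: "norm u = 1" and \<eta>: "0 < \<eta>" "\<eta> \<le> 1"
  shows "unit_vol TYPE('a) / (2 * 8 ^ DIM('a)) * \<eta> ^ (DIM('a) - 1) \<le> cone_vol Q"
proof -
  define K where "K = nat \<lfloor>1 / \<eta>\<rfloor>"
  have K: "1 / (2 * \<eta>) \<le> real K" "real K \<le> 1 / \<eta>" using floor_inverse_bound[OF \<eta>] by (simp_all add: K_def)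
  let ?\<rho> = "\<lambda>k. 1 / 2 + real k * (\<eta> / 4)"
  have Kd: "real k * (\<eta> / 4) \<le> 1 / 4" if "k < K" for k
  proof -
    have "real k * \<eta> \<le> real K * \<eta>" using that \<eta> by (intro mult_right_mono) auto
    also have "\<dots> \<le> 1" using K(2) \<eta> by (simp add: field_simps)
    finally show ?thesis by simp
  qed
  have "real (card {..<K}) * ((\<eta> / 8) ^ DIM('a) * unit_vol TYPE('a)) \<le> measure lborel (cone_part Q 0 1)"
  proof (rule disjoint_balls_volume_le[where c = "\<lambda>k. ?\<rho> k *\<^sub>R u"])
    fix i j assume "i \<in> {..<K}" "j \<in> {..<K}" "i \<noteq> j"
    then have "1 \<le> \<bar>real i - real j\<bar>" by linarith
    then have "\<eta> / 4 \<le> \<bar>real i - real j\<bar> * (\<eta> / 4)" using \<eta> by simp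
    also have "\<dots> = \<bar>(real i - real j) * (\<eta> / 4)\<bar>" using \<eta> by (simp add: abs_mult)
    also have "\<dots> = \<bar>?\<rho> i - ?\<rho> j\<bar>" by (rule arg_cong[where f = abs]) (simp add: field_simps)
    also have "\<dots> = dist (?\<rho> i *\<^sub>R u) (?\<rho> j *\<^sub>R u)" using u by (simp only: dist_norm scaleR_diff_left[symmetric] norm_scaleR mult_1_right)
    finally show "2 * (\<eta> / 8) \<le> dist (?\<rho> i *\<^sub>R u) (?\<rho> j *\<^sub>R u)" by simp
  next
    fix k assume "k \<in> {..<K}"
    then have \<rho>: "1 / 2 \<le> ?\<rho> k" "?\<rho> k \<le> 3 / 4" using Kd[of k] \<eta> by auto
    show "ball (?\<rho> k *\<^sub>R u) (\<eta> / 8) \<subseteq> cone_part Q 0 1"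
    proof
      fix x assume "x \<in> ball (?\<rho> k *\<^sub>R u) (\<eta> / 8)"
      then have d: "norm (x - ?\<rho> k *\<^sub>R u) < \<eta> / 8" by (simp add: dist_norm norm_minus_commute)
      have n: "norm (?\<rho> k *\<^sub>R u) = ?\<rho> k" using u \<rho> by simp
      have "\<bar>norm x - ?\<rho> k\<bar> < 1 / 8" using norm_triangle_ineq3[of x "?\<rho> k *\<^sub>R u"] d n \<eta> by linarith
      then have nx: "0 < norm x" "norm x \<le> 1" using \<rho> by linarith+
      have "sgn (?\<rho> k *\<^sub>R u) = u" using \<rho> u by (simp add: sgn_scaleR sgn_div_norm)
      moreover have "?\<rho> k *\<^sub>R u \<noteq> 0" using n \<rho> by (metis norm_zero not_one_le_zero half_gt_zero_iff less_le_trans not_less zero_less_one order_refl)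
      ultimately have "norm (sgn x - u) \<le> 2 * norm (x - ?\<rho> k *\<^sub>R u) / ?\<rho> k"
        using norm_sgn_diff_le[of "?\<rho> k *\<^sub>R u" x] n by simp
      also have "\<dots> \<le> 2 * norm (x - ?\<rho> k *\<^sub>R u) / (1 / 2)" using \<rho> by (intro divide_left_mono) auto
      also have "\<dots> < \<eta>" using d \<eta> by simp
      finally have "sgn x \<in> ball u \<eta>" by (simp add: dist_norm norm_minus_commute)
      moreover have "sgn x \<in> sphere 0 1" using nx by (auto simp: norm_sgn)
      ultimately show "x \<in> cone_part Q 0 1" using Q(2) nx by (auto simp: cone_part_def)
    qed
  qed (use \<eta> cone_part_fmeasurable[OF Q(1)] in auto)
  then have "real K * ((\<eta> / 8) ^ DIM('a) * unit_vol TYPE('a)) \<le> cone_vol Q" by (simp add: cone_vol_def)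
  moreover have "1 / (2 * \<eta>) * ((\<eta> / 8) ^ DIM('a) * unit_vol TYPE('a)) \<le> real K * ((\<eta> / 8) ^ DIM('a) * unit_vol TYPE('a))"
    using K(1) \<eta> by (intro mult_right_mono) auto
  moreover have "1 / (2 * \<eta>) * ((\<eta> / 8) ^ DIM('a) * unit_vol TYPE('a)) = unit_vol TYPE('a) / (2 * 8 ^ DIM('a)) * \<eta> ^ (DIM('a) - 1)"
  proof -
    have "\<eta> ^ DIM('a) = \<eta> * \<eta> ^ (DIM('a) - 1)" by (simp flip: power_Suc)
    then show ?thesis using \<eta> by (simp add: power_divide)
  qed
  ultimately show ?thesis by linarith
qed

section \<open>Faces of hulls and sphere nets\<close>

text \<open>
  A face is the intersection of the hull with its own affine hull, which is spanned by \<open>j + 1\<close>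
  of its points from \<open>S\<close>. So a face is determined by a subset of \<open>W\<close> of this size.
\<close>

lemma card_faces_le:
  fixes S :: "'a::euclidean_space set"
  assumes S: "finite S" and W: "finite W"
  shows "card {F. F face_of convex hull S \<and> aff_dim F = int j \<and> F \<inter> S \<subseteq> W} \<le> card W ^ (j + 1)"
proof -
  let ?\<F> = "{F. F face_of convex hull S \<and> aff_dim F = int j \<and> F \<inter> S \<subseteq> W}"
  have "\<exists>B. B \<subseteq> F \<inter> S \<and> card B = j + 1 \<and> affine hull B = affine hull F" if F: "F \<in> ?\<F>" for F
  proof -
    have FS: "F = convex hull (F \<inter> S)" using face_of_convex_hull_points[OF S] F by blast
    have aff: "affine hull F = affine hull (F \<inter> S)" by (subst FS) simp
    obtain B where B: "\<not> affine_dependent B" "B \<subseteq> F \<inter> S" "affine hull B = affine hull (F \<inter> S)"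
      using affine_basis_exists[of "F \<inter> S"] by auto
    have "aff_dim B = aff_dim F" using B(3) aff by (metis aff_dim_affine_hull)
    then have "card B = j + 1" using aff_dim_affine_independent[OF B(1)] F by simp
    then show ?thesis using B aff by blast
  qed
  then have "\<forall>F\<in>?\<F>. \<exists>B. B \<subseteq> F \<inter> S \<and> card B = j + 1 \<and> affine hull B = affine hull F" by blast
  from bchoice[OF this] obtain B where B': "\<forall>F\<in>?\<F>. B F \<subseteq> F \<inter> S \<and> card (B F) = j + 1 \<and> affine hull (B F) = affine hull F" ..
  have B: "B F \<subseteq> F \<inter> S" "card (B F) = j + 1" "affine hull (B F) = affine hull F" if "F \<in> ?\<F>" for F
    using bspec[OF B' that] by simp_all
  have "inj_on B ?\<F>"
  proof (rule inj_onI)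
    fix F G assume F: "F \<in> ?\<F>" and G: "G \<in> ?\<F>" and eq: "B F = B G"
    have "F = affine hull F \<inter> convex hull S" "G = affine hull G \<inter> convex hull S"
      using F G face_of_imp_eq_affine_Int[OF convex_convex_hull] by blast+
    then have "F = affine hull (B F) \<inter> convex hull S" "G = affine hull (B G) \<inter> convex hull S"
      unfolding B(3)[OF F] B(3)[OF G] .
    then show "F = G" unfolding eq by (rule trans[OF _ sym])
  qed
  moreover have "B ` ?\<F> \<subseteq> {T. T \<subseteq> W \<and> card T = j + 1}" using B(1,2) by blast
  moreover have "finite {T. T \<subseteq> W \<and> card T = j + 1}" using W by simp
  ultimately have "card ?\<F> \<le> card {T. T \<subseteq> W \<and> card T = j + 1}" by (rule card_inj_on_le)
  also have "\<dots> = card W choose (j + 1)" using W by (rule n_subsets)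
  also have "\<dots> \<le> card W ^ (j + 1)"
    by (cases "j + 1 \<le> card W") (auto intro: binomial_le_pow simp del: power_Suc simp: binomial_eq_0)
  finally show ?thesis .
qed

lemma finite_faces_convex_hull:
  fixes S :: "'a::euclidean_space set"
  assumes "finite S" shows "finite {F. F face_of convex hull S}"
  using assms finite_polytope_faces[of "convex hull S"] unfolding polytope_def by blast

text \<open>
  Voronoi cells, with ties broken in favour of the smallest index, so that the cells form a
  partition.
\<close>

definition vcell :: "(nat \<Rightarrow> 'a::metric_space) \<Rightarrow> nat \<Rightarrow> nat \<Rightarrow> 'a set" where
  "vcell u N i = {w. (\<forall>j<N. dist w (u i) \<le> dist w (u j)) \<and> (\<forall>j<i. dist w (u i) < dist w (u j))}"

locale sphere_net =
  fixes u :: "nat \<Rightarrow> 'a::euclidean_space" and N :: nat and \<delta> :: real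
  assumes N_pos: "N > 0" and \<delta>: "0 < \<delta>" "\<delta> \<le> 1"
    and norm_u: "\<And>i. i < N \<Longrightarrow> norm (u i) = 1"
    and sep_u: "\<And>i j. i < N \<Longrightarrow> j < N \<Longrightarrow> i \<noteq> j \<Longrightarrow> \<delta> \<le> dist (u i) (u j)"
    and cover_u: "\<And>w. norm w = 1 \<Longrightarrow> \<exists>i<N. dist w (u i) < \<delta>"
begin

abbreviation "Q \<equiv> vcell u N"

lemma Q_borel [measurable]: "Q i \<in> sets borel"
proof -
  have "Q i = (\<Inter>j\<in>{..<N}. {w. dist w (u i) \<le> dist w (u j)}) \<inter> (\<Inter>j\<in>{..<i}. {w. dist w (u i) < dist w (u j)})"
    by (auto simp: vcell_def)
  also have "\<dots> \<in> sets borel"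
    by (intro sets.Int borel_closed borel_open closed_INT open_INT ballI closed_Collect_le open_Collect_less
        continuous_intros) auto
  finally show ?thesis .
qed

lemma Q_disjoint: "i < N \<Longrightarrow> j < N \<Longrightarrow> w \<in> Q i \<Longrightarrow> w \<in> Q j \<Longrightarrow> i = j"
proof (rule ccontr)
  assume a: "i < N" "j < N" "w \<in> Q i" "w \<in> Q j" "i \<noteq> j"
  have "dist w (u i) \<le> dist w (u j)" "dist w (u j) \<le> dist w (u i)"
    using a(1-4) by (simp_all add: vcell_def)
  moreover have "i < j \<Longrightarrow> dist w (u j) < dist w (u i)" "j < i \<Longrightarrow> dist w (u i) < dist w (u j)"
    using a(3,4) by (simp_all add: vcell_def)
  ultimately have "\<not> i < j" "\<not> j < i" by fastforce+
  then show False using a(5) by simp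
qed

lemma Q_cover: "\<exists>i<N. w \<in> Q i"
proof -
  let ?D = "(\<lambda>i. dist w (u i)) ` {..<N}"
  define i where "i = (LEAST i. i < N \<and> dist w (u i) = Min ?D)"
  have "Min ?D \<in> ?D" using N_pos by (intro Min_in) auto
  then have "\<exists>i. i < N \<and> dist w (u i) = Min ?D" by auto
  then have i: "i < N" "dist w (u i) = Min ?D" unfolding i_def by (metis (mono_tags, lifting) LeastI_ex)+
  have le: "dist w (u i) \<le> dist w (u j)" if "j < N" for j unfolding i(2) using that by (intro Min_le) auto
  moreover have "dist w (u i) < dist w (u j)" if "j < i" for j
  proof -
    have "\<not> (j < N \<and> dist w (u j) = Min ?D)" using that unfolding i_def by (rule not_less_Least)
    then have "dist w (u j) \<noteq> dist w (u i)" using i that by simp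
    then show ?thesis using le[of j] i(1) that by simp
  qed
  ultimately show ?thesis using i(1) by (auto simp: vcell_def)
qed

lemma Q_near: "i < N \<Longrightarrow> norm w = 1 \<Longrightarrow> w \<in> Q i \<Longrightarrow> dist w (u i) < \<delta>"
proof -
  assume a: "i < N" "norm w = 1" "w \<in> Q i"
  obtain j where "j < N" "dist w (u j) < \<delta>" using cover_u[OF a(2)] by blast
  moreover have "dist w (u i) \<le> dist w (u j)" using a(3) \<open>j < N\<close> by (simp add: vcell_def)
  ultimately show ?thesis by simp
qed

lemma ball_subset_Q:
  assumes i: "i < N" shows "ball (u i) (\<delta> / 2) \<inter> sphere 0 1 \<subseteq> Q i"
proof
  fix w assume "w \<in> ball (u i) (\<delta> / 2) \<inter> sphere 0 1"
  then have w: "dist w (u i) < \<delta> / 2" by (simp add: dist_commute)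
  obtain j where j: "j < N" "w \<in> Q j" using Q_cover by blast
  have "dist w (u j) < \<delta> / 2" using j i w by (force simp: vcell_def)
  then have "dist (u i) (u j) < \<delta>" using w dist_triangle2[of "u i" "u j" w] by (simp add: dist_commute)
  then have "i = j" using sep_u[OF i j(1)] by fastforce
  then show "w \<in> Q i" using j by simp
qed

text \<open>
  If \<open>x\<close> is not in the hull, separate it by a unit vector \<open>v\<close>. The cell of \<open>v\<close> contains the
  direction of some \<open>s\<close> with \<open>norm s > \<rho>\<close>, and this direction is at distance less than \<open>2 * \<delta>\<close>
  from \<open>v\<close>. Hence \<open>v \<bullet> s\<close> exceeds \<open>\<rho> * (1 - 2 * \<delta>\<^sup>2) > norm x\<close>, which contradicts the
  separation.
\<close>

lemma hull_contains_ball: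
  assumes S: "finite S" and \<rho>: "0 < \<rho>" and d: "2 * \<delta>\<^sup>2 < 1" and hit: "\<And>i. i < N \<Longrightarrow> \<exists>s\<in>S. \<rho> < norm s \<and> sgn s \<in> Q i"
  shows "ball 0 (\<rho> * (1 - 2 * \<delta>\<^sup>2)) \<subseteq> convex hull S"
proof (rule subsetI, rule ccontr)
  fix x assume x: "x \<in> ball 0 (\<rho> * (1 - 2 * \<delta>\<^sup>2))" "x \<notin> convex hull S"
  have "closed (convex hull S)" using S by (simp add: compact_imp_closed finite_imp_compact compact_convex_hull)
  then obtain a b where ab: "a \<bullet> x < b" "\<forall>y\<in>convex hull S. a \<bullet> y > b"
    using separating_hyperplane_closed_point[OF convex_convex_hull _ x(2)] by blast
  obtain s0 where "s0 \<in> S" using hit[OF N_pos] by blast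
  then have "a \<bullet> s0 > a \<bullet> x" using ab hull_inc[of s0 S convex] by force
  then have a: "a \<noteq> 0" by auto
  define v where "v = - (a /\<^sub>R norm a)"
  have v: "norm v = 1" using a by (simp add: v_def)
  obtain i where i: "i < N" "v \<in> Q i" using Q_cover by blast
  obtain s where s: "s \<in> S" "\<rho> < norm s" "sgn s \<in> Q i" using hit[OF i(1)] by blast
  have ns: "norm (sgn s) = 1" using s \<rho> by (auto simp: norm_sgn)
  have "dist v (sgn s) < 2 * \<delta>"
    using Q_near[OF i(1) v i(2)] Q_near[OF i(1) ns s(3)] dist_triangle2[of v "sgn s" "u i"] by simp
  then have "(dist v (sgn s))\<^sup>2 < (2 * \<delta>)\<^sup>2" by (intro power_strict_mono) auto
  moreover have "(dist v (sgn s))\<^sup>2 = 2 - 2 * (v \<bullet> sgn s)"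
    using v ns by (simp add: dist_norm power2_norm_eq_inner inner_diff_left inner_diff_right inner_commute)
      (simp add: norm_eq_1)
  ultimately have vs: "1 - 2 * \<delta>\<^sup>2 < v \<bullet> sgn s" by (simp add: power2_eq_square)
  have "\<rho> * (1 - 2 * \<delta>\<^sup>2) < norm s * (v \<bullet> sgn s)"
    by (rule mult_strict_mono) (use s vs d \<rho> in auto)
  also have "\<dots> = v \<bullet> s"
  proof -
    have "s \<noteq> 0" using s(2) \<rho> by auto
    then show ?thesis by (simp add: sgn_div_norm)
  qed
  also have "v \<bullet> s < v \<bullet> x"
  proof -
    have "a \<bullet> x < a \<bullet> s" using ab s(1) hull_inc[of s S convex] by force
    then show ?thesis using a by (simp add: v_def divide_strict_right_mono)
  qed
  also have "v \<bullet> x \<le> norm x" using norm_cauchy_schwarz[of v x] v by simp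
  finally show False using x(1) by simp
qed

end

lemma ex_sphere_net:
  assumes \<delta>: "0 < \<delta>" "\<delta> \<le> 1"
  shows "\<exists>(u :: nat \<Rightarrow> 'a::euclidean_space) N. sphere_net u N \<delta> \<and> real N * \<delta> ^ (DIM('a) - 1) \<le> 2 * 6 ^ DIM('a)"
proof -
  obtain W :: "'a set" where W: "finite W" "W \<noteq> {}" "W \<subseteq> sphere 0 1" "separated \<delta> W" "\<forall>x\<in>sphere 0 1. \<exists>w\<in>W. dist x w < \<delta>"
    using sphere_net_exists[OF \<delta>] by blast
  obtain u where u: "bij_betw u {..<card W} W"
    using ex_bij_betw_nat_finite[OF W(1)] by (metis atLeast0LessThan)
  then have uW: "u ` {..<card W} = W" "inj_on u {..<card W}" by (auto simp: bij_betw_def)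
  have "sphere_net u (card W) \<delta>"
  proof
    show "card W > 0" using W by (simp add: card_gt_0_iff)
    show "norm (u i) = 1" if "i < card W" for i
    proof -
      have "u i \<in> W" using uW(1) that by blast
      then show ?thesis using W(3) by auto
    qed
    show "\<delta> \<le> dist (u i) (u j)" if "i < card W" "j < card W" "i \<noteq> j" for i j
    proof -
      have "u i \<in> W" "u j \<in> W" "u i \<noteq> u j" using uW that by (auto simp: inj_on_def)
      then show ?thesis using W(4) unfolding separated_def by blast
    qed
    show "\<exists>i<card W. dist w (u i) < \<delta>" if "norm w = 1" for w
    proof -
      obtain v where "v \<in> W" "dist w v < \<delta>" using bspec[OF W(5), of w] \<open>norm w = 1\<close> by auto
      moreover from this obtain i where "i < card W" "v = u i" using uW(1) by (metis imageE lessThan_iff)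
      ultimately show ?thesis by blast
    qed
  qed (use \<delta> in auto)
  then show ?thesis using sphere_packing_bound[OF W(1,3,4) \<delta>] by blast
qed

text \<open>
  The midpoint of \<open>x\<close> and \<open>s\<close> has norm at least \<open>r\<close>; use the parallelogram law.
\<close>

lemma cap_diameter:
  fixes x s v :: "'a::real_inner"
  assumes "norm v = 1" "0 \<le> r" "v \<bullet> x \<ge> r" "v \<bullet> s \<ge> r" "norm x \<le> R" "norm s \<le> R"
  shows "norm (x - s) \<le> 2 * sqrt (R\<^sup>2 - r\<^sup>2)"
proof -
  have "2 * r \<le> v \<bullet> (x + s)" using assms by (simp add: inner_add_right)
  also have "\<dots> \<le> norm (x + s)" using norm_cauchy_schwarz[of v "x + s"] assms by simp
  finally have "(2 * r)\<^sup>2 \<le> (norm (x + s))\<^sup>2" using assms by (intro power_mono) auto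
  moreover have "(norm (x - s))\<^sup>2 = 2 * (norm x)\<^sup>2 + 2 * (norm s)\<^sup>2 - (norm (x + s))\<^sup>2"
    by (simp add: power2_norm_eq_inner inner_add_left inner_add_right inner_diff_left inner_diff_right inner_commute)
  moreover have "(norm x)\<^sup>2 \<le> R\<^sup>2" "(norm s)\<^sup>2 \<le> R\<^sup>2" using assms by (auto intro: power_mono)
  ultimately have "(norm (x - s))\<^sup>2 \<le> 2\<^sup>2 * (R\<^sup>2 - r\<^sup>2)" by (simp add: power2_eq_square)
  then have "norm (x - s) \<le> sqrt (2\<^sup>2 * (R\<^sup>2 - r\<^sup>2))" by (rule real_le_rsqrt)
  then show ?thesis unfolding real_sqrt_mult by simp
qed

section \<open>Configurations in an annulus\<close>

text \<open>
  The parameters of configurations in which the points outside the ball of radius \<open>r1\<close> have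
  norm at most \<open>R2\<close>, with at most \<open>m\<close> points in each cone and at least one of them beyond \<open>r0\<close>.
  The gap between \<open>r0\<close> and \<open>r1\<close> guarantees that the hull contains the inner ball. The angle \<open>\<eta>\<close>
  bounds the extent of a cap cut off from the outer ball by a hyperplane that does not cut the
  inner one, plus the radius of a cell.
\<close>

locale net_annulus = sphere_net u N \<delta> for u :: "nat \<Rightarrow> 'a::euclidean_space" and N \<delta> +
  fixes r1 r0 R2 \<eta> :: real and m :: nat
  assumes r1: "0 < r1" and r01: "r1 < r0" and r02: "r0 < R2"
    and \<delta>2: "2 * \<delta>\<^sup>2 < 1" and r1_lt: "r1 < r0 * (1 - 2 * \<delta>\<^sup>2)"
    and \<eta>: "4 * sqrt (R2\<^sup>2 - r1\<^sup>2) / r1 + \<delta> \<le> \<eta>" "\<eta> \<le> 1"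
begin

definition good_cell :: "nat \<Rightarrow> 'a set \<Rightarrow> bool" where
  "good_cell i S \<longleftrightarrow> finite S \<and> S \<subseteq> cone_part (Q i) r1 R2 \<and> (\<exists>s\<in>S. r0 < norm s) \<and> card S \<le> m"

definition good_family :: "(nat \<Rightarrow> 'a set) \<Rightarrow> bool" where
  "good_family S \<longleftrightarrow> (\<forall>i<N. good_cell i (S i))"

definition total :: "(nat \<Rightarrow> 'a set) \<Rightarrow> 'a set" where
  "total S = (\<Union>i<N. S i)"

lemma total_finite: "good_family S \<Longrightarrow> finite (total S)"
  by (auto simp: good_family_def good_cell_def total_def)

lemma total_norm: "good_family S \<Longrightarrow> s \<in> total S \<Longrightarrow> norm s \<le> R2 \<and> r1 < norm s"
  by (force simp: good_family_def good_cell_def total_def cone_part_def)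

lemma eta_pos: "0 < \<eta>"
proof -
  have "0 \<le> 4 * sqrt (R2\<^sup>2 - r1\<^sup>2) / r1" using r1 r01 r02 by (intro divide_nonneg_nonneg) (auto intro: power_mono)
  then show ?thesis using \<eta> \<delta> by linarith
qed

lemma good_hull_ball:
  assumes "good_family S"
  shows "ball 0 (r0 * (1 - 2 * \<delta>\<^sup>2)) \<subseteq> convex hull total S"
proof (rule hull_contains_ball[OF total_finite[OF assms]])
  show "\<exists>s\<in>total S. r0 < norm s \<and> sgn s \<in> Q i" if "i < N" for i
  proof -
    have "good_cell i (S i)" using assms that unfolding good_family_def by blast
    then obtain s where "s \<in> S i" "r0 < norm s" unfolding good_cell_def by blast
    moreover have "sgn s \<in> Q i" using assms that calculation(1) by (auto simp: good_family_def good_cell_def cone_part_def)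
    ultimately show ?thesis using that unfolding total_def by blast
  qed
qed (use r1 r01 \<delta>2 in auto)

lemma good_hull_cball: "good_family S \<Longrightarrow> cball 0 r1 \<subseteq> convex hull total S"
  using good_hull_ball[of S] r1_lt by (fastforce simp: subset_iff)

lemma inner_points_irrelevant:
  assumes "good_family S" "T \<subseteq> cball 0 r1"
  shows "convex hull (T \<union> total S) = convex hull total S"
proof
  have "T \<union> total S \<subseteq> convex hull total S"
    using assms good_hull_cball[OF assms(1)] hull_subset[of "total S" convex] by blast
  then show "convex hull (T \<union> total S) \<subseteq> convex hull total S" by (rule hull_minimal) simp
qed (simp add: hull_mono)

lemma hull_norm_le: "good_family S \<Longrightarrow> convex hull total S \<subseteq> cball 0 R2"
  by (rule hull_minimal) (use total_norm in auto)

text \<open>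
  Two points of a common cap are close to each other; so if one of them is in the cone of cell
  \<open>i\<close>, the direction of the other is near \<open>u i\<close>.
\<close>

lemma cap_direction:
  assumes i: "i < N" and s: "s \<in> cone_part (Q i) r1 R2" and v: "norm v = 1" "r1 \<le> v \<bullet> x" "r1 \<le> v \<bullet> s" and x: "norm x \<le> R2"
  shows "sgn x \<in> cball (u i) \<eta>"
proof -
  have s': "r1 < norm s" "norm s \<le> R2" "sgn s \<in> Q i" using s by (auto simp: cone_part_def)
  then have s0: "s \<noteq> 0" using r1 by auto
  have "norm (sgn x - sgn s) \<le> 2 * norm (x - s) / norm s" by (rule norm_sgn_diff_le[OF s0])
  also have "\<dots> \<le> 2 * (2 * sqrt (R2\<^sup>2 - r1\<^sup>2)) / r1"
    using cap_diameter[OF v(1) _ v(2,3) x s'(2)] r1 s' by (intro frac_le mult_left_mono) auto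
  finally have "dist (sgn x) (sgn s) \<le> 4 * sqrt (R2\<^sup>2 - r1\<^sup>2) / r1" by (simp add: dist_norm)
  moreover have "dist (sgn s) (u i) < \<delta>" using s0 s'(3) by (intro Q_near[OF i]) (auto simp: norm_sgn)
  ultimately show ?thesis using \<eta>(1) dist_triangle[of "sgn x" "u i" "sgn s"] by (simp add: dist_commute)
qed

lemma separate_from_hull:
  assumes "good_family S" "x \<notin> convex hull total S"
  obtains v where "norm v = 1" "r1 < v \<bullet> x" "\<And>y. y \<in> convex hull total S \<Longrightarrow> v \<bullet> y < v \<bullet> x"
proof -
  have "closed (convex hull total S)" using total_finite[OF assms(1)] by (simp add: compact_imp_closed finite_imp_compact compact_convex_hull)
  then obtain a b where ab: "a \<bullet> x < b" "\<forall>y\<in>convex hull total S. a \<bullet> y > b"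
    using separating_hyperplane_closed_point[OF convex_convex_hull _ assms(2)] by blast
  have z: "0 \<in> convex hull total S" using good_hull_cball[OF assms(1)] r1 by auto
  then have a: "a \<noteq> 0" using ab by force
  define v where "v = - (a /\<^sub>R norm a)"
  have v: "norm v = 1" using a by (simp add: v_def)
  have lt: "v \<bullet> y < v \<bullet> x" if "y \<in> convex hull total S" for y
  proof -
    have "a \<bullet> x < a \<bullet> y" using ab that by force
    then show ?thesis using a by (simp add: v_def divide_strict_right_mono)
  qed
  have "r1 *\<^sub>R v \<in> convex hull total S" using good_hull_cball[OF assms(1)] v r1 by auto
  from lt[OF this] have "r1 < v \<bullet> x" using v by (simp add: norm_eq_1)
  then show ?thesis using that v lt by blast
qed

definition vol_diff :: real where
  "vol_diff = (R2 ^ DIM('a) - r1 ^ DIM('a)) * ((3 * 2 ^ DIM('a) * unit_vol TYPE('a)) * \<eta> ^ (DIM('a) - 1))"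

text \<open>
  A point of the first hull that is missing from the second is cut off from the latter by a
  hyperplane. Some point of the first configuration lies beyond this hyperplane, and it can
  only belong to cell \<open>i\<close>. So the missing point is in the shell over the cap of radius \<open>\<eta>\<close>
  around \<open>u i\<close>.
\<close>

lemma volume_difference_le:
  assumes S: "good_family S" and S': "good_family S'" and i: "i < N" and eq: "\<And>k. k < N \<Longrightarrow> k \<noteq> i \<Longrightarrow> S k = S' k"
  shows "measure lebesgue (convex hull total S) \<le> measure lebesgue (convex hull total S') + vol_diff"
proof -
  let ?C = "cone_part (cball (u i) \<eta>) r1 R2"
  have sub: "convex hull total S \<subseteq> convex hull total S' \<union> ?C"
  proof (rule subsetI, rule UnCI)
    fix x assume x: "x \<in> convex hull total S" and nx: "x \<notin> ?C"
    show "x \<in> convex hull total S'"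
    proof (rule ccontr)
      assume x': "x \<notin> convex hull total S'"
      obtain v where v: "norm v = 1" "r1 < v \<bullet> x" "\<And>y. y \<in> convex hull total S' \<Longrightarrow> v \<bullet> y < v \<bullet> x"
        using separate_from_hull[OF S' x'] by blast
      have "\<exists>s\<in>total S. v \<bullet> x \<le> v \<bullet> s"
      proof (rule ccontr)
        assume "\<not> (\<exists>s\<in>total S. v \<bullet> x \<le> v \<bullet> s)"
        then have "convex hull total S \<subseteq> {y. v \<bullet> y < v \<bullet> x}"
          by (intro hull_minimal) (auto simp: not_le convex_halfspace_lt)
        then show False using x by auto
      qed
      then obtain s where s: "s \<in> total S" "v \<bullet> x \<le> v \<bullet> s" by blast
      have "s \<notin> total S'" using v(3)[of s] s(2) hull_inc[of s "total S'" convex] by force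
      then have "s \<in> S i" using s(1) eq unfolding total_def by auto
      then have sc: "s \<in> cone_part (Q i) r1 R2" using S i by (auto simp: good_family_def good_cell_def)
      have nR: "norm x \<le> R2" using hull_norm_le[OF S] x by auto
      have "sgn x \<in> cball (u i) \<eta>" by (rule cap_direction[OF i sc v(1)]) (use v s nR in auto)
      moreover have "r1 < norm x" using v(2) norm_cauchy_schwarz[of v x] v(1) by simp
      ultimately show False using nx nR by (simp add: cone_part_def)
    qed
  qed
  have Cb: "?C \<in> fmeasurable lborel" by (rule cone_part_fmeasurable) simp
  have fin: "convex hull total S'' \<in> lmeasurable" if "good_family S''" for S''
    using total_finite[OF that] by (intro lmeasurable_compact) (simp add: finite_imp_compact compact_convex_hull)
  have CL: "?C \<in> lmeasurable" 
    using Cb cone_part_bounded by (intro bounded_set_imp_lmeasurable) (auto dest: fmeasurableD)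
  have "measure lebesgue (convex hull total S) \<le> measure lebesgue (convex hull total S' \<union> ?C)"
    using sub fin[OF S] fin[OF S'] CL by (intro measure_mono_fmeasurable) (auto intro: fmeasurableD)
  also have "\<dots> \<le> measure lebesgue (convex hull total S') + measure lebesgue ?C"
    using fin[OF S'] CL by (intro measure_Un_le) (auto intro: fmeasurableD)
  also have "measure lebesgue ?C = measure lborel ?C" using Cb by (intro measure_completion) (auto intro: fmeasurableD)
  also have "\<dots> = (R2 ^ DIM('a) - r1 ^ DIM('a)) * cone_vol (cball (u i) \<eta>)"
    using r1 r01 r02 by (intro measure_cone_part) auto
  also have "\<dots> \<le> vol_diff" unfolding vol_diff_def
    using r1 r01 r02 by (intro mult_left_mono cone_vol_le[where u = "u i"] eta_pos \<eta>) (auto simp: norm_u[OF i] intro: power_mono)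
  finally show ?thesis by simp
qed

definition face_diff :: "nat \<Rightarrow> nat" where
  "face_diff j = (m * nat \<lfloor>(3 * (\<eta> + \<delta>) / \<delta>) ^ DIM('a)\<rfloor>) ^ (j + 1)"

text \<open>
  The cells involved have pairwise separated centres within distance \<open>\<eta> + \<delta>\<close> of \<open>u i\<close>, so a
  packing bound limits their number.
\<close>

lemma near_points_card:
  assumes S: "good_family S" and i: "i < N"
  shows "card {s \<in> total S. sgn s \<in> cball (u i) \<eta>} \<le> m * nat \<lfloor>(3 * (\<eta> + \<delta>) / \<delta>) ^ DIM('a)\<rfloor>"
proof -
  let ?I = "{k. k < N \<and> u k \<in> cball (u i) (\<eta> + \<delta>)}"
  have inj: "inj_on u ?I"
    using sep_u \<delta> by (intro inj_onI) (metis (mono_tags, lifting) dist_self mem_Collect_eq not_less)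
  have "real (card (u ` ?I)) \<le> (3 * (\<eta> + \<delta>) / \<delta>) ^ DIM('a)"
  proof (rule ball_packing_bound)
    show "separated \<delta> (u ` ?I)" unfolding separated_def
    proof (intro ballI impI)
      fix v w assume "v \<in> u ` ?I" "w \<in> u ` ?I" "v \<noteq> w"
      then obtain k l where "k < N" "l < N" "v = u k" "w = u l" by blast
      moreover from this have "k \<noteq> l" using \<open>v \<noteq> w\<close> by blast
      ultimately show "\<delta> \<le> dist v w" using sep_u by simp
    qed
  qed (use \<delta> eta_pos in auto)
  then have "int (card (u ` ?I)) \<le> \<lfloor>(3 * (\<eta> + \<delta>) / \<delta>) ^ DIM('a)\<rfloor>" by (simp add: le_floor_iff)
  then have cI: "card ?I \<le> nat \<lfloor>(3 * (\<eta> + \<delta>) / \<delta>) ^ DIM('a)\<rfloor>" using card_image[OF inj] by linarith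
  have "{s \<in> total S. sgn s \<in> cball (u i) \<eta>} \<subseteq> (\<Union>k\<in>?I. S k)"
  proof
    fix s assume s: "s \<in> {s \<in> total S. sgn s \<in> cball (u i) \<eta>}"
    then obtain k where k: "k < N" "s \<in> S k" by (auto simp: total_def)
    then have sk: "sgn s \<in> Q k" "r1 < norm s" using S by (auto simp: good_family_def good_cell_def cone_part_def)
    then have "dist (sgn s) (u k) < \<delta>" using k r1 by (intro Q_near) (auto simp: norm_sgn)
    moreover have "dist (u i) (sgn s) \<le> \<eta>" using s by simp
    ultimately have "dist (u i) (u k) \<le> \<eta> + \<delta>" using dist_triangle[of "u i" "u k" "sgn s"] by simp
    then show "s \<in> (\<Union>k\<in>?I. S k)" using k by auto
  qed
  then have "card {s \<in> total S. sgn s \<in> cball (u i) \<eta>} \<le> card (\<Union>k\<in>?I. S k)"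
    using S by (intro card_mono) (auto simp: good_family_def good_cell_def)
  also have "\<dots> \<le> (\<Sum>k\<in>?I. card (S k))" by (rule card_UN_le) simp
  also have "\<dots> \<le> (\<Sum>k\<in>?I. m)" using S by (intro sum_mono) (auto simp: good_family_def good_cell_def)
  also have "\<dots> = card ?I * m" by simp
  also have "\<dots> \<le> m * nat \<lfloor>(3 * (\<eta> + \<delta>) / \<delta>) ^ DIM('a)\<rfloor>" using cI by (simp add: mult.commute)
  finally show ?thesis .
qed

text \<open>
  Take a face of the first hull together with a supporting hyperplane. If no point of cell \<open>i\<close>,
  old or new, is on or beyond the hyperplane, the face is also a face of the second hull.
  Otherwise a point of cell \<open>i\<close> lies in the same cap as the vertices of the face, and these are
  among the few points near \<open>u i\<close>.
\<close>

lemma face_difference_le: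
  assumes S: "good_family S" and S': "good_family S'" and i: "i < N" and eq: "\<And>k. k < N \<Longrightarrow> k \<noteq> i \<Longrightarrow> S k = S' k"
    and j: "j < DIM('a)"
  shows "card {F. F face_of convex hull total S \<and> aff_dim F = int j} \<le> card {F. F face_of convex hull total S' \<and> aff_dim F = int j} + face_diff j"
proof -
  let ?K = "convex hull total S" and ?K' = "convex hull total S'"
  let ?W = "{s \<in> total S. sgn s \<in> cball (u i) \<eta>}"
  let ?A = "{F. F face_of ?K \<and> aff_dim F = int j}" and ?A' = "{F. F face_of ?K' \<and> aff_dim F = int j}"
  let ?B = "{F. F face_of ?K \<and> aff_dim F = int j \<and> F \<inter> total S \<subseteq> ?W}"
  have fin: "finite ?A'" "finite ?B"
    using finite_faces_convex_hull[OF total_finite[OF S]] finite_faces_convex_hull[OF total_finite[OF S']]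
    by (auto elim: finite_subset[rotated])
  have "?A \<subseteq> ?A' \<union> ?B"
  proof
    fix F assume F: "F \<in> ?A"
    then have Ff: "F face_of ?K" and Fd: "aff_dim F = int j" by auto
    obtain a h where ah: "\<And>x. x \<in> ?K \<Longrightarrow> a \<bullet> x \<le> h" "F = ?K \<inter> {x. a \<bullet> x = h}"
      using face_exposed_points[OF total_finite[OF S] Ff] by blast
    have cb: "cball 0 r1 \<subseteq> ?K" by (rule good_hull_cball[OF S])
    have "a \<noteq> 0"
    proof
      assume a0: "a = 0"
      have "F \<noteq> {}" using Fd by auto
      then have "F = ?K" using ah(2) a0 by auto
      then have "aff_dim (cball (0::'a) r1) \<le> int j" using aff_dim_subset[OF cb] Fd by simp
      then show False using aff_dim_cball[of r1 "0::'a"] r1 j by simp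
    qed
    define v where "v = a /\<^sub>R norm a"
    define k where "k = h / norm a"
    have v: "norm v = 1" using \<open>a \<noteq> 0\<close> by (simp add: v_def)
    have vk: "v \<bullet> x \<le> k \<longleftrightarrow> a \<bullet> x \<le> h" "v \<bullet> x = k \<longleftrightarrow> a \<bullet> x = h" for x
      using \<open>a \<noteq> 0\<close> by (simp_all add: v_def k_def divide_simps mult.commute)
    have le: "v \<bullet> x \<le> k" if "x \<in> ?K" for x using ah(1)[OF that] vk by simp
    have FK: "F = ?K \<inter> {x. v \<bullet> x = k}" using ah(2) vk by simp
    have "r1 *\<^sub>R v \<in> ?K" using cb v r1 by auto
    from le[OF this] have r1k: "r1 \<le> k" using v by (simp add: norm_eq_1)
    show "F \<in> ?A' \<union> ?B"
    proof (cases "\<exists>t\<in>S i \<union> S' i. k \<le> v \<bullet> t")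
      case True
      then obtain t where t: "t \<in> S i \<union> S' i" "k \<le> v \<bullet> t" by blast
      have tc: "t \<in> cone_part (Q i) r1 R2" using t S S' i by (auto simp: good_family_def good_cell_def)
      have "s \<in> ?W" if s: "s \<in> F \<inter> total S" for s
      proof -
        have "v \<bullet> s = k" using s FK by blast
        moreover have "norm s \<le> R2" using s total_norm[OF S] by blast
        ultimately have "sgn s \<in> cball (u i) \<eta>"
          using r1k t(2) by (intro cap_direction[OF i tc v]) auto
        then show ?thesis using s by blast
      qed
      then show ?thesis using Ff Fd by blast
    next
      case False
      then have lt: "v \<bullet> t < k" if "t \<in> S i \<union> S' i" for t using that by (auto simp: not_le)
      have memS: "s \<in> total S \<longleftrightarrow> s \<in> total S'" if "v \<bullet> s \<ge> k" for s
      proof -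
        have "s \<notin> S i" "s \<notin> S' i" using lt[of s] that by auto
        then have "s \<in> S l \<longleftrightarrow> s \<in> S' l" if "l < N" for l using eq[OF that] by (cases "l = i") auto
        then show ?thesis unfolding total_def by blast
      qed
      have leS': "v \<bullet> s \<le> k" if s: "s \<in> total S'" for s
      proof (cases "v \<bullet> s \<ge> k")
        case True
        then have "s \<in> total S" using memS s by blast
        then show ?thesis using le hull_inc[of s "total S" convex] by blast
      qed simp
      then have "?K' \<subseteq> {x. v \<bullet> x \<le> k}" by (intro hull_minimal) (auto simp: convex_halfspace_le)
      then have f': "(?K' \<inter> {x. v \<bullet> x = k}) face_of ?K'" by (intro face_of_Int_supporting_hyperplane_le) auto
      have "?K' \<inter> {x. v \<bullet> x = k} = convex hull ((?K' \<inter> {x. v \<bullet> x = k}) \<inter> total S')"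
        by (rule face_of_convex_hull_points[OF total_finite[OF S'] f'])
      also have "(?K' \<inter> {x. v \<bullet> x = k}) \<inter> total S' = F \<inter> total S"
        unfolding FK using memS hull_inc[of _ "total S" convex] hull_inc[of _ "total S'" convex] by auto
      also have "convex hull (F \<inter> total S) = F"
        using face_of_convex_hull_points[OF total_finite[OF S] Ff] by simp
      finally have "F face_of ?K'" using f' by simp
      then show ?thesis using Fd by blast
    qed
  qed
  then have "card ?A \<le> card (?A' \<union> ?B)" using fin by (intro card_mono) auto
  also have "\<dots> \<le> card ?A' + card ?B" by (rule card_Un_le)
  also have "card ?B \<le> card ?W ^ (j + 1)"
    using total_finite[OF S] by (intro card_faces_le) auto
  also have "\<dots> \<le> face_diff j" unfolding face_diff_def by (rule power_mono[OF near_points_card[OF S i]]) simp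
  finally show ?thesis by simp
qed

end

text \<open>
  A proper face avoids the interior of the hull, in particular the inscribed ball, so its
  vertices are outer points.
\<close>

lemma (in sphere_net) card_faces_outer_le:
  assumes S: "finite S" and \<rho>: "0 < \<rho>" and d: "2 * \<delta>\<^sup>2 < 1" and hit: "\<And>i. i < N \<Longrightarrow> \<exists>s\<in>S. \<rho> < norm s \<and> sgn s \<in> Q i"
    and j: "j < DIM('a)"
  shows "card {F. F face_of convex hull S \<and> aff_dim F = int j} \<le> card (S - ball 0 (\<rho> * (1 - 2 * \<delta>\<^sup>2))) ^ (j + 1)"
proof -
  let ?b = "ball (0::'a) (\<rho> * (1 - 2 * \<delta>\<^sup>2))"
  have sub: "?b \<subseteq> convex hull S" by (rule hull_contains_ball[OF S \<rho> d hit])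
  have pos: "0 < \<rho> * (1 - 2 * \<delta>\<^sup>2)" using \<rho> d by simp
  have "{F. F face_of convex hull S \<and> aff_dim F = int j} \<subseteq> {F. F face_of convex hull S \<and> aff_dim F = int j \<and> F \<inter> S \<subseteq> S - ?b}"
  proof (rule subsetI)
    fix F assume "F \<in> {F. F face_of convex hull S \<and> aff_dim F = int j}"
    then have F: "F face_of convex hull S" "aff_dim F = int j" by auto
    have "F \<noteq> convex hull S"
    proof
      assume "F = convex hull S"
      then have "aff_dim ?b \<le> int j" using aff_dim_subset[OF sub] F(2) by simp
      then show False using aff_dim_open[of ?b] pos j by simp
    qed
    then have "F \<inter> interior (convex hull S) = {}" by (rule face_of_disjoint_interior[OF F(1)])
    moreover have "?b \<subseteq> interior (convex hull S)" using sub by (simp add: interior_maximal)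
    ultimately show "F \<in> {F. F face_of convex hull S \<and> aff_dim F = int j \<and> F \<inter> S \<subseteq> S - ?b}" using F by blast
  qed
  then have "card {F. F face_of convex hull S \<and> aff_dim F = int j} \<le> card {F. F face_of convex hull S \<and> aff_dim F = int j \<and> F \<inter> S \<subseteq> S - ?b}"
    using finite_faces_convex_hull[OF S] by (intro card_mono) (auto elim: finite_subset[rotated])
  also have "\<dots> \<le> card (S - ?b) ^ (j + 1)" using S by (intro card_faces_le) auto
  finally show ?thesis .
qed

section \<open>Gaussian mass estimates\<close>

definition gauss :: "real \<Rightarrow> (real ^ 'n) measure" where
  "gauss l = scale_measure (ennreal l) std_gaussian"

definition gconst :: "'n::finite itself \<Rightarrow> real" where
  "gconst _ = (2 * pi) powr (- real CARD('n) / 2)"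

lemma gconst_pos: "gconst TYPE('n::finite) > 0"
  by (simp add: gconst_def)

lemma sets_gauss [simp, measurable_cong]: "sets (gauss l :: (real ^ 'n) measure) = sets borel"
  by (simp add: gauss_def std_gaussian_def)

lemma space_gauss [simp]: "space (gauss l :: (real ^ 'n) measure) = UNIV"
  by (simp add: gauss_def std_gaussian_def space_scale_measure)

lemma emeasure_gauss:
  fixes A :: "(real ^ 'n) set"
  assumes l: "0 \<le> l" and A: "A \<in> sets borel"
  shows "emeasure (gauss l) A = (\<integral>\<^sup>+x. ennreal (l * gconst TYPE('n) * exp (- (norm x)\<^sup>2 / 2)) * indicator A x \<partial>lborel)"
proof -
  have "emeasure (gauss l) A = ennreal l * (\<integral>\<^sup>+x. ennreal (gconst TYPE('n) * exp (- (norm x)\<^sup>2 / 2)) * indicator A x \<partial>lborel)"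
    using A by (simp add: gauss_def std_gaussian_def gconst_def emeasure_density)
  also have "\<dots> = (\<integral>\<^sup>+x. ennreal l * (ennreal (gconst TYPE('n) * exp (- (norm x)\<^sup>2 / 2)) * indicator A x) \<partial>lborel)"
    using A by (intro nn_integral_cmult[symmetric]) auto
  finally show ?thesis using l gconst_pos[where 'n = 'n] by (simp add: ennreal_mult' mult.assoc[symmetric])
qed

lemma nn_integral_gauss:
  fixes f :: "real ^ 'n \<Rightarrow> ennreal"
  assumes l: "0 \<le> l" and f: "f \<in> borel_measurable borel"
  shows "(\<integral>\<^sup>+x. f x \<partial>gauss l) = (\<integral>\<^sup>+x. ennreal (l * gconst TYPE('n) * exp (- (norm x)\<^sup>2 / 2)) * f x \<partial>lborel)"
proof -
  have "gauss l = density lborel (\<lambda>x :: real ^ 'n. ennreal (l * gconst TYPE('n) * exp (- (norm x)\<^sup>2 / 2)))"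
    by (rule measure_eqI) (use emeasure_gauss[OF l] in \<open>auto simp: emeasure_density\<close>)
  then show ?thesis using f by (simp add: nn_integral_density)
qed

text \<open>
  The total mass of the unnormalized density; it enters all bounds as a constant.
\<close>

definition gint :: "'n::finite itself \<Rightarrow> real" where
  "gint _ = enn2real (\<integral>\<^sup>+x. ennreal (exp (- (norm (x :: real ^ 'n))\<^sup>2 / 2)) \<partial>lborel)"

lemma nn_integral_exp_norm_sq: "(\<integral>\<^sup>+x. ennreal (exp (- (norm (x :: real ^ 'n))\<^sup>2 / 2)) \<partial>lborel) = ennreal (gint TYPE('n))"
proof -
  have one: "(\<integral>\<^sup>+x. ennreal (exp (- x\<^sup>2 / 2)) \<partial>lborel) = ennreal (sqrt (2 * pi))"
  proof -
    interpret prob_space "density lborel std_normal_density" by (rule prob_space_normal_density) simp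
    have "(\<integral>\<^sup>+x. ennreal (std_normal_density x) \<partial>lborel) = 1"
      using emeasure_space_1 by (simp add: emeasure_density)
    then have "ennreal (sqrt (2 * pi)) = ennreal (sqrt (2 * pi)) * (\<integral>\<^sup>+x. ennreal (std_normal_density x) \<partial>lborel)" by simp
    also have "\<dots> = (\<integral>\<^sup>+x. ennreal (sqrt (2 * pi)) * ennreal (std_normal_density x) \<partial>lborel)"
      by (rule nn_integral_cmult[symmetric]) simp
    also have "\<dots> = (\<integral>\<^sup>+x. ennreal (exp (- x\<^sup>2 / 2)) \<partial>lborel)"
      by (intro nn_integral_cong) (simp add: std_normal_density_def ennreal_mult'[symmetric])
    finally show ?thesis by simp
  qed
  have "(\<integral>\<^sup>+x. ennreal (exp (- (norm (x :: real ^ 'n))\<^sup>2 / 2)) \<partial>lborel)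
     = (\<integral>\<^sup>+x. (\<Prod>b\<in>Basis. ennreal (exp (- ((x :: real ^ 'n) \<bullet> b)\<^sup>2 / 2))) \<partial>lborel)"
  proof (rule nn_integral_cong)
    fix x :: "real ^ 'n"
    have "(norm x)\<^sup>2 = (\<Sum>b\<in>Basis. (x \<bullet> b)\<^sup>2)"
      by (subst power2_norm_eq_inner, subst euclidean_inner) (simp add: power2_eq_square)
    then have "- (norm x)\<^sup>2 / 2 = (\<Sum>b\<in>Basis. - (x \<bullet> b)\<^sup>2 / 2)"
      by (simp add: sum_negf flip: sum_divide_distrib)
    then show "ennreal (exp (- (norm x)\<^sup>2 / 2)) = (\<Prod>b\<in>Basis. ennreal (exp (- (x \<bullet> b)\<^sup>2 / 2)))"
      by (simp add: exp_sum prod_ennreal)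
  qed
  also have "\<dots> = (\<Prod>b\<in>(Basis :: (real ^ 'n) set). (\<integral>\<^sup>+x. ennreal (exp (- x\<^sup>2 / 2)) \<partial>lborel))"
    by (rule nn_integral_lborel_prod) auto
  also have "\<dots> < \<infinity>" unfolding one by (simp add: ennreal_power flip: prod_ennreal)
  finally show ?thesis unfolding gint_def by (simp add: less_top)
qed

lemma gint_nonneg: "gint TYPE('n::finite) \<ge> 0"
  by (simp add: gint_def)

lemma nn_integral_exp_norm_sq_scaled:
  assumes \<rho>: "\<rho> > 0"
  shows "(\<integral>\<^sup>+x. ennreal (exp (- (norm (x :: real ^ 'n))\<^sup>2 / (2 * \<rho>\<^sup>2))) \<partial>lborel) = ennreal (\<rho> ^ CARD('n) * gint TYPE('n))"
proof -
  have "(\<integral>\<^sup>+x. ennreal (exp (- (norm (x :: real ^ 'n))\<^sup>2 / (2 * \<rho>\<^sup>2))) \<partial>lborel)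
    = (\<integral>\<^sup>+x. ennreal (exp (- (norm (x :: real ^ 'n))\<^sup>2 / (2 * \<rho>\<^sup>2))) \<partial>density (distr lborel borel (\<lambda>x. 0 + \<rho> *\<^sub>R x)) (\<lambda>_. ennreal (\<bar>\<rho>\<bar> ^ DIM(real ^ 'n))))"
    using lborel_affine[of \<rho> "0 :: real ^ 'n"] \<rho> by simp
  also have "\<dots> = (\<integral>\<^sup>+x. ennreal (\<rho> ^ CARD('n)) * ennreal (exp (- (norm (\<rho> *\<^sub>R x :: real ^ 'n))\<^sup>2 / (2 * \<rho>\<^sup>2))) \<partial>lborel)"
    using \<rho> by (simp add: nn_integral_density nn_integral_distr)
  also have "\<dots> = (\<integral>\<^sup>+x. ennreal (\<rho> ^ CARD('n)) * ennreal (exp (- (norm (x :: real ^ 'n))\<^sup>2 / 2)) \<partial>lborel)"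
    using \<rho> by (simp add: power_mult_distrib)
  also have "\<dots> = ennreal (\<rho> ^ CARD('n)) * ennreal (gint TYPE('n))"
    unfolding nn_integral_exp_norm_sq[symmetric] by (rule nn_integral_cmult) measurable
  finally show ?thesis using \<rho> gint_nonneg[where 'n = 'n] by (simp add: ennreal_mult')
qed

lemma finite_measure_gauss:
  assumes l: "0 \<le> l" shows "finite_measure (gauss l :: (real ^ 'n) measure)"
proof (rule finite_measureI)
  have "emeasure (gauss l) (UNIV :: (real ^ 'n) set) = (\<integral>\<^sup>+x. ennreal (l * gconst TYPE('n)) * ennreal (exp (- (norm (x :: real ^ 'n))\<^sup>2 / 2)) \<partial>lborel)"
    using l gconst_pos[where 'n = 'n] by (subst emeasure_gauss[OF l]) (auto simp: ennreal_mult')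
  also have "\<dots> = ennreal (l * gconst TYPE('n)) * ennreal (gint TYPE('n))"
    unfolding nn_integral_exp_norm_sq[symmetric] by (rule nn_integral_cmult) measurable
  finally show "emeasure (gauss l) (space (gauss l :: (real ^ 'n) measure)) \<noteq> \<infinity>"
    by (simp add: ennreal_mult_eq_top_iff)
qed

lemma gauss_abs_continuous:
  fixes A :: "(real ^ 'n) set"
  assumes l: "0 \<le> l" and A: "A \<in> sets borel" "A \<in> null_sets lborel"
  shows "emeasure (gauss l) A = 0"
proof -
  have "AE x in lborel. x \<notin> A" using A(2) by (rule AE_not_in)
  then have "(\<integral>\<^sup>+x. ennreal (l * gconst TYPE('n) * exp (- (norm x)\<^sup>2 / 2)) * indicator A x \<partial>lborel) = (\<integral>\<^sup>+x. 0 \<partial>(lborel :: (real^'n) measure))"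
  proof (intro nn_integral_cong_AE, eventually_elim)
    case (elim x)
    then show ?case by simp
  qed
  then show ?thesis using emeasure_gauss[OF l A(1)] by simp
qed

lemma measure_gauss_le:
  fixes A :: "(real ^ 'n) set"
  assumes l: "0 \<le> l" and A: "A \<in> fmeasurable lborel" and a: "0 \<le> a" "\<And>x. x \<in> A \<Longrightarrow> a \<le> norm x"
  shows "measure (gauss l) A \<le> l * gconst TYPE('n) * exp (- a\<^sup>2 / 2) * measure lborel A"
proof -
  have "emeasure (gauss l) A \<le> (\<integral>\<^sup>+x. ennreal (l * gconst TYPE('n) * exp (- a\<^sup>2 / 2)) * indicator A x \<partial>lborel)"
  proof (subst emeasure_gauss[OF l])
    show "A \<in> sets borel" using fmeasurableD[OF A] by simp
    show "(\<integral>\<^sup>+x. ennreal (l * gconst TYPE('n) * exp (- (norm x)\<^sup>2 / 2)) * indicator A x \<partial>lborel)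
      \<le> (\<integral>\<^sup>+x. ennreal (l * gconst TYPE('n) * exp (- a\<^sup>2 / 2)) * indicator A x \<partial>lborel)"
    proof (rule nn_integral_mono)
      fix x
      show "ennreal (l * gconst TYPE('n) * exp (- (norm x)\<^sup>2 / 2)) * indicator A x \<le> ennreal (l * gconst TYPE('n) * exp (- a\<^sup>2 / 2)) * indicator A x"
      proof (cases "x \<in> A")
        case True
        have "a\<^sup>2 \<le> (norm x)\<^sup>2" by (rule power_mono[OF a(2)[OF True] a(1)])
        then show ?thesis using True l gconst_pos[where 'n = 'n] by (auto intro!: ennreal_leI mult_left_mono)
      qed simp
    qed
  qed
  also have "\<dots> = ennreal (l * gconst TYPE('n) * exp (- a\<^sup>2 / 2) * measure lborel A)"
    using A l gconst_pos[where 'n = 'n] fmeasurableD[OF A]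
    by (subst nn_integral_cmult_indicator) (auto simp: emeasure_eq_measure2 ennreal_mult')
  finally show ?thesis unfolding measure_def[of "gauss l"]
    using l gconst_pos[where 'n = 'n] by (intro enn2real_leI) auto
qed

lemma measure_gauss_ge:
  fixes A :: "(real ^ 'n) set"
  assumes l: "0 \<le> l" and A: "A \<in> fmeasurable lborel" and b: "\<And>x. x \<in> A \<Longrightarrow> norm x \<le> b"
  shows "l * gconst TYPE('n) * exp (- b\<^sup>2 / 2) * measure lborel A \<le> measure (gauss l) A"
proof -
  interpret finite_measure "gauss l :: (real ^ 'n) measure" by (rule finite_measure_gauss[OF l])
  have "ennreal (l * gconst TYPE('n) * exp (- b\<^sup>2 / 2) * measure lborel A)
      = (\<integral>\<^sup>+x. ennreal (l * gconst TYPE('n) * exp (- b\<^sup>2 / 2)) * indicator A x \<partial>lborel)"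
    using A l gconst_pos[where 'n = 'n] fmeasurableD[OF A]
    by (subst nn_integral_cmult_indicator) (auto simp: emeasure_eq_measure2 ennreal_mult')
  also have "\<dots> \<le> emeasure (gauss l) A"
  proof (subst emeasure_gauss[OF l])
    show "A \<in> sets borel" using fmeasurableD[OF A] by simp
    show "(\<integral>\<^sup>+x. ennreal (l * gconst TYPE('n) * exp (- b\<^sup>2 / 2)) * indicator A x \<partial>lborel)
      \<le> (\<integral>\<^sup>+x. ennreal (l * gconst TYPE('n) * exp (- (norm x)\<^sup>2 / 2)) * indicator A x \<partial>lborel)"
    proof (rule nn_integral_mono)
      fix x
      show "ennreal (l * gconst TYPE('n) * exp (- b\<^sup>2 / 2)) * indicator A x \<le> ennreal (l * gconst TYPE('n) * exp (- (norm x)\<^sup>2 / 2)) * indicator A x"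
      proof (cases "x \<in> A")
        case True
        have "(norm x)\<^sup>2 \<le> b\<^sup>2" by (rule power_mono[OF b[OF True]]) simp
        then show ?thesis using True l gconst_pos[where 'n = 'n] by (auto intro!: ennreal_leI mult_left_mono)
      qed simp
    qed
  qed
  finally show ?thesis by (simp add: emeasure_eq_measure ennreal_le_iff)
qed

text \<open>
  For \<open>norm x > \<rho>\<close> the exponent splits off \<open>\<rho>\<^sup>2 / 2 - 1\<close> and leaves the Gaussian exponent of
  standard deviation \<open>\<rho>\<close>: with \<open>y\<close> the square of the norm, this is
  \<open>0 \<le> (y - \<rho>\<^sup>2) * (1 - 1 / \<rho>\<^sup>2)\<close>. The remaining integral is computed by scaling.
\<close>

lemma gauss_tail_le:
  assumes l: "0 \<le> l" and \<rho>: "\<rho> \<ge> 1"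
  shows "measure (gauss l) {x :: real ^ 'n. \<rho> < norm x} \<le> l * (gconst TYPE('n) * gint TYPE('n) * exp 1) * \<rho> ^ CARD('n) * exp (- \<rho>\<^sup>2 / 2)"
proof -
  let ?A = "{x :: real ^ 'n. \<rho> < norm x}"
  have A: "?A \<in> sets borel" by measurable
  have "emeasure (gauss l) ?A \<le> (\<integral>\<^sup>+x. ennreal (l * gconst TYPE('n) * exp 1 * exp (- \<rho>\<^sup>2 / 2)) * ennreal (exp (- (norm (x :: real ^ 'n))\<^sup>2 / (2 * \<rho>\<^sup>2))) \<partial>lborel)"
    unfolding emeasure_gauss[OF l A]
  proof (rule nn_integral_mono)
    fix x :: "real ^ 'n"
    show "ennreal (l * gconst TYPE('n) * exp (- (norm x)\<^sup>2 / 2)) * indicator ?A x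
       \<le> ennreal (l * gconst TYPE('n) * exp 1 * exp (- \<rho>\<^sup>2 / 2)) * ennreal (exp (- (norm x)\<^sup>2 / (2 * \<rho>\<^sup>2)))"
    proof (cases "x \<in> ?A")
      case True
      define y where "y = (norm x)\<^sup>2"
      have "\<rho>\<^sup>2 \<le> y" using True \<rho> unfolding y_def by (intro power_mono) auto
      moreover have r1: "1 \<le> \<rho>\<^sup>2" using \<rho> by (rule one_le_power)
      moreover have "1 / \<rho>\<^sup>2 \<le> 1" using r1 by (subst divide_le_eq_1_pos) auto
      ultimately have "0 \<le> (y - \<rho>\<^sup>2) * (1 - 1 / \<rho>\<^sup>2)" by (intro mult_nonneg_nonneg) auto
      also have "\<dots> = y - \<rho>\<^sup>2 - y / \<rho>\<^sup>2 + 1"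
      proof -
        have "(y - q) * (1 - 1 / q) = y - q - y / q + 1" if "q \<noteq> 0" for q :: real using that by (simp add: algebra_simps diff_divide_distrib)
        moreover have "\<rho>\<^sup>2 \<noteq> 0" using r1 by linarith
        ultimately show ?thesis by blast
      qed
      finally have "- y / 2 \<le> 1 + - \<rho>\<^sup>2 / 2 + - y / (2 * \<rho>\<^sup>2)" by (simp add: field_simps)
      then have "exp (- y / 2) \<le> exp 1 * exp (- \<rho>\<^sup>2 / 2) * exp (- y / (2 * \<rho>\<^sup>2))"
        unfolding exp_add[symmetric] by simp
      then have "l * gconst TYPE('n) * exp (- y / 2) \<le> l * gconst TYPE('n) * (exp 1 * exp (- \<rho>\<^sup>2 / 2) * exp (- y / (2 * \<rho>\<^sup>2)))"
        using l gconst_pos[where 'n = 'n] by (intro mult_left_mono) auto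
      then show ?thesis using True l gconst_pos[where 'n = 'n]
        by (auto simp: y_def ennreal_mult'[symmetric] mult.assoc intro!: ennreal_leI)
    qed simp
  qed
  also have "\<dots> = ennreal (l * gconst TYPE('n) * exp 1 * exp (- \<rho>\<^sup>2 / 2)) * ennreal (\<rho> ^ CARD('n) * gint TYPE('n))"
    unfolding nn_integral_exp_norm_sq_scaled[where 'n = 'n, OF less_le_trans[OF zero_less_one \<rho>], symmetric]
    by (rule nn_integral_cmult) measurable
  also have "\<dots> = ennreal (l * (gconst TYPE('n) * gint TYPE('n) * exp 1) * \<rho> ^ CARD('n) * exp (- \<rho>\<^sup>2 / 2))"
    using l gconst_pos[where 'n = 'n] gint_nonneg[where 'n = 'n] \<rho> by (simp add: ennreal_mult'[symmetric] mult_ac)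
  finally show ?thesis unfolding measure_def
    using l gconst_pos[where 'n = 'n] gint_nonneg[where 'n = 'n] \<rho> by (intro enn2real_leI) auto
qed

text \<open>
  Beyond \<open>T\<close> the factor \<open>l\<close> is at most \<open>exp ((norm x)\<^sup>2 / 4)\<close>, and the polynomial weight at
  most a multiple of \<open>exp ((norm x)\<^sup>2 / 8)\<close>; the density still leaves \<open>exp (- (norm x)\<^sup>2 / 8)\<close>.
  So the bound is uniform in \<open>l\<close>.
\<close>

lemma gauss_tail_moment_le:
  assumes l: "0 \<le> l" "l \<le> exp (T\<^sup>2 / 4)" and T: "0 \<le> T"
  shows "(\<integral>\<^sup>+x. ennreal ((norm x + 1) ^ q) * indicator {x :: real ^ 'n. T < norm x} x \<partial>gauss l)
    \<le> ennreal (gconst TYPE('n) * fact q * exp 3 * (2 ^ CARD('n) * gint TYPE('n)))"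
proof -
  have "(\<integral>\<^sup>+x. ennreal ((norm x + 1) ^ q) * indicator {x :: real ^ 'n. T < norm x} x \<partial>gauss l)
    = (\<integral>\<^sup>+x. ennreal (l * gconst TYPE('n) * exp (- (norm x)\<^sup>2 / 2)) * (ennreal ((norm x + 1) ^ q) * indicator {x :: real ^ 'n. T < norm x} x) \<partial>lborel)"
    by (rule nn_integral_gauss[OF l(1)]) measurable
  also have "\<dots> \<le> (\<integral>\<^sup>+x. ennreal (gconst TYPE('n) * fact q * exp 3) * ennreal (exp (- (norm (x :: real ^ 'n))\<^sup>2 / (2 * 2\<^sup>2))) \<partial>lborel)"
  proof (rule nn_integral_mono)
    fix x :: "real ^ 'n"
    show "ennreal (l * gconst TYPE('n) * exp (- (norm x)\<^sup>2 / 2)) * (ennreal ((norm x + 1) ^ q) * indicator {x. T < norm x} x)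
      \<le> ennreal (gconst TYPE('n) * fact q * exp 3) * ennreal (exp (- (norm x)\<^sup>2 / (2 * 2\<^sup>2)))"
    proof (cases "T < norm x")
      case True
      define y where "y = norm x"
      have y: "T < y" "0 \<le> y" using True by (auto simp: y_def)
      have "T\<^sup>2 \<le> y\<^sup>2" using y T by (intro power_mono) auto
      then have "l \<le> exp (y\<^sup>2 / 4)" using l(2) by (meson divide_right_mono exp_le_cancel_iff order_trans zero_le_numeral)
      moreover have "(y + 1) ^ q \<le> fact q * exp (y\<^sup>2 / 8 + 3)"
      proof -
        have "(\<Sum>k\<in>{q}. (y + 1) ^ k /\<^sub>R fact k) \<le> (\<Sum>k. (y + 1) ^ k /\<^sub>R fact k)"
          by (rule sum_le_suminf) (use y summable_exp_generic[of "y + 1"] in auto)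
        then have "(y + 1) ^ q / fact q \<le> exp (y + 1)" by (simp add: exp_def divide_inverse mult.commute)
        then have "(y + 1) ^ q \<le> fact q * exp (y + 1)" by (simp add: pos_divide_le_eq mult.commute)
        also have "\<dots> \<le> fact q * exp (y\<^sup>2 / 8 + 3)"
        proof -
          have "0 \<le> (y - 4)\<^sup>2" by simp
          then have "y + 1 \<le> y\<^sup>2 / 8 + 3" by (simp add: power2_diff)
          then show ?thesis by simp
        qed
        finally show ?thesis .
      qed
      ultimately have "l * exp (- y\<^sup>2 / 2) * (y + 1) ^ q \<le> exp (y\<^sup>2 / 4) * exp (- y\<^sup>2 / 2) * (fact q * exp (y\<^sup>2 / 8 + 3))"
        using l y by (intro mult_mono) auto
      also have "\<dots> = fact q * (exp (y\<^sup>2 / 4) * exp (- y\<^sup>2 / 2) * exp (y\<^sup>2 / 8 + 3))" by simp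
      also have "\<dots> = fact q * (exp 3 * exp (- y\<^sup>2 / (2 * 2\<^sup>2)))"
        unfolding exp_add[symmetric] by (simp add: field_simps)
      finally have "gconst TYPE('n) * (l * exp (- y\<^sup>2 / 2) * (y + 1) ^ q) \<le> gconst TYPE('n) * (fact q * (exp 3 * exp (- y\<^sup>2 / (2 * 2\<^sup>2))))"
        using gconst_pos[where 'n = 'n] by (intro mult_left_mono) auto
      then show ?thesis using True l y gconst_pos[where 'n = 'n]
        by (auto simp: y_def ennreal_mult'[symmetric] mult_ac intro!: ennreal_leI)
    qed simp
  qed
  also have "\<dots> = ennreal (gconst TYPE('n) * fact q * exp 3) * ennreal (2 ^ CARD('n) * gint TYPE('n))"
    unfolding nn_integral_exp_norm_sq_scaled[where 'n = 'n, OF zero_less_numeral[of "num.Bit0 num.One"], symmetric]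
    by (rule nn_integral_cmult) measurable
  finally show ?thesis using gconst_pos[where 'n = 'n] gint_nonneg[where 'n = 'n] by (simp add: ennreal_mult'[symmetric])
qed

section \<open>Measurability and concentration for Poisson functionals\<close>

text \<open>
  A representative of the dyadic cube of \<open>x\<close>, chosen on the same side of each of the sets \<open>P i\<close>
  as \<open>x\<close>, so that rounding does not move points from one cone to another.
\<close>

definition discretize :: "(nat \<Rightarrow> 'a::euclidean_space set) \<Rightarrow> nat \<Rightarrow> nat \<Rightarrow> 'a \<Rightarrow> 'a" where
  "discretize P K n x = (SOME y. grid n y = grid n x \<and> (\<forall>i<K. y \<in> P i \<longleftrightarrow> x \<in> P i))"

lemma discretize_key: "grid n (discretize P K n x) = grid n x \<and> (\<forall>i<K. discretize P K n x \<in> P i \<longleftrightarrow> x \<in> P i)"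
  unfolding discretize_def by (rule someI[of _ x]) simp

lemma discretize_cong:
  assumes "grid n x = grid n y" "\<And>i. i < K \<Longrightarrow> x \<in> P i \<longleftrightarrow> y \<in> P i"
  shows "discretize P K n x = discretize P K n y"
  unfolding discretize_def by (rule arg_cong[where f = Eps]) (use assms in auto)

lemma discretize_tendsto: "(\<lambda>n. discretize P K n x) \<longlonglongrightarrow> (x :: 'a::euclidean_space)"
proof (rule tendsto_dist_iff[THEN iffD2])
  show "(\<lambda>n. dist (discretize P K n x) x) \<longlonglongrightarrow> 0"
  proof (rule tendsto_sandwich[OF _ _ tendsto_const])
    show "(\<lambda>n. real DIM('a) * (1/2) ^ n) \<longlonglongrightarrow> 0"
      using tendsto_mult[OF tendsto_const[of "real DIM('a)"] LIMSEQ_power_zero[of "1/2::real"]] by simp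
    show "eventually (\<lambda>n. dist (discretize P K n x) x \<le> real DIM('a) * (1/2) ^ n) sequentially"
      using dist_grid[OF conjunct1[OF discretize_key[of _ P K x]]] by (auto simp: power_divide)
  qed auto
qed

text \<open>
  A fibre is empty or the intersection of a cube with sets \<open>P i\<close> and complements of such sets.
\<close>

lemma discretize_vimage:
  assumes "\<And>i. i < K \<Longrightarrow> P i \<in> sets borel"
  shows "discretize P K n -` {v} \<in> sets borel"
proof (cases "discretize P K n v = v")
  case True
  have "discretize P K n -` {v} = grid n -` {grid n v} \<inter> (\<Inter>i\<in>{..<K}. if v \<in> P i then P i else - P i)"
  proof
    show "discretize P K n -` {v} \<subseteq> grid n -` {grid n v} \<inter> (\<Inter>i\<in>{..<K}. if v \<in> P i then P i else - P i)"
      using discretize_key[of n P K] by fastforce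
    show "grid n -` {grid n v} \<inter> (\<Inter>i\<in>{..<K}. if v \<in> P i then P i else - P i) \<subseteq> discretize P K n -` {v}"
    proof
      fix x assume x: "x \<in> grid n -` {grid n v} \<inter> (\<Inter>i\<in>{..<K}. if v \<in> P i then P i else - P i)"
      have "discretize P K n x = discretize P K n v"
      proof (rule discretize_cong)
        show "grid n x = grid n v" using x by auto
        show "x \<in> P i \<longleftrightarrow> v \<in> P i" if "i < K" for i
        proof -
          have "x \<in> (if v \<in> P i then P i else - P i)" using x that by blast
          then show ?thesis by (auto split: if_splits)
        qed
      qed
      then show "x \<in> discretize P K n -` {v}" using True by simp
    qed
  qed
  also have "\<dots> \<in> sets borel"
  proof (cases "K = 0")
    case False
    then show ?thesis using assms grid_measurable by (intro sets.Int sets.finite_INT) auto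
  qed (simp add: grid_measurable)
  finally show ?thesis .
next
  case False
  have "discretize P K n x \<noteq> v" for x
  proof
    assume eq: "discretize P K n x = v"
    have "discretize P K n v = discretize P K n x"
      by (rule discretize_cong) (use discretize_key[of n P K x] eq in auto)
    then show False using False eq by simp
  qed
  then have "discretize P K n -` {v} = {}" by auto
  then show ?thesis by (simp only: sets.empty_sets)
qed

lemma finite_discretize_image:
  assumes "bounded B" shows "finite (discretize P K n ` B)"
proof -
  let ?k = "\<lambda>x. (grid n x, {i. i < K \<and> x \<in> P i})"
  have "?k ` B \<subseteq> grid n ` B \<times> Pow {..<K}" by auto
  moreover have "finite (grid n ` B \<times> Pow {..<K})" using finite_grid_image[OF assms] by simp
  ultimately have fin: "finite (?k ` B)" by (rule finite_subset)
  have "discretize P K n x = discretize P K n (SOME y. ?k y = ?k x)" for x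
  proof (rule discretize_cong)
    have "?k (SOME y. ?k y = ?k x) = ?k x" by (rule someI[of "\<lambda>y. ?k y = ?k x" x]) simp
    then show "grid n x = grid n (SOME y. ?k y = ?k x)" "i < K \<Longrightarrow> x \<in> P i \<longleftrightarrow> (SOME y. ?k y = ?k x) \<in> P i" for i
      by (auto simp: set_eq_iff)
  qed
  then have "discretize P K n ` B \<subseteq> (\<lambda>k. discretize P K n (SOME y. ?k y = k)) ` ?k ` B" by force
  then show ?thesis using fin finite_subset by blast
qed

text \<open>
  Continuity at the finite sets in general position, under arbitrary perturbations of their
  points.
\<close>

definition stable_functional :: "('a::euclidean_space set \<Rightarrow> real) \<Rightarrow> bool" where
  "stable_functional F \<longleftrightarrow> (\<forall>S \<phi>. finite S \<longrightarrow> gen_pos S \<longrightarrow> (\<forall>s\<in>S. (\<lambda>n. \<phi> n s) \<longlonglongrightarrow> s) \<longrightarrow> (\<lambda>n. F (\<phi> n ` S)) \<longlonglongrightarrow> F S)"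

text \<open>
  A function that agrees almost everywhere with a measurable one is measurable for the
  completed measure and has the same integral.
\<close>

lemma integral_completion_AE_eq:
  fixes f g :: "'w \<Rightarrow> real"
  assumes f: "f \<in> borel_measurable M" and eq: "AE \<omega> in M. f \<omega> = g \<omega>"
  shows "(\<integral>\<omega>. g \<omega> \<partial>completion M) = (\<integral>\<omega>. f \<omega> \<partial>M)"
proof -
  have eq': "AE \<omega> in completion M. f \<omega> = g \<omega>" using eq by (rule AE_completion)
  have f': "f \<in> borel_measurable (completion M)" using f by (rule measurable_completion)
  have g': "g \<in> borel_measurable (completion M)"
  proof (rule measurableI)
    fix A :: "real set" assume A: "A \<in> sets borel"
    show "g -` A \<inter> space (completion M) \<in> sets (completion M)"
    proof (rule completion.in_sets_AE)
      show "f -` A \<inter> space (completion M) \<in> sets (completion M)" using f' A by (rule measurable_sets)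
      show "AE x in completion M. (x \<in> f -` A \<inter> space (completion M)) = (x \<in> g -` A \<inter> space (completion M))"
        using eq' by eventually_elim auto
    qed auto
  qed simp
  have "(\<integral>\<omega>. g \<omega> \<partial>completion M) = (\<integral>\<omega>. f \<omega> \<partial>completion M)"
    by (rule integral_cong_AE[OF g' f']) (use eq' in eventually_elim, simp)
  also have "\<dots> = (\<integral>\<omega>. f \<omega> \<partial>M)" by (rule integral_completion[OF f])
  finally show ?thesis .
qed

lemma gen_pos_subset: "gen_pos S \<Longrightarrow> T \<subseteq> S \<Longrightarrow> gen_pos T"
  unfolding gen_pos_def by blast

context poisson_points
begin

text \<open>
  The discretized configuration takes finitely many values, each of them on an event.
\<close>

lemma finite_valued_measurable:
  fixes F :: "'a set \<Rightarrow> real"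
  assumes C: "C \<in> sets borel" "bounded C" and P: "\<And>i. i < K \<Longrightarrow> P i \<in> sets borel"
  shows "(\<lambda>\<omega>. F (discretize P K n ` (X \<omega> \<inter> C))) \<in> borel_measurable M"
proof -
  let ?V = "discretize P K n ` C"
  have V: "finite ?V" using C(2) by (rule finite_discretize_image)
  have ev: "{\<omega>\<in>space M. discretize P K n ` (X \<omega> \<inter> C) = y} \<in> sets M" for y
    using indep_images(1)[of "{0::nat}" "\<lambda>_. C" "discretize P K n" ?V 0 y] C V discretize_vimage[OF P]
    by (simp add: disjoint_family_on_def)
  have "F (discretize P K n ` (X \<omega> \<inter> C)) = (\<Sum>y\<in>Pow ?V. F y * indicator {\<omega>\<in>space M. discretize P K n ` (X \<omega> \<inter> C) = y} \<omega>)"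
    if "\<omega> \<in> space M" for \<omega>
  proof -
    have "(\<Sum>y\<in>Pow ?V. F y * indicator {\<omega>\<in>space M. discretize P K n ` (X \<omega> \<inter> C) = y} \<omega>)
      = (\<Sum>y\<in>Pow ?V. if y = discretize P K n ` (X \<omega> \<inter> C) then F y else 0)"
      by (rule sum.cong) (use that in \<open>auto simp: indicator_def\<close>)
    moreover have "discretize P K n ` (X \<omega> \<inter> C) \<in> Pow ?V" by blast
    ultimately show ?thesis using V by simp
  qed
  moreover have "(\<lambda>\<omega>. \<Sum>y\<in>Pow ?V. F y * indicator {\<omega>\<in>space M. discretize P K n ` (X \<omega> \<inter> C) = y} \<omega>) \<in> borel_measurable M"
    using ev by (intro borel_measurable_sum borel_measurable_times borel_measurable_indicator) auto
  ultimately show ?thesis by (subst measurable_cong) auto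
qed

lemma functional_AE_measurable:
  assumes gp: "AE \<omega> in M. gen_pos (X \<omega>)" and F: "stable_functional F"
  shows "\<exists>f\<in>borel_measurable M. AE \<omega> in M. f \<omega> = F (X \<omega>)"
proof -
  let ?\<phi> = "\<lambda>n. discretize (\<lambda>_. {}) 0 n"
  let ?f = "\<lambda>n \<omega>. F (?\<phi> n ` (X \<omega> \<inter> ball 0 (real n)))"
  have m: "?f n \<in> borel_measurable M" for n by (rule finite_valued_measurable) auto
  have "AE \<omega> in M. lim (\<lambda>n. ?f n \<omega>) = F (X \<omega>)"
    using gp AE_finite
  proof eventually_elim
    case (elim \<omega>)
    have lim: "(\<lambda>n. F (?\<phi> n ` X \<omega>)) \<longlonglongrightarrow> F (X \<omega>)"
      using F elim discretize_tendsto unfolding stable_functional_def by blast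
    obtain R where R: "\<And>x. x \<in> X \<omega> \<Longrightarrow> norm x \<le> R" using elim(2) finite_imp_bounded bounded_iff by metis
    obtain n0 where n0: "R < real n0" using reals_Archimedean2 by blast
    have "eventually (\<lambda>n. F (?\<phi> n ` X \<omega>) = ?f n \<omega>) sequentially"
      using eventually_ge_at_top[of n0]
    proof eventually_elim
      case (elim n)
      have "X \<omega> \<subseteq> ball 0 (real n)"
      proof
        fix x assume "x \<in> X \<omega>"
        then have "norm x \<le> R" by (rule R)
        then show "x \<in> ball 0 (real n)" using n0 elim by simp
      qed
      then have "X \<omega> \<inter> ball 0 (real n) = X \<omega>" by blast
      then show ?case by simp
    qed
    from Lim_transform_eventually[OF lim this] show ?case by (rule limI)
  qed
  moreover have "(\<lambda>\<omega>. lim (\<lambda>n. ?f n \<omega>)) \<in> borel_measurable M"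
    by (rule borel_measurable_lim_metric[OF m])
  ultimately show ?thesis by (intro bexI[of _ "\<lambda>\<omega>. lim (\<lambda>n. ?f n \<omega>)"])
qed

text \<open>
  McDiarmid's inequality for a functional of a Poisson process. The sets \<open>C i\<close> carry the
  independent coordinates. Outside the event \<open>bad\<close> the functional depends only on the points in
  them, and it has bounded differences among the configurations called \<open>good\<close>.

  The inequality is applied to \<open>fn n\<close>, the functional of the discretized configuration in which
  the content of every coordinate that is not good is replaced by that of a fixed good
  configuration \<open>D\<close>. This makes \<open>fn n\<close> a bounded function with bounded differences on the whole
  product space. Outside \<open>bad\<close> it converges to \<open>f\<close>. The expectations of \<open>fn n\<close> and \<open>f\<close> may
  differ on \<open>bad\<close>, but by at most \<open>t / 4\<close> in view of the second moment, so a deviation of \<open>f\<close>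
  by \<open>t\<close> forces one of \<open>fn n\<close> by \<open>t / 4\<close> for all large \<open>n\<close>.
\<close>

lemma concentration:
  fixes F :: "'a set \<Rightarrow> real" and C A :: "nat \<Rightarrow> 'a set" and N m :: nat
  assumes gp: "AE \<omega> in M. gen_pos (X \<omega>)" and F: "stable_functional F"
    and C: "\<And>i. i < N \<Longrightarrow> C i \<in> sets borel" "\<And>i. i < N \<Longrightarrow> bounded (C i)" "disjoint_family_on C {..<N}"
    and A: "\<And>i. i < N \<Longrightarrow> A i \<in> sets borel" "\<And>i. i < N \<Longrightarrow> A i \<subseteq> C i"
    and Z: "Z \<in> sets borel"
  defines "good \<equiv> \<lambda>S. \<forall>i<N. finite (S i) \<and> S i \<subseteq> C i \<and> S i \<inter> A i \<noteq> {} \<and> card (S i) \<le> m"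
  defines "bad \<equiv> {\<omega>\<in>space M. \<not> ((\<forall>i<N. X \<omega> \<inter> A i \<noteq> {} \<and> card (X \<omega> \<inter> C i) \<le> m) \<and> X \<omega> \<inter> Z = {})}"
  assumes inner: "\<And>S T. good S \<Longrightarrow> T \<inter> ((\<Union>i<N. C i) \<union> Z) = {} \<Longrightarrow> F (T \<union> (\<Union>i<N. S i)) = F (\<Union>i<N. S i)"
    and lip: "\<And>S S' i. good S \<Longrightarrow> good S' \<Longrightarrow> i < N \<Longrightarrow> (\<And>k. k < N \<Longrightarrow> k \<noteq> i \<Longrightarrow> S k = S' k) \<Longrightarrow> \<bar>F (\<Union>i<N. S i) - F (\<Union>i<N. S' i)\<bar> \<le> c"
    and bound: "\<And>S. good S \<Longrightarrow> \<bar>F (\<Union>i<N. S i)\<bar> \<le> B"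
    and f: "f \<in> borel_measurable M" "AE \<omega> in M. f \<omega> = F (X \<omega>)"
    and E2: "(\<integral>\<^sup>+\<omega>. ennreal ((f \<omega>)\<^sup>2) \<partial>M) \<le> ennreal E2" "0 \<le> E2"
    and s: "s > 0" and small: "E2 / s + (s + B) * prob bad \<le> t / 4"
    and Kc: "real N * c\<^sup>2 \<le> K" "K > 0" and t: "t > 0"
  shows "prob {\<omega>\<in>space M. \<bar>f \<omega> - (\<integral>\<omega>. f \<omega> \<partial>M)\<bar> \<ge> t} \<le> prob bad + 2 * exp (- 2 * (t / 4)\<^sup>2 / K)"
proof -
  have m1: "{\<omega>\<in>space M. X \<omega> \<inter> A i \<noteq> {}} \<in> sets M" if "i < N" for i
  proof -
    have "{\<omega>\<in>space M. X \<omega> \<inter> A i \<noteq> {}} = space M - {\<omega>\<in>space M. X \<omega> \<inter> A i = {}}" by auto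
    then show ?thesis using hit_measurable[OF A(1)[OF that]] by simp
  qed
  have m2: "{\<omega>\<in>space M. card (X \<omega> \<inter> C i) \<le> m} \<in> sets M" if "i < N" for i
    using measurable_sets[OF card_measurable[OF C(1)[OF that]], of "{..m}"] by (simp add: vimage_def Int_def conj_commute)
  have gdm: "{\<omega>\<in>space M. (\<forall>i\<in>{..<N}. X \<omega> \<inter> A i \<noteq> {} \<and> card (X \<omega> \<inter> C i) \<le> m) \<and> X \<omega> \<inter> Z = {}} \<in> sets M" (is "?G \<in> _")
    by (intro sets.sets_Collect_conj sets.sets_Collect_finite_All hit_measurable[OF Z] m1 m2) auto
  have bad_eq: "bad = space M - ?G" unfolding bad_def by auto
  have bad_sets: "bad \<in> sets M" unfolding bad_eq using gdm by simp
  define t' where "t' = t / 4"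
  have t': "t' > 0" using t by (simp add: t'_def)
  have B0: "0 \<le> B" if "good S" for S using bound[OF that] by linarith
  show "prob {\<omega>\<in>space M. \<bar>f \<omega> - (\<integral>\<omega>. f \<omega> \<partial>M)\<bar> \<ge> t} \<le> prob bad + 2 * exp (- 2 * (t / 4)\<^sup>2 / K)"
  \<comment> \<open>Without a good configuration the event \<open>bad\<close> has probability one and the bound is trivial.\<close>
  proof (cases "\<exists>S. good S")
    case False
    have "AE \<omega> in M. \<omega> \<in> bad"
      using AE_finite AE_space
    proof eventually_elim
      case (elim \<omega>)
      show ?case
      proof (rule ccontr)
        assume "\<omega> \<notin> bad"
        then have "good (\<lambda>i. X \<omega> \<inter> C i)" using elim A(2) unfolding good_def bad_def by blast
        then show False using False by blast
      qed
    qed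
    then have "prob bad = 1" using bad_sets by (simp add: prob_eq_1)
    then show ?thesis using prob_le_1[of "{\<omega>\<in>space M. \<bar>f \<omega> - (\<integral>\<omega>. f \<omega> \<partial>M)\<bar> \<ge> t}"]
      by (simp add: add_increasing2)
  next
    case True
    then obtain D where D: "good D" by blast
    \<comment> \<open>Rounding has to respect the sets \<open>C i\<close> as well as the sets \<open>A i\<close>, listed one after the other.\<close>
    define P where "P i = (if i < N then C i else A (i - N))" for i
    define \<phi> where "\<phi> n = discretize P (2 * N) n" for n
    have Pb: "P i \<in> sets borel" if "i < 2 * N" for i using that C(1) A(1) by (auto simp: P_def)
    have \<phi>C: "\<phi> n x \<in> C i \<longleftrightarrow> x \<in> C i" if "i < N" for n x i
      using discretize_key[of n P "2 * N" x] that unfolding \<phi>_def P_def by (auto dest!: spec[of _ i])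
    have \<phi>A: "\<phi> n x \<in> A i \<longleftrightarrow> x \<in> A i" if "i < N" for n x i
      using discretize_key[of n P "2 * N" x] that unfolding \<phi>_def P_def by (auto dest!: spec[of _ "i + N"])
    define V where "V n = \<phi> n ` (\<Union>i<N. C i)" for n
    have V: "finite (V n)" for n unfolding V_def \<phi>_def using C(2) by (intro finite_discretize_image bounded_UN) auto
    have \<phi>V: "\<phi> n -` {v} \<in> sets borel" for n v unfolding \<phi>_def by (rule discretize_vimage[OF Pb])
    define W where "W n i \<omega> = \<phi> n ` (X \<omega> \<inter> C i)" for n i \<omega>
    have CV: "\<phi> n ` C i \<subseteq> V n" if "i < N" for n i using that by (auto simp: V_def)
    define okc where "okc i y \<longleftrightarrow> finite y \<and> y \<subseteq> C i \<and> y \<inter> A i \<noteq> {} \<and> card y \<le> m" for i y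
    define h where "h i y = (if okc i y then y else D i)" for i y
    have good_h: "good (\<lambda>i. h i (w i))" for w
      using D unfolding good_def h_def okc_def by auto
    define g where "g w = F (\<Union>i<N. h i (w i))" for w
    define fn where "fn n \<omega> = g (\<lambda>i. if i \<in> {..<N} then W n i \<omega> else {})" for n \<omega>
    have fnB: "\<bar>fn n \<omega>\<bar> \<le> B" for n \<omega> unfolding fn_def g_def by (rule bound[OF good_h])
    have mc: "fn n \<in> borel_measurable M \<and> prob {\<omega>\<in>space M. \<bar>fn n \<omega> - (\<integral>\<omega>. fn n \<omega> \<partial>M)\<bar> \<ge> t'} \<le> 2 * exp (- 2 * t'\<^sup>2 / K)" for n
    proof -
      have 1: "finite {..<N}" "finite (Pow (V n))" using V by auto
      have 2: "{\<omega>\<in>space M. W n i \<omega> = y} \<in> sets M" if "i \<in> {..<N}" for i y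
        unfolding W_def by (rule indep_images(1)[where I = "{..<N}" and V = "V n"]) (use that C \<phi>V V CV in auto)
      have 3: "W n i \<omega> \<in> Pow (V n)" if "i \<in> {..<N}" for i \<omega> using that by (auto simp: W_def V_def)
      have 4: "prob {\<omega>\<in>space M. \<forall>i\<in>{..<N}. W n i \<omega> = y i} = (\<Prod>i\<in>{..<N}. prob {\<omega>\<in>space M. W n i \<omega> = y i})"
        if "\<And>i. i \<in> {..<N} \<Longrightarrow> y i \<in> Pow (V n)" for y
        unfolding W_def by (rule indep_images(2)[where V = "V n"]) (use that C \<phi>V V CV in auto)
      have 5: "\<bar>g (x(i := v)) - g (x(i := w))\<bar> \<le> c" if "i \<in> {..<N}" for x i v w
        unfolding g_def by (rule lip[OF good_h good_h, of i]) (use that in auto)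
      have 6: "real (card {..<N}) * c\<^sup>2 \<le> K" using Kc(1) by simp
      show ?thesis unfolding fn_def
        using McDiarmid_finite_rv[OF prob_space_axioms 1, of "W n" "{}" g c K t', OF 2 3 4 5 6 Kc(2) t'] by blast
    qed
    have conv: "AE \<omega> in M. \<omega> \<in> ?G \<longrightarrow> (\<lambda>n. fn n \<omega>) \<longlonglongrightarrow> f \<omega> \<and> \<bar>f \<omega>\<bar> \<le> B"
      using gp AE_finite f(2) AE_space
    proof eventually_elim
      case (elim \<omega>)
      show ?case
      proof
        assume G: "\<omega> \<in> ?G"
        let ?S = "\<lambda>i. X \<omega> \<inter> C i"
        have gS: "good ?S" using G elim A(2) unfolding good_def by blast
        have "X \<omega> = (X \<omega> - (\<Union>i<N. C i)) \<union> (\<Union>i<N. ?S i)" by auto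
        moreover have "(X \<omega> - (\<Union>i<N. C i)) \<inter> ((\<Union>i<N. C i) \<union> Z) = {}" using G by auto
        ultimately have FX: "F (X \<omega>) = F (\<Union>i<N. ?S i)" using inner[OF gS] by metis
        have "fn n \<omega> = F (\<phi> n ` (\<Union>i<N. ?S i))" for n
        proof -
          have "h i (W n i \<omega>) = W n i \<omega>" if i: "i < N" for i
          proof -
            have "card (W n i \<omega>) \<le> m" unfolding W_def using gS i card_image_le[of "?S i" "\<phi> n"] unfolding good_def by force
            moreover have "W n i \<omega> \<inter> A i \<noteq> {}"
            proof -
              obtain x where "x \<in> X \<omega> \<inter> C i" "x \<in> A i" using gS i unfolding good_def by blast
              then have "\<phi> n x \<in> W n i \<omega> \<inter> A i" using \<phi>A[OF i] by (auto simp: W_def)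
              then show ?thesis by blast
            qed
            ultimately have "okc i (W n i \<omega>)" unfolding okc_def W_def using \<phi>C[OF i] elim(2) by auto
            then show ?thesis by (simp add: h_def)
          qed
          then have "(\<Union>i<N. h i (if i \<in> {..<N} then W n i \<omega> else {})) = \<phi> n ` (\<Union>i<N. ?S i)"
            unfolding image_UN by (intro SUP_cong refl) (auto simp: W_def)
          then show ?thesis unfolding fn_def g_def by (rule arg_cong)
        qed
        moreover have "(\<lambda>n. F (\<phi> n ` (\<Union>i<N. ?S i))) \<longlonglongrightarrow> F (\<Union>i<N. ?S i)"
        proof -
          have "finite (\<Union>i<N. ?S i)" "gen_pos (\<Union>i<N. ?S i)" using elim by (auto intro: gen_pos_subset)
          then show ?thesis using F discretize_tendsto unfolding stable_functional_def \<phi>_def by blast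
        qed
        ultimately show "(\<lambda>n. fn n \<omega>) \<longlonglongrightarrow> f \<omega> \<and> \<bar>f \<omega>\<bar> \<le> B"
          using FX elim(3) bound[OF gS] by simp
      qed
    qed
    have B0: "0 \<le> B" by (rule B0[OF D])
    have fm: "fn n \<in> borel_measurable M" for n using mc by blast
    have intfn: "integrable M (fn n)" for n
      by (rule integrable_const_bound[of _ B]) (use fm fnB in auto)
    have int2: "integrable M (\<lambda>\<omega>. (f \<omega>)\<^sup>2)"
      by (rule integrableI_bounded) (use f(1) E2 in \<open>auto simp: ennreal_power less_top[symmetric] top_unique\<close>)
    have E2': "(\<integral>\<omega>. (f \<omega>)\<^sup>2 \<partial>M) \<le> E2"
    proof -
      have "ennreal (\<integral>\<omega>. (f \<omega>)\<^sup>2 \<partial>M) \<le> ennreal E2"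
        using E2 nn_integral_eq_integral[OF int2] by simp
      then show ?thesis using E2(2) by (simp add: ennreal_le_iff)
    qed
    have intf: "integrable M f"
    proof (rule Bochner_Integration.integrable_bound[of M "\<lambda>\<omega>. 1 + (f \<omega>)\<^sup>2"])
      show "AE \<omega> in M. norm (f \<omega>) \<le> norm (1 + (f \<omega>)\<^sup>2)"
      proof (rule AE_I2)
        fix \<omega>
        have "0 \<le> (\<bar>f \<omega>\<bar> - 1)\<^sup>2" by simp
        then have "2 * \<bar>f \<omega>\<bar> \<le> 1 + (f \<omega>)\<^sup>2" by (simp add: power2_diff)
        then show "norm (f \<omega>) \<le> norm (1 + (f \<omega>)\<^sup>2)" by simp
      qed
    qed (use int2 f(1) in auto)
    define r where "r n \<omega> = indicator ?G \<omega> * \<bar>fn n \<omega> - f \<omega>\<bar>" for n \<omega>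
    have rm: "r n \<in> borel_measurable M" for n
      unfolding r_def using gdm fm f(1) by (intro borel_measurable_times borel_measurable_indicator borel_measurable_abs borel_measurable_diff) auto
    have rbound: "AE \<omega> in M. norm (r n \<omega>) \<le> 2 * B" for n
      using conv
    proof eventually_elim
      case (elim \<omega>)
      then show ?case using fnB[of n \<omega>] B0 by (auto simp: r_def indicator_def)
    qed
    have r0: "(\<lambda>n. \<integral>\<omega>. r n \<omega> \<partial>M) \<longlonglongrightarrow> (\<integral>\<omega>. 0 \<partial>M)"
    proof (rule integral_dominated_convergence[where w = "\<lambda>_. 2 * B"])
      show "AE \<omega> in M. (\<lambda>n. r n \<omega>) \<longlonglongrightarrow> 0"
        using conv
      proof eventually_elim
        case (elim \<omega>)
        show ?case
        proof (cases "\<omega> \<in> ?G")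
          case True
          then have "(\<lambda>n. \<bar>fn n \<omega> - f \<omega>\<bar>) \<longlonglongrightarrow> \<bar>f \<omega> - f \<omega>\<bar>" using elim by (intro tendsto_intros) auto
          then show ?thesis using True by (simp add: r_def)
        qed (simp add: r_def)
      qed
    qed (use rm rbound in auto)
    have diff: "\<bar>(\<integral>\<omega>. fn n \<omega> \<partial>M) - (\<integral>\<omega>. f \<omega> \<partial>M)\<bar> \<le> (\<integral>\<omega>. r n \<omega> \<partial>M) + t'" for n
    proof -
      have intr: "integrable M (r n)"
        by (rule integrable_const_bound[OF rbound rm])
      have intb: "integrable M (\<lambda>\<omega>. (f \<omega>)\<^sup>2 / s + (s + B) * indicator bad \<omega>)"
        using int2 bad_sets by (intro Bochner_Integration.integrable_add integrable_divide integrable_mult_right)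
          (auto simp: emeasure_eq_measure)
      have "\<bar>(\<integral>\<omega>. fn n \<omega> \<partial>M) - (\<integral>\<omega>. f \<omega> \<partial>M)\<bar> = \<bar>\<integral>\<omega>. fn n \<omega> - f \<omega> \<partial>M\<bar>"
        using intfn intf by simp
      also have "\<dots> \<le> (\<integral>\<omega>. \<bar>fn n \<omega> - f \<omega>\<bar> \<partial>M)" by (rule integral_abs_bound)
      also have "\<dots> \<le> (\<integral>\<omega>. r n \<omega> + ((f \<omega>)\<^sup>2 / s + (s + B) * indicator bad \<omega>) \<partial>M)"
      proof (rule integral_mono)
        show "integrable M (\<lambda>\<omega>. \<bar>fn n \<omega> - f \<omega>\<bar>)" using intfn intf by auto
        show "integrable M (\<lambda>\<omega>. r n \<omega> + ((f \<omega>)\<^sup>2 / s + (s + B) * indicator bad \<omega>))"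
          using intr intb by (rule Bochner_Integration.integrable_add)
        fix \<omega> assume w: "\<omega> \<in> space M"
        show "\<bar>fn n \<omega> - f \<omega>\<bar> \<le> r n \<omega> + ((f \<omega>)\<^sup>2 / s + (s + B) * indicator bad \<omega>)"
        proof (cases "\<omega> \<in> ?G")
          case True
          then have "r n \<omega> = \<bar>fn n \<omega> - f \<omega>\<bar>" by (simp add: r_def)
          then show ?thesis using s B0 by (simp add: indicator_def)
        next
          case False
          then have "\<omega> \<in> bad" using w bad_eq by blast
          \<comment> \<open>On \<open>bad\<close>, bound \<open>\<bar>f \<omega>\<bar>\<close> by \<open>(f \<omega>)\<^sup>2 / s + s\<close> in place of the Cauchy--Schwarz inequality.\<close>
          have "0 \<le> (\<bar>f \<omega>\<bar> - s)\<^sup>2" by simp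
          moreover have "(\<bar>f \<omega>\<bar> - s)\<^sup>2 = (f \<omega>)\<^sup>2 + s * s - 2 * (\<bar>f \<omega>\<bar> * s)"
            by (simp add: power2_diff) (simp add: power2_eq_square)
          ultimately have "2 * (\<bar>f \<omega>\<bar> * s) \<le> (f \<omega>)\<^sup>2 + s * s" by linarith
          moreover have "0 \<le> \<bar>f \<omega>\<bar> * s" using s by simp
          ultimately have "\<bar>f \<omega>\<bar> * s \<le> (f \<omega>)\<^sup>2 + s * s" by linarith
          then have "\<bar>f \<omega>\<bar> \<le> (f \<omega>)\<^sup>2 / s + s" using s by (simp add: field_simps)
          moreover have "\<bar>fn n \<omega> - f \<omega>\<bar> \<le> B + \<bar>f \<omega>\<bar>" using fnB[of n \<omega>] by linarith
          moreover have "r n \<omega> = 0" using False by (simp add: r_def)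
          ultimately show ?thesis using \<open>\<omega> \<in> bad\<close> by simp
        qed
      qed
      also have "\<dots> = (\<integral>\<omega>. r n \<omega> \<partial>M) + ((\<integral>\<omega>. (f \<omega>)\<^sup>2 \<partial>M) / s + (s + B) * prob bad)"
      proof -
        have i1: "integrable M (\<lambda>\<omega>. (f \<omega>)\<^sup>2 / s)" using int2 by (rule integrable_divide)
        have i2: "integrable M (\<lambda>\<omega>. (s + B) * indicator bad \<omega>)"
          using bad_sets by (intro integrable_mult_right) (auto simp: emeasure_eq_measure)
        have "(\<integral>\<omega>. (s + B) * indicator bad \<omega> \<partial>M) = (s + B) * prob bad" using bad_sets by simp
        then show ?thesis
          using Bochner_Integration.integral_add[OF intr intb] Bochner_Integration.integral_add[OF i1 i2] by simp
      qed
      also have "\<dots> \<le> (\<integral>\<omega>. r n \<omega> \<partial>M) + t'"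
        using small divide_right_mono[OF E2', of s] s unfolding t'_def by linarith
      finally show ?thesis .
    qed
    define H where "H n = {\<omega>\<in>space M. \<bar>fn n \<omega> - (\<integral>\<omega>. fn n \<omega> \<partial>M)\<bar> \<ge> t'}" for n
    have Hm: "H n \<in> sets M" for n unfolding H_def using fm by measurable
    have Hp: "prob (H n) \<le> 2 * exp (- 2 * t'\<^sup>2 / K)" for n unfolding H_def using mc by blast
    \<comment> \<open>A deviation for all large \<open>n\<close> is no more likely than a deviation for a single one.\<close>
    define L where "L k = (\<Inter>n\<in>{k..}. H n)" for k
    have Lm: "L k \<in> sets M" for k unfolding L_def using Hm by (intro sets.countable_INT') auto
    have Lp: "prob (L k) \<le> 2 * exp (- 2 * t'\<^sup>2 / K)" for k
      using finite_measure_mono[of "L k" "H k"] Hm Hp[of k] by (fastforce simp: L_def)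
    have "incseq L" by (auto simp: L_def incseq_def)
    then have "(\<lambda>k. prob (L k)) \<longlonglongrightarrow> prob (\<Union>k. L k)"
      using Lm by (intro finite_Lim_measure_incseq) auto
    then have UL: "prob (\<Union>k. L k) \<le> 2 * exp (- 2 * t'\<^sup>2 / K)"
      by (rule LIMSEQ_le_const2) (use Lp in auto)
    have evr: "eventually (\<lambda>n. (\<integral>\<omega>. r n \<omega> \<partial>M) < t' / 2) sequentially"
      using order_tendstoD(2)[OF r0, of "t' / 2"] t' by simp
    let ?T = "{\<omega>\<in>space M. \<bar>f \<omega> - (\<integral>\<omega>. f \<omega> \<partial>M)\<bar> \<ge> t}"
    have Tm: "?T \<in> sets M" using f(1) by measurable
    have "prob ?T \<le> prob (bad \<union> (\<Union>k. L k))"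
    proof (rule finite_measure_mono_AE)
      show "AE \<omega> in M. \<omega> \<in> ?T \<longrightarrow> \<omega> \<in> bad \<union> (\<Union>k. L k)"
        using conv AE_space
      proof eventually_elim
        case (elim \<omega>)
        show ?case
        proof (rule impI, rule ccontr)
          assume T: "\<omega> \<in> ?T" and n: "\<omega> \<notin> bad \<union> (\<Union>k. L k)"
          then have "\<omega> \<in> ?G" using bad_eq elim(2) by blast
          then have "(\<lambda>n. fn n \<omega>) \<longlonglongrightarrow> f \<omega>" using elim(1) by blast
          then have "eventually (\<lambda>n. dist (fn n \<omega>) (f \<omega>) < t' / 2) sequentially" using t' by (intro tendstoD) auto
          then have "eventually (\<lambda>n. \<omega> \<in> H n) sequentially"
            using evr
          proof eventually_elim
            case (elim n)
            have "t \<le> \<bar>f \<omega> - (\<integral>\<omega>. f \<omega> \<partial>M)\<bar>" using T by simp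
            moreover have "\<bar>fn n \<omega> - f \<omega>\<bar> < t' / 2" using elim(1) by (simp add: dist_real_def)
            moreover note diff[of n] elim(2)
            ultimately have "\<bar>fn n \<omega> - (\<integral>\<omega>. fn n \<omega> \<partial>M)\<bar> \<ge> t'" unfolding t'_def by linarith
            then show ?case using T by (simp add: H_def)
          qed
          then obtain k where "\<forall>n\<ge>k. \<omega> \<in> H n" unfolding eventually_sequentially by blast
          then have "\<omega> \<in> L k" by (simp add: L_def)
          then show False using n by blast
        qed
      qed
    qed (use bad_sets Lm Tm in auto)
    also have "\<dots> \<le> prob bad + prob (\<Union>k. L k)"
      using bad_sets Lm by (intro measure_Un_le) auto
    also have "\<dots> \<le> prob bad + 2 * exp (- 2 * (t / 4)\<^sup>2 / K)" using UL by (simp add: t'_def)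
    finally show ?thesis .
  qed
qed

end

section \<open>Critical radii and fine nets\<close>

text \<open>
  The radius at which the Gaussian density of intensity \<open>exp L\<close> has decayed to
  \<open>L powr (b / 2)\<close>, up to its normalizing constant.
\<close>

definition rad :: "real \<Rightarrow> real \<Rightarrow> real" where
  "rad b L = sqrt (2 * L - b * ln L)"

text \<open>
  Proportional to the width of a cap of height of order \<open>1 / sqrt L\<close> divided by the radius. The
  factor eight makes the relative loss \<open>2 * (mesh L)\<^sup>2\<close> equal to \<open>1 / (4 * L)\<close>.
\<close>

definition mesh :: "real \<Rightarrow> real" where
  "mesh L = 1 / sqrt (8 * L)"

lemma rad_bounds: "\<forall>\<^sub>F L in at_top. 1 \<le> sqrt L \<and> sqrt L \<le> rad b L \<and> rad b L \<le> 2 * sqrt L \<and> (rad b L)\<^sup>2 = 2 * L - b * ln L"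
proof -
  have "\<forall>\<^sub>F L::real in at_top. L \<le> 2 * L - b * ln L" by real_asymp
  moreover have "\<forall>\<^sub>F L::real in at_top. 2 * L - b * ln L \<le> 4 * L" by real_asymp
  ultimately show ?thesis using eventually_ge_at_top[of 1]
  proof eventually_elim
    case (elim L)
    have "rad b L \<le> sqrt (2\<^sup>2 * L)" unfolding rad_def using elim by (intro real_sqrt_le_mono) simp
    also have "\<dots> = 2 * sqrt L" unfolding real_sqrt_mult by simp
    finally show ?case using elim by (auto simp: rad_def)
  qed
qed

lemma rad_exp: "\<forall>\<^sub>F L in at_top. exp L * exp (- (rad b L)\<^sup>2 / 2) = L powr (b / 2)"
  using rad_bounds[of b] eventually_gt_at_top[of 1]
proof eventually_elim
  case (elim L)
  have "exp L * exp (- (rad b L)\<^sup>2 / 2) = exp (b / 2 * ln L)"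
    unfolding exp_add[symmetric] using elim by (simp add: field_simps)
  then show ?case using elim by (simp add: powr_def)
qed

text \<open>
  The squared radii differ by a multiple of \<open>ln L\<close>, while passing to the inscribed ball or
  adding the thickness of a shell changes a squared radius only by a bounded amount.
\<close>

lemma rad_less:
  assumes "b < b'"
  shows "\<forall>\<^sub>F L in at_top. rad b' L < rad b L * (1 - 2 * (mesh L)\<^sup>2) \<and> rad b' L + 1 / rad b' L \<le> rad b L"
proof -
  have "\<forall>\<^sub>F L::real in at_top. 3 < (b' - b) * ln L" using assms by real_asymp
  then show ?thesis using rad_bounds[of b] rad_bounds[of b'] eventually_ge_at_top[of 1]
  proof eventually_elim
    case (elim L)
    have m: "(mesh L)\<^sup>2 = 1 / (8 * L)" using elim by (simp add: mesh_def power_divide)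
    have m1: "2 * (mesh L)\<^sup>2 \<le> 1 / 4" unfolding m using elim by (simp add: field_simps)
    have "(rad b L)\<^sup>2 * (1 - 4 * (mesh L)\<^sup>2) \<le> (rad b L)\<^sup>2 * (1 - 2 * (mesh L)\<^sup>2)\<^sup>2"
      by (intro mult_left_mono) (auto simp: power2_diff)
    also have "\<dots> = (rad b L * (1 - 2 * (mesh L)\<^sup>2))\<^sup>2" by (simp add: power_mult_distrib)
    finally have 1: "(rad b L)\<^sup>2 * (1 - 4 * (mesh L)\<^sup>2) \<le> (rad b L * (1 - 2 * (mesh L)\<^sup>2))\<^sup>2" .
    have "(rad b L)\<^sup>2 \<le> (2 * sqrt L)\<^sup>2" using elim by (intro power_mono) auto
    then have "(rad b L)\<^sup>2 \<le> 4 * L" using elim by simp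
    then have "(rad b L)\<^sup>2 * (4 * (mesh L)\<^sup>2) \<le> 4 * L * (4 * (mesh L)\<^sup>2)" by (intro mult_right_mono) auto
    also have "\<dots> = 2" unfolding m using elim by simp
    finally have "(rad b L)\<^sup>2 - 2 \<le> (rad b L * (1 - 2 * (mesh L)\<^sup>2))\<^sup>2" using 1
      right_diff_distrib[of "(rad b L)\<^sup>2" 1 "4 * (mesh L)\<^sup>2"] by linarith
    moreover have lt: "(rad b' L)\<^sup>2 + 3 < (rad b L)\<^sup>2" using elim by (simp add: left_diff_distrib)
    ultimately have "(rad b' L)\<^sup>2 < (rad b L * (1 - 2 * (mesh L)\<^sup>2))\<^sup>2" by linarith
    then have A: "rad b' L < rad b L * (1 - 2 * (mesh L)\<^sup>2)"
      by (rule power2_less_imp_less) (use elim m1 in auto)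
    have r1: "1 \<le> rad b' L" using elim by linarith
    then have "1 / rad b' L \<le> 1" by simp
    then have "(rad b' L + 1 / rad b' L)\<^sup>2 \<le> (rad b' L)\<^sup>2 + 3"
      using r1 by (simp add: power2_sum power_le_one)
    then have "(rad b' L + 1 / rad b' L)\<^sup>2 \<le> (rad b L)\<^sup>2" using lt by linarith
    then have "rad b' L + 1 / rad b' L \<le> rad b L" by (rule power2_le_imp_le) (use elim in auto)
    then show ?case using A by blast
  qed
qed

lemma power_diff_bounds:
  fixes r R :: real
  assumes "0 \<le> r" "r \<le> R"
  shows "R ^ Suc n - r ^ Suc n \<le> real (Suc n) * R ^ n * (R - r)" "(R - r) * r ^ n \<le> R ^ Suc n - r ^ Suc n"
proof -
  have eq: "R ^ Suc n - r ^ Suc n = (R - r) * (\<Sum>p<Suc n. R ^ p * r ^ (n - p))"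
    using diff_power_eq_sum[of R n r] by simp
  have "(\<Sum>p<Suc n. R ^ p * r ^ (n - p)) \<le> (\<Sum>p<Suc n. R ^ n)"
  proof (rule sum_mono)
    fix p assume p: "p \<in> {..<Suc n}"
    have "R ^ p * r ^ (n - p) \<le> R ^ p * R ^ (n - p)" using assms by (intro mult_left_mono power_mono) auto
    also have "\<dots> = R ^ n" using p by (simp flip: power_add)
    finally show "R ^ p * r ^ (n - p) \<le> R ^ n" .
  qed
  then show "R ^ Suc n - r ^ Suc n \<le> real (Suc n) * R ^ n * (R - r)"
    unfolding eq using assms by (simp add: mult.commute mult_left_mono)
  have "R ^ 0 * r ^ (n - 0) \<le> (\<Sum>p<Suc n. R ^ p * r ^ (n - p))"
    using assms by (intro member_le_sum) auto
  then show "(R - r) * r ^ n \<le> R ^ Suc n - r ^ Suc n"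
    unfolding eq using assms by (intro mult_left_mono) auto
qed

text \<open>
  In the shell of thickness \<open>1 / rad b L\<close> the density is comparable to \<open>L powr (b / 2)\<close>. The
  cell has diameter of order \<open>1 / rad b L\<close>, so that the volume of the piece of the shell is of
  order \<open>1 / rad b L\<close>, that is \<open>L powr (- 1 / 2)\<close>.
\<close>

lemma cone_mass_lower:
  "\<exists>c>0. \<forall>\<^sub>F L in at_top. \<forall>(u :: nat \<Rightarrow> real ^ 'n) N i. sphere_net u N (mesh L) \<longrightarrow> i < N \<longrightarrow>
     c * L powr ((b - 1) / 2) \<le> measure (gauss (exp L)) (cone_part (vcell u N i) (rad b L) (rad b L + 1 / rad b L))"
proof -
  let ?d = "CARD('n)"
  define n where "n = ?d - 1"
  have d: "?d = Suc n" by (simp add: n_def)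
  define k where "k = gconst TYPE('n) * exp (- 3 / 2) * (unit_vol TYPE(real ^ 'n) / (2 * 8 ^ ?d)) * (1 / (2 * sqrt 8)) ^ n / 2"
  have "k > 0" unfolding k_def using gconst_pos[where 'n = 'n] unit_vol_pos[where 'a = "real ^ 'n"] by simp
  moreover have "\<forall>\<^sub>F L in at_top. \<forall>(u :: nat \<Rightarrow> real ^ 'n) N i. sphere_net u N (mesh L) \<longrightarrow> i < N \<longrightarrow>
     k * L powr ((b - 1) / 2) \<le> measure (gauss (exp L)) (cone_part (vcell u N i) (rad b L) (rad b L + 1 / rad b L))"
    using rad_bounds[of b] rad_exp[of b] eventually_ge_at_top[of 1]
  proof (eventually_elim, intro allI impI)
    fix L :: real and u :: "nat \<Rightarrow> real ^ 'n" and N i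
    assume L1: "1 \<le> sqrt L \<and> sqrt L \<le> rad b L \<and> rad b L \<le> 2 * sqrt L \<and> (rad b L)\<^sup>2 = 2 * L - b * ln L"
      and L2: "exp L * exp (- (rad b L)\<^sup>2 / 2) = L powr (b / 2)" and L: "1 \<le> L" and net: "sphere_net u N (mesh L)" and i: "i < N"
    interpret sphere_net u N "mesh L" by (rule net)
    define r where "r = rad b L"
    define s where "s = r + 1 / r"
    have r: "1 \<le> r" "sqrt L \<le> r" "r \<le> 2 * sqrt L" unfolding r_def using L1 by linarith+
    let ?C = "cone_part (vcell u N i) r s"
    have s2: "s\<^sup>2 \<le> r\<^sup>2 + 3" using r by (simp add: s_def power2_sum power_le_one)
    have e: "exp L * exp (- s\<^sup>2 / 2) \<ge> L powr (b / 2) * exp (- 3 / 2)"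
    proof -
      have "exp L * exp (- r\<^sup>2 / 2) * exp (- 3 / 2) \<le> exp L * exp (- s\<^sup>2 / 2)"
        unfolding exp_add[symmetric] using s2 by simp
      then show ?thesis unfolding r_def L2 .
    qed
    have vol: "1 / r * r ^ n * cone_vol (vcell u N i) \<le> measure lborel ?C"
    proof -
      have "cone_vol (vcell u N i) \<ge> 0" by (simp add: cone_vol_def)
      moreover have "1 / r * r ^ n \<le> s ^ ?d - r ^ ?d"
        using power_diff_bounds(2)[of r s n] r unfolding d by (simp add: s_def)
      ultimately have "1 / r * r ^ n * cone_vol (vcell u N i) \<le> (s ^ ?d - r ^ ?d) * cone_vol (vcell u N i)"
        by (rule mult_right_mono[rotated])
      also have "\<dots> = measure lborel ?C" using r by (subst measure_cone_part) (auto simp: s_def)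
      finally show ?thesis .
    qed
    have cv: "unit_vol TYPE(real ^ 'n) / (2 * 8 ^ ?d) * (mesh L / 2) ^ n \<le> cone_vol (vcell u N i)"
      using cone_vol_ge[OF Q_borel ball_subset_Q[OF i] norm_u[OF i]] \<delta> by (simp add: n_def)
    have mr: "1 / (2 * sqrt 8) \<le> r * (mesh L / 2)"
    proof -
      have "1 / (2 * sqrt 8) = sqrt L * (mesh L / 2)" using L by (simp add: mesh_def real_sqrt_mult)
      also have "\<dots> \<le> r * (mesh L / 2)" using r \<delta> by (intro mult_right_mono) auto
      finally show ?thesis .
    qed
    have rinv: "1 / (2 * sqrt L) \<le> 1 / r" using r by (intro divide_left_mono) (use L in auto)
    let ?v = "unit_vol TYPE(real ^ 'n) / (2 * 8 ^ ?d)"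
    have v: "?v > 0" using unit_vol_pos[where 'a = "real ^ 'n"] by simp
    have "1 / (2 * sqrt L) * (?v * (1 / (2 * sqrt 8)) ^ n) \<le> 1 / r * (?v * (r * (mesh L / 2)) ^ n)"
      using rinv mr r v L by (intro mult_mono power_mono) auto
    also have "\<dots> = 1 / r * r ^ n * (?v * (mesh L / 2) ^ n)" by (simp only: power_mult_distrib mult_ac)
    also have "\<dots> \<le> 1 / r * r ^ n * cone_vol (vcell u N i)" using cv r by (intro mult_left_mono) auto
    also note vol
    finally have V: "1 / (2 * sqrt L) * (?v * (1 / (2 * sqrt 8)) ^ n) \<le> measure lborel ?C" .
    have "k * L powr ((b - 1) / 2) = gconst TYPE('n) * (L powr (b / 2) * exp (- 3 / 2)) * (1 / (2 * sqrt L) * (?v * (1 / (2 * sqrt 8)) ^ n))"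
    proof -
      have "L powr ((b - 1) / 2) = L powr (b / 2) * (1 / sqrt L)"
        using L by (simp add: powr_diff diff_divide_distrib powr_half_sqrt)
      then show ?thesis by (simp add: k_def mult_ac)
    qed
    also have "\<dots> \<le> gconst TYPE('n) * (exp L * exp (- s\<^sup>2 / 2)) * measure lborel ?C"
      by (rule mult_mono[OF mult_left_mono[OF e] V]) (use v L gconst_pos[where 'n = 'n] in auto)
    also have "\<dots> = exp L * gconst TYPE('n) * exp (- s\<^sup>2 / 2) * measure lborel ?C" by simp
    also have "\<dots> \<le> measure (gauss (exp L)) ?C"
      by (rule measure_gauss_ge) (auto simp: cone_part_def intro: cone_part_fmeasurable[unfolded cone_part_def])
    finally show "k * L powr ((b - 1) / 2) \<le> measure (gauss (exp L)) (cone_part (vcell u N i) (rad b L) (rad b L + 1 / rad b L))"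
      by (simp add: s_def r_def)
  qed
  ultimately show ?thesis by blast
qed

lemma rad_shell:
  assumes B: "B < b"
  shows "\<forall>\<^sub>F L in at_top. rad b L \<le> rad B L \<and> rad B L - rad b L \<le> (b - B) * ln L / (2 * sqrt L)
    \<and> rad B L ^ CARD('n::finite) - rad b L ^ CARD('n) \<le> real CARD('n) * rad B L ^ (CARD('n) - 1) * ((b - B) * ln L / (2 * sqrt L))"
  using rad_bounds[of b] rad_bounds[of B] rad_less[OF B] eventually_ge_at_top[of 1]
proof eventually_elim
  case (elim L)
  let ?r = "rad b L" and ?R = "rad B L"
  have r1: "1 \<le> ?r" using elim by linarith
  have le: "?r \<le> ?R"
  proof -
    have "?r \<le> ?r + 1 / ?r" using r1 by simp
    then show ?thesis using elim by linarith
  qed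
  have "(?R - ?r) * (?R + ?r) = (b - B) * ln L" using elim by (simp add: square_diff_square_factored[symmetric] power2_eq_square[symmetric] left_diff_distrib algebra_simps)
  moreover have "(?R - ?r) * (2 * sqrt L) \<le> (?R - ?r) * (?R + ?r)" using le elim by (intro mult_left_mono) auto
  ultimately have gap: "?R - ?r \<le> (b - B) * ln L / (2 * sqrt L)" using elim by (simp add: pos_le_divide_eq)
  have "?R ^ CARD('n) - ?r ^ CARD('n) \<le> real CARD('n) * ?R ^ (CARD('n) - 1) * (?R - ?r)"
    using power_diff_bounds(1)[of ?r ?R "CARD('n) - 1"] r1 le by simp
  also have "\<dots> \<le> real CARD('n) * ?R ^ (CARD('n) - 1) * ((b - B) * ln L / (2 * sqrt L))"
    using gap r1 le by (intro mult_left_mono) auto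
  finally show ?case using le gap by blast
qed

text \<open>
  The density is at most of order \<open>L powr (b / 2)\<close>, the cross-section of the cone is bounded,
  and the thickness of the shell is at most of order \<open>ln L / sqrt L\<close>.
\<close>

lemma cone_mass_upper:
  assumes B: "B < b"
  shows "\<exists>C>0. \<forall>\<^sub>F L in at_top. \<forall>(u :: nat \<Rightarrow> real ^ 'n) N i. sphere_net u N (mesh L) \<longrightarrow> i < N \<longrightarrow>
     measure (gauss (exp L)) (cone_part (vcell u N i) (rad b L) (rad B L)) \<le> C * (L powr ((b - 1) / 2) * ln L)"
proof -
  let ?d = "CARD('n)"
  define n where "n = ?d - 1"
  define V where "V = 3 * 2 ^ ?d * unit_vol TYPE(real ^ 'n)"
  have V: "V > 0" unfolding V_def using unit_vol_pos[where 'a = "real ^ 'n"] by simp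
  define k where "k = gconst TYPE('n) * (real ?d * (b - B) / 2 * V)"
  have "k > 0" unfolding k_def using gconst_pos[where 'n = 'n] V B by simp
  moreover have "\<forall>\<^sub>F L in at_top. \<forall>(u :: nat \<Rightarrow> real ^ 'n) N i. sphere_net u N (mesh L) \<longrightarrow> i < N \<longrightarrow>
     measure (gauss (exp L)) (cone_part (vcell u N i) (rad b L) (rad B L)) \<le> k * (L powr ((b - 1) / 2) * ln L)"
    using rad_bounds[of b] rad_bounds[of B] rad_exp[of b] rad_shell[OF B, where 'n = 'n] eventually_ge_at_top[of 1]
  proof (eventually_elim, intro allI impI)
    fix L :: real and u :: "nat \<Rightarrow> real ^ 'n" and N i
    assume L1: "1 \<le> sqrt L \<and> sqrt L \<le> rad b L \<and> rad b L \<le> 2 * sqrt L \<and> (rad b L)\<^sup>2 = 2 * L - b * ln L"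
      and L1': "1 \<le> sqrt L \<and> sqrt L \<le> rad B L \<and> rad B L \<le> 2 * sqrt L \<and> (rad B L)\<^sup>2 = 2 * L - B * ln L"
      and L2: "exp L * exp (- (rad b L)\<^sup>2 / 2) = L powr (b / 2)"
      and L3: "rad b L \<le> rad B L \<and> rad B L - rad b L \<le> (b - B) * ln L / (2 * sqrt L)
        \<and> rad B L ^ ?d - rad b L ^ ?d \<le> real ?d * rad B L ^ (?d - 1) * ((b - B) * ln L / (2 * sqrt L))"
      and L: "1 \<le> L" and net: "sphere_net u N (mesh L)" and i: "i < N"
    interpret sphere_net u N "mesh L" by (rule net)
    let ?r = "rad b L" and ?R = "rad B L" and ?Q = "vcell u N i"
    have cv: "cone_vol ?Q \<le> V * mesh L ^ n"
      using cone_vol_le[OF Q_borel _ norm_u[OF i] \<delta>(1,2), of i] Q_near[OF i]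
      by (force simp: V_def n_def dist_commute less_imp_le)
    have Rm: "?R * mesh L \<le> 1"
    proof -
      have "?R * mesh L \<le> 2 * sqrt L * mesh L" using L1' \<delta> by (intro mult_right_mono) auto
      also have "\<dots> = 2 / sqrt 8" using L by (simp add: mesh_def real_sqrt_mult)
      also have "\<dots> \<le> 1" by (simp add: real_le_rsqrt)
      finally show ?thesis .
    qed
    have "measure lborel (cone_part ?Q ?r ?R) = (?R ^ ?d - ?r ^ ?d) * cone_vol ?Q"
      using L1 L3 by (subst measure_cone_part) auto
    also have "\<dots> \<le> (real ?d * ?R ^ n * ((b - B) * ln L / (2 * sqrt L))) * (V * mesh L ^ n)"
      using L3 cv L1' B L V by (intro mult_mono) (auto simp: n_def cone_vol_def)
    also have "\<dots> = real ?d * ((b - B) * ln L / (2 * sqrt L)) * V * (?R * mesh L) ^ n"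
      by (simp add: power_mult_distrib)
    also have "\<dots> \<le> real ?d * ((b - B) * ln L / (2 * sqrt L)) * V * 1"
      using Rm L1' \<delta> B V L by (intro mult_left_mono power_le_one) auto
    finally have vol: "measure lborel (cone_part ?Q ?r ?R) \<le> real ?d * ((b - B) * ln L / (2 * sqrt L)) * V" by simp
    have "measure (gauss (exp L)) (cone_part ?Q ?r ?R) \<le> exp L * gconst TYPE('n) * exp (- ?r\<^sup>2 / 2) * measure lborel (cone_part ?Q ?r ?R)"
      using L1 by (intro measure_gauss_le cone_part_fmeasurable) (auto simp: cone_part_def)
    also have "\<dots> = gconst TYPE('n) * L powr (b / 2) * measure lborel (cone_part ?Q ?r ?R)"
      using L2 by (simp add: mult_ac)
    also have "\<dots> \<le> gconst TYPE('n) * L powr (b / 2) * (real ?d * ((b - B) * ln L / (2 * sqrt L)) * V)"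
      using vol gconst_pos[where 'n = 'n] by (intro mult_left_mono) auto
    also have "\<dots> = k * (L powr ((b - 1) / 2) * ln L)"
    proof -
      have "L powr ((b - 1) / 2) = L powr (b / 2) * (1 / sqrt L)"
        using L by (simp add: powr_diff diff_divide_distrib powr_half_sqrt)
      then show ?thesis by (simp add: k_def)
    qed
    finally show "measure (gauss (exp L)) (cone_part ?Q ?r ?R) \<le> k * (L powr ((b - 1) / 2) * ln L)" .
  qed
  ultimately show ?thesis by blast
qed

lemma gauss_tail_upper:
  "\<exists>C>0. \<forall>\<^sub>F L in at_top. measure (gauss (exp L)) {x :: real ^ 'n. rad b L < norm x} \<le> C * L powr ((real CARD('n) + b) / 2)"
proof -
  let ?d = "CARD('n)"
  define k where "k = gconst TYPE('n) * gint TYPE('n) * exp 1 * 2 ^ ?d + 1"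
  have k0: "gconst TYPE('n) * gint TYPE('n) * exp 1 \<ge> 0" using gconst_pos[where 'n = 'n] gint_nonneg[where 'n = 'n] by simp
  have "k > 0" unfolding k_def using k0 by (simp add: add_nonneg_pos)
  moreover have "\<forall>\<^sub>F L in at_top. measure (gauss (exp L)) {x :: real ^ 'n. rad b L < norm x} \<le> k * L powr ((real ?d + b) / 2)"
    using rad_bounds[of b] rad_exp[of b] eventually_ge_at_top[of 1]
  proof eventually_elim
    case (elim L)
    let ?r = "rad b L"
    have r: "1 \<le> ?r" using elim by linarith
    have "measure (gauss (exp L)) {x :: real ^ 'n. ?r < norm x} \<le> exp L * (gconst TYPE('n) * gint TYPE('n) * exp 1) * ?r ^ ?d * exp (- ?r\<^sup>2 / 2)"
      using r by (intro gauss_tail_le) auto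
    also have "\<dots> = (gconst TYPE('n) * gint TYPE('n) * exp 1) * ?r ^ ?d * L powr (b / 2)"
      using elim by (simp add: mult_ac)
    also have "\<dots> \<le> (gconst TYPE('n) * gint TYPE('n) * exp 1) * (2 * sqrt L) ^ ?d * L powr (b / 2)"
      using elim r k0 by (intro mult_right_mono mult_left_mono power_mono) auto
    also have "\<dots> = (gconst TYPE('n) * gint TYPE('n) * exp 1 * 2 ^ ?d) * (L powr (real ?d / 2) * L powr (b / 2))"
    proof -
      have "sqrt L ^ ?d = L powr (real ?d / 2)"
        using elim by (simp add: powr_half_sqrt[symmetric] powr_power)
      then show ?thesis by (simp add: power_mult_distrib)
    qed
    also have "\<dots> = (gconst TYPE('n) * gint TYPE('n) * exp 1 * 2 ^ ?d) * L powr ((real ?d + b) / 2)"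
      by (simp add: powr_add[symmetric] add_divide_distrib)
    also have "\<dots> \<le> k * L powr ((real ?d + b) / 2)" unfolding k_def by (intro mult_right_mono) auto
    finally show ?case .
  qed
  ultimately show ?thesis by blast
qed

text \<open>
  A net at scale \<open>mesh L\<close> with the optimal order of the number of points.
\<close>

definition fine_net :: "real \<Rightarrow> (nat \<Rightarrow> 'a::euclidean_space) \<Rightarrow> nat \<Rightarrow> bool" where
  "fine_net L u N \<longleftrightarrow> sphere_net u N (mesh L) \<and> real N * mesh L ^ (DIM('a) - 1) \<le> 2 * 6 ^ DIM('a)"

lemma fine_net_exists: "L \<ge> 1 \<Longrightarrow> \<exists>(u :: nat \<Rightarrow> 'a::euclidean_space) N. fine_net L u N"
  unfolding fine_net_def by (rule ex_sphere_net) (auto simp: mesh_def real_le_rsqrt)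

lemma fine_net_card:
  fixes u :: "nat \<Rightarrow> real ^ 'n"
  assumes L: "L \<ge> 1" and net: "fine_net L u N"
  shows "real N \<le> (2 * 6 ^ CARD('n) * 8 ^ CARD('n)) * L powr ((real CARD('n) - 1) / 2)"
proof -
  define n where "n = CARD('n) - 1"
  have d: "CARD('n) = Suc n" by (simp add: n_def)
  have s: "mesh L * sqrt (8 * L) = 1" using L by (simp add: mesh_def)
  have "real N = real N * mesh L ^ n * sqrt (8 * L) ^ n"
    using s by (simp add: mult.assoc power_mult_distrib[symmetric])
  also have "\<dots> \<le> 2 * 6 ^ CARD('n) * sqrt (8 * L) ^ n"
    using net L by (intro mult_right_mono) (auto simp: fine_net_def n_def)
  also have "sqrt (8 * L) ^ n = sqrt 8 ^ n * L powr ((real CARD('n) - 1) / 2)"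
  proof -
    have "sqrt L ^ n = L powr (real n / 2)" using L by (simp add: powr_half_sqrt[symmetric] powr_power)
    then show ?thesis by (simp add: real_sqrt_mult power_mult_distrib d)
  qed
  also have "2 * 6 ^ CARD('n) * (sqrt 8 ^ n * L powr ((real CARD('n) - 1) / 2)) \<le> 2 * 6 ^ CARD('n) * (8 ^ CARD('n) * L powr ((real CARD('n) - 1) / 2))"
  proof -
    have "sqrt 8 ^ n \<le> (8::real) ^ n" by (intro power_mono) (auto simp: real_le_lsqrt)
    also have "\<dots> \<le> 8 ^ CARD('n)" by (intro power_increasing) (auto simp: n_def)
    finally show ?thesis by (intro mult_left_mono mult_right_mono) auto
  qed
  finally show ?thesis by (simp add: mult.assoc)
qed

text \<open>
  The squared radii differ by a multiple of \<open>ln L\<close>, so the caps have angular diameter of order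
  \<open>sqrt (ln L / L)\<close>; the factor \<open>L powr \<epsilon>\<close> absorbs the logarithm and all constants.
\<close>

lemma net_annulus_eventually:
  assumes eps: "0 < \<epsilon>" "\<epsilon> < 1 / 2" and B: "0 \<le> B"
  shows "\<forall>\<^sub>F L in at_top. \<forall>(u :: nat \<Rightarrow> 'a::euclidean_space) N. sphere_net u N (mesh L) \<longrightarrow>
     net_annulus u N (mesh L) (rad (1 + 3 * \<epsilon>) L) (rad (1 + 2 * \<epsilon>) L) (rad (- B) L) (L powr (\<epsilon> - 1 / 2))"
proof -
  let ?c = "B + (1 + 3 * \<epsilon>)"
  have c: "?c > 0" using eps B by simp
  have l1: "1 + 2 * \<epsilon> < 1 + 3 * \<epsilon>" and l2: "- B < 1 + 2 * \<epsilon>" using eps B by auto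
  have "\<forall>\<^sub>F L::real in at_top. 4 * sqrt (?c * ln L) / sqrt L + 1 / sqrt (8 * L) \<le> L powr (\<epsilon> - 1 / 2)"
    using eps c by real_asymp
  moreover have "\<forall>\<^sub>F L::real in at_top. L powr (\<epsilon> - 1 / 2) \<le> 1" using eps by real_asymp
  ultimately show ?thesis using rad_less[OF l1] rad_less[OF l2] rad_bounds[of "1 + 3 * \<epsilon>"]
    rad_bounds[of "1 + 2 * \<epsilon>"] rad_bounds[of "- B"] eventually_gt_at_top[of 1]
  proof (eventually_elim, intro allI impI)
    fix L :: real and u :: "nat \<Rightarrow> 'a" and N
    let ?r1 = "rad (1 + 3 * \<epsilon>) L" and ?r0 = "rad (1 + 2 * \<epsilon>) L" and ?R = "rad (- B) L"
    assume h: "4 * sqrt (?c * ln L) / sqrt L + 1 / sqrt (8 * L) \<le> L powr (\<epsilon> - 1 / 2)" "L powr (\<epsilon> - 1 / 2) \<le> 1"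
      "?r1 < ?r0 * (1 - 2 * (mesh L)\<^sup>2) \<and> ?r1 + 1 / ?r1 \<le> ?r0"
      "?r0 < ?R * (1 - 2 * (mesh L)\<^sup>2) \<and> ?r0 + 1 / ?r0 \<le> ?R"
      "1 \<le> sqrt L \<and> sqrt L \<le> ?r1 \<and> ?r1 \<le> 2 * sqrt L \<and> ?r1\<^sup>2 = 2 * L - (1 + 3 * \<epsilon>) * ln L"
      "1 \<le> sqrt L \<and> sqrt L \<le> ?r0 \<and> ?r0 \<le> 2 * sqrt L \<and> ?r0\<^sup>2 = 2 * L - (1 + 2 * \<epsilon>) * ln L"
      "1 \<le> sqrt L \<and> sqrt L \<le> ?R \<and> ?R \<le> 2 * sqrt L \<and> ?R\<^sup>2 = 2 * L - - B * ln L"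
      "1 < L" and net: "sphere_net u N (mesh L)"
    interpret sphere_net u N "mesh L" by (rule net)
    have pos: "1 \<le> ?r1" "1 \<le> ?r0" using h by linarith+
    show "net_annulus u N (mesh L) ?r1 ?r0 ?R (L powr (\<epsilon> - 1 / 2))"
    proof
      show "0 < ?r1" using pos by simp
      have "0 < 1 / ?r1" "0 < 1 / ?r0" using pos by simp_all
      then show "?r1 < ?r0" "?r0 < ?R" using h by linarith+
      have "(mesh L)\<^sup>2 = 1 / (8 * L)" using h(8) by (simp add: mesh_def power_divide)
      then show "2 * (mesh L)\<^sup>2 < 1" using h(8) by (simp add: divide_less_eq)
      show "?r1 < ?r0 * (1 - 2 * (mesh L)\<^sup>2)" using h by blast
      have "?R\<^sup>2 - ?r1\<^sup>2 = ?c * ln L" using h by (simp add: algebra_simps)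
      then have "4 * sqrt (?R\<^sup>2 - ?r1\<^sup>2) / ?r1 \<le> 4 * sqrt (?c * ln L) / sqrt L"
        using h c pos by (auto intro!: divide_left_mono mult_pos_pos)
      then show "4 * sqrt (?R\<^sup>2 - ?r1\<^sup>2) / ?r1 + mesh L \<le> L powr (\<epsilon> - 1 / 2)"
        using h(1) unfolding mesh_def by linarith
      show "L powr (\<epsilon> - 1 / 2) \<le> 1" by (rule h(2))
    qed
  qed
qed

text \<open>
  The union bound over the ways in which a configuration can be bad.
\<close>

lemma (in poisson_points) bad_configuration_bound:
  fixes C A :: "nat \<Rightarrow> 'a set"
  assumes C: "\<And>i. i < N \<Longrightarrow> C i \<in> sets borel" and A: "\<And>i. i < N \<Longrightarrow> A i \<in> sets borel" and Z: "Z \<in> sets borel"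
    and muA: "\<And>i. i < N \<Longrightarrow> \<alpha> \<le> measure \<mu> (A i)" and muC: "\<And>i. i < N \<Longrightarrow> measure \<mu> (C i) \<le> \<gamma>"
  shows "prob {\<omega>\<in>space M. \<not> ((\<forall>i<N. X \<omega> \<inter> A i \<noteq> {} \<and> card (X \<omega> \<inter> C i) \<le> m) \<and> X \<omega> \<inter> Z = {})}
    \<le> real N * (exp (- \<alpha>) + exp (2 * \<gamma> - real m)) + measure \<mu> Z" (is "prob ?bad \<le> _")
proof -
  let ?E = "\<lambda>i. {\<omega>\<in>space M. X \<omega> \<inter> A i = {}}" and ?G = "\<lambda>i. {\<omega>\<in>space M. m \<le> card (X \<omega> \<inter> C i)}"
  let ?Z = "{\<omega>\<in>space M. X \<omega> \<inter> Z \<noteq> {}}"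
  have Em: "?E i \<in> events" if "i < N" for i using A[OF that] by (rule hit_measurable)
  have Gm: "?G i \<in> events" if "i < N" for i
    using measurable_sets[OF card_measurable[OF C[OF that]], of "{m..}"] by (simp add: vimage_def Int_def conj_commute)
  have Zm: "?Z \<in> events"
  proof -
    have "?Z = space M - {\<omega>\<in>space M. X \<omega> \<inter> Z = {}}" by auto
    then show ?thesis using hit_measurable[OF Z] by simp
  qed
  have EGm: "?E i \<union> ?G i \<in> events" if "i \<in> {..<N}" for i using Em Gm that by auto
  have Um: "(\<Union>i\<in>{..<N}. ?E i \<union> ?G i) \<in> events" using EGm by (intro sets.finite_UN) auto
  have "?bad \<subseteq> (\<Union>i\<in>{..<N}. ?E i \<union> ?G i) \<union> ?Z" by auto
  then have "prob ?bad \<le> prob ((\<Union>i\<in>{..<N}. ?E i \<union> ?G i) \<union> ?Z)"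
    using Um Zm by (intro finite_measure_mono) auto
  also have "\<dots> \<le> prob (\<Union>i\<in>{..<N}. ?E i \<union> ?G i) + prob ?Z" using Um Zm by (intro measure_Un_le) auto
  also have "prob (\<Union>i\<in>{..<N}. ?E i \<union> ?G i) \<le> (\<Sum>i\<in>{..<N}. prob (?E i \<union> ?G i))"
    using EGm by (intro measure_UNION_le) auto
  also have "\<dots> \<le> (\<Sum>i\<in>{..<N}. exp (- \<alpha>) + exp (2 * \<gamma> - real m))"
  proof (rule sum_mono)
    fix i assume "i \<in> {..<N}"
    then have i: "i < N" by simp
    have "prob (?E i \<union> ?G i) \<le> prob (?E i) + prob (?G i)" using Em[OF i] Gm[OF i] by (intro measure_Un_le) auto
    also have "prob (?E i) \<le> exp (- \<alpha>)" using prob_empty[OF A[OF i]] muA[OF i] by simp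
    also have "prob (?G i) \<le> exp (2 * \<gamma> - real m)"
      using prob_card_ge[OF C[OF i], of m] muC[OF i] by (meson diff_right_mono exp_le_cancel_iff mult_left_mono order_trans zero_le_numeral)
    finally show "prob (?E i \<union> ?G i) \<le> exp (- \<alpha>) + exp (2 * \<gamma> - real m)" by simp
  qed
  also have "prob ?Z \<le> measure \<mu> Z" by (rule prob_nonempty_le[OF Z])
  finally show ?thesis by simp
qed

text \<open>
  The expected number of points of a cone is at least of order \<open>L powr \<epsilon>\<close> beyond the middle
  radius, and at most of order \<open>L powr (3 * \<epsilon> / 2) * ln L\<close> beyond the inner one, which is
  smaller than the admissible \<open>L powr (2 * \<epsilon>)\<close>. Both failures have stretched-exponential
  probabilities. The outer tail is of order \<open>L powr ((d - B) / 2)\<close>, which forces the condition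
  on \<open>B\<close>.
\<close>

lemma bad_probability_eventually:
  assumes eps: "0 < \<epsilon>" "\<epsilon> < 1 / 2" and B: "0 \<le> B" "real CARD('n) + 2 * K < B"
  shows "\<forall>\<^sub>F L in at_top. \<forall>(u :: nat \<Rightarrow> real ^ 'n) N (M :: 'w measure) X. fine_net L u N \<longrightarrow> poisson_points M (gauss (exp L)) X \<longrightarrow>
     measure M {\<omega>\<in>space M. \<not> ((\<forall>i<N. X \<omega> \<inter> cone_part (vcell u N i) (rad (1 + 2 * \<epsilon>) L) (rad (- B) L) \<noteq> {} \<and>
         card (X \<omega> \<inter> cone_part (vcell u N i) (rad (1 + 3 * \<epsilon>) L) (rad (- B) L)) \<le> nat \<lceil>L powr (2 * \<epsilon>)\<rceil>)
       \<and> X \<omega> \<inter> {x. rad (- B) L < norm x} = {})} \<le> L powr (- K)"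
proof -
  let ?d = "real CARD('n)"
  obtain c0 where c0: "c0 > 0" and low: "\<forall>\<^sub>F L in at_top. \<forall>(u :: nat \<Rightarrow> real ^ 'n) N i. sphere_net u N (mesh L) \<longrightarrow> i < N \<longrightarrow>
     c0 * L powr (((1 + 2 * \<epsilon>) - 1) / 2) \<le> measure (gauss (exp L)) (cone_part (vcell u N i) (rad (1 + 2 * \<epsilon>) L) (rad (1 + 2 * \<epsilon>) L + 1 / rad (1 + 2 * \<epsilon>) L))"
    using cone_mass_lower[of "1 + 2 * \<epsilon>", where 'n = 'n] by blast
  have l3: "- B < 1 + 3 * \<epsilon>" and l2: "- B < 1 + 2 * \<epsilon>" using eps B by auto
  obtain C1 where C1: "C1 > 0" and up: "\<forall>\<^sub>F L in at_top. \<forall>(u :: nat \<Rightarrow> real ^ 'n) N i. sphere_net u N (mesh L) \<longrightarrow> i < N \<longrightarrow>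
     measure (gauss (exp L)) (cone_part (vcell u N i) (rad (1 + 3 * \<epsilon>) L) (rad (- B) L)) \<le> C1 * (L powr (((1 + 3 * \<epsilon>) - 1) / 2) * ln L)"
    using cone_mass_upper[OF l3, where 'n = 'n] by blast
  obtain C2 where C2: "C2 > 0" and tail: "\<forall>\<^sub>F L in at_top. measure (gauss (exp L)) {x :: real ^ 'n. rad (- B) L < norm x} \<le> C2 * L powr ((?d + - B) / 2)"
    using gauss_tail_upper[of "- B", where 'n = 'n] by blast
  define CN where "CN = (2 * 6 ^ CARD('n) * 8 ^ CARD('n) :: real)"
  have CN: "CN > 0" by (simp add: CN_def)
  have BK: "(?d + - B) / 2 < - K" using B by simp
  have "\<forall>\<^sub>F L::real in at_top. CN * L powr ((?d - 1) / 2) * (exp (- (c0 * L powr (((1 + 2 * \<epsilon>) - 1) / 2))) +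
      exp (2 * (C1 * (L powr (((1 + 3 * \<epsilon>) - 1) / 2) * ln L)) - L powr (2 * \<epsilon>))) + C2 * L powr ((?d + - B) / 2) \<le> L powr (- K)"
  proof -
    have "\<forall>\<^sub>F L::real in at_top. CN * L powr ((?d - 1) / 2) * exp (- (c0 * L powr (((1 + 2 * \<epsilon>) - 1) / 2))) \<le> L powr (- K) / 3"
      using eps c0 CN by real_asymp
    moreover have "\<forall>\<^sub>F L::real in at_top. CN * L powr ((?d - 1) / 2) * exp (2 * (C1 * (L powr (((1 + 3 * \<epsilon>) - 1) / 2) * ln L)) - L powr (2 * \<epsilon>)) \<le> L powr (- K) / 3"
      using eps C1 CN by real_asymp
    moreover have "\<forall>\<^sub>F L::real in at_top. C2 * L powr ((?d + - B) / 2) \<le> L powr (- K) / 3"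
      using BK C2 by real_asymp
    ultimately show ?thesis by eventually_elim (simp add: distrib_left)
  qed
  then show ?thesis using low up tail rad_less[OF l2] rad_bounds[of "1 + 2 * \<epsilon>"] eventually_ge_at_top[of 1]
  proof (eventually_elim, intro allI impI)
    fix L :: real and u :: "nat \<Rightarrow> real ^ 'n" and N and M :: "'w measure" and X :: "'w \<Rightarrow> (real ^ 'n) set"
    let ?r1 = "rad (1 + 3 * \<epsilon>) L" and ?r0 = "rad (1 + 2 * \<epsilon>) L" and ?R = "rad (- B) L"
    let ?\<alpha> = "c0 * L powr (((1 + 2 * \<epsilon>) - 1) / 2)" and ?\<gamma> = "C1 * (L powr (((1 + 3 * \<epsilon>) - 1) / 2) * ln L)"
    let ?m = "nat \<lceil>L powr (2 * \<epsilon>)\<rceil>" and ?Z = "{x :: real ^ 'n. ?R < norm x}"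
    assume main: "CN * L powr ((?d - 1) / 2) * (exp (- ?\<alpha>) + exp (2 * ?\<gamma> - L powr (2 * \<epsilon>))) + C2 * L powr ((?d + - B) / 2) \<le> L powr (- K)"
      and low: "\<forall>(u :: nat \<Rightarrow> real ^ 'n) N i. sphere_net u N (mesh L) \<longrightarrow> i < N \<longrightarrow> ?\<alpha> \<le> measure (gauss (exp L)) (cone_part (vcell u N i) ?r0 (?r0 + 1 / ?r0))"
      and up: "\<forall>(u :: nat \<Rightarrow> real ^ 'n) N i. sphere_net u N (mesh L) \<longrightarrow> i < N \<longrightarrow> measure (gauss (exp L)) (cone_part (vcell u N i) ?r1 ?R) \<le> ?\<gamma>"
      and tail: "measure (gauss (exp L)) ?Z \<le> C2 * L powr ((?d + - B) / 2)"
      and rr: "?r0 < ?R * (1 - 2 * (mesh L)\<^sup>2) \<and> ?r0 + 1 / ?r0 \<le> ?R"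
      and L: "1 \<le> L" and net: "fine_net L u N" and pp: "poisson_points M (gauss (exp L)) X"
    interpret poisson_points M "gauss (exp L)" X by (rule pp)
    have net': "sphere_net u N (mesh L)" using net by (simp add: fine_net_def)
    interpret sphere_net u N "mesh L" by (rule net')
    have muA: "?\<alpha> \<le> measure (gauss (exp L)) (cone_part (vcell u N i) ?r0 ?R)" if "i < N" for i
    proof -
      have "cone_part (vcell u N i) ?r0 (?r0 + 1 / ?r0) \<subseteq> cone_part (vcell u N i) ?r0 ?R"
        using rr by (auto simp: cone_part_def)
      then have "measure (gauss (exp L)) (cone_part (vcell u N i) ?r0 (?r0 + 1 / ?r0)) \<le> measure (gauss (exp L)) (cone_part (vcell u N i) ?r0 ?R)"
        by (rule finite_measure.finite_measure_mono[OF finite_measure_gauss[OF exp_ge_zero]]) auto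
      then show ?thesis using low net' that by fastforce
    qed
    have "measure M {\<omega>\<in>space M. \<not> ((\<forall>i<N. X \<omega> \<inter> cone_part (vcell u N i) ?r0 ?R \<noteq> {} \<and> card (X \<omega> \<inter> cone_part (vcell u N i) ?r1 ?R) \<le> ?m) \<and> X \<omega> \<inter> ?Z = {})}
       \<le> real N * (exp (- ?\<alpha>) + exp (2 * ?\<gamma> - real ?m)) + measure (gauss (exp L)) ?Z"
      by (rule bad_configuration_bound) (use muA up net' in auto)
    also have "\<dots> \<le> CN * L powr ((?d - 1) / 2) * (exp (- ?\<alpha>) + exp (2 * ?\<gamma> - L powr (2 * \<epsilon>))) + C2 * L powr ((?d + - B) / 2)"
    proof (intro add_mono mult_mono tail)
      show "real N \<le> CN * L powr ((?d - 1) / 2)" unfolding CN_def by (rule fine_net_card[OF L net])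
      have "L powr (2 * \<epsilon>) \<le> real ?m" by linarith
      then show "exp (2 * ?\<gamma> - real ?m) \<le> exp (2 * ?\<gamma> - L powr (2 * \<epsilon>))" by simp
    qed (auto simp: CN_def)
    also note main
    finally show "measure M {\<omega>\<in>space M. \<not> ((\<forall>i<N. X \<omega> \<inter> cone_part (vcell u N i) ?r0 ?R \<noteq> {} \<and> card (X \<omega> \<inter> cone_part (vcell u N i) ?r1 ?R) \<le> ?m) \<and> X \<omega> \<inter> ?Z = {})} \<le> L powr (- K)" .
  qed
qed

section \<open>Tail bounds for flat functionals\<close>

text \<open>
  The condition on families of points in \<^locale>\<open>net_annulus\<close> for the radii in use, available outside
  the locale so that asymptotic statements can quantify over nets.
\<close>

definition good_config :: "real \<Rightarrow> real \<Rightarrow> real \<Rightarrow> (nat \<Rightarrow> 'a::euclidean_space) \<Rightarrow> nat \<Rightarrow> (nat \<Rightarrow> 'a set) \<Rightarrow> bool" where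
  "good_config \<epsilon> B L u N S \<longleftrightarrow> (\<forall>i<N. finite (S i) \<and> S i \<subseteq> cone_part (vcell u N i) (rad (1 + 3 * \<epsilon>) L) (rad (- B) L)
     \<and> S i \<inter> cone_part (vcell u N i) (rad (1 + 2 * \<epsilon>) L) (rad (- B) L) \<noteq> {} \<and> card (S i) \<le> nat \<lceil>L powr (2 * \<epsilon>)\<rceil>)"

lemma (in net_annulus) good_family_iff:
  "good_family S \<longleftrightarrow> (\<forall>i<N. finite (S i) \<and> S i \<subseteq> cone_part (Q i) r1 R2 \<and> S i \<inter> cone_part (Q i) r0 R2 \<noteq> {} \<and> card (S i) \<le> m)"
proof -
  have "(\<exists>s\<in>T. r0 < norm s) \<longleftrightarrow> T \<inter> cone_part (Q i) r0 R2 \<noteq> {}" if "T \<subseteq> cone_part (Q i) r1 R2" for T i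
    using that by (fastforce simp: cone_part_def)
  then show ?thesis unfolding good_family_def good_cell_def by blast
qed

text \<open>
  Changing one cell of a good configuration changes the functional by at most \<open>c\<close>, where the
  variance proxy of McDiarmid's inequality is at most \<open>L powr \<kappa>\<close>; besides, the functional has a
  polynomial bound of degree \<open>q\<close> on good configurations.
\<close>

definition flat_functional :: "real \<Rightarrow> real \<Rightarrow> real \<Rightarrow> ((real ^ 'n) set \<Rightarrow> real) \<Rightarrow> bool" where
  "flat_functional \<epsilon> \<kappa> q F \<longleftrightarrow> (\<forall>B\<ge>0. \<forall>\<^sub>F L in at_top. \<forall>u N. fine_net L u N \<longrightarrow>
     (\<exists>c. real N * c\<^sup>2 \<le> L powr \<kappa> \<and>
       (\<forall>S S' i. good_config \<epsilon> B L u N S \<longrightarrow> good_config \<epsilon> B L u N S' \<longrightarrow> i < N \<longrightarrow> (\<forall>k<N. k \<noteq> i \<longrightarrow> S k = S' k) \<longrightarrow>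
          \<bar>F (\<Union>k<N. S k) - F (\<Union>k<N. S' k)\<bar> \<le> c) \<and>
       (\<forall>S. good_config \<epsilon> B L u N S \<longrightarrow> \<bar>F (\<Union>k<N. S k)\<bar> \<le> L powr q)))"

text \<open>
  The bound is uniform over all Poisson processes of intensity \<open>exp L\<close> on probability spaces
  over one type. The type argument names that type, which does not occur in \<open>F\<close>.
\<close>

definition second_moment_functional :: "'w itself \<Rightarrow> real \<Rightarrow> ((real ^ 'n) set \<Rightarrow> real) \<Rightarrow> bool" where
  "second_moment_functional _ q F \<longleftrightarrow> (\<forall>\<^sub>F L in at_top. \<forall>(M :: 'w measure) X f. poisson_points M (gauss (exp L)) X \<longrightarrow>
     f \<in> borel_measurable M \<longrightarrow> (AE \<omega> in M. f \<omega> = F (X \<omega>)) \<longrightarrow> (\<integral>\<^sup>+\<omega>. ennreal ((f \<omega>)\<^sup>2) \<partial>M) \<le> ennreal (L powr q))"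

lemma poisson_gauss_gen_pos:
  fixes X :: "'w \<Rightarrow> (real ^ 'n) set"
  assumes "poisson_points M (gauss (exp L)) X"
  shows "AE \<omega> in M. gen_pos (X \<omega>)"
  using assms by (rule poisson_points.AE_gen_pos) (rule gauss_abs_continuous[OF exp_ge_zero])

text \<open>
  The bounded-difference inequality for a deviation \<open>\<tau> * L powr \<beta> / 4\<close> has the exponent
  \<open>L powr (2 * \<beta> - \<kappa>)\<close> up to constants, so its contribution is negligible, and the probability
  of the exceptional event dominates.
\<close>

lemma asymptotic_tail:
  fixes F :: "(real ^ 'n) set \<Rightarrow> real"
  assumes eps: "0 < \<epsilon>" "\<epsilon> < 1 / 2" and stab: "stable_functional F"
    and hull: "\<And>S T. convex hull S = convex hull T \<Longrightarrow> F S = F T"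
    and flat: "flat_functional \<epsilon> \<kappa> q F" and mom: "second_moment_functional TYPE('w) q F"
    and \<tau>: "0 < \<tau>" and \<beta>: "\<kappa> < 2 * \<beta>"
  shows "\<forall>\<^sub>F L in at_top. \<forall>(M :: 'w measure) X f. poisson_points M (gauss (exp L)) X \<longrightarrow>
     f \<in> borel_measurable M \<longrightarrow> (AE \<omega> in M. f \<omega> = F (X \<omega>)) \<longrightarrow>
     measure M {\<omega>\<in>space M. \<tau> * L powr \<beta> \<le> \<bar>f \<omega> - (\<integral>\<omega>. f \<omega> \<partial>M)\<bar>} \<le> 2 * L powr (- 2)"
proof -
  \<comment> \<open>The truncation level \<open>s = L powr \<sigma>\<close> makes \<open>L powr q / s\<close> small against \<open>L powr \<beta>\<close>. Then \<open>K\<close> is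
     so large that \<open>L powr (- K)\<close> compensates for \<open>s\<close> and for \<open>L powr q\<close>, and \<open>B\<close> so large that the
     exceptional event has probability at most \<open>L powr (- K)\<close>.\<close>
  define \<sigma> where "\<sigma> = q - \<beta> + 1"
  define K where "K = \<bar>\<sigma>\<bar> + \<bar>q\<bar> + \<bar>\<beta>\<bar> + 3"
  define B where "B = real CARD('n) + 2 * K + 1"
  have K: "2 < K" "\<sigma> - K < \<beta>" "q - K < \<beta>" "q - \<sigma> < \<beta>" unfolding K_def \<sigma>_def by linarith+
  have B: "0 \<le> B" "real CARD('n) + 2 * K < B" using K(1) by (simp_all add: B_def)
  have "\<forall>\<^sub>F L::real in at_top. L powr q / L powr \<sigma> \<le> \<tau> * L powr \<beta> / 12" using K(4) \<tau> by real_asymp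
  moreover have "\<forall>\<^sub>F L::real in at_top. L powr \<sigma> * L powr (- K) \<le> \<tau> * L powr \<beta> / 12" using K(2) \<tau> by real_asymp
  moreover have "\<forall>\<^sub>F L::real in at_top. L powr q * L powr (- K) \<le> \<tau> * L powr \<beta> / 12" using K(3) \<tau> by real_asymp
  moreover have "\<forall>\<^sub>F L::real in at_top. 2 * exp (- 2 * (\<tau> * L powr \<beta> / 4)\<^sup>2 / L powr \<kappa>) \<le> L powr (- 2)"
    using \<tau> \<beta> by real_asymp
  moreover have "\<forall>\<^sub>F L::real in at_top. L powr (- K) \<le> L powr (- 2)" using K(1) by real_asymp
  moreover note bad_probability_eventually[OF eps B, where 'w = 'w]
    net_annulus_eventually[OF eps B(1), where 'a = "real ^ 'n"] mom[unfolded second_moment_functional_def]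
    flat[unfolded flat_functional_def, rule_format, OF B(1)]
  ultimately show ?thesis using eventually_ge_at_top[of 1]
  proof (eventually_elim, intro allI impI)
    fix L :: real and M :: "'w measure" and X :: "'w \<Rightarrow> (real ^ 'n) set" and f
    let ?r1 = "rad (1 + 3 * \<epsilon>) L" and ?r0 = "rad (1 + 2 * \<epsilon>) L" and ?R = "rad (- B) L"
    let ?m = "nat \<lceil>L powr (2 * \<epsilon>)\<rceil>" and ?Z = "{x :: real ^ 'n. ?R < norm x}"
    assume s1: "L powr q / L powr \<sigma> \<le> \<tau> * L powr \<beta> / 12" and s2: "L powr \<sigma> * L powr (- K) \<le> \<tau> * L powr \<beta> / 12"
      and s3: "L powr q * L powr (- K) \<le> \<tau> * L powr \<beta> / 12"
      and s4: "2 * exp (- 2 * (\<tau> * L powr \<beta> / 4)\<^sup>2 / L powr \<kappa>) \<le> L powr (- 2)" and s5: "L powr (- K) \<le> L powr (- 2)"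
      and bad: "\<forall>(u :: nat \<Rightarrow> real ^ 'n) N (M :: 'w measure) X. fine_net L u N \<longrightarrow> poisson_points M (gauss (exp L)) X \<longrightarrow>
         measure M {\<omega>\<in>space M. \<not> ((\<forall>i<N. X \<omega> \<inter> cone_part (vcell u N i) ?r0 ?R \<noteq> {} \<and>
         card (X \<omega> \<inter> cone_part (vcell u N i) ?r1 ?R) \<le> ?m) \<and> X \<omega> \<inter> ?Z = {})} \<le> L powr (- K)"
      and ann: "\<forall>(u :: nat \<Rightarrow> real ^ 'n) N. sphere_net u N (mesh L) \<longrightarrow> net_annulus u N (mesh L) ?r1 ?r0 ?R (L powr (\<epsilon> - 1 / 2))"
      and mom: "\<forall>(M :: 'w measure) X f. poisson_points M (gauss (exp L)) X \<longrightarrow>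
         f \<in> borel_measurable M \<longrightarrow> (AE \<omega> in M. f \<omega> = F (X \<omega>)) \<longrightarrow> (\<integral>\<^sup>+\<omega>. ennreal ((f \<omega>)\<^sup>2) \<partial>M) \<le> ennreal (L powr q)"
      and flat: "\<forall>u N. fine_net L u N \<longrightarrow> (\<exists>c. real N * c\<^sup>2 \<le> L powr \<kappa> \<and>
       (\<forall>S S' i. good_config \<epsilon> B L u N S \<longrightarrow> good_config \<epsilon> B L u N S' \<longrightarrow> i < N \<longrightarrow> (\<forall>k<N. k \<noteq> i \<longrightarrow> S k = S' k) \<longrightarrow>
          \<bar>F (\<Union>k<N. S k) - F (\<Union>k<N. S' k)\<bar> \<le> c) \<and>
       (\<forall>S. good_config \<epsilon> B L u N S \<longrightarrow> \<bar>F (\<Union>k<N. S k)\<bar> \<le> L powr q))"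
      and L: "1 \<le> L" and hP: "poisson_points M (gauss (exp L)) X"
      and f: "f \<in> borel_measurable M" "AE \<omega> in M. f \<omega> = F (X \<omega>)"
    interpret poisson_points M "gauss (exp L)" X by (rule hP)
    obtain u :: "nat \<Rightarrow> real ^ 'n" and N where net: "fine_net L u N" using fine_net_exists[OF L] by blast
    have net': "sphere_net u N (mesh L)" using net by (simp add: fine_net_def)
    interpret A: net_annulus u N "mesh L" ?r1 ?r0 ?R "L powr (\<epsilon> - 1 / 2)" ?m by (rule ann[rule_format, OF net'])
    let ?C = "\<lambda>i. cone_part (vcell u N i) ?r1 ?R" and ?A = "\<lambda>i. cone_part (vcell u N i) ?r0 ?R"
    from flat[rule_format, OF net] obtain c where c': "real N * c\<^sup>2 \<le> L powr \<kappa> \<and>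
       (\<forall>S S' i. good_config \<epsilon> B L u N S \<longrightarrow> good_config \<epsilon> B L u N S' \<longrightarrow> i < N \<longrightarrow> (\<forall>k<N. k \<noteq> i \<longrightarrow> S k = S' k) \<longrightarrow>
          \<bar>F (\<Union>k<N. S k) - F (\<Union>k<N. S' k)\<bar> \<le> c) \<and>
       (\<forall>S. good_config \<epsilon> B L u N S \<longrightarrow> \<bar>F (\<Union>k<N. S k)\<bar> \<le> L powr q)" ..
    note c1 = c'[THEN conjunct1] and c2 = c'[THEN conjunct2, THEN conjunct1, rule_format]
      and c3 = c'[THEN conjunct2, THEN conjunct2, rule_format]
    let ?bad = "{\<omega>\<in>space M. \<not> ((\<forall>i<N. X \<omega> \<inter> ?A i \<noteq> {} \<and> card (X \<omega> \<inter> ?C i) \<le> ?m) \<and> X \<omega> \<inter> ?Z = {})}"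
    have pb: "prob ?bad \<le> L powr (- K)" by (rule bad[rule_format, OF net hP])
    have "prob {\<omega>\<in>space M. \<tau> * L powr \<beta> \<le> \<bar>f \<omega> - (\<integral>\<omega>. f \<omega> \<partial>M)\<bar>} \<le> prob ?bad + 2 * exp (- 2 * (\<tau> * L powr \<beta> / 4)\<^sup>2 / L powr \<kappa>)"
    proof (rule concentration[where N = N and m = ?m and c = c and K = "L powr \<kappa>" and t = "\<tau> * L powr \<beta>" and f = f and F = F and C = ?C and A = ?A and Z = ?Z and s = "L powr \<sigma>" and B = "L powr q" and ?E2.0 = "L powr q"])
      show "AE \<omega> in M. gen_pos (X \<omega>)" by (rule poisson_gauss_gen_pos[OF hP])
      show "disjoint_family_on ?C {..<N}"
        unfolding disjoint_family_on_def cone_part_def using A.Q_disjoint by auto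
      show "?A i \<subseteq> ?C i" for i using A.r01 by (auto simp: cone_part_def)
      show "bounded (?C i)" for i by (rule cone_part_bounded)
      show "?Z \<in> sets borel" by measurable
    next
      fix S :: "nat \<Rightarrow> (real ^ 'n) set" and T
      assume S: "\<forall>i<N. finite (S i) \<and> S i \<subseteq> ?C i \<and> S i \<inter> ?A i \<noteq> {} \<and> card (S i) \<le> ?m"
        and T: "T \<inter> ((\<Union>i<N. ?C i) \<union> ?Z) = {}"
      have g: "A.good_family S" using S by (simp add: A.good_family_iff)
      have "T \<subseteq> cball 0 ?r1"
      proof
        fix x assume x: "x \<in> T"
        obtain i where "i < N" "sgn x \<in> vcell u N i" using A.Q_cover by blast
        moreover have "x \<notin> ?C i" using x T \<open>i < N\<close> by blast
        moreover have "x \<notin> ?Z" using x T by blast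
        ultimately show "x \<in> cball 0 ?r1" by (auto simp: cone_part_def not_less)
      qed
      from A.inner_points_irrelevant[OF g this] show "F (T \<union> (\<Union>i<N. S i)) = F (\<Union>i<N. S i)"
        unfolding A.total_def by (rule hull)
    next
      fix S S' :: "nat \<Rightarrow> (real ^ 'n) set" and i
      assume "\<forall>i<N. finite (S i) \<and> S i \<subseteq> ?C i \<and> S i \<inter> ?A i \<noteq> {} \<and> card (S i) \<le> ?m"
        "\<forall>i<N. finite (S' i) \<and> S' i \<subseteq> ?C i \<and> S' i \<inter> ?A i \<noteq> {} \<and> card (S' i) \<le> ?m"
        "i < N" "\<And>k. k < N \<Longrightarrow> k \<noteq> i \<Longrightarrow> S k = S' k"
      then show "\<bar>F (\<Union>i<N. S i) - F (\<Union>i<N. S' i)\<bar> \<le> c"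
        by (intro c2[of S S' i]) (auto simp: good_config_def)
    next
      fix S :: "nat \<Rightarrow> (real ^ 'n) set"
      assume "\<forall>i<N. finite (S i) \<and> S i \<subseteq> ?C i \<and> S i \<inter> ?A i \<noteq> {} \<and> card (S i) \<le> ?m"
      then show "\<bar>F (\<Union>i<N. S i)\<bar> \<le> L powr q" by (intro c3) (simp add: good_config_def)
    next
      show "(\<integral>\<^sup>+\<omega>. ennreal ((f \<omega>)\<^sup>2) \<partial>M) \<le> ennreal (L powr q)" by (rule mom[rule_format, OF hP f])
      show "L powr q / L powr \<sigma> + (L powr \<sigma> + L powr q) * prob ?bad \<le> \<tau> * L powr \<beta> / 4"
      proof -
        have "(L powr \<sigma> + L powr q) * prob ?bad \<le> (L powr \<sigma> + L powr q) * L powr (- K)"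
          using pb by (intro mult_left_mono) auto
        also have "\<dots> = L powr \<sigma> * L powr (- K) + L powr q * L powr (- K)" by (rule distrib_right)
        finally show ?thesis using s1 s2 s3 by linarith
      qed
      show "0 < \<tau> * L powr \<beta>" using \<tau> L by simp
      show "0 < L powr \<sigma>" "0 < L powr \<kappa>" using L by simp_all
    qed (use stab f c1 in \<open>auto intro: cone_part_borel A.Q_borel\<close>)
    then show "prob {\<omega>\<in>space M. \<tau> * L powr \<beta> \<le> \<bar>f \<omega> - (\<integral>\<omega>. f \<omega> \<partial>M)\<bar>} \<le> 2 * L powr (- 2)"
      using pb s4 s5 by linarith
  qed
qed

section \<open>Flatness of volume and face numbers\<close>

text \<open>
  One cell changes the volume by at most the volume of a shell of thickness \<open>ln L / sqrt L\<close>
  over a cap of radius \<open>L powr (\<epsilon> - 1 / 2)\<close>, at distance of order \<open>sqrt L\<close>: of order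
  \<open>L powr ((d - 1) * \<epsilon> - 1 / 2) * ln L\<close>. Squaring and multiplying with the number
  \<open>L powr ((d - 1) / 2)\<close> of cells gives the exponent \<open>(d - 3) / 2\<close> up to multiples of \<open>\<epsilon>\<close>.
\<close>

lemma flat_volume:
  assumes eps: "0 < \<epsilon>" "\<epsilon> < 1 / 2" and \<kappa>: "(real CARD('n) - 3) / 2 + 2 * real CARD('n) * \<epsilon> < \<kappa>" and q: "real CARD('n) / 2 < q"
  shows "flat_functional \<epsilon> \<kappa> q (hull_volume :: (real ^ 'n) set \<Rightarrow> real)"
  unfolding flat_functional_def
proof (intro allI impI)
  fix B :: real assume B: "0 \<le> B"
  let ?d = "CARD('n)"
  define n where "n = ?d - 1"
  define CN where "CN = (2 * 6 ^ ?d * 8 ^ ?d :: real)"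
  define V where "V = 3 * 2 ^ ?d * unit_vol TYPE(real ^ 'n)"
  have V: "V > 0" unfolding V_def using unit_vol_pos[where 'a = "real ^ 'n"] by simp
  define b where "b = (1 + 3 * \<epsilon>) - - B"
  have b: "b > 0" using eps B by (simp add: b_def)
  have lB: "- B < 1 + 3 * \<epsilon>" using eps B by simp
  define C3 where "C3 = real ?d * (b / 2) * V * 2 ^ n"
  have C3: "C3 > 0" using b V by (simp add: C3_def)
  have CN: "CN > 0" by (simp add: CN_def)
  have n: "real n = real ?d - 1" by (simp add: n_def)
  have n0: "0 \<le> real n" by simp
  have \<kappa>': "(real n - 2) / 2 + 2 * (real n + 1) * \<epsilon> < \<kappa>" using \<kappa> by (simp add: n)
  have "\<forall>\<^sub>F L::real in at_top. CN * L powr (real n / 2) * (C3 * (L powr (real n * \<epsilon>) * ln L / sqrt L))\<^sup>2 \<le> L powr \<kappa>"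
  proof -
    have "real n / 2 + 2 * (real n * \<epsilon>) - 1 < \<kappa>" 
    proof -
      have "2 * (real n + 1) * \<epsilon> = 2 * (real n * \<epsilon>) + 2 * \<epsilon>" by (simp add: algebra_simps)
      moreover have "v / 2 + 2 * x - 1 < k" if "(v - 2) / 2 + y < k" "0 < e" "y = 2 * x + 2 * e" for v x y e k :: real
        using that by (simp add: field_simps)
      ultimately show ?thesis using \<kappa>' eps(1) by blast
    qed
    then show ?thesis using CN C3 by real_asymp
  qed
  moreover have "\<forall>\<^sub>F L::real in at_top. (2 ^ ?d * unit_vol TYPE(real ^ 'n)) * L powr (real ?d / 2) \<le> L powr q"
    using q by real_asymp
  ultimately show "\<forall>\<^sub>F L in at_top. \<forall>(u :: nat \<Rightarrow> real ^ 'n) N. fine_net L u N \<longrightarrow>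
     (\<exists>c. real N * c\<^sup>2 \<le> L powr \<kappa> \<and>
       (\<forall>S S' i. good_config \<epsilon> B L u N S \<longrightarrow> good_config \<epsilon> B L u N S' \<longrightarrow> i < N \<longrightarrow> (\<forall>k<N. k \<noteq> i \<longrightarrow> S k = S' k) \<longrightarrow>
          \<bar>hull_volume (\<Union>k<N. S k) - hull_volume (\<Union>k<N. S' k)\<bar> \<le> c) \<and>
       (\<forall>S. good_config \<epsilon> B L u N S \<longrightarrow> \<bar>hull_volume (\<Union>k<N. S k)\<bar> \<le> L powr q))"
    using net_annulus_eventually[OF eps B, where 'a = "real ^ 'n"] rad_shell[OF lB, where 'n = 'n]
      rad_bounds[of "- B"] rad_bounds[of "1 + 3 * \<epsilon>"] eventually_ge_at_top[of 1]
  proof (eventually_elim, intro allI impI)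
    fix L :: real and u :: "nat \<Rightarrow> real ^ 'n" and N
    let ?r1 = "rad (1 + 3 * \<epsilon>) L" and ?r0 = "rad (1 + 2 * \<epsilon>) L" and ?R = "rad (- B) L"
    let ?m = "nat \<lceil>L powr (2 * \<epsilon>)\<rceil>" and ?\<eta> = "L powr (\<epsilon> - 1 / 2)"
    assume h1: "CN * L powr (real n / 2) * (C3 * (L powr (real n * \<epsilon>) * ln L / sqrt L))\<^sup>2 \<le> L powr \<kappa>"
      and h2: "(2 ^ ?d * unit_vol TYPE(real ^ 'n)) * L powr (real ?d / 2) \<le> L powr q"
      and ann: "\<forall>(u :: nat \<Rightarrow> real ^ 'n) N. sphere_net u N (mesh L) \<longrightarrow> net_annulus u N (mesh L) ?r1 ?r0 ?R ?\<eta>"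
      and sh: "?r1 \<le> ?R \<and> ?R - ?r1 \<le> ((1 + 3 * \<epsilon>) - - B) * ln L / (2 * sqrt L)
        \<and> ?R ^ ?d - ?r1 ^ ?d \<le> real ?d * ?R ^ (?d - 1) * (((1 + 3 * \<epsilon>) - - B) * ln L / (2 * sqrt L))"
      and RB: "1 \<le> sqrt L \<and> sqrt L \<le> ?R \<and> ?R \<le> 2 * sqrt L \<and> ?R\<^sup>2 = 2 * L - - B * ln L"
      and rB: "1 \<le> sqrt L \<and> sqrt L \<le> ?r1 \<and> ?r1 \<le> 2 * sqrt L \<and> ?r1\<^sup>2 = 2 * L - (1 + 3 * \<epsilon>) * ln L"
      and L: "1 \<le> L" and net: "fine_net L u N"
    interpret A: net_annulus u N "mesh L" ?r1 ?r0 ?R ?\<eta> ?m using ann net by (auto simp: fine_net_def)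
    have good: "good_config \<epsilon> B L u N S \<longleftrightarrow> A.good_family S" for S
      by (simp add: A.good_family_iff good_config_def)
    have vd: "A.vol_diff \<le> C3 * (L powr (real n * \<epsilon>) * ln L / sqrt L)"
    proof -
      have "A.vol_diff = (?R ^ ?d - ?r1 ^ ?d) * (V * ?\<eta> ^ n)" by (simp add: A.vol_diff_def V_def n_def)
      also have "\<dots> \<le> (real ?d * ?R ^ n * (b * ln L / (2 * sqrt L))) * (V * ?\<eta> ^ n)"
        using sh V by (intro mult_right_mono) (auto simp: n_def b_def)
      also have "\<dots> = real ?d * (b * ln L / (2 * sqrt L)) * V * (?R * ?\<eta>) ^ n" by (simp add: power_mult_distrib)
      also have "\<dots> \<le> real ?d * (b * ln L / (2 * sqrt L)) * V * (2 * L powr \<epsilon>) ^ n"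
      proof (intro mult_left_mono power_mono)
        have "?R * ?\<eta> \<le> 2 * sqrt L * ?\<eta>" using RB by (intro mult_right_mono) auto
        also have "\<dots> = 2 * L powr \<epsilon>" using L by (simp add: powr_half_sqrt[symmetric] powr_add[symmetric])
        finally show "?R * ?\<eta> \<le> 2 * L powr \<epsilon>" .
        show "0 \<le> ?R * ?\<eta>" using RB by (intro mult_nonneg_nonneg) auto
        show "0 \<le> real ?d * (b * ln L / (2 * sqrt L)) * V" using b V L by simp
      qed
      also have "\<dots> = C3 * (L powr (real n * \<epsilon>) * ln L / sqrt L)"
        using L by (simp add: C3_def power_mult_distrib powr_power mult_ac)
      finally show ?thesis .
    qed
    have vd0: "0 \<le> A.vol_diff"
      unfolding A.vol_diff_def using sh rB unit_vol_pos[where 'a = "real ^ 'n"]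
      by (intro mult_nonneg_nonneg) (auto intro: power_mono)
    have "real N * A.vol_diff\<^sup>2 \<le> (CN * L powr (real n / 2)) * (C3 * (L powr (real n * \<epsilon>) * ln L / sqrt L))\<^sup>2"
      using fine_net_card[OF L net] vd vd0 by (intro mult_mono power_mono) (auto simp: CN_def n)
    also note h1
    finally have 1: "real N * A.vol_diff\<^sup>2 \<le> L powr \<kappa>" .
    have 2: "\<bar>hull_volume (\<Union>k<N. S k) - hull_volume (\<Union>k<N. S' k)\<bar> \<le> A.vol_diff"
      if "good_config \<epsilon> B L u N S" "good_config \<epsilon> B L u N S'" "i < N" "\<forall>k<N. k \<noteq> i \<longrightarrow> S k = S' k" for S S' i
    proof -
      have "hull_volume (A.total S) \<le> hull_volume (A.total S') + A.vol_diff"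
        unfolding hull_volume_def by (rule A.volume_difference_le) (use that good in auto)
      moreover have "hull_volume (A.total S') \<le> hull_volume (A.total S) + A.vol_diff"
        unfolding hull_volume_def by (rule A.volume_difference_le) (use that good in auto)
      ultimately show ?thesis by (simp add: A.total_def)
    qed
    have 3: "\<bar>hull_volume (\<Union>k<N. S k)\<bar> \<le> L powr q" if g: "good_config \<epsilon> B L u N S" for S
    proof -
      have fin: "finite (A.total S)" using g good A.total_finite by blast
      have "hull_volume (A.total S) \<le> measure lebesgue (cball (0 :: real ^ 'n) ?R)"
        unfolding hull_volume_def
        using g good A.hull_norm_le fin by (intro measure_mono_fmeasurable)
          (auto intro!: fmeasurableD lmeasurable_compact simp: finite_imp_compact compact_convex_hull)
      also have "\<dots> = ?R ^ ?d * unit_vol TYPE(real ^ 'n)"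
        using RB by (simp add: content_cball_conv_ball content_ball_conv_unit_ball[of ?R])
      also have "\<dots> \<le> (2 * sqrt L) ^ ?d * unit_vol TYPE(real ^ 'n)"
        using RB by (intro mult_right_mono power_mono) auto
      also have "\<dots> = (2 ^ ?d * unit_vol TYPE(real ^ 'n)) * L powr (real ?d / 2)"
        using L by (simp add: power_mult_distrib powr_half_sqrt[symmetric] powr_power)
      also note h2
      finally show ?thesis by (simp add: A.total_def hull_volume_def)
    qed
    show "\<exists>c. real N * c\<^sup>2 \<le> L powr \<kappa> \<and>
       (\<forall>S S' i. good_config \<epsilon> B L u N S \<longrightarrow> good_config \<epsilon> B L u N S' \<longrightarrow> i < N \<longrightarrow> (\<forall>k<N. k \<noteq> i \<longrightarrow> S k = S' k) \<longrightarrow>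
          \<bar>hull_volume (\<Union>k<N. S k) - hull_volume (\<Union>k<N. S' k)\<bar> \<le> c) \<and>
       (\<forall>S. good_config \<epsilon> B L u N S \<longrightarrow> \<bar>hull_volume (\<Union>k<N. S k)\<bar> \<le> L powr q)"
      by (rule exI[of _ A.vol_diff]) (use 1 2 3 in blast)
  qed
qed

text \<open>
  About \<open>L powr (d * \<epsilon>)\<close> cells are within distance \<open>L powr (\<epsilon> - 1 / 2)\<close> of a given one, and
  each contains at most about \<open>L powr (2 * \<epsilon>)\<close> points. So one cell affects at most of order
  \<open>L powr ((d + 2) * (j + 1) * \<epsilon>)\<close> faces, and the exponent \<open>(d - 1) / 2\<close> comes from the number
  of cells alone.
\<close>

lemma flat_faces:
  assumes eps: "0 < \<epsilon>" "\<epsilon> < 1 / 2" and j: "j < CARD('n)"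
    and \<kappa>: "(real CARD('n) - 1) / 2 + 2 * (real CARD('n) + 2) * real (j + 1) * \<epsilon> < \<kappa>"
    and q: "((real CARD('n) - 1) / 2 + 2 * \<epsilon>) * real (j + 1) < q"
  shows "flat_functional \<epsilon> \<kappa> q (hull_faces j :: (real ^ 'n) set \<Rightarrow> real)"
  unfolding flat_functional_def
proof (intro allI impI)
  fix B :: real assume B: "0 \<le> B"
  let ?d = "CARD('n)"
  define n where "n = ?d - 1"
  define CN where "CN = (2 * 6 ^ ?d * 8 ^ ?d :: real)"
  have CN: "CN > 0" by (simp add: CN_def)
  have n: "real n = real ?d - 1" by (simp add: n_def)
  define C4 where "C4 = (2 * 12 ^ ?d :: real) ^ (j + 1)"
  have C4: "C4 > 0" by (simp add: C4_def)
  define e where "e = (real ?d + 2) * \<epsilon> * real (j + 1)"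
  define C5 where "C5 = (CN * 2) ^ (j + 1)"
  have C5: "C5 > 0" using CN by (simp add: C5_def)
  define e5 where "e5 = ((real ?d - 1) / 2 + 2 * \<epsilon>) * real (j + 1)"
  have "real n / 2 + 2 * e < \<kappa>" using \<kappa> by (simp add: n e_def algebra_simps)
  then have "\<forall>\<^sub>F L::real in at_top. CN * L powr (real n / 2) * (C4 * L powr e)\<^sup>2 \<le> L powr \<kappa>"
    using CN C4 by real_asymp
  moreover have "e5 < q" using q by (simp add: e5_def)
  then have "\<forall>\<^sub>F L::real in at_top. C5 * L powr e5 \<le> L powr q" using C5 by real_asymp
  ultimately show "\<forall>\<^sub>F L in at_top. \<forall>(u :: nat \<Rightarrow> real ^ 'n) N. fine_net L u N \<longrightarrow>
     (\<exists>c. real N * c\<^sup>2 \<le> L powr \<kappa> \<and>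
       (\<forall>S S' i. good_config \<epsilon> B L u N S \<longrightarrow> good_config \<epsilon> B L u N S' \<longrightarrow> i < N \<longrightarrow> (\<forall>k<N. k \<noteq> i \<longrightarrow> S k = S' k) \<longrightarrow>
          \<bar>hull_faces j (\<Union>k<N. S k) - hull_faces j (\<Union>k<N. S' k)\<bar> \<le> c) \<and>
       (\<forall>S. good_config \<epsilon> B L u N S \<longrightarrow> \<bar>hull_faces j (\<Union>k<N. S k)\<bar> \<le> L powr q))"
    using net_annulus_eventually[OF eps B, where 'a = "real ^ 'n"] eventually_ge_at_top[of 1]
  proof (eventually_elim, intro allI impI)
    fix L :: real and u :: "nat \<Rightarrow> real ^ 'n" and N
    let ?r1 = "rad (1 + 3 * \<epsilon>) L" and ?r0 = "rad (1 + 2 * \<epsilon>) L" and ?R = "rad (- B) L"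
    let ?m = "nat \<lceil>L powr (2 * \<epsilon>)\<rceil>" and ?\<eta> = "L powr (\<epsilon> - 1 / 2)"
    assume h1: "CN * L powr (real n / 2) * (C4 * L powr e)\<^sup>2 \<le> L powr \<kappa>"
      and h2: "C5 * L powr e5 \<le> L powr q"
      and ann: "\<forall>(u :: nat \<Rightarrow> real ^ 'n) N. sphere_net u N (mesh L) \<longrightarrow> net_annulus u N (mesh L) ?r1 ?r0 ?R ?\<eta>"
      and L: "1 \<le> L" and net: "fine_net L u N"
    interpret A: net_annulus u N "mesh L" ?r1 ?r0 ?R ?\<eta> ?m using ann net by (auto simp: fine_net_def)
    have good: "good_config \<epsilon> B L u N S \<longleftrightarrow> A.good_family S" for S
      by (simp add: A.good_family_iff good_config_def)
    have one: "1 \<le> L powr \<epsilon>" "1 \<le> L powr (2 * \<epsilon>)" using L eps by (simp_all add: ge_one_powr_ge_zero)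
    have m: "real ?m \<le> 2 * L powr (2 * \<epsilon>)" using one(2) by linarith
    have ratio: "3 * (?\<eta> + mesh L) / mesh L \<le> 12 * L powr \<epsilon>"
    proof -
      have "3 * (?\<eta> + mesh L) / mesh L = 3 * (?\<eta> * sqrt (8 * L) + 1)"
        using L by (simp add: mesh_def distrib_left distrib_right)
      also have "?\<eta> * sqrt (8 * L) = sqrt 8 * L powr \<epsilon>"
        using L by (simp add: real_sqrt_mult powr_half_sqrt[symmetric] powr_add[symmetric])
      also have "sqrt 8 \<le> (3::real)" by (rule real_le_lsqrt) auto
      then have "3 * (sqrt 8 * L powr \<epsilon> + 1) \<le> 3 * (3 * L powr \<epsilon> + L powr \<epsilon>)"
        using one(1) by (intro mult_left_mono add_mono mult_right_mono) auto
      finally show ?thesis by simp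
    qed
    have ratio0: "0 \<le> 3 * (?\<eta> + mesh L) / mesh L" using A.\<delta> by simp
    have fd: "real (A.face_diff j) \<le> C4 * L powr e"
    proof -
      let ?x = "(3 * (?\<eta> + mesh L) / mesh L) ^ ?d"
      have "real (nat \<lfloor>?x\<rfloor>) \<le> ?x" using ratio0 by (intro of_nat_floor zero_le_power)
      also have "\<dots> \<le> (12 * L powr \<epsilon>) ^ ?d" using ratio ratio0 by (rule power_mono)
      finally have "real ?m * real (nat \<lfloor>?x\<rfloor>) \<le> 2 * L powr (2 * \<epsilon>) * (12 * L powr \<epsilon>) ^ ?d"
        using m by (intro mult_mono) auto
      also have "\<dots> = 2 * 12 ^ ?d * L powr ((real ?d + 2) * \<epsilon>)"
        using L by (simp add: power_mult_distrib powr_power powr_add[symmetric] algebra_simps)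
      finally have "(real ?m * real (nat \<lfloor>?x\<rfloor>)) ^ (j + 1) \<le> (2 * 12 ^ ?d * L powr ((real ?d + 2) * \<epsilon>)) ^ (j + 1)"
        by (intro power_mono mult_nonneg_nonneg of_nat_0_le_iff)
      also have "\<dots> = C4 * L powr e"
        using L by (simp add: C4_def e_def power_mult_distrib powr_power mult_ac del: power_Suc)
      finally show ?thesis by (simp add: A.face_diff_def del: power_Suc)
    qed
    have "real N * (real (A.face_diff j))\<^sup>2 \<le> (CN * L powr (real n / 2)) * (C4 * L powr e)\<^sup>2"
      using fine_net_card[OF L net] fd by (intro mult_mono power_mono) (auto simp: CN_def n)
    also note h1
    finally have 1: "real N * (real (A.face_diff j))\<^sup>2 \<le> L powr \<kappa>" .
    have jd: "j < DIM(real ^ 'n)" using j by simp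
    have 2: "\<bar>hull_faces j (\<Union>k<N. S k) - hull_faces j (\<Union>k<N. S' k)\<bar> \<le> real (A.face_diff j)"
      if "good_config \<epsilon> B L u N S" "good_config \<epsilon> B L u N S'" "i < N" "\<forall>k<N. k \<noteq> i \<longrightarrow> S k = S' k" for S S' i
    proof -
      have "card {F. F face_of convex hull A.total S \<and> aff_dim F = int j} \<le> card {F. F face_of convex hull A.total S' \<and> aff_dim F = int j} + A.face_diff j"
        by (rule A.face_difference_le[OF _ _ that(3) _ jd]) (use that good in auto)
      moreover have "card {F. F face_of convex hull A.total S' \<and> aff_dim F = int j} \<le> card {F. F face_of convex hull A.total S \<and> aff_dim F = int j} + A.face_diff j"
        by (rule A.face_difference_le[OF _ _ that(3) _ jd]) (use that good in auto)
      ultimately show ?thesis unfolding hull_faces_def A.total_def by linarith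
    qed
    have 3: "\<bar>hull_faces j (\<Union>k<N. S k)\<bar> \<le> L powr q" if g: "good_config \<epsilon> B L u N S" for S
    proof -
      have fin: "finite (A.total S)" using g good A.total_finite by blast
      have "card {F. F face_of convex hull A.total S \<and> aff_dim F = int j \<and> F \<inter> A.total S \<subseteq> A.total S} \<le> card (A.total S) ^ (j + 1)"
        by (rule card_faces_le[OF fin fin])
      then have "hull_faces j (A.total S) \<le> real (card (A.total S)) ^ (j + 1)"
        unfolding hull_faces_def by (simp del: power_Suc flip: of_nat_power)
      also have "\<dots> \<le> (CN * 2 * L powr ((real ?d - 1) / 2 + 2 * \<epsilon>)) ^ (j + 1)"
      proof (rule power_mono)
        have "card (A.total S) \<le> (\<Sum>k\<in>{..<N}. card (S k))" unfolding A.total_def by (rule card_UN_le) simp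
        also have "\<dots> \<le> (\<Sum>k\<in>{..<N}. ?m)" using g by (intro sum_mono) (auto simp: good_config_def)
        finally have "real (card (A.total S)) \<le> real (N * ?m)" by (intro of_nat_mono) simp
        also have "\<dots> = real N * real ?m" by (rule of_nat_mult)
        also have "\<dots> \<le> (CN * L powr ((real ?d - 1) / 2)) * (2 * L powr (2 * \<epsilon>))"
          using fine_net_card[OF L net] m CN one(2) by (intro mult_mono mult_nonneg_nonneg of_nat_0_le_iff powr_ge_zero) (simp_all add: CN_def)
        also have "\<dots> = CN * 2 * L powr ((real ?d - 1) / 2 + 2 * \<epsilon>)" by (simp add: powr_add)
        finally show "real (card (A.total S)) \<le> CN * 2 * L powr ((real ?d - 1) / 2 + 2 * \<epsilon>)" .
      qed simp
      also have "\<dots> = C5 * L powr e5" using L by (simp add: C5_def e5_def power_mult_distrib powr_power mult_ac del: power_Suc)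
      also note h2
      finally show ?thesis by (simp add: A.total_def hull_faces_def)
    qed
    show "\<exists>c. real N * c\<^sup>2 \<le> L powr \<kappa> \<and>
       (\<forall>S S' i. good_config \<epsilon> B L u N S \<longrightarrow> good_config \<epsilon> B L u N S' \<longrightarrow> i < N \<longrightarrow> (\<forall>k<N. k \<noteq> i \<longrightarrow> S k = S' k) \<longrightarrow>
          \<bar>hull_faces j (\<Union>k<N. S k) - hull_faces j (\<Union>k<N. S' k)\<bar> \<le> c) \<and>
       (\<forall>S. good_config \<epsilon> B L u N S \<longrightarrow> \<bar>hull_faces j (\<Union>k<N. S k)\<bar> \<le> L powr q)"
      by (rule exI[of _ "real (A.face_diff j)"]) (use 1 2 3 in blast)
  qed
qed

section \<open>Second moments\<close>

text \<open>
  The variable \<open>h\<close> sums, over the shells of unit thickness beyond \<open>T\<close> that contain a point, the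
  power of the outer radius. It dominates the power of the norm of each point beyond \<open>T\<close>, in
  particular of the farthest one, and unlike the latter it is visibly measurable. A shell is
  occupied with probability at most its intensity.
\<close>

lemma (in poisson_points) nn_integral_max_norm:
  fixes T :: real and q :: nat
  defines "h \<equiv> \<lambda>\<omega>. \<Sum>b. ennreal ((real b + 1) ^ q) * indicator {\<omega>\<in>space M. X \<omega> \<inter> {x. T < norm x \<and> real b < norm x \<and> norm x \<le> real b + 1} \<noteq> {}} \<omega>"
  shows "h \<in> borel_measurable M"
    and "(\<integral>\<^sup>+\<omega>. h \<omega> \<partial>M) \<le> (\<integral>\<^sup>+x. ennreal ((norm x + 1) ^ q) * indicator {x. T < norm x} x \<partial>\<mu>)"
    and "\<omega> \<in> space M \<Longrightarrow> x \<in> X \<omega> \<Longrightarrow> T < norm x \<Longrightarrow> 0 \<le> T \<Longrightarrow> ennreal (norm x ^ q) \<le> h \<omega>"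
proof -
  let ?A = "\<lambda>b::nat. {x :: 'a. T < norm x \<and> real b < norm x \<and> norm x \<le> real b + 1}"
  let ?H = "\<lambda>b. {\<omega>\<in>space M. X \<omega> \<inter> ?A b \<noteq> {}}"
  have A: "?A b \<in> sets borel" for b by measurable
  have H: "?H b \<in> sets M" for b
  proof -
    have "?H b = space M - {\<omega>\<in>space M. X \<omega> \<inter> ?A b = {}}" by auto
    then show ?thesis using hit_measurable[OF A] by simp
  qed
  show "h \<in> borel_measurable M" 
  proof -
    note [measurable] = H
    show ?thesis unfolding h_def by measurable
  qed
  have "(\<integral>\<^sup>+\<omega>. h \<omega> \<partial>M) = (\<Sum>b. ennreal ((real b + 1) ^ q) * emeasure M (?H b))"
    unfolding h_def using H by (subst nn_integral_suminf) (auto simp: nn_integral_cmult_indicator)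
  also have "\<dots> \<le> (\<Sum>b. \<integral>\<^sup>+x. ennreal ((norm x + 1) ^ q) * indicator (?A b) x \<partial>\<mu>)"
  proof (rule suminf_le)
    fix b
    have "ennreal ((real b + 1) ^ q) * emeasure M (?H b) \<le> ennreal ((real b + 1) ^ q) * emeasure \<mu> (?A b)"
      using prob_nonempty_le[OF A, of b] by (intro mult_left_mono) (auto simp: emeasure_eq_measure mu.emeasure_eq_measure ennreal_leI)
    also have "\<dots> = (\<integral>\<^sup>+x. ennreal ((real b + 1) ^ q) * indicator (?A b) x \<partial>\<mu>)"
      using A sets_mu by (subst nn_integral_cmult_indicator) auto
    also have "\<dots> \<le> (\<integral>\<^sup>+x. ennreal ((norm x + 1) ^ q) * indicator (?A b) x \<partial>\<mu>)"
      by (intro nn_integral_mono) (auto simp: indicator_def intro!: ennreal_leI power_mono)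
    finally show "ennreal ((real b + 1) ^ q) * emeasure M (?H b) \<le> (\<integral>\<^sup>+x. ennreal ((norm x + 1) ^ q) * indicator (?A b) x \<partial>\<mu>)" .
  qed auto
  also have "\<dots> = (\<integral>\<^sup>+x. (\<Sum>b. ennreal ((norm x + 1) ^ q) * indicator (?A b) x) \<partial>\<mu>)"
    using A sets_mu by (intro nn_integral_suminf[symmetric]) (auto intro!: borel_measurable_times borel_measurable_indicator measurable_compose[OF borel_measurable_norm] simp: measurable_cong_sets[OF sets_mu refl])
  also have "\<dots> \<le> (\<integral>\<^sup>+x. ennreal ((norm x + 1) ^ q) * indicator {x. T < norm x} x \<partial>\<mu>)"
  proof (rule nn_integral_mono)
    fix x :: 'a
    have "disjoint_family ?A" unfolding disjoint_family_on_def
    proof (intro ballI impI, rule ccontr)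
      fix b c :: nat assume bc: "b \<noteq> c" "?A b \<inter> ?A c \<noteq> {}"
      then obtain y :: 'a where "real b < norm y" "norm y \<le> real b + 1" "real c < norm y" "norm y \<le> real c + 1" by auto
      then have "real b < real (c + 1)" "real c < real (b + 1)" by simp_all
      then show False using bc(1) by linarith
    qed
    then have "(\<Sum>b. indicator (?A b) x) = (indicator (\<Union>b. ?A b) x :: ennreal)" by (rule suminf_indicator)
    also have "\<dots> \<le> indicator {x. T < norm x} x" by (auto simp: indicator_def)
    finally show "(\<Sum>b. ennreal ((norm x + 1) ^ q) * indicator (?A b) x) \<le> ennreal ((norm x + 1) ^ q) * indicator {x. T < norm x} x"
      by (simp add: mult_left_mono)
  qed
  finally show "(\<integral>\<^sup>+\<omega>. h \<omega> \<partial>M) \<le> (\<integral>\<^sup>+x. ennreal ((norm x + 1) ^ q) * indicator {x. T < norm x} x \<partial>\<mu>)" .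
  show "ennreal (norm x ^ q) \<le> h \<omega>" if w: "\<omega> \<in> space M" and x: "x \<in> X \<omega>" "T < norm x" and T: "0 \<le> T"
  proof -
    define b where "b = nat (\<lceil>norm x\<rceil> - 1)"
    have "0 < norm x" using x(2) T by linarith
    then have "0 < \<lceil>norm x\<rceil>" by simp
    then have b: "real b = of_int \<lceil>norm x\<rceil> - 1" unfolding b_def by simp
    have bb: "real b < norm x" "norm x \<le> real b + 1" unfolding b by linarith+
    have "ennreal (norm x ^ q) \<le> ennreal ((real b + 1) ^ q)" using bb by (intro ennreal_leI power_mono) auto
    also have "\<dots> = ennreal ((real b + 1) ^ q) * indicator (?H b) \<omega>" using w x bb by (auto simp: indicator_def)
    also have "\<dots> \<le> h \<omega>"
    proof -
      have single: "g b \<le> (\<Sum>k. g k)" for g :: "nat \<Rightarrow> ennreal"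
        using sum_le_suminf[of g "{b}"] by simp
      show ?thesis unfolding h_def by (rule single)
    qed
    finally show ?thesis .
  qed
qed

text \<open>
  The hull is contained in the ball through the farthest point. If that point has norm at most
  \<open>2 * sqrt L\<close>, the volume is at most of order \<open>L powr (d / 2)\<close>. The points beyond contribute a
  bounded amount.
\<close>

lemma second_moment_volume:
  assumes q: "real CARD('n) < q"
  shows "second_moment_functional TYPE('w) q (hull_volume :: (real ^ 'n) set \<Rightarrow> real)"
  unfolding second_moment_functional_def
proof -
  let ?d = "CARD('n)"
  let ?v = "unit_vol TYPE(real ^ 'n)"
  define C where "C = gconst TYPE('n) * fact (2 * ?d) * exp 3 * (2 ^ ?d * gint TYPE('n))"
  have C: "C \<ge> 0" unfolding C_def using gconst_pos[where 'n = 'n] gint_nonneg[where 'n = 'n] by simp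
  have v: "?v > 0" using unit_vol_pos[where 'a = "real ^ 'n"] .
  have "\<forall>\<^sub>F L::real in at_top. ?v\<^sup>2 * 4 ^ ?d * L powr (real ?d) \<le> L powr q / 2" using q by real_asymp
  moreover have "\<forall>\<^sub>F L::real in at_top. ?v\<^sup>2 * C \<le> L powr q / 2"
  proof -
    have "0 < q" using q by linarith
    then show ?thesis by real_asymp
  qed
  ultimately show "\<forall>\<^sub>F L in at_top. \<forall>(M :: 'w measure) X f. poisson_points M (gauss (exp L)) X \<longrightarrow>
     f \<in> borel_measurable M \<longrightarrow> (AE \<omega> in M. f \<omega> = hull_volume (X \<omega> :: (real ^ 'n) set)) \<longrightarrow> (\<integral>\<^sup>+\<omega>. ennreal ((f \<omega>)\<^sup>2) \<partial>M) \<le> ennreal (L powr q)"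
    using eventually_ge_at_top[of 1]
  proof (eventually_elim, intro allI impI)
    fix L :: real and M :: "'w measure" and X :: "'w \<Rightarrow> (real ^ 'n) set" and f
    assume h1: "?v\<^sup>2 * 4 ^ ?d * L powr (real ?d) \<le> L powr q / 2" and h2: "?v\<^sup>2 * C \<le> L powr q / 2" and L: "1 \<le> L"
      and hP: "poisson_points M (gauss (exp L)) X" and f: "f \<in> borel_measurable M" "AE \<omega> in M. f \<omega> = hull_volume (X \<omega>)"
    interpret poisson_points M "gauss (exp L)" X by (rule hP)
    \<comment> \<open>With this choice the intensity \<open>exp L\<close> equals \<open>exp (T\<^sup>2 / 4)\<close>.\<close>
    define T where "T = 2 * sqrt L"
    have T: "0 \<le> T" "T\<^sup>2 = 4 * L" using L by (simp_all add: T_def power_mult_distrib)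
    let ?h = "\<lambda>\<omega>. \<Sum>b. ennreal ((real b + 1) ^ (2 * ?d)) * indicator {\<omega>\<in>space M. X \<omega> \<inter> {x. T < norm x \<and> real b < norm x \<and> norm x \<le> real b + 1} \<noteq> {}} \<omega>"
    have cb: "hull_volume (X \<omega>) \<le> r ^ ?d * ?v" if fin: "finite (X \<omega>)" and r: "0 \<le> r" and sub: "\<And>x. x \<in> X \<omega> \<Longrightarrow> norm x \<le> r" for \<omega> r
    proof -
      have "convex hull X \<omega> \<subseteq> cball 0 r" by (rule hull_minimal) (use sub in auto)
      then have "hull_volume (X \<omega>) \<le> measure lebesgue (cball (0 :: real ^ 'n) r)"
        unfolding hull_volume_def using fin
        by (intro measure_mono_fmeasurable) (auto intro!: fmeasurableD lmeasurable_compact simp: finite_imp_compact compact_convex_hull)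
      then show ?thesis using r by (simp add: content_cball_conv_ball content_ball_conv_unit_ball[of r])
    qed
    have "(\<integral>\<^sup>+\<omega>. ennreal ((f \<omega>)\<^sup>2) \<partial>M) \<le> (\<integral>\<^sup>+\<omega>. ennreal (?v\<^sup>2 * T ^ (2 * ?d)) + ennreal (?v\<^sup>2) * ?h \<omega> \<partial>M)"
    proof (rule nn_integral_mono_AE)
      show "AE \<omega> in M. ennreal ((f \<omega>)\<^sup>2) \<le> ennreal (?v\<^sup>2 * T ^ (2 * ?d)) + ennreal (?v\<^sup>2) * ?h \<omega>"
        using f(2) AE_finite AE_space
      proof eventually_elim
        case (elim \<omega>)
        have nonneg: "0 \<le> hull_volume (X \<omega>)" by (simp add: hull_volume_def)
        show ?case
        proof (cases "\<forall>x\<in>X \<omega>. norm x \<le> T")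
          case True
          have "(f \<omega>)\<^sup>2 \<le> (T ^ ?d * ?v)\<^sup>2" using cb[OF elim(2) T(1)] True elim(1) nonneg by (intro power_mono) auto
          also have "\<dots> = ?v\<^sup>2 * T ^ (2 * ?d)" by (simp add: power_mult_distrib power_mult[symmetric] mult.commute)
          finally have "ennreal ((f \<omega>)\<^sup>2) \<le> ennreal (?v\<^sup>2 * T ^ (2 * ?d))" by (rule ennreal_leI)
          then show ?thesis by (rule order_trans) simp
        next
          case False
          then have ne: "norm ` X \<omega> \<noteq> {}" by auto
          have fin: "finite (norm ` X \<omega>)" using elim(2) by simp
          obtain x where x: "x \<in> X \<omega>" "norm x = Max (norm ` X \<omega>)" using Max_in[OF fin ne] by auto
          have mx: "norm y \<le> norm x" if "y \<in> X \<omega>" for y unfolding x(2) using fin that by simp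
          have Tx: "T < norm x" using False mx by force
          have "(f \<omega>)\<^sup>2 \<le> (norm x ^ ?d * ?v)\<^sup>2" using cb[OF elim(2) norm_ge_zero mx] elim(1) nonneg by (intro power_mono) auto
          also have "\<dots> = ?v\<^sup>2 * norm x ^ (2 * ?d)" by (simp add: power_mult_distrib power_mult[symmetric] mult.commute)
          finally have "ennreal ((f \<omega>)\<^sup>2) \<le> ennreal (?v\<^sup>2) * ennreal (norm x ^ (2 * ?d))"
            by (simp add: ennreal_mult'[symmetric] ennreal_leI)
          also have "\<dots> \<le> ennreal (?v\<^sup>2) * ?h \<omega>"
            by (rule mult_left_mono[OF nn_integral_max_norm(3)[OF elim(3) x(1) Tx T(1)]]) simp
          finally show ?thesis by (rule order_trans) simp
        qed
      qed
    qed
    also have "\<dots> = ennreal (?v\<^sup>2 * T ^ (2 * ?d)) + ennreal (?v\<^sup>2) * (\<integral>\<^sup>+\<omega>. ?h \<omega> \<partial>M)"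
      using nn_integral_max_norm(1)[where q = "2 * ?d" and T = T]
      by (subst nn_integral_add) (auto simp: nn_integral_cmult emeasure_space_1)
    also have "\<dots> \<le> ennreal (?v\<^sup>2 * T ^ (2 * ?d)) + ennreal (?v\<^sup>2) * ennreal C"
    proof (intro add_left_mono mult_left_mono)
      have "(\<integral>\<^sup>+\<omega>. ?h \<omega> \<partial>M) \<le> (\<integral>\<^sup>+x. ennreal ((norm x + 1) ^ (2 * ?d)) * indicator {x. T < norm x} x \<partial>(gauss (exp L) :: (real ^ 'n) measure))"
        using nn_integral_max_norm(2)[where q = "2 * ?d" and T = T] .
      also have "\<dots> \<le> ennreal C" unfolding C_def by (rule gauss_tail_moment_le) (use T in auto)
      finally show "(\<integral>\<^sup>+\<omega>. ?h \<omega> \<partial>M) \<le> ennreal C" .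
    qed simp
    also have "\<dots> = ennreal (?v\<^sup>2 * T ^ (2 * ?d) + ?v\<^sup>2 * C)" using C T by (simp add: ennreal_mult'[symmetric])
    also have "\<dots> \<le> ennreal (L powr q)"
    proof (rule ennreal_leI)
      have "T ^ (2 * ?d) = (4 * L) ^ ?d" using T(2) by (simp add: power_mult)
      also have "\<dots> = 4 ^ ?d * L powr (real ?d)" using L by (simp add: power_mult_distrib powr_realpow)
      finally have "?v\<^sup>2 * T ^ (2 * ?d) \<le> L powr q / 2" using h1 by (simp add: mult.assoc)
      then show "?v\<^sup>2 * T ^ (2 * ?d) + ?v\<^sup>2 * C \<le> L powr q" using h2 by linarith
    qed
    finally show "(\<integral>\<^sup>+\<omega>. ennreal ((f \<omega>)\<^sup>2) \<partial>M) \<le> ennreal (L powr q)" .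
  qed
qed

text \<open>
  Off \<open>E\<close> the number of points in \<open>A\<close> controls \<open>f\<close>; on \<open>E\<close> only the total number does. There
  \<open>x \<le> x\<^sup>2 / S + S\<close> separates the moment of the total number from the probability of \<open>E\<close>.
\<close>

lemma (in poisson_points) nn_integral_square_split:
  fixes g f :: "'w \<Rightarrow> real" and A :: "'a set" and p :: nat
  assumes E: "E \<in> sets M" and PE: "measure M E \<le> \<delta>" and A: "A \<in> sets borel"
    and a: "1 \<le> a" "measure \<mu> A \<le> a" and c: "1 \<le> c" "measure \<mu> UNIV \<le> c" and S: "0 < S"
    and bd: "AE \<omega> in M. 0 \<le> f \<omega> \<and> f \<omega> \<le> real (card (X \<omega>)) ^ p \<and> (\<omega> \<notin> E \<longrightarrow> f \<omega> \<le> real (card (X \<omega> \<inter> A)) ^ p)"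
  shows "(\<integral>\<^sup>+\<omega>. ennreal ((f \<omega>)\<^sup>2) \<partial>M) \<le> ennreal (fact (2 * p) * exp 2 * a ^ (2 * p) + (1 / S) * (fact (4 * p) * exp 2 * c ^ (4 * p)) + S * \<delta>)"
proof -
  have mA: "(\<lambda>\<omega>. ennreal (real (card (X \<omega> \<inter> B)) ^ q)) \<in> borel_measurable M" if "B \<in> sets borel" for B q
    by (rule measurable_compose[OF card_measurable[OF that]]) simp
  have "(\<integral>\<^sup>+\<omega>. ennreal ((f \<omega>)\<^sup>2) \<partial>M)
      \<le> (\<integral>\<^sup>+\<omega>. ennreal (real (card (X \<omega> \<inter> A)) ^ (2 * p)) + (ennreal (1 / S) * ennreal (real (card (X \<omega> \<inter> UNIV)) ^ (4 * p)) + ennreal S * indicator E \<omega>) \<partial>M)"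
  proof (rule nn_integral_mono_AE)
    show "AE \<omega> in M. ennreal ((f \<omega>)\<^sup>2) \<le> ennreal (real (card (X \<omega> \<inter> A)) ^ (2 * p)) + (ennreal (1 / S) * ennreal (real (card (X \<omega> \<inter> UNIV)) ^ (4 * p)) + ennreal S * indicator E \<omega>)"
      using bd
    proof eventually_elim
      case (elim \<omega>)
      show ?case
      proof (cases "\<omega> \<in> E")
        case False
        then have "(f \<omega>)\<^sup>2 \<le> (real (card (X \<omega> \<inter> A)) ^ p)\<^sup>2" using elim by (intro power_mono) auto
        then have "ennreal ((f \<omega>)\<^sup>2) \<le> ennreal (real (card (X \<omega> \<inter> A)) ^ (2 * p))"
          by (intro ennreal_leI) (simp add: power_mult[symmetric] mult.commute)
        then show ?thesis by (rule order_trans) simp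
      next
        case True
        let ?n = "real (card (X \<omega>)) ^ p"
        have "(f \<omega>)\<^sup>2 \<le> ?n\<^sup>2" using elim by (intro power_mono) auto
        also have "\<dots> \<le> 1 / S * (?n\<^sup>2)\<^sup>2 + S"
        proof -
          have "x \<le> 1 / S * x\<^sup>2 + S" if "0 \<le> x" for x
          proof (cases "x \<le> S")
            case True
            have "0 \<le> 1 / S * x\<^sup>2" using S by simp
            then show ?thesis using True by linarith
          next
            case False
            then have "x * S \<le> x * x" using that by (intro mult_left_mono) auto
            then have "x \<le> 1 / S * x\<^sup>2" using S by (simp add: field_simps power2_eq_square)
            then show ?thesis using S by linarith
          qed
          from this[of "?n\<^sup>2"] show ?thesis by simp
        qed
        also have "(?n\<^sup>2)\<^sup>2 = real (card (X \<omega> \<inter> UNIV)) ^ (4 * p)" by (simp add: power_mult[symmetric] mult.commute)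
        finally have "ennreal ((f \<omega>)\<^sup>2) \<le> ennreal (1 / S * real (card (X \<omega> \<inter> UNIV)) ^ (4 * p) + S)" by (rule ennreal_leI)
        also have "\<dots> = ennreal (1 / S) * ennreal (real (card (X \<omega> \<inter> UNIV)) ^ (4 * p)) + ennreal S * indicator E \<omega>"
          using True S by (subst ennreal_plus) (auto simp: ennreal_mult'[symmetric])
        finally show ?thesis by (rule order_trans) simp
      qed
    qed
  qed
  also have "\<dots> = (\<integral>\<^sup>+\<omega>. ennreal (real (card (X \<omega> \<inter> A)) ^ (2 * p)) \<partial>M)
      + (ennreal (1 / S) * (\<integral>\<^sup>+\<omega>. ennreal (real (card (X \<omega> \<inter> UNIV)) ^ (4 * p)) \<partial>M) + ennreal S * emeasure M E)"
  proof -
    note mA[OF A, measurable] and mA[of UNIV, simplified, measurable] and E[measurable]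
    have "(\<integral>\<^sup>+\<omega>. ennreal (1 / S) * ennreal (real (card (X \<omega> \<inter> UNIV)) ^ (4 * p)) + ennreal S * indicator E \<omega> \<partial>M)
      = ennreal (1 / S) * (\<integral>\<^sup>+\<omega>. ennreal (real (card (X \<omega> \<inter> UNIV)) ^ (4 * p)) \<partial>M) + ennreal S * emeasure M E"
      using E by (subst nn_integral_add) (auto simp: nn_integral_cmult nn_integral_cmult_indicator)
    then show ?thesis by (subst nn_integral_add[OF mA[OF A]]) auto
  qed
  also have "\<dots> \<le> ennreal (fact (2 * p) * exp 2 * a ^ (2 * p)) + (ennreal (1 / S) * ennreal (fact (4 * p) * exp 2 * c ^ (4 * p)) + ennreal S * ennreal \<delta>)"
    by (intro add_mono mult_left_mono nn_integral_card_power A a c)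
      (use PE in \<open>auto simp: emeasure_eq_measure ennreal_leI\<close>)
  also have "\<dots> = ennreal (fact (2 * p) * exp 2 * a ^ (2 * p) + (1 / S) * (fact (4 * p) * exp 2 * c ^ (4 * p)) + S * \<delta>)"
  proof -
    have "0 \<le> \<delta>" using PE measure_nonneg order_trans by blast
    then show ?thesis using S a c by (simp add: ennreal_mult'[symmetric] ennreal_plus[symmetric] add.assoc del: ennreal_plus)
  qed
  finally show ?thesis .
qed

lemma gauss_total: "0 \<le> l \<Longrightarrow> measure (gauss l) (UNIV :: (real ^ 'n) set) = l * measure std_gaussian (UNIV :: (real ^ 'n) set)"
  unfolding gauss_def measure_def by (simp add: enn2real_mult)

text \<open>
  If every cone has a point beyond \<open>rad 5 L\<close>, the vertices of the hull lie beyond \<open>rad 6 L\<close>,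
  where the expected number of points is of order \<open>L powr ((d + 6) / 2)\<close>. Each cone fails with
  probability at most \<open>exp (- c * L\<^sup>2)\<close>, so little that the crude bound by a power of the total
  number of points, with moments of order \<open>exp (O(L))\<close>, suffices on that event. The value five
  stands for any \<open>b\<close> with \<open>(b - 1) / 2 > 1\<close>.
\<close>

lemma second_moment_faces:
  assumes j: "j < CARD('n)" and q: "(real CARD('n) + 7) * real (j + 1) < q"
  shows "second_moment_functional TYPE('w) q (hull_faces j :: (real ^ 'n) set \<Rightarrow> real)"
  unfolding second_moment_functional_def
proof -
  let ?d = "CARD('n)"
  define p where "p = j + 1"
  define n where "n = ?d - 1"
  have n: "real n = real ?d - 1" by (simp add: n_def)
  define CN where "CN = (2 * 6 ^ ?d * 8 ^ ?d :: real)"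
  have CN: "CN > 0" by (simp add: CN_def)
  obtain C where C: "C > 0" and tail: "\<forall>\<^sub>F L in at_top. measure (gauss (exp L)) {x :: real ^ 'n. rad 6 L < norm x} \<le> C * L powr ((real ?d + 6) / 2)"
    using gauss_tail_upper[where 'n = 'n, of 6] by auto
  obtain c where c: "c > 0" and low: "\<forall>\<^sub>F L in at_top. \<forall>(u :: nat \<Rightarrow> real ^ 'n) N i. sphere_net u N (mesh L) \<longrightarrow> i < N \<longrightarrow>
     c * L powr ((5 - 1) / 2) \<le> measure (gauss (exp L)) (cone_part (vcell u N i) (rad 5 L) (rad 5 L + 1 / rad 5 L))"
    using cone_mass_lower[where 'n = 'n, of 5] by auto
  define T where "T = measure std_gaussian (UNIV :: (real ^ 'n) set) + 1"
  have T: "1 \<le> T" by (simp add: T_def)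
  define G1 where "G1 = (fact (2 * p) * exp 2 :: real)"
  define G2 where "G2 = fact (4 * p) * exp 2 * T ^ (4 * p)"
  have G: "0 < G1" "0 < G2" using T by (simp_all add: G1_def G2_def)
  \<comment> \<open>The truncation level \<open>exp ((s + 1) * L)\<close> used below exceeds the order \<open>exp (s * L)\<close> of the moment of the total number.\<close>
  define s where "s = real (4 * p)"
  have s: "0 < s" by (simp add: s_def p_def)
  define D where "D = (real ?d + 7) * real p"
  have D: "D < q" using q by (simp add: D_def p_def)
  have qpos: "0 < q" using D by (smt (verit) D_def mult_nonneg_nonneg of_nat_0_le_iff)
  have "\<forall>\<^sub>F L::real in at_top. G1 * L powr D \<le> L powr q / 3" using D G by real_asymp
  moreover have "\<forall>\<^sub>F L::real in at_top. 1 / exp ((s + 1) * L) * (G2 * exp (s * L)) \<le> L powr q / 3" using qpos G s by real_asymp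
  moreover have "\<forall>\<^sub>F L::real in at_top. exp ((s + 1) * L) * (CN * L powr (real n / 2) * exp (- (c * L powr ((5 - 1) / 2)))) \<le> L powr q / 3"
    using qpos CN c s by real_asymp
  moreover have "\<forall>\<^sub>F L::real in at_top. C * L powr ((real ?d + 6) / 2) \<le> L powr ((real ?d + 7) / 2)" using C by real_asymp
  ultimately show "\<forall>\<^sub>F L in at_top. \<forall>(M :: 'w measure) X f. poisson_points M (gauss (exp L)) X \<longrightarrow>
     f \<in> borel_measurable M \<longrightarrow> (AE \<omega> in M. f \<omega> = hull_faces j (X \<omega> :: (real ^ 'n) set)) \<longrightarrow> (\<integral>\<^sup>+\<omega>. ennreal ((f \<omega>)\<^sup>2) \<partial>M) \<le> ennreal (L powr q)"
    using tail low rad_less[of 5 6, simplified] rad_bounds[of 5] eventually_ge_at_top[of 1]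
  proof (eventually_elim, intro allI impI)
    fix L :: real and M :: "'w measure" and X :: "'w \<Rightarrow> (real ^ 'n) set" and f
    assume h1: "G1 * L powr D \<le> L powr q / 3"
      and h2: "1 / exp ((s + 1) * L) * (G2 * exp (s * L)) \<le> L powr q / 3"
      and h3: "exp ((s + 1) * L) * (CN * L powr (real n / 2) * exp (- (c * L powr ((5 - 1) / 2)))) \<le> L powr q / 3"
      and h4: "C * L powr ((real ?d + 6) / 2) \<le> L powr ((real ?d + 7) / 2)"
      and h5: "measure (gauss (exp L)) {x :: real ^ 'n. rad 6 L < norm x} \<le> C * L powr ((real ?d + 6) / 2)"
      and h6: "\<forall>(u :: nat \<Rightarrow> real ^ 'n) N i. sphere_net u N (mesh L) \<longrightarrow> i < N \<longrightarrow>
     c * L powr ((5 - 1) / 2) \<le> measure (gauss (exp L)) (cone_part (vcell u N i) (rad 5 L) (rad 5 L + 1 / rad 5 L))"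
      and h7: "rad 6 L < rad 5 L * (1 - 2 * (mesh L)\<^sup>2) \<and> rad 6 L + 1 / rad 6 L \<le> rad 5 L"
      and h8: "1 \<le> sqrt L \<and> sqrt L \<le> rad 5 L \<and> rad 5 L \<le> 2 * sqrt L \<and> (rad 5 L)\<^sup>2 = 2 * L - 5 * ln L"
      and L: "1 \<le> L"
      and hP: "poisson_points M (gauss (exp L)) X" and f: "f \<in> borel_measurable M" "AE \<omega> in M. f \<omega> = hull_faces j (X \<omega>)"
    interpret poisson_points M "gauss (exp L)" X by (rule hP)
    obtain u :: "nat \<Rightarrow> real ^ 'n" and N where net: "fine_net L u N" using fine_net_exists[OF L] by blast
    have net': "sphere_net u N (mesh L)" using net by (simp add: fine_net_def)
    interpret S: sphere_net u N "mesh L" by (rule net')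
    let ?A = "\<lambda>i. cone_part (vcell u N i) (rad 5 L) (rad 5 L + 1 / rad 5 L)"
    let ?Z = "{x :: real ^ 'n. rad 6 L < norm x}"
    let ?E = "\<Union>i\<in>{..<N}. {\<omega>\<in>space M. X \<omega> \<inter> ?A i = {}}"
    have A: "?A i \<in> sets borel" for i by (intro cone_part_borel S.Q_borel)
    have E: "?E \<in> sets M" by (intro sets.finite_UN hit_measurable A) simp
    have "prob ?E \<le> (\<Sum>i<N. prob {\<omega>\<in>space M. X \<omega> \<inter> ?A i = {}})"
      by (intro finite_measure_subadditive_finite) (auto intro: hit_measurable A)
    also have "\<dots> \<le> (\<Sum>i<N. exp (- (c * L powr ((5 - 1) / 2))))"
      using h6 net' by (intro sum_mono) (simp add: prob_empty[OF A])
    also have "\<dots> \<le> CN * L powr (real n / 2) * exp (- (c * L powr ((5 - 1) / 2)))"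
      using fine_net_card[OF L net] by (simp add: CN_def n mult_right_mono)
    finally have PE: "prob ?E \<le> CN * L powr (real n / 2) * exp (- (c * L powr ((5 - 1) / 2)))" .
    have m2: "2 * (mesh L)\<^sup>2 < 1" using L by (simp add: mesh_def power_divide)
    have a1: "1 \<le> L powr ((real ?d + 7) / 2)" using L by (simp add: ge_one_powr_ge_zero)
    have Z: "?Z \<in> sets borel" by measurable
    have c1: "1 \<le> T * exp L" using T L mult_mono[of 1 T 1 "exp L"] by simp
    have c2: "measure (gauss (exp L)) (UNIV :: (real ^ 'n) set) \<le> T * exp L"
      by (simp add: gauss_total T_def distrib_right mult.commute)
    have "(\<integral>\<^sup>+\<omega>. ennreal ((f \<omega>)\<^sup>2) \<partial>M) \<le> ennreal (fact (2 * p) * exp 2 * (L powr ((real ?d + 7) / 2)) ^ (2 * p)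
      + (1 / exp ((s + 1) * L)) * (fact (4 * p) * exp 2 * (T * exp L) ^ (4 * p))
      + exp ((s + 1) * L) * (CN * L powr (real n / 2) * exp (- (c * L powr ((5 - 1) / 2)))))"
    proof (rule nn_integral_square_split[OF E PE Z a1 order_trans[OF h5 h4] c1 c2])
      show "AE \<omega> in M. 0 \<le> f \<omega> \<and> f \<omega> \<le> real (card (X \<omega>)) ^ p \<and> (\<omega> \<notin> ?E \<longrightarrow> f \<omega> \<le> real (card (X \<omega> \<inter> ?Z)) ^ p)"
        using f(2) AE_finite AE_space
      proof eventually_elim
        case (elim \<omega>)
        have "card {F. F face_of convex hull X \<omega> \<and> aff_dim F = int j \<and> F \<inter> X \<omega> \<subseteq> X \<omega>} \<le> card (X \<omega>) ^ (j + 1)"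
          by (rule card_faces_le[OF elim(2) elim(2)])
        then have 1: "hull_faces j (X \<omega>) \<le> real (card (X \<omega>)) ^ p"
          unfolding hull_faces_def p_def by (simp del: power_Suc flip: of_nat_power)
        have 2: "hull_faces j (X \<omega>) \<le> real (card (X \<omega> \<inter> ?Z)) ^ p" if "\<omega> \<notin> ?E"
        proof -
          have hit: "\<exists>s\<in>X \<omega>. rad 5 L < norm s \<and> sgn s \<in> vcell u N i" if "i < N" for i
          proof -
            have "X \<omega> \<inter> ?A i \<noteq> {}" using \<open>\<omega> \<notin> ?E\<close> that elim(3) by blast
            then show ?thesis by (auto simp: cone_part_def)
          qed
          have r5: "0 < rad 5 L" using h8 by linarith
          have jd: "j < DIM(real ^ 'n)" using j by simp
          have "card {F. F face_of convex hull X \<omega> \<and> aff_dim F = int j} \<le> card (X \<omega> - ball 0 (rad 5 L * (1 - 2 * (mesh L)\<^sup>2))) ^ (j + 1)"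
            by (rule S.card_faces_outer_le[OF elim(2) r5 m2 hit jd])
          also have "\<dots> \<le> card (X \<omega> \<inter> ?Z) ^ (j + 1)"
            by (intro power_mono card_mono) (use elim(2) h7 in auto)
          finally show ?thesis unfolding hull_faces_def p_def by (simp del: power_Suc flip: of_nat_power)
        qed
        show ?case using 1 2 elim(1) by (simp add: hull_faces_def)
      qed
    qed simp
    also have "\<dots> \<le> ennreal (L powr q)"
    proof (rule ennreal_leI)
      have e0: "(real ?d + 7) / 2 * real (2 * p) = D" by (simp add: D_def)
      have e1: "(L powr ((real ?d + 7) / 2)) ^ (2 * p) = L powr D"
        using L by (subst powr_realpow[symmetric]) (simp_all only: powr_powr e0, simp)
      have e2: "(T * exp L) ^ (4 * p) = T ^ (4 * p) * exp (s * L)"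
        by (simp only: power_mult_distrib s_def exp_of_nat_mult)
      show "fact (2 * p) * exp 2 * (L powr ((real ?d + 7) / 2)) ^ (2 * p)
      + (1 / exp ((s + 1) * L)) * (fact (4 * p) * exp 2 * (T * exp L) ^ (4 * p))
      + exp ((s + 1) * L) * (CN * L powr (real n / 2) * exp (- (c * L powr ((5 - 1) / 2)))) \<le> L powr q"
        unfolding e1 e2 using h1 h2 h3 unfolding G1_def G2_def mult.assoc by linarith
    qed
    finally show "(\<integral>\<^sup>+\<omega>. ennreal ((f \<omega>)\<^sup>2) \<partial>M) \<le> ennreal (L powr q)" .
  qed
qed

section \<open>The strong law along geometric intensities\<close>

text \<open>
  The Borel--Cantelli lemma for each of the thresholds \<open>1 / (i + 1)\<close>.
\<close>

lemma AE_tendsto_0_of_summable_tails: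
  fixes Z :: "nat \<Rightarrow> 'w \<Rightarrow> real"
  assumes M: "prob_space M" and meas: "\<And>k. Z k \<in> borel_measurable M"
    and g: "summable g"
    and tail: "\<And>\<tau>. 0 < \<tau> \<Longrightarrow> \<forall>\<^sub>F k in sequentially. measure M {\<omega>\<in>space M. \<tau> \<le> \<bar>Z k \<omega>\<bar>} \<le> g k"
  shows "AE \<omega> in M. (\<lambda>k. Z k \<omega>) \<longlonglongrightarrow> 0"
proof -
  interpret prob_space M by (rule M)
  have "AE \<omega> in M. \<forall>\<^sub>F k in sequentially. \<bar>Z k \<omega>\<bar> < 1 / real (Suc i)" for i
  proof -
    let ?\<tau> = "1 / real (Suc i)"
    have "\<forall>\<^sub>F k in sequentially. measure M {\<omega>\<in>space M. ?\<tau> \<le> \<bar>Z k \<omega>\<bar>} \<le> g k" by (rule tail) simp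
    then obtain k1 where k1: "\<And>k. k1 \<le> k \<Longrightarrow> measure M {\<omega>\<in>space M. ?\<tau> \<le> \<bar>Z k \<omega>\<bar>} \<le> g k"
      unfolding eventually_sequentially by auto
    let ?A = "\<lambda>k. {\<omega>\<in>space M. ?\<tau> \<le> \<bar>Z (k + k1) \<omega>\<bar>}"
    have m: "Z (k + k1) \<in> borel_measurable M" for k by (rule meas)
    have A: "?A k \<in> sets M" for k using m[of k] by measurable
    have "AE \<omega> in M. \<forall>\<^sub>F k in sequentially. \<omega> \<in> space M - ?A k"
    proof (rule borel_cantelli_AE1[OF A])
      show "emeasure M (?A k) < \<infinity>" for k by (simp add: emeasure_eq_measure)
      show "summable (\<lambda>k. measure M (?A k))"
      proof (rule summable_comparison_test_ev)
        show "summable (\<lambda>k. g (k + k1))" using g by (rule summable_ignore_initial_segment)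
        show "\<forall>\<^sub>F k in sequentially. norm (measure M (?A k)) \<le> g (k + k1)"
          by (rule always_eventually) (use k1 in simp)
      qed
    qed
    then show ?thesis
    proof eventually_elim
      case (elim \<omega>)
      then have "\<forall>\<^sub>F k in sequentially. \<bar>Z (k + k1) \<omega>\<bar> < ?\<tau>" by eventually_elim auto
      then show ?case by (rule eventually_sequentially_seg[THEN iffD1])
    qed
  qed
  then have "AE \<omega> in M. \<forall>i. \<forall>\<^sub>F k in sequentially. \<bar>Z k \<omega>\<bar> < 1 / real (Suc i)" by (simp add: AE_all_countable)
  then show ?thesis
  proof eventually_elim
    case (elim \<omega>)
    show ?case
    proof (rule tendstoI)
      fix e :: real assume "0 < e"
      then obtain i where i: "1 / real (Suc i) < e" using nat_approx_posE by blast
      show "\<forall>\<^sub>F k in sequentially. dist (Z k \<omega>) 0 < e" using elim[rule_format, of i]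
        by eventually_elim (use i in \<open>simp add: dist_real_def\<close>)
    qed
  qed
qed

text \<open>
  Along \<open>L = k * ln a\<close> the tail bound \<open>2 * L powr (- 2)\<close> is summable in \<open>k\<close>. It is applied to a
  measurable version \<open>f k\<close> of the functional, which has the same expectation for the completed
  measure.
\<close>

lemma geometric_strong_law:
  fixes F :: "(real ^ 'n) set \<Rightarrow> real" and X :: "nat \<Rightarrow> 'w \<Rightarrow> (real ^ 'n) set"
  assumes M: "prob_space M" and a: "1 < a"
    and X: "\<And>k. poisson_process M (gauss (a ^ k)) (X k)"
    and eps: "0 < \<epsilon>" "\<epsilon> < 1 / 2" and stab: "stable_functional F"
    and hull: "\<And>S T. convex hull S = convex hull T \<Longrightarrow> F S = F T"
    and flat: "flat_functional \<epsilon> \<kappa> q F" and mom: "second_moment_functional TYPE('w) q F"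
    and \<beta>: "\<kappa> < 2 * \<beta>"
  shows "AE \<omega> in M. (\<lambda>k. (F (X k \<omega>) - expect M (\<lambda>\<omega>. F (X k \<omega>))) / ln (a ^ k) powr \<beta>) \<longlonglongrightarrow> 0"
proof -
  have gk: "gauss (a ^ k) = gauss (exp (ln (a ^ k)))" for k using a by simp
  have P: "poisson_points M (gauss (exp (ln (a ^ k)))) (X k)" for k
    unfolding poisson_points_def poisson_points_axioms_def using M X[of k, unfolded gk[of k]] finite_measure_gauss[OF exp_ge_zero] by auto
  have "\<exists>f\<in>borel_measurable M. AE \<omega> in M. f \<omega> = F (X k \<omega>)" for k
    by (rule poisson_points.functional_AE_measurable[OF P poisson_gauss_gen_pos[OF P] stab])
  then obtain f where f: "\<And>k. f k \<in> borel_measurable M" "\<And>k. AE \<omega> in M. f k \<omega> = F (X k \<omega>)" by metis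
  have ex: "expect M (\<lambda>\<omega>. F (X k \<omega>)) = (\<integral>\<omega>. f k \<omega> \<partial>M)" for k
    unfolding expect_def by (rule integral_completion_AE_eq[OF f])
  define Z where "Z k \<omega> = (f k \<omega> - (\<integral>\<omega>. f k \<omega> \<partial>M)) / ln (a ^ k) powr \<beta>" for k \<omega>
  have lna: "0 < ln a" using a by simp
  have lim: "filterlim (\<lambda>k::nat. ln (a ^ k)) at_top sequentially"
  proof -
    have "filterlim (\<lambda>k::nat. real k * ln a) at_top sequentially" using lna by real_asymp
    then show ?thesis using a by (simp add: ln_realpow)
  qed
  have "AE \<omega> in M. (\<lambda>k. Z k \<omega>) \<longlonglongrightarrow> 0"
  proof (rule AE_tendsto_0_of_summable_tails[OF M])
    show "Z k \<in> borel_measurable M" for k unfolding Z_def using f(1)[of k] by measurable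
    show "summable (\<lambda>k::nat. 2 * ln a powr (- 2) * real k powr (- 2))"
      by (intro summable_mult) (simp add: summable_real_powr_iff)
    fix \<tau> :: real assume \<tau>: "0 < \<tau>"
    have tail: "\<forall>\<^sub>F L in at_top. \<forall>(M :: 'w measure) X f. poisson_points M (gauss (exp L)) X \<longrightarrow>
       f \<in> borel_measurable M \<longrightarrow> (AE \<omega> in M. f \<omega> = F (X \<omega>)) \<longrightarrow>
       measure M {\<omega>\<in>space M. \<tau> * L powr \<beta> \<le> \<bar>f \<omega> - (\<integral>\<omega>. f \<omega> \<partial>M)\<bar>} \<le> 2 * L powr (- 2)"
      by (rule asymptotic_tail[OF eps stab _ flat mom \<tau> \<beta>]) (rule hull)
    have "\<forall>\<^sub>F k in sequentially. measure M {\<omega>\<in>space M. \<tau> * ln (a ^ k) powr \<beta> \<le> \<bar>f k \<omega> - (\<integral>\<omega>. f k \<omega> \<partial>M)\<bar>} \<le> 2 * ln (a ^ k) powr (- 2)"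
      using eventually_compose_filterlim[OF tail lim]
    proof eventually_elim
      case (elim k)
      show ?case by (rule elim[rule_format, OF P[of k] f(1) f(2)])
    qed
    then show "\<forall>\<^sub>F k in sequentially. measure M {\<omega>\<in>space M. \<tau> \<le> \<bar>Z k \<omega>\<bar>} \<le> 2 * ln a powr (- 2) * real k powr (- 2)"
      using eventually_gt_at_top[of 0]
    proof eventually_elim
      case (elim k)
      have l: "ln (a ^ k) = real k * ln a" using a by (simp add: ln_realpow)
      have pos: "0 < ln (a ^ k) powr \<beta>" using elim(2) lna by (simp add: l)
      have "\<tau> \<le> \<bar>Z k \<omega>\<bar> \<longleftrightarrow> \<tau> * ln (a ^ k) powr \<beta> \<le> \<bar>f k \<omega> - (\<integral>\<omega>. f k \<omega> \<partial>M)\<bar>" for \<omega>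
        unfolding Z_def abs_divide using pos by (simp only: pos_le_divide_eq abs_of_pos)
      then show ?case using elim lna by (simp add: l powr_mult mult_ac)
    qed
  qed
  moreover have "AE \<omega> in M. \<forall>k. f k \<omega> = F (X k \<omega>)" using f(2) by (simp add: AE_all_countable)
  ultimately show ?thesis
  proof eventually_elim
    case (elim \<omega>)
    then show ?case by (simp add: Z_def ex)
  qed
qed

lemma small_perturbation: "\<exists>\<epsilon>::real. 0 < \<epsilon> \<and> \<epsilon> < 1 / 2 \<and> x + c * \<epsilon> < y" if "x < y" "0 \<le> c" for x y c :: real
proof -
  define e where "e = min (1 / 4) ((y - x) / (2 * (c + 1)))"
  have e: "0 < e" "e < 1 / 2" "e \<le> (y - x) / (2 * (c + 1))" using that unfolding e_def by (auto simp: min_def)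
  have "e * (2 * (c + 1)) \<le> y - x" using e(3) that(2) by (simp add: pos_le_divide_eq)
  then have "x + c * e < y" using e(1) mult_nonneg_nonneg[OF that(2) less_imp_le[OF e(1)]] by (simp add: algebra_simps)
  then show ?thesis using e by blast
qed

theorem theorem1p3:
  fixes M :: "'w measure"
    and X :: "nat \<Rightarrow> 'w \<Rightarrow> (real ^ 'n) set"
    and a :: real
    and lam :: "nat \<Rightarrow> real"
  assumes dim: "CARD('n) \<ge> 2"
    and M: "prob_space M"
    and a: "a > 1"
    and lam: "\<And>k. lam k = a ^ k"
    and X: "\<And>k. poisson_process M (scale_measure (ennreal (lam k)) std_gaussian) (X k)"
  shows "(\<forall>p::real. p > (real CARD('n) - 3) / (2 * real CARD('n)) \<longrightarrow>
           (AE \<omega> in M.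
             (\<lambda>k. (hull_volume (X k \<omega>) - expect M (\<lambda>\<omega>'. hull_volume (X k \<omega>')))
                   / ln (lam k) powr (p * (real CARD('n) / 2))) \<longlonglongrightarrow> 0))
       \<and> (\<forall>j\<in>{0..CARD('n) - 1}. \<forall>p::real. p > 1 / 2 \<longrightarrow>
           (AE \<omega> in M.
             (\<lambda>k. (hull_faces j (X k \<omega>) - expect M (\<lambda>\<omega>'. hull_faces j (X k \<omega>')))
                   / ln (lam k) powr (p * ((real CARD('n) - 1) / 2))) \<longlonglongrightarrow> 0))"
proof (intro conjI allI ballI impI)
  let ?d = "real CARD('n)"
  have d: "2 \<le> ?d" using dim by simp
  have X': "poisson_process M (gauss (a ^ k)) (X k)" for k using X[of k] by (simp add: gauss_def lam)
  {
    fix p :: real assume "p > (?d - 3) / (2 * ?d)"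
    then have "(?d - 3) / 2 < p * ?d" using d by (simp add: field_simps)
    then obtain \<kappa> where \<kappa>: "(?d - 3) / 2 < \<kappa>" "\<kappa> < p * ?d" using dense by blast
    obtain \<epsilon> where eps: "0 < \<epsilon>" "\<epsilon> < 1 / 2" "(?d - 3) / 2 + 2 * ?d * \<epsilon> < \<kappa>"
      using small_perturbation[OF \<kappa>(1), of "2 * ?d"] by auto
    have stab: "stable_functional (hull_volume :: (real ^ 'n) set \<Rightarrow> real)"
      unfolding stable_functional_def by (intro allI impI hull_volume_stable) auto
    show "AE \<omega> in M. (\<lambda>k. (hull_volume (X k \<omega>) - expect M (\<lambda>\<omega>'. hull_volume (X k \<omega>')))
                   / ln (lam k) powr (p * (?d / 2))) \<longlonglongrightarrow> 0"
      unfolding lam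
    proof (rule geometric_strong_law[OF M a X' eps(1,2) stab])
      show "flat_functional \<epsilon> \<kappa> (?d + 1) (hull_volume :: (real ^ 'n) set \<Rightarrow> real)"
        using eps by (rule flat_volume) (use d in linarith)
      show "second_moment_functional TYPE('w) (?d + 1) (hull_volume :: (real ^ 'n) set \<Rightarrow> real)"
        by (rule second_moment_volume) simp
      show "\<kappa> < 2 * (p * (?d / 2))" using \<kappa>(2) by simp
    qed (simp add: hull_volume_def)
  }
  {
    fix j :: nat and p :: real assume "j \<in> {0..CARD('n) - 1}" and p: "p > 1 / 2"
    then have j: "j < CARD('n)" using dim by auto
    have "1 / 2 * (?d - 1) < p * (?d - 1)" using p d by (intro mult_strict_right_mono) auto
    then have "(?d - 1) / 2 < p * (?d - 1)" by simp
    then obtain \<kappa> where \<kappa>: "(?d - 1) / 2 < \<kappa>" "\<kappa> < p * (?d - 1)" using dense by blast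
    obtain \<epsilon> where eps: "0 < \<epsilon>" "\<epsilon> < 1 / 2" "(?d - 1) / 2 + 2 * (?d + 2) * real (j + 1) * \<epsilon> < \<kappa>"
      using small_perturbation[OF \<kappa>(1), of "2 * (?d + 2) * real (j + 1)"] by auto
    have stab: "stable_functional (hull_faces j :: (real ^ 'n) set \<Rightarrow> real)"
      unfolding stable_functional_def by (intro allI impI hull_faces_stable j) auto
    let ?q = "(?d + 8) * real (j + 1)"
    show "AE \<omega> in M. (\<lambda>k. (hull_faces j (X k \<omega>) - expect M (\<lambda>\<omega>'. hull_faces j (X k \<omega>')))
                   / ln (lam k) powr (p * ((?d - 1) / 2))) \<longlonglongrightarrow> 0"
      unfolding lam
    proof (rule geometric_strong_law[OF M a X' eps(1,2) stab])
      show "flat_functional \<epsilon> \<kappa> ?q (hull_faces j :: (real ^ 'n) set \<Rightarrow> real)"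
      proof (rule flat_faces[OF eps(1,2) j eps(3)])
        have "(x - 1) / 2 + 2 * e < x + 8" if "e < 1 / 2" "2 \<le> x" for x e :: real
          using that by (simp add: field_simps)
        from this[OF eps(2) d] have "(?d - 1) / 2 + 2 * \<epsilon> < ?d + 8" .
        then show "((?d - 1) / 2 + 2 * \<epsilon>) * real (j + 1) < ?q" by (intro mult_strict_right_mono) auto
      qed
      show "second_moment_functional TYPE('w) ?q (hull_faces j :: (real ^ 'n) set \<Rightarrow> real)"
        by (rule second_moment_faces[OF j]) simp
      show "\<kappa> < 2 * (p * ((?d - 1) / 2))" using \<kappa>(2) by simp
    qed (simp add: hull_faces_def)
  }
qed

end
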